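(* Let $u(x,t)$ be the solution of the delay problem stated in the context. Assume that $u$ can be decomposed as $$u(x,t)=\sum_{j=0}^m\gamma_jt^{j\alpha}+\tilde\gamma t+Y(x,t),\quad(x,t)\in[0,L]\times[0,K\tau],$$ where $m$ is the smallest positive integer with $(m+1)\alpha>1$, $\gamma_j$ and $\tilde\gamma$ are bounded functions of $x$, and $Y(\cdot,0)=\partial_tY(\cdot,t)|_{t=0}=0$, $Y(\cdot,t)\in C^1[0,K\tau]$, $|\partial_tY(\cdot,t)|\le C(1+t^{(m+1)\alpha-1})$, $\partial_t^2Y(\cdot,t)\in L^1[0,K\tau]$ (regularity in $t$). Assume also that $u(\cdot,t)\in H^2(0,L)$ for each fixed $t$; that for all $x\in[0,L]$, $\varphi(x,\cdot)\in C^1([-\tau,0])$ and $|\partial_t\varphi(x,t)|\le C$; and that the starting values $u_h^n\in X_h$, $-N\le n\le0$, of the fully discrete scheme described in the context satisfy $\|u_h^n-\varphi(\cdot,t_n)\|_0\le Ch^2$. Then the numerical solution $u_h^n$ of the scheme satisfies $$\|u^n-u_h^n\|_0\le C\Big[h^2+\rho\Big(\sum_{j=1}^{k-1}\big(1+\ln(n-jN)\big)+(1+\ln n)t_n^{\alpha-1}\Big)\Big],$$ where $(k-1)N+1\le n\le kN$, $k=1,2,\dots,K$, and $u^n=u(\cdot,t_n)$.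
   Context: Problem. $0<\alpha<1$, $\Omega=(0,L)$ with $L>0$, constants $p\ge0$, $a\le0$, $b\ne0$, delay $\tau>0$, $K$ a given positive integer, $f$ continuous, $\varphi$ continuous on $\bar\Omega\times[-\tau,0]$. The delay problem is $$\partial_tu(x,t)=\partial_t^{1-\alpha}\big(p\Delta u(x,t)+au(x,t)\big)+bu(x,t-\tau)+f(x,t),\quad(x,t)\in\Omega\times(0,K\tau],$$ $u=\varphi$ on $\bar\Omega\times[-\tau,0]$, $u(0,t)=u(L,t)=0$ for $t\in[-\tau,K\tau]$, with Riemann–Liouville derivative $\partial_t^{1-\alpha}v(t)=\frac{\partial}{\partial t}\int_0^t\frac{(t-s)^{\alpha-1}}{\Gamma(\alpha)}v(s)\,ds$. $(\cdot,\cdot)$ and $\|\cdot\|_0$ are the inner product and norm of $L^2(0,L)$. $\varphi(t)$ denotes $\varphi(\cdot,t)$. Discretization. $N$ is a positive integer, $\rho=\tau/N$, $t_n=n\rho$ for $-N\le n\le KN$. $X_h\subset H_0^1(\Omega)$ is the continuous piecewise linear finite element space on a quasi-uniform partition of $\Omega$ of maximum diameter $h$. Let $A_k=\rho^{-\alpha}\frac{\Gamma(k+1-\alpha)}{\Gamma(1-\alpha)\Gamma(k+1)}$, $k\ge0$, and $g_k^{(\beta)}=(-1)^k\binom{\beta}{k}$. For a sequence $v^n$ define $$\bar\partial_\rho^\alpha v^n=\sum_{k=1}^nA_{n-k}(v^k-v^{k-1}),\qquad J^{1-\alpha}v^{n-N}=\rho^{1-\alpha}\sum_{k=0}^ng_{n-k}^{(\alpha-1)}v^{k-N}=\rho\sum_{k=0}^nA_kv^{n-N-k}.$$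 Further, $$H^n=\partial_t\varphi(0)\,\rho^{1-\alpha}\sum_{k=N}^ng_{n-k}^{(\alpha-1)}(t_k-\tau)-\varphi(-\tau)\,\rho^{1-\alpha}\sum_{k=0}^ng_{n-k}^{(\alpha-1)}$$ (an empty sum is $0$), $\tilde f(x,t)=\int_0^t\frac{(t-s)^{-\alpha}}{\Gamma(1-\alpha)}f(x,s)\,ds$, $\tilde f^n=\tilde f(\cdot,t_n)$, and $$F^n=\tilde f^n+b\frac{t_n^{1-\alpha}}{\Gamma(2-\alpha)}\varphi(\cdot,-\tau)\ \text{ if }t_n\le\tau,\qquad F^n=\tilde f^n-b\Big[\frac{(t_n-\tau)^{2-\alpha}}{\Gamma(3-\alpha)}\partial_t\varphi(\cdot,0)-\frac{t_n^{1-\alpha}}{\Gamma(2-\alpha)}\varphi(\cdot,-\tau)\Big]\ \text{ if }t_n>\tau.$$ Scheme. Given $u_h^n\in X_h$ for $-N\le n\le0$, find $u_h^n\in X_h$, $n=1,\dots,KN$, such that for all $v_h\in X_h$ $$\big(\bar\partial_\rho^\alpha u_h^n,v_h\big)=-p(\nabla u_h^n,\nabla v_h)+a(u_h^n,v_h)+b\big(J^{1-\alpha}u_h^{n-N},v_h\big)+b(H^n,v_h)+(F^n,v_h).$$ $C$ denotes a generic positive constant, independent of $x,t,h,N,\rho,n$, which may differ from one occurrence to another.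
   Formalization: Two regularity assumptions are read uniformly, as the pointwise readings make the claim false: ∂_t²Y also lies in L¹(0,Kτ;L²(0,L)), and when p=0 the H² norm of u(·,t) is bounded uniformly in t. *)

theory Defs
  imports "HOL-Analysis.Analysis"
begin

text \<open>A function of space and time is curried, \<open>u x t\<close>.  Only its values for
  \<open>x \<in> [0, L]\<close> (and \<open>t\<close> in the relevant time interval) matter.\<close>

definition in_L2 :: "real \<Rightarrow> (real \<Rightarrow> real) \<Rightarrow> bool" where
  "in_L2 L v \<longleftrightarrow> set_borel_measurable lebesgue {0..L} v
     \<and> set_integrable lebesgue {0..L} (\<lambda>x. (v x)\<^sup>2)"

definition inner_L2 :: "real \<Rightarrow> (real \<Rightarrow> real) \<Rightarrow> (real \<Rightarrow> real) \<Rightarrow> real" where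
  "inner_L2 L v w = (LINT x:{0..L}|lebesgue. v x * w x)"

definition norm_L2 :: "real \<Rightarrow> (real \<Rightarrow> real) \<Rightarrow> real" where
  "norm_L2 L v = sqrt (inner_L2 L v v)"

text \<open>Test functions of class \<open>C\<^sup>1\<close> with compact support in \<open>(0, L)\<close>; in one dimension they
  give the same weak derivatives as smooth ones.\<close>

definition test_function :: "real \<Rightarrow> (real \<Rightarrow> real) \<Rightarrow> (real \<Rightarrow> real) \<Rightarrow> bool" where
  "test_function L \<psi> \<psi>' \<longleftrightarrow> (\<forall>x. (\<psi> has_real_derivative \<psi>' x) (at x))
     \<and> continuous_on UNIV \<psi>'
     \<and> (\<exists>c d. 0 < c \<and> c < d \<and> d < L \<and> (\<forall>x. x \<notin> {c..d} \<longrightarrow> \<psi> x = 0))"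

definition weak_deriv :: "real \<Rightarrow> (real \<Rightarrow> real) \<Rightarrow> (real \<Rightarrow> real) \<Rightarrow> bool" where
  "weak_deriv L v g \<longleftrightarrow>
     (\<forall>\<psi> \<psi>'. test_function L \<psi> \<psi>' \<longrightarrow> inner_L2 L v \<psi>' = - inner_L2 L g \<psi>)"

definition H2_derivs ::
  "real \<Rightarrow> (real \<Rightarrow> real) \<Rightarrow> (real \<Rightarrow> real) \<Rightarrow> (real \<Rightarrow> real) \<Rightarrow> bool" where
  "H2_derivs L v g1 g2 \<longleftrightarrow> in_L2 L v \<and> in_L2 L g1 \<and> in_L2 L g2
     \<and> weak_deriv L v g1 \<and> weak_deriv L g1 g2"

definition in_H2 :: "real \<Rightarrow> (real \<Rightarrow> real) \<Rightarrow> bool" where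
  "in_H2 L v \<longleftrightarrow> (\<exists>g1 g2. H2_derivs L v g1 g2)"

definition H2_norm_le :: "real \<Rightarrow> (real \<Rightarrow> real) \<Rightarrow> real \<Rightarrow> bool" where
  "H2_norm_le L v B \<longleftrightarrow> (\<exists>g1 g2. H2_derivs L v g1 g2
     \<and> sqrt ((norm_L2 L v)\<^sup>2 + (norm_L2 L g1)\<^sup>2 + (norm_L2 L g2)\<^sup>2) \<le> B)"

text \<open>Membership of \<open>t \<mapsto> w(\<cdot>, t)\<close> in \<open>L\<^sup>1(0, T; L\<^sup>2(0, L))\<close>.\<close>

definition in_L1_L2 :: "real \<Rightarrow> real \<Rightarrow> (real \<Rightarrow> real \<Rightarrow> real) \<Rightarrow> bool" where
  "in_L1_L2 T L w \<longleftrightarrow>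
     set_borel_measurable borel ({0..L} \<times> {0..T}) (\<lambda>(x, t). w x t)
     \<and> (AE t in lebesgue. t \<in> {0..T} \<longrightarrow> in_L2 L (\<lambda>x. w x t))
     \<and> set_integrable lebesgue {0..T} (\<lambda>t. norm_L2 L (\<lambda>x. w x t))"

definition frac_integral :: "real \<Rightarrow> (real \<Rightarrow> real) \<Rightarrow> real \<Rightarrow> real" where
  "frac_integral \<beta> v t = (LINT s:{0..t}|lebesgue. (t - s) powr (\<beta> - 1) / Gamma \<beta> * v s)"

text \<open>On \<open>[0, T]\<close>, \<open>v\<close> has Riemann--Liouville derivative \<open>D\<close> of order \<open>1 - \<alpha>\<close> at \<open>t\<close>.
  The first conjunct is the convergence of the integrals that are differentiated.\<close>

definition has_RL_derivative ::
  "real \<Rightarrow> real \<Rightarrow> (real \<Rightarrow> real) \<Rightarrow> real \<Rightarrow> real \<Rightarrow> bool" where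
  "has_RL_derivative T \<alpha> v D t \<longleftrightarrow>
     (\<forall>r\<in>{0<..T}. set_integrable lebesgue {0..r} (\<lambda>s. (r - s) powr (\<alpha> - 1) * v s))
     \<and> (frac_integral \<alpha> v has_real_derivative D) (at t within {0..T})"

text \<open>The Laplacian \<open>lap(\<cdot>, t)\<close> is the weak second derivative of \<open>u(\<cdot>, t) \<in> H\<^sup>2(0, L)\<close>, so the
  equation is required for almost every \<open>x\<close>, and for such \<open>x\<close> at every \<open>t \<in> (0, K \<tau>]\<close>.
  A classical solution with \<open>u(\<cdot>, t) \<in> H\<^sup>2(0, L)\<close> is a special case.  Time derivatives
  at \<open>t = K \<tau>\<close> are one-sided.\<close>

definition delay_solution ::
  "real \<Rightarrow> real \<Rightarrow> real \<Rightarrow> real \<Rightarrow> real \<Rightarrow> real \<Rightarrow> nat \<Rightarrow> (real \<Rightarrow> real \<Rightarrow> real) \<Rightarrow>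
   (real \<Rightarrow> real \<Rightarrow> real) \<Rightarrow> (real \<Rightarrow> real \<Rightarrow> real) \<Rightarrow> bool" where
  "delay_solution \<alpha> L p a b \<tau> K f \<phi> u \<longleftrightarrow>
     continuous_on ({0..L} \<times> {-\<tau>..real K * \<tau>}) (\<lambda>(x, t). u x t)
     \<and> (\<forall>x\<in>{0..L}. \<forall>t\<in>{-\<tau>..0}. u x t = \<phi> x t)
     \<and> (\<forall>t\<in>{-\<tau>..real K * \<tau>}. u 0 t = 0 \<and> u L t = 0)
     \<and> (\<exists>lap.
          set_borel_measurable borel ({0..L} \<times> {0..real K * \<tau>}) (\<lambda>(x, t). lap x t)
          \<and> (\<forall>t\<in>{0<..real K * \<tau>}. \<exists>g. H2_derivs L (\<lambda>x. u x t) g (\<lambda>x. lap x t))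
          \<and> (AE x in lebesgue. x \<in> {0<..<L} \<longrightarrow>
               (\<forall>t\<in>{0<..real K * \<tau>}. \<exists>ut D.
                  (u x has_real_derivative ut) (at t within {0..real K * \<tau>})
                  \<and> has_RL_derivative (real K * \<tau>) \<alpha> (\<lambda>s. p * lap x s + a * u x s) D t
                  \<and> ut = D + b * u x (t - \<tau>) + f x t)))"

text \<open>A partition \<open>0 = P 0 < P 1 < \<dots> < P M = L\<close>.\<close>

definition is_partition :: "real \<Rightarrow> nat \<Rightarrow> (nat \<Rightarrow> real) \<Rightarrow> bool" where
  "is_partition L M P \<longleftrightarrow> 0 < M \<and> P 0 = 0 \<and> P M = L \<and> (\<forall>i<M. P i < P (Suc i))"

definition mesh_size :: "nat \<Rightarrow> (nat \<Rightarrow> real) \<Rightarrow> real" where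
  "mesh_size M P = Max ((\<lambda>i. P (Suc i) - P i) ` {..<M})"

definition quasi_uniform :: "real \<Rightarrow> nat \<Rightarrow> (nat \<Rightarrow> real) \<Rightarrow> bool" where
  "quasi_uniform \<sigma> M P \<longleftrightarrow> (\<forall>i<M. mesh_size M P \<le> \<sigma> * (P (Suc i) - P i))"

definition fe_space :: "real \<Rightarrow> nat \<Rightarrow> (nat \<Rightarrow> real) \<Rightarrow> (real \<Rightarrow> real) set" where
  "fe_space L M P = {v. continuous_on {0..L} v \<and> v 0 = 0 \<and> v L = 0
     \<and> (\<forall>i<M. \<exists>c d. \<forall>x\<in>{P i..P (Suc i)}. v x = c + d * x)}"

text \<open>Time steps are integers, as \<open>n\<close> ranges over \<open>-N, \<dots>, K N\<close>; below, \<open>\<rho> = \<tau> / N\<close> and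
  \<open>t\<^sub>n = n \<rho>\<close>.\<close>

definition A_coeff :: "real \<Rightarrow> real \<Rightarrow> nat \<Rightarrow> real" where
  "A_coeff \<alpha> \<rho> k =
     \<rho> powr (-\<alpha>) * Gamma (real k + 1 - \<alpha>) / (Gamma (1 - \<alpha>) * Gamma (real k + 1))"

definition g_coeff :: "real \<Rightarrow> nat \<Rightarrow> real" where
  "g_coeff \<beta> k = (-1) ^ k * (\<beta> gchoose k)"

definition discrete_deriv ::
  "real \<Rightarrow> real \<Rightarrow> (int \<Rightarrow> real \<Rightarrow> real) \<Rightarrow> nat \<Rightarrow> real \<Rightarrow> real" where
  "discrete_deriv \<alpha> \<rho> v n x =
     (\<Sum>k=1..n. A_coeff \<alpha> \<rho> (n - k) * (v (int k) x - v (int k - 1) x))"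

text \<open>\<open>J\<^sup>1\<^sup>-\<^sup>\<alpha> v\<^sup>n\<^sup>-\<^sup>N\<close>\<close>

definition J_delay ::
  "real \<Rightarrow> real \<Rightarrow> nat \<Rightarrow> (int \<Rightarrow> real \<Rightarrow> real) \<Rightarrow> nat \<Rightarrow> real \<Rightarrow> real" where
  "J_delay \<alpha> \<rho> N v n x =
     \<rho> powr (1 - \<alpha>) * (\<Sum>k=0..n. g_coeff (\<alpha> - 1) (n - k) * v (int k - int N) x)"

text \<open>In the next definitions \<open>d\<phi>\<close> stands for \<open>\<partial>\<^sub>t\<phi>\<close>.\<close>

definition H_corr ::
  "real \<Rightarrow> real \<Rightarrow> nat \<Rightarrow> (real \<Rightarrow> real \<Rightarrow> real) \<Rightarrow> (real \<Rightarrow> real \<Rightarrow> real) \<Rightarrow> nat \<Rightarrow> real \<Rightarrow> real" where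
  "H_corr \<alpha> \<tau> N \<phi> d\<phi> n x =
     (let \<rho> = \<tau> / real N in
        d\<phi> x 0 * \<rho> powr (1 - \<alpha>) * (\<Sum>k=N..n. g_coeff (\<alpha> - 1) (n - k) * (real k * \<rho> - \<tau>))
        - \<phi> x (-\<tau>) * \<rho> powr (1 - \<alpha>) * (\<Sum>k=0..n. g_coeff (\<alpha> - 1) (n - k)))"

definition F_rhs ::
  "real \<Rightarrow> real \<Rightarrow> real \<Rightarrow> nat \<Rightarrow> (real \<Rightarrow> real \<Rightarrow> real) \<Rightarrow> (real \<Rightarrow> real \<Rightarrow> real) \<Rightarrow>
   (real \<Rightarrow> real \<Rightarrow> real) \<Rightarrow> nat \<Rightarrow> real \<Rightarrow> real" where
  "F_rhs \<alpha> b \<tau> N f \<phi> d\<phi> n x =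
     (let t = real n * (\<tau> / real N);
          ft = frac_integral (1 - \<alpha>) (f x) t
      in if t \<le> \<tau>
         then ft + b * (t powr (1 - \<alpha>) / Gamma (2 - \<alpha>)) * \<phi> x (-\<tau>)
         else ft - b * ((t - \<tau>) powr (2 - \<alpha>) / Gamma (3 - \<alpha>) * d\<phi> x 0
                        - t powr (1 - \<alpha>) / Gamma (2 - \<alpha>) * \<phi> x (-\<tau>)))"

text \<open>Elements of the finite element space are differentiable off the finitely many nodes, so
  \<open>deriv\<close> represents their weak gradient.\<close>

definition fe_scheme ::
  "real \<Rightarrow> real \<Rightarrow> real \<Rightarrow> real \<Rightarrow> real \<Rightarrow> real \<Rightarrow> nat \<Rightarrow> (real \<Rightarrow> real \<Rightarrow> real) \<Rightarrow>
   (real \<Rightarrow> real \<Rightarrow> real) \<Rightarrow> (real \<Rightarrow> real \<Rightarrow> real) \<Rightarrow> nat \<Rightarrow> (nat \<Rightarrow> real) \<Rightarrow> nat \<Rightarrow>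
   (int \<Rightarrow> real \<Rightarrow> real) \<Rightarrow> bool" where
  "fe_scheme \<alpha> L p a b \<tau> K f \<phi> d\<phi> M P N uh \<longleftrightarrow>
     (\<forall>n\<in>{- int N..int K * int N}. uh n \<in> fe_space L M P)
     \<and> (\<forall>n\<in>{1..K * N}. \<forall>v\<in>fe_space L M P.
          inner_L2 L (discrete_deriv \<alpha> (\<tau> / real N) uh n) v =
            - p * inner_L2 L (deriv (uh (int n))) (deriv v)
            + a * inner_L2 L (uh (int n)) v
            + b * inner_L2 L (J_delay \<alpha> (\<tau> / real N) N uh n) v
            + b * inner_L2 L (H_corr \<alpha> \<tau> N \<phi> d\<phi> n) v
            + inner_L2 L (F_rhs \<alpha> b \<tau> N f \<phi> d\<phi> n) v)"

end

theory Submission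
 imports Defs "HOL-Library.Function_Algebras" "HOL-Real_Asymp.Real_Asymp"
begin

text \<open>Let \<open>\<theta>\<^sup>n = P u\<^sup>n - u\<^sub>h\<^sup>n\<close> with \<open>P\<close> the \<open>L\<^sup>2\<close>-projection on the finite element space. Abel inversion turns
 the delay equation into a Caputo-type equation whose right-hand side is Hoelder continuous in time,
 so that \<open>\<theta>\<^sup>n\<close> solves the scheme with the truncation error and the elliptic defect
 \<open>p D(\<xi>\<^sup>n, v)\<close>, \<open>\<xi>\<^sup>n = P u\<^sup>n - I u\<^sup>n\<close>, as data. No bound on \<open>\<xi>\<^sup>n\<close> in the energy norm is available at order
 \<open>h\<^sup>2\<close>; instead the defect is absorbed by a discrete convolution of powers of the resolvent
 \<open>R = (1 + \<epsilon> D)\<^sup>-\<^sup>1\<close>, where \<open>\<parallel>R\<^sup>m (1 - R)\<parallel> <= 1 / (m + 1)\<close> and the time regularity of \<open>\<xi>\<close> make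
 the sum converge. The truncation error is \<open>O(1 / n)\<close> for the singular part of \<open>u\<close>, plus \<open>\<rho>\<close> times a
 discrete convolution of \<open>L\<^sup>1\<close> data for the rest; convolution with the inverse weights and a discrete
 Gronwall argument over the delay finish the proof.\<close>

text \<open>With the elliptic projection in place of P, the fractional time derivative of its error
  would be needed at order h^2, hence time regularity of the Laplacian, which is not assumed. The
  time difference of u - P u is orthogonal to the test space; the price is a defect that is O(h^2)
  in L2 only. The kernel absorbing it decays like 1 / i, so a bound on \<xi> alone would cost a
  factor ln n; differences of \<xi> in time save it. Their Hoelder bound comes from the equation:
  inverted in time it reads p u_xx + a u = E with a fractional integral E of order 1 - \<alpha>,
  which is Hoelder continuous for t > 0 because its most singular source t^(\<alpha> - 1) is mapped
  to a constant. The inversion leaves a possible term c(x) t^(-\<alpha>) and holds almost everywhere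
  only; both defects vanish after testing with hat functions, since then only values of u occur,
  bounded and Hoelder continuous in time. For p = 0 the equation says nothing about u_xx and the
  uniform H^2 bound is a hypothesis. In time, errors are measured in the scheme's own weights, so
  that the inverse weights turn them into plain sums and integrable second derivatives
  suffice.\<close>

section \<open>Binomial weights of (1 - z)^b and their two-sided bounds\<close>

lemma g_coeff_0 [simp]: "g_coeff b 0 = 1"
 by (simp add: g_coeff_def)

lemma g_coeff_Suc: "g_coeff b (Suc k) = g_coeff b k * (real k - b) / (real k + 1)"
proof -
 have *: "(b gchoose Suc k) = (b gchoose k) * (b - real k) / (real k + 1)"
  by (simp add: gbinomial_prod_rev prod.atLeast0_lessThan_Suc field_simps)
 have **: "real k - b = - (b - real k)" by simp
 show ?thesis unfolding g_coeff_def * ** power_Suc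
  by (simp only: mult_minus_left mult_minus_right minus_divide_left times_divide_eq_right mult_1_left mult.assoc)
qed

text \<open>\<open>g_coeff b k\<close> is the coefficient of z^k in (1 - z)^b, so this is the
  product of two such series; every inversion formula for the weights comes from it.\<close>

lemma g_coeff_Vandermonde: "(\<Sum>k\<le>n. g_coeff a k * g_coeff b (n - k)) = g_coeff (a + b) n"
proof -
 have "(\<Sum>k\<le>n. g_coeff a k * g_coeff b (n - k)) = (\<Sum>k\<le>n. (-1)^n * ((a gchoose k) * (b gchoose (n - k))))"
 proof (rule sum.cong)
  fix k assume "k \<in> {..n}"
  then have "(-1::real)^k * (-1)^(n-k) = (-1)^n" by (simp flip: power_add)
  then show "g_coeff a k * g_coeff b (n - k) = (-1)^n * ((a gchoose k) * (b gchoose (n - k)))"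
   unfolding g_coeff_def by (metis (no_types, opaque_lifting) mult.assoc mult.commute)
 qed simp
 then show ?thesis
  by (simp add: g_coeff_def gbinomial_Vandermonde atMost_atLeast0 flip: sum_distrib_left)
qed

lemma g_coeff_minus_one [simp]: "g_coeff (-1) n = 1"
 by (induction n) (auto simp: g_coeff_Suc)

text \<open>Partial summation is multiplication by (1 - z)^(-1) and lowers the order by one.\<close>

lemma sum_g_coeff: "(\<Sum>k\<le>n. g_coeff b k) = g_coeff (b - 1) n"
 using g_coeff_Vandermonde[of b "-1" n] by simp

lemma g_coeff_diff: "g_coeff (b - 1) (Suc n) - g_coeff (b - 1) n = g_coeff b (Suc n)"
 by (simp flip: sum_g_coeff)

lemma Gamma_add_one_real: "0 < x ==> Gamma (x + 1) = x * Gamma (x::real)"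
 by (rule Gamma_plus1) (meson nonpos_Ints_nonpos not_le)

lemma g_coeff_Gamma:
 assumes "b < 0"
 shows "g_coeff b k = Gamma (real k - b) / (Gamma (- b) * fact k)"
proof (induction k)
 case 0
 then show ?case using assms Gamma_real_pos[of "-b"] by (simp add: less_imp_neq[THEN not_sym])
next
 case (Suc k)
 have "Gamma (real (Suc k) - b) = (real k - b) * Gamma (real k - b)"
  using Gamma_add_one_real[of "real k - b"] assms by (simp add: algebra_simps)
 then show ?case using Suc by (simp add: g_coeff_Suc field_simps)
qed

lemma Gamma_times_g_coeff: "b < 0 ==> Gamma (- b) * g_coeff b j = Gamma (real j - b) / fact j"
 using Gamma_real_pos[of "- b"] by (simp add: g_coeff_Gamma less_imp_neq[THEN not_sym])

lemmas Gamma_times_g_coeff_alpha = Gamma_times_g_coeff[of "\<alpha> - 1" for \<alpha>, simplified, simplified diff_diff_eq2]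

lemma A_coeff_eq: "0 < \<alpha> ==> \<alpha> < 1 ==> A_coeff \<alpha> \<rho> k = \<rho> powr (- \<alpha>) * g_coeff (\<alpha> - 1) k"
 using Gamma_fact[of k, where 'a=real]
 by (simp add: g_coeff_Gamma A_coeff_def diff_diff_eq2 add.commute[of 1])

lemma g_coeff_neg_pos: "b < 0 ==> 0 < g_coeff b k"
 by (induction k) (auto simp: g_coeff_Suc)

lemma g_coeff_neg_antimono:
 assumes "-1 <= b" "b < 0" shows "g_coeff b (Suc k) <= g_coeff b k"
 using g_coeff_neg_pos[of b k] assms mult_left_mono[of "real k - b" "real k + 1" "g_coeff b k"]
 by (simp add: g_coeff_Suc divide_le_eq)

lemma g_coeff_nonpos:
 assumes "0 < b" "b < 1" shows "g_coeff b (Suc k) <= 0"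
 using g_coeff_neg_antimono[of "b - 1" k] g_coeff_diff[of b k] assms by simp

text \<open>Convexity of exp between 0 and ln (1 + x).\<close>

lemma powr_Bernoulli_le:
 assumes "0 <= c" "c <= 1" "(x::real) > -1"
 shows "(1 + x) powr c <= 1 + c * x"
proof -
 have "exp (c *\<^sub>R ln (1 + x) + (1 - c) *\<^sub>R 0) <= c * exp (ln (1 + x)) + (1 - c) * exp 0"
  using convex_onD[OF exp_convex, of c 0 "ln (1+x)"] assms by (auto simp: add.commute)
 then show ?thesis using assms by (simp add: powr_def algebra_simps)
qed

text \<open>With y = 1 / (j + 1) the ratio of consecutive weights is 1 - c y, that of the powers is
  (1 + y)^(-c), and (1 - c y) (1 + y)^c <= (1 - c y) (1 + c y) <= 1.\<close>

lemma g_coeff_upper: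
 assumes "0 <= c" "c <= 1" shows "g_coeff (c - 1) j <= (real j + 1) powr (- c)"
proof (induction j)
 case 0 show ?case by simp
next
 case (Suc j)
 have p: "0 <= g_coeff (c - 1) j"
  using g_coeff_neg_pos[of "c-1" j] assms by (cases "c = 1") (auto simp: g_coeff_def gbinomial_0_left)
 define y where "y = 1 / (real j + 1)"
 have y: "0 < y" "y <= 1" by (auto simp: y_def)
 have "(1 - c * y) * (1 + y) powr c <= (1 - c * y) * (1 + c * y)"
  using assms y powr_Bernoulli_le[of c y] mult_le_one[of c y] by (intro mult_left_mono) auto
 also have "... <= 1" using assms y by (simp add: algebra_simps)
 finally have "1 - c * y <= (1 + y) powr (- c)"
  using y by (simp add: powr_minus pos_le_divide_eq inverse_eq_divide)
 moreover have "g_coeff (c - 1) (Suc j) = g_coeff (c - 1) j * (1 - c * y)"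
  by (simp add: g_coeff_Suc y_def divide_simps)
 ultimately have "g_coeff (c - 1) (Suc j) <= (real j + 1) powr (- c) * (1 + y) powr (- c)"
  using Suc p mult_le_one[of c y] assms y by simp (intro mult_mono, auto)
 also have "... = ((real j + 1) * (1 + y)) powr (- c)"
  using y by (simp add: powr_mult)
 also have "(real j + 1) * (1 + y) = real (Suc j) + 1"
  by (simp add: y_def divide_simps algebra_simps)
 finally show ?case .
qed

text \<open>Log-convexity of Gamma: x + s is the convex combination of x and x + 1 with weight
  s.\<close>

lemma Gamma_ratio_upper:
 assumes "0 < x" "0 <= s" "s <= (1::real)"
 shows "Gamma (x + s) <= x powr s * Gamma x"
proof -
 have "(ln \<circ> Gamma) ((1 - s) *\<^sub>R x + s *\<^sub>R (x + 1)) <= (1 - s) * (ln \<circ> Gamma) x + s * (ln \<circ> Gamma) (x + 1)"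
  using convex_onD[OF log_convex_Gamma_real, of s x "x+1"] assms by auto
 moreover have "(1 - s) *\<^sub>R x + s *\<^sub>R (x + 1) = x + s" by (simp add: algebra_simps)
 moreover have "Gamma (x + 1) = x * Gamma x"
  using assms by (intro Gamma_add_one_real)
 ultimately have "ln (Gamma (x + s)) <= s * ln x + ln (Gamma x)"
  using assms Gamma_real_pos[OF assms(1)]
  by (simp add: ln_mult_pos algebra_simps)
 also have "... = ln (x powr s * Gamma x)"
  using assms Gamma_real_pos[OF assms(1)] by (simp add: ln_mult_pos ln_powr)
 finally show ?thesis using assms Gamma_real_pos[of x] Gamma_real_pos[of "x+s"] by simp
qed

text \<open>\<open>Gamma_ratio_upper\<close> at x = j with s = 1 - \<alpha>. In contrast to
  \<open>g_coeff_upper\<close> the constant 1 / Gamma (1 - \<alpha>) is sharp, as the comparison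
  with the continuous kernel requires.\<close>

lemma g_coeff_Wendel_upper:
 assumes "0 < \<alpha>" "\<alpha> < 1" "1 <= j"
 shows "Gamma (1 - \<alpha>) * g_coeff (\<alpha> - 1) j <= real j powr (- \<alpha>)"
proof -
 have "Gamma (real j + (1 - \<alpha>)) <= real j powr (1 - \<alpha>) * Gamma (real j)"
  using assms by (intro Gamma_ratio_upper) auto
 moreover have "fact j = real j * Gamma (real j)"
  using assms Gamma_add_one_real[of "real j"] Gamma_fact[of j, where 'a=real] by (simp add: add.commute)
 moreover have "real j powr (1 - \<alpha>) = real j * real j powr (- \<alpha>)"
  using assms powr_add[of "real j" 1 "- \<alpha>"] by simp
 ultimately have "Gamma (real j + (1 - \<alpha>)) <= real j powr (- \<alpha>) * fact j"
  by (simp add: mult_ac)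
 then show ?thesis using assms
  by (simp add: Gamma_times_g_coeff_alpha pos_divide_le_eq add_diff_eq)
qed

lemma g_coeff_Wendel_lower:
 assumes "0 < \<alpha>" "\<alpha> < 1"
 shows "(real j + 1) powr (- \<alpha>) <= Gamma (1 - \<alpha>) * g_coeff (\<alpha> - 1) j"
proof -
 let ?x = "real j + (1 - \<alpha>)"
 have "Gamma (?x + \<alpha>) <= ?x powr \<alpha> * Gamma ?x"
  using assms by (intro Gamma_ratio_upper) auto
 also have "... <= (real j + 1) powr \<alpha> * Gamma ?x"
  using assms by (intro mult_right_mono powr_mono2) (auto intro!: less_imp_le Gamma_real_pos)
 finally have "fact j <= (real j + 1) powr \<alpha> * Gamma ?x"
  using Gamma_fact[of j, where 'a=real] by (simp add: add.commute)
 then have "(real j + 1) powr (- \<alpha>) * fact j <= (real j + 1) powr (- \<alpha>) * ((real j + 1) powr \<alpha> * Gamma ?x)"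
  by (intro mult_left_mono) auto
 also have "... = Gamma ?x" by (simp add: powr_minus)
 finally show ?thesis using assms
  by (simp add: Gamma_times_g_coeff_alpha pos_le_divide_eq add_diff_eq)
qed

text \<open>The order \<alpha> - 2 belongs to the partial sums of the scheme's weights, so these
  bounds compare them with the integrated kernel, a power 1 - \<alpha>.\<close>

lemma g_coeff2_Wendel:
 assumes "0 < \<alpha>" "\<alpha> < 1"
 shows "real j powr (1 - \<alpha>) <= Gamma (2 - \<alpha>) * g_coeff (\<alpha> - 2) j"
  and "Gamma (2 - \<alpha>) * g_coeff (\<alpha> - 2) j <= (real j + 1) powr (1 - \<alpha>)"
proof -
 have eq: "Gamma (2 - \<alpha>) * g_coeff (\<alpha> - 2) j = Gamma (real j + 2 - \<alpha>) / fact j"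
  using assms Gamma_times_g_coeff[of "\<alpha> - 2" j] by (simp add: diff_diff_eq2)
 have "real j + 1 + (1 - \<alpha>) = real j + 2 - \<alpha>" by simp
 then have "Gamma (real j + 2 - \<alpha>) <= (real j + 1) powr (1 - \<alpha>) * Gamma (real j + 1)"
  using assms Gamma_ratio_upper[of "real j + 1" "1 - \<alpha>"] by (metis add.commute diff_gt_0_iff_gt le_add_same_cancel1 diff_le_eq less_eq_real_def of_nat_0_le_iff zero_less_one add_nonneg_pos)
 then show "Gamma (2 - \<alpha>) * g_coeff (\<alpha> - 2) j <= (real j + 1) powr (1 - \<alpha>)"
  unfolding eq using Gamma_fact[of j, where 'a=real]
  by (simp add: pos_divide_le_eq add.commute)
 let ?x = "real j + 1 - \<alpha>"
 have "fact j <= ?x powr \<alpha> * Gamma ?x"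
  using Gamma_ratio_upper[of ?x \<alpha>] Gamma_fact[of j, where 'a=real] assms by (simp add: add.commute)
 then have "?x powr (1 - \<alpha>) * fact j <= ?x powr (1 - \<alpha>) * (?x powr \<alpha> * Gamma ?x)"
  by (rule mult_left_mono) simp
 also have "... = (?x powr (1 - \<alpha>) * ?x powr \<alpha>) * Gamma ?x" by simp
 also have "?x powr (1 - \<alpha>) * ?x powr \<alpha> = ?x" using assms by (simp flip: powr_add)
 also have "?x * Gamma ?x = Gamma (?x + 1)" using assms Gamma_add_one_real[of ?x] by simp
 also have "?x + 1 = real j + 2 - \<alpha>" by simp
 finally have "?x powr (1 - \<alpha>) * fact j <= Gamma (real j + 2 - \<alpha>)" .
 moreover have "real j powr (1 - \<alpha>) <= ?x powr (1 - \<alpha>)"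
  using assms by (intro powr_mono2) auto
 ultimately show "real j powr (1 - \<alpha>) <= Gamma (2 - \<alpha>) * g_coeff (\<alpha> - 2) j"
  unfolding eq pos_le_divide_eq[OF fact_gt_zero] by (meson dual_order.trans fact_ge_zero mult_right_mono)
qed

section \<open>Semi-definite inner products, orthonormal families and powers of a resolvent\<close>

text \<open>Semi-definiteness is forced: functions that agree on [0, L] are at distance zero, and
  for p = 0 the elliptic form vanishes identically.\<close>

locale semi_inner =
 fixes W :: "'a::real_vector set" and ip :: "'a => 'a => real"
 assumes W: "subspace W"
  and ip_sym: "!!x y. x \<in> W ==> y \<in> W ==> ip x y = ip y x"
  and ip_add: "!!x y z. x \<in> W ==> y \<in> W ==> z \<in> W ==> ip (x + y) z = ip x z + ip y z"
  and ip_scale: "!!c x z. x \<in> W ==> z \<in> W ==> ip (c *\<^sub>R x) z = c * ip x z"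
  and ip_nonneg: "!!x. x \<in> W ==> 0 <= ip x x"
begin

definition nrm :: "'a => real" where "nrm x = sqrt (ip x x)"

lemmas W_intros [simp, intro] =
 subspace_add[OF W] subspace_diff[OF W] subspace_scale[OF W] subspace_0[OF W] subspace_sum[OF W] subspace_neg[OF W]

lemma ip_0_left [simp]: "z \<in> W ==> ip 0 z = 0"
 using ip_scale[of 0 z 0] by simp

lemma ip_diff: "x \<in> W ==> y \<in> W ==> z \<in> W ==> ip (x - y) z = ip x z - ip y z"
 using ip_add[of "x - y" y z] by simp

lemma ip_add_right: "x \<in> W ==> y \<in> W ==> z \<in> W ==> ip z (x + y) = ip z x + ip z y"
 by (metis ip_add ip_sym W_intros(1))

lemma ip_diff_right: "x \<in> W ==> y \<in> W ==> z \<in> W ==> ip z (x - y) = ip z x - ip z y"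
 by (metis ip_diff ip_sym W_intros(2))

lemma ip_scale_right: "x \<in> W ==> z \<in> W ==> ip z (c *\<^sub>R x) = c * ip z x"
 by (metis ip_scale ip_sym W_intros(3))

lemma ip_0_right [simp]: "z \<in> W ==> ip z 0 = 0"
 by (metis ip_0_left ip_sym W_intros(4))

lemma ip_sum: "(!!i. i \<in> I ==> f i \<in> W) ==> z \<in> W ==> ip (\<Sum>i\<in>I. f i) z = (\<Sum>i\<in>I. ip (f i) z)"
 by (induction I rule: infinite_finite_induct) (auto simp: ip_add)

lemma nrm_nonneg [simp]: "0 <= nrm x" if "x \<in> W"
 using ip_nonneg that by (simp add: nrm_def)

lemma nrm_sq: "x \<in> W ==> (nrm x)\<^sup>2 = ip x x"
 by (simp add: nrm_def ip_nonneg)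

lemma Cauchy_Schwarz_sq:
 assumes "x \<in> W" "y \<in> W" shows "(ip x y)\<^sup>2 <= ip x x * ip y y"
proof -
 have q: "0 <= ip x x - 2 * t * ip x y + t\<^sup>2 * ip y y" for t
  using ip_nonneg[of "x - t *\<^sub>R y"] assms
  by (simp add: ip_diff ip_diff_right ip_scale ip_scale_right ip_sym[of y x] power2_eq_square algebra_simps)
 show ?thesis
 proof (cases "ip y y = 0")
  case True
  show ?thesis
  proof (cases "ip x y = 0")
   case False
   \<comment> \<open>The expression is affine in t; at t = (ip x x + 1) / (2 * ip x y) it equals -1,
     a contradiction.\<close>
   have "0 <= ip x x - 2 * ((ip x x + 1) / (2 * ip x y)) * ip x y" using q True by (metis mult_zero_right add.right_neutral)
   then show ?thesis using False by simp
  qed (use True in auto)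
 next
  case False
  then have p: "ip y y > 0" using ip_nonneg[of y] assms by simp
  have "0 <= ip x x - (ip x y)\<^sup>2 / ip y y"
   using q[of "ip x y / ip y y"] p by (simp add: power2_eq_square)
  then show ?thesis using p by (simp add: field_simps)
 qed
qed

lemma Cauchy_Schwarz:
 assumes "x \<in> W" "y \<in> W" shows "\<bar>ip x y\<bar> <= nrm x * nrm y"
 using real_sqrt_le_mono[OF Cauchy_Schwarz_sq[OF assms]] by (simp add: nrm_def real_sqrt_mult)

text \<open>A null vector is orthogonal to everything by Cauchy-Schwarz; this replaces definiteness
  wherever uniqueness would be invoked.\<close>

lemma ip_eq_0: "x \<in> W ==> y \<in> W ==> ip x x = 0 ==> ip x y = 0"
 using Cauchy_Schwarz_sq[of x y] by simp

lemma nrm_triangle: assumes "x \<in> W" "y \<in> W" shows "nrm (x + y) <= nrm x + nrm y"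
proof (rule power2_le_imp_le)
 have "(nrm (x + y))\<^sup>2 = ip x x + 2 * ip x y + ip y y"
  using assms by (simp add: nrm_sq ip_add ip_add_right ip_sym[of y x])
 also have "... <= ip x x + 2 * (nrm x * nrm y) + ip y y"
  using Cauchy_Schwarz[OF assms] by simp
 also have "... = (nrm x + nrm y)\<^sup>2"
  using assms by (simp add: power2_sum nrm_sq)
 finally show "(nrm (x + y))\<^sup>2 <= (nrm x + nrm y)\<^sup>2" .
qed (use assms in simp)

lemma nrm_scale: "x \<in> W ==> nrm (c *\<^sub>R x) = \<bar>c\<bar> * nrm x"
 by (simp add: nrm_def ip_scale ip_scale_right real_sqrt_mult flip: mult.assoc)

lemma nrm_0 [simp]: "nrm 0 = 0"
 using nrm_scale[of 0 0] by simp

lemma nrm_minus: "x \<in> W ==> nrm (- x) = nrm x"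
 using nrm_scale[of x "-1"] by simp

lemma nrm_sum: "(!!i. i \<in> I ==> f i \<in> W) ==> nrm (\<Sum>i\<in>I. f i) <= (\<Sum>i\<in>I. nrm (f i))"
 by (induction I rule: infinite_finite_induct) (auto intro: order_trans[OF nrm_triangle])

lemma span_subset_W: "B \<subseteq> W ==> span B \<subseteq> W"
 by (simp add: span_minimal W)

text \<open>Gram--Schmidt for a semi-definite form: vectors of length zero are skipped.\<close>

lemma orthonormal_family:
 assumes "finite B" "B \<subseteq> W"
 shows "\<exists>es. set es \<subseteq> span B &
  (\<forall>v\<in>span B. \<forall>w\<in>span B. ip v w = (\<Sum>e\<leftarrow>es. ip v e * ip e w))"
 using assms
proof (induction B)
 case empty
 show ?case by (rule exI[of _ "[]"]) auto
next
 case (insert h B)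
 then obtain es where es: "set es \<subseteq> span B"
  "!!v w. v \<in> span B ==> w \<in> span B ==> ip v w = (\<Sum>e\<leftarrow>es. ip v e * ip e w)" by auto
 have BW: "span B \<subseteq> W" and hW: "h \<in> W" using insert by (auto intro!: span_subset_W)
 have esW: "e \<in> W" if "e \<in> set es" for e using es(1) BW that by auto
 define p where "p = (\<Sum>e\<leftarrow>es. ip h e *\<^sub>R e)"
 have psp: "p \<in> span B" unfolding p_def using es(1)
  by (induction es) (auto intro!: span_add span_scale span_zero)
 have ip_p: "ip p w = (\<Sum>e\<leftarrow>es. ip h e * ip e w)" if "w \<in> W" for w
  unfolding p_def using esW
 proof (induction es)
  case (Cons e es)
  have "(\<Sum>e\<leftarrow>es. ip h e *\<^sub>R e) \<in> W" using Cons.prems by (induction es) auto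
  then show ?case using Cons that by (simp add: ip_add ip_scale)
 qed (use that in simp)
 define h' where "h' = h - p"
 have h'W: "h' \<in> W" using hW psp BW by (auto simp: h'_def)
 have orth: "ip h' v = 0" if "v \<in> span B" for v
 proof -
  have "ip p v = ip h v"
  proof -
   have "ip p v = (\<Sum>e\<leftarrow>es. ip h e * ip e v)" using ip_p that BW by auto
   also have "... = ip h (\<Sum>e\<leftarrow>es. ip e v *\<^sub>R e)"
    using esW
   proof (induction es)
    case (Cons e es)
    have "(\<Sum>e\<leftarrow>es. ip e v *\<^sub>R e) \<in> W" using Cons.prems by (induction es) auto
    then show ?case using Cons hW by (simp add: ip_add_right ip_scale_right)
   qed (use hW in simp)
   also have "... = ip h v"
   proof -
    define q where "q = (\<Sum>e\<leftarrow>es. ip e v *\<^sub>R e)"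
    have qs: "q \<in> span B" unfolding q_def using es(1)
     by (induction es) (auto intro!: span_add span_scale span_zero)
    have q: "ip q w = (\<Sum>e\<leftarrow>es. ip e v * ip e w)" if "w \<in> W" for w
     unfolding q_def using esW
    proof (induction es)
     case (Cons e es)
     have "(\<Sum>e\<leftarrow>es. ip e v *\<^sub>R e) \<in> W" using Cons.prems by (induction es) auto
     then show ?case using Cons that by (simp add: ip_add ip_scale)
    qed (use that in simp)
    have eq: "ip q w = ip v w" if "w \<in> span B" for w
    proof -
     have "ip q w = (\<Sum>e\<leftarrow>es. ip e v * ip e w)" using q[of w] that BW by auto
     also have "... = (\<Sum>e\<leftarrow>es. ip v e * ip e w)"
      using esW \<open>v \<in> span B\<close> BW ip_sym by (intro arg_cong[where f=sum_list] map_cong) (auto simp: subset_iff)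
     finally show ?thesis using es(2)[of v w] that \<open>v \<in> span B\<close> by simp
    qed
    \<comment> \<open>\<open>q - v\<close> need not vanish, but it has length zero, which makes it
      orthogonal to \<open>h\<close> as well, although \<open>h\<close> need not lie in
      \<open>span B\<close>.\<close>
    have "ip (q - v) (q - v) = 0"
     using eq[of "q - v"] qs that BW by (auto simp: ip_diff span_diff subset_iff)
    then have "ip (q - v) h = 0"
     using ip_eq_0[of "q - v" h] qs that BW hW by (auto simp: span_diff subset_iff)
    then have "ip q h = ip v h" using qs that BW hW by (auto simp: ip_diff subset_iff)
    then show ?thesis using ip_sym[of h] qs that BW hW unfolding q_def[symmetric] by (auto simp: subset_iff)
   qed
   finally show ?thesis .
  qed
  then show ?thesis using hW psp BW that by (auto simp: h'_def ip_diff subset_iff)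
 qed
 have decomp: "\<exists>c v0. v0 \<in> span B & v = v0 + c *\<^sub>R h'" if "v \<in> span (insert h B)" for v
 proof -
  obtain c where "v - c *\<^sub>R h \<in> span B" using \<open>v \<in> span (insert h B)\<close> span_breakdown_eq by metis
  then have "v - c *\<^sub>R h + c *\<^sub>R p \<in> span B" using psp by (auto intro: span_add span_scale)
  then show ?thesis by (intro exI[of _ c] exI[of _ "v - c *\<^sub>R h + c *\<^sub>R p"]) (auto simp: h'_def algebra_simps)
 qed
 have h'sp: "h' \<in> span (insert h B)"
  using psp span_mono[of B "insert h B"] by (auto simp: h'_def intro!: span_diff intro: span_base)
 have expand: "ip (v0 + c *\<^sub>R h') (w0 + d *\<^sub>R h') = ip v0 w0 + c * d * ip h' h'"
  if "v0 \<in> span B" "w0 \<in> span B" for v0 w0 c d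
  using that BW h'W orth ip_sym[of v0 h'] by (auto simp: ip_add ip_add_right ip_scale ip_scale_right subset_iff)
 have ve: "ip (v0 + c *\<^sub>R h') e = ip v0 e" "ip e (v0 + c *\<^sub>R h') = ip e v0"
  if "v0 \<in> span B" "e \<in> set es" for v0 c e
  using that es(1) BW h'W orth ip_sym[of e h'] by (auto simp: ip_add ip_add_right ip_scale ip_scale_right subset_iff)
 have list_eq: "(\<Sum>e\<leftarrow>es. ip (v0 + c *\<^sub>R h') e * ip e (w0 + d *\<^sub>R h')) = ip v0 w0"
  if "v0 \<in> span B" "w0 \<in> span B" for v0 w0 c d
 proof -
  have "map (%e. ip (v0 + c *\<^sub>R h') e * ip e (w0 + d *\<^sub>R h')) es = map (%e. ip v0 e * ip e w0) es"
   using ve that by auto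
  then show ?thesis using es(2)[OF that] by (simp only:)
 qed
 have essp: "set es \<subseteq> span (insert h B)" using es(1) span_mono[of B "insert h B"] by auto
 show ?case
 proof (cases "ip h' h' = 0")
  case True
  show ?thesis
  proof (intro exI[of _ es] conjI ballI)
   fix v w assume "v \<in> span (insert h B)" "w \<in> span (insert h B)"
   then obtain c v0 d w0 where "v0 \<in> span B" "v = v0 + c *\<^sub>R h'" "w0 \<in> span B" "w = w0 + d *\<^sub>R h'"
    using decomp by metis
   then show "ip v w = (\<Sum>e\<leftarrow>es. ip v e * ip e w)" using expand list_eq True by simp
  qed (use essp in auto)
 next
  case False
  define e' where "e' = (1 / nrm h') *\<^sub>R h'"
  have n: "nrm h' * nrm h' = ip h' h'" "nrm h' ~= 0" using nrm_sq[OF h'W] False by (auto simp: power2_eq_square)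
  have e': "ip (v0 + c *\<^sub>R h') e' = c * nrm h'" "ip e' (v0 + c *\<^sub>R h') = c * nrm h'" if "v0 \<in> span B" for v0 c
  proof -
   have v0: "v0 \<in> W" using that BW by auto
   have "ip (v0 + c *\<^sub>R h') e' = c * (ip h' h' / nrm h')"
    using v0 h'W orth[OF that] ip_sym[of v0 h']
    by (simp add: e'_def ip_add ip_scale ip_scale_right)
   moreover have "ip e' (v0 + c *\<^sub>R h') = c * (ip h' h' / nrm h')"
    using v0 h'W orth[OF that]
    by (simp add: e'_def ip_add_right ip_scale ip_scale_right)
   moreover have "ip h' h' / nrm h' = nrm h'" using n by (simp add: field_simps)
   ultimately show "ip (v0 + c *\<^sub>R h') e' = c * nrm h'" "ip e' (v0 + c *\<^sub>R h') = c * nrm h'" by auto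
  qed
  show ?thesis
  proof (intro exI[of _ "e' # es"] conjI ballI)
   show "set (e' # es) \<subseteq> span (insert h B)" using essp h'sp by (auto simp: e'_def intro: span_scale)
   fix v w assume "v \<in> span (insert h B)" "w \<in> span (insert h B)"
   then obtain c v0 d w0 where "v0 \<in> span B" "v = v0 + c *\<^sub>R h'" "w0 \<in> span B" "w = w0 + d *\<^sub>R h'"
    using decomp by metis
   then show "ip v w = (\<Sum>e\<leftarrow>e' # es. ip v e * ip e w)"
    using expand list_eq e' n(1) by (simp add: mult_ac)
  qed
 qed
qed

end

text \<open>A symmetric operator \<open>R\<close> with \<open>0 <= R <= I\<close>; the last two axioms are what is needed of this.\<close>

locale resolvent = semi_inner +
 fixes R :: "'a => 'a"
 assumes R_W: "!!x. x \<in> W ==> R x \<in> W"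
  and R_add: "!!x y. x \<in> W ==> y \<in> W ==> R (x + y) = R x + R y"
  and R_scale: "!!c x. x \<in> W ==> R (c *\<^sub>R x) = c *\<^sub>R R x"
  and R_sym: "!!x y. x \<in> W ==> y \<in> W ==> ip (R x) y = ip x (R y)"
  and R_pos: "!!x. x \<in> W ==> 0 <= ip (x - R x) (R x)"
begin

lemma R_0: "R 0 = 0"
 using R_scale[of 0 0] by simp

lemma R_diff: "x \<in> W ==> y \<in> W ==> R (x - y) = R x - R y"
 using R_add[of "x - y" y] by simp

lemma R_sum: "(!!i. i \<in> I ==> f i \<in> W) ==> R (\<Sum>i\<in>I. f i) = (\<Sum>i\<in>I. R (f i))"
 by (induction I rule: infinite_finite_induct) (auto simp: R_add R_0)

lemma Rm_W: "x \<in> W ==> (R ^^ m) x \<in> W"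
 by (induction m) (auto simp: R_W)

lemma Rm_diff: "x \<in> W ==> y \<in> W ==> (R ^^ m) (x - y) = (R ^^ m) x - (R ^^ m) y"
 by (induction m) (auto simp: R_diff Rm_W)

lemma R_nonneg: "x \<in> W ==> 0 <= ip (R x) x"
 using R_pos[of x] ip_nonneg[of "R x"] by (simp add: R_W ip_diff R_sym)

lemma I_R_nonneg: "x \<in> W ==> 0 <= ip (x - R x) x"
 using R_pos[of x] ip_nonneg[of "x - R x"] by (simp add: R_W ip_diff_right)

lemma R_power_sym: "x \<in> W ==> y \<in> W ==> ip ((R ^^ m) x) y = ip x ((R ^^ m) y)"
proof (induction m arbitrary: y)
 case (Suc m)
 then have "ip ((R ^^ Suc m) x) y = ip x ((R ^^ m) (R y))" by (simp add: R_sym R_W Rm_W)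
 then show ?case by (simp add: funpow_swap1)
qed simp

lemma ip_R_power_add: "x \<in> W ==> y \<in> W ==> ip ((R ^^ (j + k)) x) y = ip ((R ^^ j) x) ((R ^^ k) y)"
 using R_power_sym[of "(R ^^ j) x" y k] by (simp add: funpow_add add.commute[of j] Rm_W)

text \<open>By symmetry an even power 2 j gives the squared length of R^j x, and an odd power 2 j +
  1 gives (R y, y) with y = R^j x.\<close>

lemma R_power_nonneg: assumes "x \<in> W" shows "0 <= ip ((R ^^ k) x) x"
proof (cases "even k")
 case True
 then obtain j where "k = j + j" by (metis evenE mult_2)
 then show ?thesis using ip_R_power_add[OF assms assms, of j j] ip_nonneg[OF Rm_W[OF assms, of j]] by simp
next
 case False
 then obtain j where "k = Suc j + j" by (metis oddE mult_2 Suc_eq_plus1 add_Suc)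
 then show ?thesis using ip_R_power_add[OF assms assms, of "Suc j" j] R_nonneg[OF Rm_W[OF assms, of j]] by simp
qed

text \<open>The same halving of the exponent: the even case is positivity of 1 - R at R^j x, the odd
  case is the axiom \<open>R_pos\<close>, positivity of (1 - R) R.\<close>

lemma R_power_antimono: assumes "x \<in> W" shows "ip ((R ^^ Suc k) x) x <= ip ((R ^^ k) x) x"
proof (cases "even k")
 case True
 then obtain j where k: "k = j + j" by (metis evenE mult_2)
 show ?thesis
  using I_R_nonneg[OF Rm_W[OF assms, of j]] ip_R_power_add[OF assms assms, of "Suc j" j]
   ip_R_power_add[OF assms assms, of j j] unfolding k by (simp add: ip_diff R_W Rm_W assms)
next
 case False
 then obtain j where k: "k = j + Suc j" by (metis oddE mult_2 Suc_eq_plus1 add_Suc_right)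
 show ?thesis
  using R_pos[OF Rm_W[OF assms, of j]] ip_R_power_add[OF assms assms, of "Suc j" "Suc j"]
   ip_R_power_add[OF assms assms, of j "Suc j"] unfolding k by (simp add: ip_diff R_W Rm_W assms)
qed

text \<open>The numbers \<open>q k = (R\<^sup>k x, x)\<close> have nonnegative differences up to order three, so that
 \<open>(k + 1) (q k - q (k + 1)) <= q 0\<close> and likewise for second differences.\<close>

lemma nrm_R_power_diff:
 assumes x: "x \<in> W"
 shows "nrm ((R ^^ m) x - (R ^^ Suc m) x) <= nrm x / (real m + 1)"
proof -
 define q where "q k = ip ((R ^^ k) x) x" for k
 define y where "y = x - R x"
 have yW: "y \<in> W" using x R_W by (auto simp: y_def)
 define d where "d k = q k - q (Suc k)" for k
 define dd where "dd k = d k - d (Suc k)" for k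
 have Ry: "(R ^^ k) y = (R ^^ k) x - (R ^^ Suc k) x" for k
  using x by (simp add: y_def Rm_diff R_W funpow_swap1)
 have d: "d k = ip ((R ^^ k) y) x" for k
  unfolding d_def q_def Ry using x by (simp add: ip_diff Rm_W R_W)
 have dd: "dd k = ip ((R ^^ k) y) y" for k
 proof -
  have "ip ((R ^^ k) y) (R x) = ip ((R ^^ Suc k) y) x"
   using x yW R_sym[of "(R ^^ k) y" x] by (simp add: Rm_W)
  then show ?thesis
   unfolding dd_def d using x yW by (subst (3) y_def) (simp add: ip_diff_right Rm_W R_W)
 qed
 have dd0: "0 <= dd k" and dda: "dd (Suc k) <= dd k" for k
  using R_power_nonneg[OF yW] R_power_antimono[OF yW] by (auto simp: dd)
 have q0: "0 <= q k" and qa: "0 <= d k" for k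
  using R_power_nonneg[OF x] R_power_antimono[OF x] by (auto simp: q_def d_def)
 have q_tele: "(\<Sum>i\<le>k. d i) = q 0 - q (Suc k)" for k
  by (induction k) (auto simp: d_def)
 have d_tele: "(\<Sum>i\<in>{m..m+j}. dd i) = d m - d (Suc (m + j))" for m j
  by (induction j) (auto simp: dd_def)
 have d_anti: "antimono d" using dd0 by (auto simp: decseq_Suc_iff dd_def)
 have dd_anti: "antimono dd" using dda by (auto simp: decseq_Suc_iff)
 have "(real m + 1) * d m <= q 0"
 proof -
  have "(real m + 1) * d m = (\<Sum>i\<le>m. d m)" by simp
  also have "... <= (\<Sum>i\<le>m. d i)" using d_anti by (intro sum_mono) (auto simp: antimono_def)
  also have "... <= q 0" using q_tele q0 by simp
  finally show ?thesis .
 qed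
 \<comment> \<open>The index 2 m is dictated by \<open>dd (2 * m)\<close> being the squared length
   of R^m (x - R x); the m + 1 second differences of index m to 2 m telescope to at most
   \<open>d m\<close>.\<close>
 moreover have "(real m + 1) * dd (2 * m) <= d m"
 proof -
  have "(real m + 1) * dd (2*m) = (\<Sum>i\<in>{m..m+m}. dd (2*m))" by simp
  also have "... <= (\<Sum>i\<in>{m..m+m}. dd i)" using dd_anti by (intro sum_mono) (auto simp: antimono_def)
  also have "... <= d m" using d_tele qa by simp
  finally show ?thesis .
 qed
 ultimately have "(real m + 1) * ((real m + 1) * dd (2 * m)) <= q 0"
  by (meson mult_left_mono of_nat_0_le_iff order_trans add_nonneg_nonneg zero_le_one)
 moreover have "dd (2 * m) = (nrm ((R ^^ m) y))\<^sup>2"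
  using ip_R_power_add[OF yW yW, of m m] yW by (simp add: dd nrm_sq Rm_W mult_2)
 moreover have "q 0 = (nrm x)\<^sup>2" using x by (simp add: q_def nrm_sq)
 ultimately have "((real m + 1) * nrm ((R ^^ m) y))\<^sup>2 <= (nrm x)\<^sup>2"
  by (simp add: power2_eq_square mult_ac)
 then have "(real m + 1) * nrm ((R ^^ m) y) <= nrm x"
  by (rule power2_le_imp_le) (use x in simp)
 then show ?thesis unfolding Ry by (simp add: field_simps)
qed

end

section \<open>Complementary convolution weights and discrete comparison\<close>

text \<open>Exchanging the sums leaves the factor 1 = sum of A i * G (m - k - i) in front of each y
  k: convolution with G turns an A-weighted sum into a plain sum.\<close>

lemma sum_convolution_one:
 fixes G A y :: "nat => real"
 assumes conv: "!!l. (\<Sum>i\<le>l. A i * G (l - i)) = 1"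
 shows "(\<Sum>n=1..m. G (m - n) * (\<Sum>k=1..n. A (n - k) * y k)) = (\<Sum>k=1..m. y k)"
proof -
 have "(\<Sum>n=1..m. G (m - n) * (\<Sum>k=1..n. A (n - k) * y k))
   = (\<Sum>n\<in>{1..m}. \<Sum>k | k \<in> {1..m} & k <= n. G (m - n) * (A (n - k) * y k))"
  by (auto simp: sum_distrib_left intro!: sum.cong)
 also have "... = (\<Sum>k\<in>{1..m}. \<Sum>n | n \<in> {1..m} & k <= n. G (m - n) * (A (n - k) * y k))"
  by (rule sum.swap_restrict) auto
 also have "... = (\<Sum>k=1..m. y k)"
 proof (rule sum.cong)
  fix k assume k: "k \<in> {1..m}"
  have "(\<Sum>n | n \<in> {1..m} & k <= n. G (m - n) * (A (n - k) * y k))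
    = (\<Sum>i\<in>{..m - k}. A i * G (m - k - i) * y k)"
   by (rule sum.reindex_bij_witness[of _ "%i. i + k" "%n. n - k"]) (use k in \<open>auto simp: mult_ac\<close>)
  also have "... = y k" using conv[of "m - k"] by (simp flip: sum_distrib_right)
  finally show "(\<Sum>n | n \<in> {1..m} & k <= n. G (m - n) * (A (n - k) * y k)) = y k" .
 qed simp
 finally show ?thesis .
qed

text \<open>Convolving the inequality with the nonnegative G makes its left-hand side telescope to x
  m - x 0.\<close>

lemma discrete_comparison:
 fixes G A x s :: "nat => real"
 assumes conv: "!!l. (\<Sum>i\<le>l. A i * G (l - i)) = 1" and G: "!!i. 0 <= G i"
  and le: "!!n. n \<in> {1..m} ==> (\<Sum>k=1..n. A (n - k) * (x k - x (k - 1))) <= s n"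
 shows "x m <= x 0 + (\<Sum>n=1..m. G (m - n) * s n)"
proof -
 have "x m - x 0 = (\<Sum>k=1..m. x k - x (k - 1))"
  by (induction m) auto
 also have "... = (\<Sum>n=1..m. G (m - n) * (\<Sum>k=1..n. A (n - k) * (x k - x (k - 1))))"
  by (rule sum_convolution_one[OF conv, symmetric])
 also have "... <= (\<Sum>n=1..m. G (m - n) * s n)"
  by (intro sum_mono mult_left_mono le G)
 finally show ?thesis by simp
qed

text \<open>Summation by parts, stated for vectors because it is applied both to norms and to
  sequences of finite element functions.\<close>

lemma sum_Abel:
 fixes f :: "nat => 'a::real_vector" and A :: "nat => real"
 shows "(\<Sum>k=1..Suc n. A (Suc n - k) *\<^sub>R (f k - f (k - 1)))
  = A 0 *\<^sub>R f (Suc n) - (\<Sum>k=1..n. (A (n - k) - A (Suc n - k)) *\<^sub>R f k) - A n *\<^sub>R f 0"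
proof -
 have "(\<Sum>k=1..Suc n. A (Suc n - k) *\<^sub>R f (k - 1)) = (\<Sum>k=0..n. A (n - k) *\<^sub>R f k)"
  by (rule sum.reindex_bij_witness[of _ Suc "%k. k - 1"]) auto
 also have "... = A n *\<^sub>R f 0 + (\<Sum>k=1..n. A (n - k) *\<^sub>R f k)"
  by (simp add: sum.atLeast_Suc_atMost)
 finally show ?thesis
  by (simp add: scaleR_diff_right scaleR_diff_left sum_subtractf)
qed

text \<open>After summation by parts the last value h n is the only one with a positive weight, and
  it is zero.\<close>

lemma sum_decreasing_weights_nonpos:
 fixes A h :: "nat => real"
 assumes A: "!!i. A (Suc i) <= A i" "!!i. 0 <= A i" and h: "!!k. k <= n ==> 0 <= h k" "h n = 0" and n: "1 <= n"
 shows "(\<Sum>k=1..n. A (n - k) * (h k - h (k - 1))) <= 0"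
proof -
 obtain l where l: "n = Suc l" using n by (cases n) auto
 have "0 <= (\<Sum>k=1..l. (A (l - k) - A (Suc l - k)) * h k)"
  using A h by (intro sum_nonneg mult_nonneg_nonneg) (auto simp: l Suc_diff_le)
 moreover have "0 <= A l * h 0" using A h by (auto simp: l)
 ultimately show ?thesis using sum_Abel[of A l h] h by (simp add: l)
qed

section \<open>Powers of the series a(z) = 1 - (1 - z)^\<alpha>\<close>

definition kappa_coeff :: "real => nat => nat => real" where
 "kappa_coeff \<alpha> m i = fps_nth ((1 - Abs_fps (g_coeff \<alpha>)) ^ m) i"

lemma kappa_coeff_0: "kappa_coeff \<alpha> 0 i = (if i = 0 then 1 else 0)"
 by (simp add: kappa_coeff_def)

lemma kappa_coeff_less: "i < m ==> kappa_coeff \<alpha> m i = 0"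
 unfolding kappa_coeff_def by (rule startsby_zero_power_prefix[rule_format]) auto

lemma kappa_coeff_Suc: "kappa_coeff \<alpha> (Suc m) i = (\<Sum>k=1..i. - g_coeff \<alpha> k * kappa_coeff \<alpha> m (i - k))"
proof -
 have "kappa_coeff \<alpha> (Suc m) i = (\<Sum>k=0..i. fps_nth (1 - Abs_fps (g_coeff \<alpha>)) k * kappa_coeff \<alpha> m (i - k))"
  by (simp add: kappa_coeff_def fps_mult_nth)
 also have "... = (\<Sum>k=1..i. - g_coeff \<alpha> k * kappa_coeff \<alpha> m (i - k))"
  by (subst sum.atLeast_Suc_atMost) (auto intro!: sum.cong)
 finally show ?thesis .
qed

text \<open>For 0 < \<alpha> < 1 the series a(z) has no constant term and the nonnegative
  coefficients \<open>- g_coeff \<alpha> k\<close>, hence so have its powers.\<close>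

lemma kappa_coeff_nonneg:
 assumes "0 < \<alpha>" "\<alpha> < 1" shows "0 <= kappa_coeff \<alpha> m i"
proof (induction m arbitrary: i)
 case (Suc m)
 have "0 <= - g_coeff \<alpha> k" if "1 <= k" for k
  using that g_coeff_nonpos[OF assms, of "k - 1"] by simp
 then show ?case unfolding kappa_coeff_Suc using Suc by (intro sum_nonneg mult_nonneg_nonneg) auto
qed (simp add: kappa_coeff_0)

text \<open>The identity \<open>\<Sum>\<^sub>m a(z)\<^sup>m / m = - ln (1 - a(z)) = - \<alpha> ln (1 - z)\<close> for
 \<open>a(z) = 1 - (1 - z)\<^sup>\<alpha>\<close>, proved by differentiating.\<close>

lemma sum_kappa_coeff_div:
 assumes n: "1 <= n"
 shows "(\<Sum>m=1..n. kappa_coeff \<alpha> m n / real m) = \<alpha> / real n"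
proof -
 define g where "g = Abs_fps (g_coeff \<alpha>)"
 define a where "a = 1 - g"
 have a0: "fps_nth a 0 = 0" by (simp add: a_def g_def)
 have da: "(1 - fps_X) * fps_deriv a = fps_const \<alpha> * g"
 proof (rule fps_ext)
  fix k
  have "fps_nth ((1 - fps_X) * fps_deriv a) k = fps_nth (fps_deriv a) k - (if k = 0 then 0 else fps_nth (fps_deriv a) (k - 1))"
   by (simp add: algebra_simps)
  also have "... = \<alpha> * g_coeff \<alpha> k"
  proof (cases k)
   case (Suc l)
   then show ?thesis using g_coeff_Suc[of \<alpha> k]
    by (simp add: a_def g_def field_simps)
  qed (use g_coeff_Suc[of \<alpha> 0] in \<open>simp add: a_def g_def\<close>)
  finally show "fps_nth ((1 - fps_X) * fps_deriv a) k = fps_nth (fps_const \<alpha> * g) k" by (simp add: g_def)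
 qed
 \<comment> \<open>S truncates a' / (1 - a) = \<alpha> / (1 - z); since a^n starts with z^n, the
   coefficients below n are not affected and all equal \<alpha>.\<close>
 define S where "S = fps_deriv a * (\<Sum>m<n. a ^ m)"
 have "(1 - fps_X) * S = fps_const \<alpha> * ((1 - a) * (\<Sum>m<n. a ^ m))"
  unfolding S_def mult.assoc[symmetric] da by (simp add: a_def)
 also have "... = fps_const \<alpha> * (1 - a ^ n)"
  by (simp add: one_diff_power_eq)
 finally have S: "(1 - fps_X) * S = fps_const \<alpha> * (1 - a ^ n)" .
 have Sk: "k < n ==> fps_nth S k = \<alpha>" for k
 proof (induction k)
  case 0
  have "fps_nth ((1 - fps_X) * S) 0 = fps_nth S 0" by (simp add: algebra_simps)
  then show ?case using S startsby_zero_power_prefix[OF a0] 0 by simp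
 next
  case (Suc k)
  have "fps_nth ((1 - fps_X) * S) (Suc k) = fps_nth S (Suc k) - fps_nth S k" by (simp add: algebra_simps)
  then show ?case using S startsby_zero_power_prefix[OF a0] Suc by simp
 qed
 have "real n * (\<Sum>m=1..n. kappa_coeff \<alpha> m n / real m) = fps_nth S (n - 1)"
 proof -
  have "real n * kappa_coeff \<alpha> m n / real m = fps_nth (fps_deriv a * a ^ (m - 1)) (n - 1)" if "m \<in> {1..n}" for m
  proof -
   have "real n * kappa_coeff \<alpha> m n = fps_nth (fps_deriv (a ^ m)) (n - 1)"
    using n by (simp add: kappa_coeff_def a_def g_def)
   also have "... = real m * fps_nth (fps_deriv a * a ^ (m - 1)) (n - 1)"
    by (simp add: fps_deriv_power mult.assoc)
   finally show ?thesis using that by simp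
  qed
  then have "real n * (\<Sum>m=1..n. kappa_coeff \<alpha> m n / real m) = (\<Sum>m=1..n. fps_nth (fps_deriv a * a ^ (m - 1)) (n - 1))"
   by (simp add: sum_distrib_left)
  also have "... = (\<Sum>m<n. fps_nth (fps_deriv a * a ^ m) (n - 1))"
   by (rule sum.reindex_bij_witness[of _ Suc "%k. k - 1"]) auto
  also have "... = fps_nth S (n - 1)"
   by (simp add: S_def sum_distrib_left fps_sum_nth)
  finally show ?thesis .
 qed
 then show ?thesis using Sk[of "n - 1"] n by (simp add: field_simps)
qed

section \<open>The defect problem solved by a convolution of resolvent powers\<close>

context resolvent begin

text \<open>Coefficient of z^i in (1 - a(z) R)^(-1) (1 - R) x with a(z) = 1 - (1 - z)^\<alpha>. With
  R = (1 + \<epsilon> D)^(-1) and \<epsilon> = \<rho>^\<alpha> this is the solution operator of the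
  time-discrete equation with data D x.\<close>

definition kappa :: "real => nat => 'a => 'a" where
 "kappa \<alpha> i x = (\<Sum>m\<le>i. kappa_coeff \<alpha> m i *\<^sub>R ((R ^^ m) x - (R ^^ Suc m) x))"

lemma kappa_W: "x \<in> W ==> kappa \<alpha> i x \<in> W"
 by (auto simp: kappa_def Rm_W R_W)

lemma kappa_0: "kappa \<alpha> 0 x = x - R x"
 by (simp add: kappa_def kappa_coeff_0)

lemma kappa_diff: "x \<in> W ==> y \<in> W ==> kappa \<alpha> i (x - y) = kappa \<alpha> i x - kappa \<alpha> i y"
 by (simp add: kappa_def Rm_diff R_diff Rm_W algebra_simps sum_subtractf del: funpow.simps(2))
  (simp add: algebra_simps sum_subtractf sum.distrib Rm_diff R_diff Rm_W)

text \<open>Coefficient form of (1 - a(z) R) kappa(z) = (1 - R) x: for i >= 1 the right-hand side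
  has no coefficient. In the proof, multiplication by a(z) R shifts m to m + 1.\<close>

lemma kappa_rec:
 assumes x: "x \<in> W" and i: "1 <= i"
 shows "kappa \<alpha> i x = R (\<Sum>k=1..i. (- g_coeff \<alpha> k) *\<^sub>R kappa \<alpha> (i - k) x)"
proof -
 define d where "d m = (R ^^ m) x - (R ^^ Suc m) x" for m
 have dW: "d m \<in> W" for m using x by (simp add: d_def Rm_W R_W)
 have Rd: "R (d m) = d (Suc m)" for m using x by (simp add: d_def R_diff Rm_W R_W)
 have ext: "kappa \<alpha> j x = (\<Sum>m<i. kappa_coeff \<alpha> m j *\<^sub>R d m)" if "j < i" for j
  unfolding kappa_def d_def[symmetric] using that kappa_coeff_less
  by (intro sum.mono_neutral_left) auto
 have "R (\<Sum>k=1..i. (- g_coeff \<alpha> k) *\<^sub>R kappa \<alpha> (i - k) x)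
   = R (\<Sum>k=1..i. \<Sum>m<i. (- g_coeff \<alpha> k * kappa_coeff \<alpha> m (i - k)) *\<^sub>R d m)"
  by (intro arg_cong[where f=R] sum.cong) (auto simp: ext scaleR_sum_right)
 also have "(\<Sum>k=1..i. \<Sum>m<i. (- g_coeff \<alpha> k * kappa_coeff \<alpha> m (i - k)) *\<^sub>R d m)
   = (\<Sum>m<i. kappa_coeff \<alpha> (Suc m) i *\<^sub>R d m)"
  by (subst sum.swap) (simp only: kappa_coeff_Suc scaleR_sum_left)
 also have "R ... = (\<Sum>m<i. kappa_coeff \<alpha> (Suc m) i *\<^sub>R d (Suc m))"
  by (simp add: R_sum dW R_scale Rd)
 also have "... = (\<Sum>m\<in>{1..i}. kappa_coeff \<alpha> m i *\<^sub>R d m)"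
  by (rule sum.reindex_bij_witness[of _ "%k. k - 1" Suc]) auto
 also have "... = kappa \<alpha> i x"
  unfolding kappa_def d_def[symmetric] using i
  by (intro sum.mono_neutral_left) (auto simp: kappa_coeff_0 not_less_eq_eq)
 finally show ?thesis ..
qed

text \<open>The decay 1 / (m + 1) of R^m (1 - R), relaxed to 1 / m, is averaged by
  \<open>sum_kappa_coeff_div\<close>. The result 1 / i is just not summable, which is why
  differences of \<xi> are needed in \<open>stability\<close>.\<close>

lemma nrm_kappa:
 assumes x: "x \<in> W" and \<alpha>: "0 < \<alpha>" "\<alpha> < 1" and i: "1 <= i"
 shows "nrm (kappa \<alpha> i x) <= \<alpha> / real i * nrm x"
proof -
 have "nrm (kappa \<alpha> i x) <= (\<Sum>m\<le>i. nrm (kappa_coeff \<alpha> m i *\<^sub>R ((R ^^ m) x - (R ^^ Suc m) x)))"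
  unfolding kappa_def by (rule nrm_sum) (use x in \<open>auto simp: Rm_W R_W\<close>)
 also have "... <= (\<Sum>m\<le>i. kappa_coeff \<alpha> m i * (nrm x / (real m + 1)))"
  using x nrm_R_power_diff[OF x] kappa_coeff_nonneg[OF \<alpha>]
  by (intro sum_mono) (subst nrm_scale, auto simp: Rm_W R_W intro!: mult_left_mono simp del: times_divide_eq_right)
 also have "... = (\<Sum>m=1..i. kappa_coeff \<alpha> m i * (nrm x / (real m + 1)))"
  using i by (intro sum.mono_neutral_right) (auto simp: kappa_coeff_0 not_less_eq_eq)
 also have "... <= (\<Sum>m=1..i. kappa_coeff \<alpha> m i * (nrm x / real m))"
  using x kappa_coeff_nonneg[OF \<alpha>]
  by (intro sum_mono mult_left_mono divide_left_mono) auto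
 also have "... = \<alpha> / real i * nrm x"
  using sum_kappa_coeff_div[OF i, of \<alpha>] by (simp flip: sum_distrib_right times_divide_eq_left)
 finally show ?thesis .
qed

text \<open>The sequence with value 0 at n = 0 that solves the principal part of the scheme with
  data D (\<xi> n) v, as \<open>omega_eq\<close> inside \<open>stability\<close> shows.\<close>

definition omega :: "real => (nat => 'a) => nat => 'a" where
 "omega \<alpha> \<xi> n = (\<Sum>j=1..n. kappa \<alpha> (n - j) (\<xi> j))"

lemma omega_0 [simp]: "omega \<alpha> \<xi> 0 = 0"
 by (simp add: omega_def)

lemma omega_W: "(!!j. \<xi> j \<in> W) ==> omega \<alpha> \<xi> n \<in> W"
 by (auto simp: omega_def kappa_W)

text \<open>Every summand j < n obeys \<open>kappa_rec\<close>; the summand j = n is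
  \<open>kappa \<alpha> 0\<close> and produces the forcing \<xi> n - R (\<xi> n).\<close>

lemma omega_rec:
 assumes \<xi>: "!!j. \<xi> j \<in> W" and n: "1 <= n"
 shows "omega \<alpha> \<xi> n = \<xi> n - R (\<xi> n) + R (\<Sum>k=1..n. (- g_coeff \<alpha> k) *\<^sub>R omega \<alpha> \<xi> (n - k))"
proof -
 have "(\<Sum>k=1..n. (- g_coeff \<alpha> k) *\<^sub>R omega \<alpha> \<xi> (n - k))
   = (\<Sum>k\<in>{1..n}. \<Sum>j | j \<in> {1..n} & k + j <= n. (- g_coeff \<alpha> k) *\<^sub>R kappa \<alpha> (n - k - j) (\<xi> j))"
  unfolding omega_def by (auto simp: scaleR_sum_right intro!: sum.cong)
 also have "... = (\<Sum>j\<in>{1..n}. \<Sum>k | k \<in> {1..n} & k + j <= n. (- g_coeff \<alpha> k) *\<^sub>R kappa \<alpha> (n - k - j) (\<xi> j))"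
  by (rule sum.swap_restrict) auto
 also have "... = (\<Sum>j\<in>{1..n}. \<Sum>k=1..n - j. (- g_coeff \<alpha> k) *\<^sub>R kappa \<alpha> (n - j - k) (\<xi> j))"
  by (intro sum.cong) (auto simp: add.commute)
 finally have "R (\<Sum>k=1..n. (- g_coeff \<alpha> k) *\<^sub>R omega \<alpha> \<xi> (n - k))
   = (\<Sum>j\<in>{1..n}. R (\<Sum>k=1..n - j. (- g_coeff \<alpha> k) *\<^sub>R kappa \<alpha> (n - j - k) (\<xi> j)))"
  by (simp add: R_sum kappa_W \<xi>)
 also have "... = (\<Sum>j\<in>{1..n}. if j = n then 0 else kappa \<alpha> (n - j) (\<xi> j))"
  by (intro sum.cong) (auto simp: R_0 kappa_rec[OF \<xi>])
 also have "... = (\<Sum>j\<in>{1..n} - {n}. kappa \<alpha> (n - j) (\<xi> j))"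
  by (simp add: sum.If_cases) (intro sum.cong; auto)
 also have "... = omega \<alpha> \<xi> n - kappa \<alpha> 0 (\<xi> n)"
  using n by (simp add: omega_def sum_diff1)
 finally show ?thesis by (simp add: kappa_0)
qed

end

text \<open>(1 - z)^(\<alpha> - 1) (1 - z)^(-\<alpha>) = (1 - z)^(-1), and the powers of \<rho>
  cancel.\<close>

lemma A_G_convolution:
 "(\<Sum>i\<le>l. (\<rho> powr (-\<alpha>) * g_coeff (\<alpha> - 1) i) * (\<rho> powr \<alpha> * g_coeff (-\<alpha>) (l - i))) = 1"
 if "\<rho> > 0"
proof -
 have "\<rho> powr (-\<alpha>) * \<rho> powr \<alpha> = 1" using that by (simp flip: powr_add)
 then have "(\<rho> powr (-\<alpha>) * g_coeff (\<alpha> - 1) i) * (\<rho> powr \<alpha> * g_coeff (-\<alpha>) (l - i))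
   = g_coeff (\<alpha> - 1) i * g_coeff (-\<alpha>) (l - i)" for i
  by (metis (no_types, opaque_lifting) mult.assoc mult.commute mult_1)
 then show ?thesis using g_coeff_Vandermonde[of "\<alpha> - 1" "-\<alpha>" l] by (simp only:) simp
qed

text \<open>For sequences starting at 0 the discrete derivative is multiplication by (1 -
  z)^(\<alpha> - 1) (1 - z) = 1 - a(z); in this form it meets the recursion for
  \<open>omega\<close>.\<close>

lemma sum_g_coeff_diff:
 fixes f :: "nat => 'a::real_vector"
 assumes "f 0 = 0" "1 <= n"
 shows "(\<Sum>k=1..n. g_coeff (\<alpha> - 1) (n - k) *\<^sub>R (f k - f (k - 1)))
  = f n - (\<Sum>k=1..n. (- g_coeff \<alpha> k) *\<^sub>R f (n - k))"
proof -
 obtain l where l: "n = Suc l" using assms(2) by (cases n) auto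
 have "(\<Sum>k=1..l. (g_coeff (\<alpha> - 1) (l - k) - g_coeff (\<alpha> - 1) (Suc l - k)) *\<^sub>R f k)
   = (\<Sum>k=1..l. (- g_coeff \<alpha> (Suc l - k)) *\<^sub>R f k)"
 proof (intro sum.cong refl)
  fix k assume "k \<in> {1..l}"
  then show "(g_coeff (\<alpha> - 1) (l - k) - g_coeff (\<alpha> - 1) (Suc l - k)) *\<^sub>R f k = (- g_coeff \<alpha> (Suc l - k)) *\<^sub>R f k"
   by (simp add: Suc_diff_le scaleR_minus_left[symmetric] del: scaleR_minus_left flip: g_coeff_diff[of \<alpha> "l - k"])
 qed
 also have "... = (\<Sum>k=1..l. (- g_coeff \<alpha> k) *\<^sub>R f (Suc l - k))"
  by (rule sum.reindex_bij_witness[of _ "%k. Suc l - k" "%k. Suc l - k"]) auto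
 also have "... = (\<Sum>k=1..Suc l. (- g_coeff \<alpha> k) *\<^sub>R f (Suc l - k))"
  using assms by simp
 finally show ?thesis using sum_Abel[of "g_coeff (\<alpha> - 1)" l f] assms by (simp add: l)
qed

section \<open>Stability of the abstract Galerkin scheme\<close>

text \<open>\<open>D\<close> is a form on the finite-dimensional span only, since general elements
  of W have no derivative.\<close>

locale galerkin = semi_inner +
 fixes B :: "'a set" and D :: "'a => 'a => real"
 assumes B: "finite B" "B \<subseteq> W"
  and D_inner: "semi_inner (span B) D"
begin

lemma span_W: "v \<in> span B ==> v \<in> W"
 using span_subset_W B by auto

lemma semi_inner_perturbed:
 assumes "0 <= \<epsilon>" shows "semi_inner (span B) (%v w. ip v w + \<epsilon> * D v w)"
proof -
 interpret D: semi_inner "span B" D by (rule D_inner)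
 show ?thesis
 proof unfold_locales
  show "ip x y + \<epsilon> * D x y = ip y x + \<epsilon> * D y x" if "x \<in> span B" "y \<in> span B" for x y
   using that span_W ip_sym[of x y] D.ip_sym[of x y] by simp
 qed (use assms span_W in \<open>auto simp: ip_add D.ip_add ip_scale D.ip_scale ip_nonneg D.ip_nonneg algebra_simps\<close>)
qed

text \<open>Riesz representation made explicit: for a family \<open>es\<close> orthonormal with
  respect to Q = ip + \<epsilon> D, R x is the sum of ip x e times e, which also shows the symmetry
  of R. For \<epsilon> = 0 this is the orthogonal projection onto the span.\<close>

lemma resolvent_exists:
 assumes \<epsilon>: "0 <= \<epsilon>"
 obtains R where "resolvent W ip R" "!!x. R x \<in> span B"
  "!!x v. x \<in> W ==> v \<in> span B ==> ip (R x) v + \<epsilon> * D (R x) v = ip x v"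
proof -
 interpret D: semi_inner "span B" D by (rule D_inner)
 define Q where "Q v w = ip v w + \<epsilon> * D v w" for v w
 interpret Q: semi_inner "span B" Q unfolding Q_def[abs_def] by (rule semi_inner_perturbed[OF \<epsilon>])
 obtain es where es: "set es \<subseteq> span B"
  "!!v w. v \<in> span B ==> w \<in> span B ==> Q v w = (\<Sum>e\<leftarrow>es. Q v e * Q e w)"
  using Q.orthonormal_family[OF B(1) span_superset] by auto
 define lc where "lc c es = (\<Sum>e\<leftarrow>es. c e *\<^sub>R e)" for c :: "'a => real" and es
 have lc_span: "set es \<subseteq> span B ==> lc c es \<in> span B" for c es
  by (induction es) (auto simp: lc_def intro!: span_add span_scale span_zero)
 have lc_Q: "set es \<subseteq> span B ==> v \<in> span B ==> Q (lc c es) v = (\<Sum>e\<leftarrow>es. c e * Q e v)" for c v es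
 proof (induction es)
  case (Cons e es)
  then show ?case using lc_span[of es c] by (simp add: lc_def Q.ip_add Q.ip_scale)
 qed (simp add: lc_def)
 have lc_ip: "set es \<subseteq> span B ==> x \<in> W ==> ip (lc c es) x = (\<Sum>e\<leftarrow>es. c e * ip e x)" for c x es
 proof (induction es)
  case (Cons e es)
  then show ?case using lc_span[of es c] span_W by (simp add: lc_def ip_add ip_scale)
 qed (simp add: lc_def)
 define R where "R x = lc (ip x) es" for x
 have R_span: "R x \<in> span B" for x unfolding R_def using lc_span es(1) by auto
 have key: "ip (R x) v + \<epsilon> * D (R x) v = ip x v" if x: "x \<in> W" and v: "v \<in> span B" for x v
 proof -
  define w where "w = lc (%e. Q v e) es"
  have w: "w \<in> span B" unfolding w_def using lc_span es(1) by auto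
  have Qw: "Q w u = Q v u" if "u \<in> span B" for u
   unfolding w_def using lc_Q[OF es(1) that] es(2)[OF v that] by simp
  have wv: "w - v \<in> span B" using w v by (rule span_diff)
  \<comment> \<open>The expansion \<open>w\<close> of v may differ from v by a null vector of Q. As
    \<epsilon> D is nonnegative, that vector is null for ip too, so the pairing with x does not see
    it.\<close>
  have "Q (w - v) (w - v) = 0" using Qw[OF wv] w v wv by (simp add: Q.ip_diff)
  then have "ip (w - v) (w - v) <= 0"
   using mult_nonneg_nonneg[OF \<epsilon> D.ip_nonneg[OF wv]] unfolding Q_def by linarith
  then have "ip (w - v) (w - v) = 0" using ip_nonneg[of "w - v"] wv span_W by fastforce
  then have "ip (w - v) x = 0" using ip_eq_0 wv x span_W by auto
  then have "ip w x = ip v x" using w v x span_W by (simp add: ip_diff)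
  moreover have "ip w x = (\<Sum>e\<leftarrow>es. Q v e * ip e x)" unfolding w_def using lc_ip es(1) x by auto
  moreover have "Q (R x) v = (\<Sum>e\<leftarrow>es. ip x e * Q e v)" unfolding R_def using lc_Q es(1) v by auto
  moreover have "(\<Sum>e\<leftarrow>es. ip x e * Q e v) = (\<Sum>e\<leftarrow>es. Q v e * ip e x)"
   using es(1) v x span_W ip_sym Q.ip_sym
   by (intro arg_cong[where f=sum_list] map_cong) (auto simp: subset_iff)
  ultimately show ?thesis using x v span_W ip_sym by (simp add: Q_def)
 qed
 have "resolvent W ip R"
 proof unfold_locales
  show "R x \<in> W" if "x \<in> W" for x using R_span span_W by auto
  have lc_add: "lc (%e. c e + d e) es = lc c es + lc d es" for c d and es :: "'a list"
   by (induction es) (auto simp: lc_def algebra_simps)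
  have lc_scale: "lc (%e. a * c e) es = a *\<^sub>R lc c es" for c a and es :: "'a list"
   by (induction es) (auto simp: lc_def algebra_simps)
  have lc_cong: "(!!e. e \<in> set es ==> c e = d e) ==> lc c es = lc d es" for c d and es :: "'a list"
   unfolding lc_def by (intro arg_cong[where f=sum_list] map_cong) auto
  have esW: "e \<in> W" if "e \<in> set es" for e using that es(1) span_W by auto
  show "R (x + y) = R x + R y" if "x \<in> W" "y \<in> W" for x y
   unfolding R_def lc_add[symmetric] by (rule lc_cong) (use that esW ip_add in auto)
  show "R (c *\<^sub>R x) = c *\<^sub>R R x" if "x \<in> W" for c x
   unfolding R_def lc_scale[symmetric] by (rule lc_cong) (use that esW ip_scale in auto)
  show "ip (R x) y = ip x (R y)" if "x \<in> W" "y \<in> W" for x y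
  proof -
   have "ip x (R y) = ip (R y) x" using that ip_sym R_span span_W by auto
   also have "... = (\<Sum>e\<leftarrow>es. ip y e * ip e x)" unfolding R_def using lc_ip es(1) that by auto
   also have "... = (\<Sum>e\<leftarrow>es. ip x e * ip e y)"
    using that esW ip_sym by (intro arg_cong[where f=sum_list] map_cong) auto
   also have "... = ip (R x) y" unfolding R_def using lc_ip es(1) that by auto
   finally show ?thesis ..
  qed
  show "0 <= ip (x - R x) (R x)" if "x \<in> W" for x
  proof -
   have "ip (x - R x) (R x) = \<epsilon> * D (R x) (R x)"
    using key[OF that R_span[of x]] that span_W[OF R_span[of x]] by (simp add: ip_diff)
   then show ?thesis using \<epsilon> D.ip_nonneg[OF R_span[of x]] by simp
  qed
 qed
 then show ?thesis using that R_span key by blast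
qed

definition ddiff :: "real => real => (nat => 'a) => nat => 'a" where
 "ddiff \<alpha> \<rho> \<theta> n = (\<Sum>k=1..n. (\<rho> powr (-\<alpha>) * g_coeff (\<alpha> - 1) (n - k)) *\<^sub>R (\<theta> k - \<theta> (k - 1)))"

text \<open>Testing with \<theta> n: h k = nrm (\<theta> n) * nrm (\<theta> k) - ip (\<theta> k)
  (\<theta> n) is nonnegative and vanishes at k = n, so decreasing weights bound the discrete
  derivative of the norms, times nrm (\<theta> n), by the tested derivative. Then
  \<open>discrete_comparison\<close> applies.\<close>

lemma energy_estimate:
 assumes \<alpha>: "0 < \<alpha>" "\<alpha> < 1" and \<rho>: "0 < \<rho>" and a: "a <= 0"
  and \<theta>: "!!n. \<theta> n \<in> span B" and r: "!!n. n \<in> {1..m} ==> r n \<in> W"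
  and eq: "!!n v. n \<in> {1..m} ==> v \<in> span B ==>
   ip (ddiff \<alpha> \<rho> \<theta> n) v + D (\<theta> n) v - a * ip (\<theta> n) v = ip (r n) v"
 shows "nrm (\<theta> m) <= nrm (\<theta> 0) + (\<Sum>n=1..m. (\<rho> powr \<alpha> * g_coeff (-\<alpha>) (m - n)) * nrm (r n))"
proof -
 interpret D: semi_inner "span B" D by (rule D_inner)
 define A where "A i = \<rho> powr (-\<alpha>) * g_coeff (\<alpha> - 1) i" for i
 have \<theta>W: "\<theta> n \<in> W" for n using \<theta> span_W by auto
 have A: "A (Suc i) <= A i" "0 <= A i" for i
  using g_coeff_neg_antimono[of "\<alpha> - 1" i] g_coeff_neg_pos[of "\<alpha> - 1" i] \<alpha>
  by (auto simp: A_def intro!: mult_left_mono)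
 have step: "(\<Sum>k=1..n. A (n - k) * (nrm (\<theta> k) - nrm (\<theta> (k - 1)))) <= nrm (r n)" if n: "n \<in> {1..m}" for n
 proof -
  define h where "h k = nrm (\<theta> n) * nrm (\<theta> k) - ip (\<theta> k) (\<theta> n)" for k
  have "0 <= h k" for k using Cauchy_Schwarz[OF \<theta>W \<theta>W, of k n] by (simp add: h_def mult.commute)
  moreover have "h n = 0" using nrm_sq[OF \<theta>W, of n] by (simp add: h_def power2_eq_square)
  ultimately have "(\<Sum>k=1..n. A (n - k) * (h k - h (k - 1))) <= 0"
   using n A by (intro sum_decreasing_weights_nonpos) auto
  moreover have "ip (ddiff \<alpha> \<rho> \<theta> n) (\<theta> n) = (\<Sum>k=1..n. A (n - k) * (ip (\<theta> k) (\<theta> n) - ip (\<theta> (k - 1)) (\<theta> n)))"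
   unfolding ddiff_def A_def[symmetric] using \<theta>W by (subst ip_sum) (auto simp: ip_scale ip_diff)
  ultimately have "nrm (\<theta> n) * (\<Sum>k=1..n. A (n - k) * (nrm (\<theta> k) - nrm (\<theta> (k - 1)))) <= ip (ddiff \<alpha> \<rho> \<theta> n) (\<theta> n)"
   by (simp add: h_def sum_distrib_left algebra_simps sum_subtractf sum.distrib)
  also have "... <= ip (r n) (\<theta> n)"
   using eq[OF n \<theta>[of n]] D.ip_nonneg[OF \<theta>[of n]] ip_nonneg[OF \<theta>W[of n]] a mult_nonpos_nonneg[of a "ip (\<theta> n) (\<theta> n)"] by linarith
  also have "... <= nrm (\<theta> n) * nrm (r n)" using Cauchy_Schwarz[OF r[OF n] \<theta>W, of n] by (simp add: mult.commute)
  finally have *: "nrm (\<theta> n) * (\<Sum>k=1..n. A (n - k) * (nrm (\<theta> k) - nrm (\<theta> (k - 1)))) <= nrm (\<theta> n) * nrm (r n)" .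
  show ?thesis
  proof (cases "nrm (\<theta> n) = 0")
   \<comment> \<open>Division by nrm (\<theta> n) is impossible here, but then the norms themselves
     form a nonnegative sequence vanishing at n.\<close>
   case True
   have "(\<Sum>k=1..n. A (n - k) * (nrm (\<theta> k) - nrm (\<theta> (k - 1)))) <= 0"
    using n A True \<theta>W by (intro sum_decreasing_weights_nonpos) auto
   then show ?thesis using nrm_nonneg[OF r[OF n]] by linarith
  next
   case False
   then show ?thesis using * nrm_nonneg[OF \<theta>W[of n]] by (simp add: mult_le_cancel_left)
  qed
 qed
 show ?thesis
  by (rule discrete_comparison[where A=A and G="%i. \<rho> powr \<alpha> * g_coeff (-\<alpha>) i"])
   (use A_G_convolution[OF \<rho>] step g_coeff_neg_pos[of "-\<alpha>"] \<alpha> in \<open>auto simp: A_def less_imp_le\<close>)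
qed

text \<open>Subtracting \<open>omega\<close> leaves \<open>energy_estimate\<close> with data r + a
  \<omega>. To bound \<omega>, \<xi> j is split into \<xi> j - \<xi> n, met by the kernel \<alpha> /
  (n - j), and the constant \<xi> n, whose response is bounded without summing that kernel.\<close>

theorem stability:
 assumes \<alpha>: "0 < \<alpha>" "\<alpha> < 1" and \<rho>: "0 < \<rho>" and a: "a <= 0"
  and \<theta>: "!!n. \<theta> n \<in> span B" and r: "!!n. n \<in> {1..m} ==> r n \<in> W" and \<xi>: "!!n. \<xi> n \<in> span B"
  and eq: "!!n v. n \<in> {1..m} ==> v \<in> span B ==>
   ip (ddiff \<alpha> \<rho> \<theta> n) v + D (\<theta> n) v - a * ip (\<theta> n) v = D (\<xi> n) v + ip (r n) v"
  and m: "1 <= m" and K: "!!n. n \<in> {1..m} ==> 2 * nrm (\<xi> n) + (\<Sum>j=1..<n. \<alpha> / real (n - j) * nrm (\<xi> j - \<xi> n)) <= \<kappa>"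
 shows "nrm (\<theta> m) <= nrm (\<theta> 0) + \<kappa> + (\<Sum>n=1..m. (\<rho> powr \<alpha> * g_coeff (-\<alpha>) (m - n)) * (nrm (r n) + \<bar>a\<bar> * \<kappa>))"
proof -
 interpret D: semi_inner "span B" D by (rule D_inner)
 obtain R where R: "resolvent W ip R" "!!x. R x \<in> span B"
  "!!x v. x \<in> W ==> v \<in> span B ==> ip (R x) v + \<rho> powr \<alpha> * D (R x) v = ip x v"
  using resolvent_exists[of "\<rho> powr \<alpha>"] by auto
 interpret R: resolvent W ip R by (rule R(1))
 have \<rho>1: "\<rho> powr (-\<alpha>) * \<rho> powr \<alpha> = 1" using \<rho> by (simp flip: powr_add)
 have omega_span: "R.omega \<alpha> \<zeta> n \<in> span B" if "!!n. \<zeta> n \<in> span B" for \<zeta> n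
 proof -
  have Rm: "x \<in> span B ==> (R ^^ i) x \<in> span B" for i x by (induction i) (auto simp: R(2))
  have "x \<in> span B ==> R.kappa \<alpha> i x \<in> span B" for i x
   unfolding R.kappa_def by (auto intro!: span_sum span_scale span_diff Rm R(2))
  then show ?thesis using that unfolding R.omega_def by (auto intro!: span_sum)
 qed
 have omega_eq: "ip (ddiff \<alpha> \<rho> (R.omega \<alpha> \<zeta>) n) v + D (R.omega \<alpha> \<zeta> n) v = D (\<zeta> n) v"
  if \<zeta>: "!!n. \<zeta> n \<in> span B" and n: "1 <= n" and v: "v \<in> span B" for \<zeta> n v
 proof -
  define w where "w = R.omega \<alpha> \<zeta>"
  have wS: "w n \<in> span B" for n unfolding w_def using omega_span[OF \<zeta>] by auto
  define x where "x = (\<Sum>k=1..n. (- g_coeff \<alpha> k) *\<^sub>R w (n - k))"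
  have xS: "x \<in> span B" unfolding x_def using wS by (auto intro!: span_sum span_scale)
  note W = span_W[OF wS] span_W[OF xS] span_W[OF \<zeta>] span_W[OF v] span_W[OF R(2)]
  have w: "w n = \<zeta> n - R (\<zeta> n) + R x"
   unfolding w_def x_def by (rule R.omega_rec[OF span_W[OF \<zeta>] n])
  have "ddiff \<alpha> \<rho> w n = \<rho> powr (-\<alpha>) *\<^sub>R (w n - x)"
   unfolding ddiff_def scaleR_scaleR[symmetric] scaleR_sum_right[symmetric] x_def
   by (subst sum_g_coeff_diff[OF _ n]) (auto simp: w_def)
  then have "ip (ddiff \<alpha> \<rho> w n) v = \<rho> powr (-\<alpha>) * (ip (\<zeta> n) v - ip (R (\<zeta> n)) v + ip (R x) v - ip x v)"
   using W by (simp add: ip_scale ip_diff ip_add w)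
  also have "ip (\<zeta> n) v - ip (R (\<zeta> n)) v = \<rho> powr \<alpha> * D (R (\<zeta> n)) v"
   using R(3)[OF W(3) v, of n] by simp
  also have "\<rho> powr \<alpha> * D (R (\<zeta> n)) v + ip (R x) v - ip x v = \<rho> powr \<alpha> * (D (R (\<zeta> n)) v - D (R x) v)"
   using R(3)[OF W(2) v] by (simp add: algebra_simps)
  also have "\<rho> powr (-\<alpha>) * (\<rho> powr \<alpha> * (D (R (\<zeta> n)) v - D (R x) v)) = D (R (\<zeta> n)) v - D (R x) v"
   using \<rho>1 by (simp flip: mult.assoc)
  also have "D (R (\<zeta> n)) v - D (R x) v = D (\<zeta> n) v - D (w n) v"
   unfolding w using \<zeta> v xS R(2) by (simp add: D.ip_add D.ip_diff)
  finally show ?thesis by (simp add: w_def)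
 qed
 \<comment> \<open>For constant data x the difference \<open>omega\<close> - x solves the
   homogeneous scheme with initial value -x, so its norm stays below nrm x.\<close>
 have omega_const: "nrm (R.omega \<alpha> (%_. x) n) <= 2 * nrm x" if x: "x \<in> span B" for x n
 proof -
  define w where "w n = R.omega \<alpha> (%_. x) n - x" for n
  have oS: "R.omega \<alpha> (%_. x) n \<in> span B" for n using omega_span x by auto
  have wS: "w n \<in> span B" for n unfolding w_def using oS x by (auto intro!: span_diff)
  have "nrm (w n) <= nrm (w 0) + (\<Sum>i=1..n. (\<rho> powr \<alpha> * g_coeff (-\<alpha>) (n - i)) * nrm 0)"
  proof (rule energy_estimate[OF \<alpha> \<rho> order_refl wS])
   fix i v assume "i \<in> {1..n}" and v: "v \<in> span B"
   moreover have "ddiff \<alpha> \<rho> w i = ddiff \<alpha> \<rho> (R.omega \<alpha> (%_. x)) i"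
    by (simp add: ddiff_def w_def)
   ultimately show "ip (ddiff \<alpha> \<rho> w i) v + D (w i) v - 0 * ip (w i) v = ip 0 v"
    using omega_eq[of "%_. x" i v] x oS span_W[OF v] by (simp add: w_def D.ip_diff)
  qed simp
  moreover have "nrm (w 0) = nrm x" using nrm_minus x span_W by (simp add: w_def)
  moreover have "nrm (R.omega \<alpha> (%_. x) n) <= nrm (w n) + nrm x"
   using nrm_triangle[of "w n" x] wS x span_W by (simp add: w_def)
  ultimately show ?thesis by simp
 qed
 define w where "w = R.omega \<alpha> \<xi>"
 have wS: "w n \<in> span B" for n unfolding w_def using omega_span[OF \<xi>] by auto
 have w_bound: "nrm (w n) <= \<kappa>" if n: "n \<in> {1..m}" for n
 proof -
  note W = span_W[OF \<xi>]
  have "w n = (\<Sum>j=1..n. R.kappa \<alpha> (n - j) (\<xi> j - \<xi> n)) + R.omega \<alpha> (%_. \<xi> n) n"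
   unfolding w_def R.omega_def by (simp add: R.kappa_diff W sum_subtractf)
  also have "(\<Sum>j=1..n. R.kappa \<alpha> (n - j) (\<xi> j - \<xi> n)) = (\<Sum>j=1..<n. R.kappa \<alpha> (n - j) (\<xi> j - \<xi> n))"
   by (rule sum.mono_neutral_right) (auto simp: R.kappa_0 R.R_0 not_less)
  finally have "nrm (w n) <= nrm (\<Sum>j=1..<n. R.kappa \<alpha> (n - j) (\<xi> j - \<xi> n)) + nrm (R.omega \<alpha> (%_. \<xi> n) n)"
   using W by (auto intro!: nrm_triangle R.omega_W W_intros R.kappa_W)
  also have "nrm (\<Sum>j=1..<n. R.kappa \<alpha> (n - j) (\<xi> j - \<xi> n)) <= (\<Sum>j=1..<n. nrm (R.kappa \<alpha> (n - j) (\<xi> j - \<xi> n)))"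
   using W by (intro nrm_sum) (auto intro!: R.kappa_W)
  also have "... <= (\<Sum>j=1..<n. \<alpha> / real (n - j) * nrm (\<xi> j - \<xi> n))"
   using W \<alpha> by (intro sum_mono R.nrm_kappa) auto
  also have "nrm (R.omega \<alpha> (%_. \<xi> n) n) <= 2 * nrm (\<xi> n)" using omega_const \<xi> by auto
  finally show ?thesis using K[OF n] by linarith
 qed
 define \<eta> where "\<eta> n = \<theta> n - w n" for n
 have \<eta>S: "\<eta> n \<in> span B" for n unfolding \<eta>_def using \<theta> wS by (auto intro!: span_diff)
 have "nrm (\<eta> m) <= nrm (\<eta> 0) + (\<Sum>n=1..m. (\<rho> powr \<alpha> * g_coeff (-\<alpha>) (m - n)) * nrm (r n + a *\<^sub>R w n))"
 proof (rule energy_estimate[OF \<alpha> \<rho> a \<eta>S])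
  show "r n + a *\<^sub>R w n \<in> W" if "n \<in> {1..m}" for n using r[OF that] span_W[OF wS, of n] by auto
  fix n v assume n: "n \<in> {1..m}" and v: "v \<in> span B"
  note W = span_W[OF wS] span_W[OF \<theta>] span_W[OF v] r[OF n]
  have "ddiff \<alpha> \<rho> \<eta> n = ddiff \<alpha> \<rho> \<theta> n - ddiff \<alpha> \<rho> w n"
   unfolding ddiff_def sum_subtractf[symmetric] by (intro sum.cong) (auto simp: \<eta>_def algebra_simps)
  moreover have "ddiff \<alpha> \<rho> \<theta> n \<in> W" "ddiff \<alpha> \<rho> w n \<in> W"
   unfolding ddiff_def using W by (auto intro!: W_intros)
  ultimately have "ip (ddiff \<alpha> \<rho> \<eta> n) v = ip (ddiff \<alpha> \<rho> \<theta> n) v - ip (ddiff \<alpha> \<rho> w n) v"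
   using W by (simp add: ip_diff)
  moreover have "ip (ddiff \<alpha> \<rho> w n) v + D (w n) v = D (\<xi> n) v"
   unfolding w_def using n v by (intro omega_eq \<xi>) auto
  ultimately show "ip (ddiff \<alpha> \<rho> \<eta> n) v + D (\<eta> n) v - a * ip (\<eta> n) v = ip (r n + a *\<^sub>R w n) v"
   using eq[OF n v] W \<theta> wS v by (simp add: \<eta>_def D.ip_diff ip_diff ip_add ip_scale algebra_simps)
 qed
 also have "\<eta> 0 = \<theta> 0" by (simp add: \<eta>_def w_def)
 also have "(\<Sum>n=1..m. (\<rho> powr \<alpha> * g_coeff (-\<alpha>) (m - n)) * nrm (r n + a *\<^sub>R w n))
  <= (\<Sum>n=1..m. (\<rho> powr \<alpha> * g_coeff (-\<alpha>) (m - n)) * (nrm (r n) + \<bar>a\<bar> * \<kappa>))"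
 proof (intro sum_mono mult_left_mono)
  fix n assume n: "n \<in> {1..m}"
  have "nrm (r n + a *\<^sub>R w n) <= nrm (r n) + \<bar>a\<bar> * nrm (w n)"
   using nrm_triangle[of "r n" "a *\<^sub>R w n"] r[OF n] span_W[OF wS, of n] by (simp add: nrm_scale)
  also have "... <= nrm (r n) + \<bar>a\<bar> * \<kappa>" using w_bound[OF n] by (simp add: mult_left_mono)
  finally show "nrm (r n + a *\<^sub>R w n) <= nrm (r n) + \<bar>a\<bar> * \<kappa>" .
 qed (use g_coeff_neg_pos[of "-\<alpha>"] \<alpha> in \<open>auto simp: less_imp_le\<close>)
 finally have "nrm (\<eta> m) <= nrm (\<theta> 0) + (\<Sum>n=1..m. (\<rho> powr \<alpha> * g_coeff (-\<alpha>) (m - n)) * (nrm (r n) + \<bar>a\<bar> * \<kappa>))"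
  by simp
 moreover have "nrm (\<theta> m) <= nrm (\<eta> m) + nrm (w m)"
  using nrm_triangle[of "\<eta> m" "w m"] span_W[OF \<eta>S, of m] span_W[OF wS, of m] by (simp add: \<eta>_def)
 moreover have "nrm (w m) <= \<kappa>" using w_bound[of m] m by auto
 ultimately show ?thesis by simp
qed

end

section \<open>L2 on the interval as a semi-inner product space of functions\<close>

text \<open>Pointwise scaling completes the pointwise additive structure, so that functions
  themselves serve as vectors in \<open>semi_inner\<close> and \<open>span\<close>.\<close>

instantiation "fun" :: (type, real_vector) real_vector
begin

definition scaleR_fun :: "real => ('a => 'b) => 'a => 'b" where
 "scaleR_fun r f = (%x. r *\<^sub>R f x)"

instance
 by standard (auto simp: scaleR_fun_def fun_eq_iff algebra_simps)

end

lemma scaleR_fun_apply [simp]: "(r *\<^sub>R f) x = r *\<^sub>R f x"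
 by (simp add: scaleR_fun_def)

lemma sum_fun_apply: "(\<Sum>i\<in>I. f i) x = (\<Sum>i\<in>I. f i x)"
 by (induction I rule: infinite_finite_induct) auto

lemma in_L2_product_integrable:
 assumes "in_L2 L v" "in_L2 L w"
 shows "set_integrable lebesgue {0..L} (%x. v x * w x)"
proof -
 have m: "(%x. indicator {0..L} x * v x) \<in> borel_measurable lebesgue"
  "(%x. indicator {0..L} x * w x) \<in> borel_measurable lebesgue"
  using assms by (auto simp: in_L2_def set_borel_measurable_def)
 have "set_integrable lebesgue {0..L} (%x. (v x)\<^sup>2 + (w x)\<^sup>2)"
  using assms by (intro set_integral_add) (auto simp: in_L2_def)
 then show ?thesis unfolding set_integrable_def
 proof (rule Bochner_Integration.integrable_bound)
  have "(%x. indicator {0..L} x *\<^sub>R (v x * w x)) = (%x. (indicator {0..L} x * v x) * (indicator {0..L} x * w x))"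
   by (auto simp: indicator_def fun_eq_iff)
  then show "(%x. indicator {0..L} x *\<^sub>R (v x * w x)) \<in> borel_measurable lebesgue" using m by simp
  have "\<bar>v x * w x\<bar> <= (v x)\<^sup>2 + (w x)\<^sup>2" for x
  proof -
   have "2 * (v x * w x) <= (v x)\<^sup>2 + (w x)\<^sup>2" "- 2 * (v x * w x) <= (v x)\<^sup>2 + (w x)\<^sup>2"
    using sum_squares_ge_zero[of "v x - w x" 0] sum_squares_ge_zero[of "v x + w x" 0]
    by (auto simp: power2_eq_square algebra_simps)
   moreover have "0 <= (v x)\<^sup>2 + (w x)\<^sup>2" by simp
   ultimately show ?thesis by linarith
  qed
  then show "AE x in lebesgue. norm (indicator {0..L} x *\<^sub>R (v x * w x)) <= norm (indicator {0..L} x *\<^sub>R ((v x)\<^sup>2 + (w x)\<^sup>2))"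
   by (auto simp: indicator_def)
 qed
qed

lemma in_L2_scale: "in_L2 L v ==> in_L2 L (c *\<^sub>R v)"
 unfolding in_L2_def set_borel_measurable_def
 by (auto simp: power_mult_distrib mult.left_commute[of _ c] intro!: set_integrable_mult_right)

lemma in_L2_add: assumes "in_L2 L v" "in_L2 L w" shows "in_L2 L (v + w)"
 unfolding in_L2_def set_borel_measurable_def
proof
 show "(%x. indicator {0..L} x *\<^sub>R (v + w) x) \<in> borel_measurable lebesgue"
  using assms by (auto simp: in_L2_def set_borel_measurable_def distrib_left)
 have "set_integrable lebesgue {0..L} (%x. (v x)\<^sup>2 + 2 * (v x * w x) + (w x)\<^sup>2)"
  using assms in_L2_product_integrable[OF assms]
  by (intro set_integral_add set_integrable_mult_right) (auto simp: in_L2_def)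
 then show "set_integrable lebesgue {0..L} (%x. ((v + w) x)\<^sup>2)"
  by (simp add: power2_sum algebra_simps)
qed

lemma semi_inner_L2: "semi_inner {v. in_L2 L v} (inner_L2 L)"
proof
 show "subspace {v. in_L2 L v}"
  by (auto simp: subspace_def in_L2_add in_L2_scale) (simp add: in_L2_def set_borel_measurable_def set_integrable_def)
 fix x y z :: "real => real" and c
 show "inner_L2 L x y = inner_L2 L y x" by (simp add: inner_L2_def mult.commute)
 show "0 <= inner_L2 L x x"
  unfolding inner_L2_def set_lebesgue_integral_def by (intro integral_nonneg_AE) auto
 assume "x \<in> {v. in_L2 L v}" "z \<in> {v. in_L2 L v}"
 then have xz: "in_L2 L x" "in_L2 L z" by auto
 show "inner_L2 L (c *\<^sub>R x) z = c * inner_L2 L x z"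
  by (simp add: inner_L2_def mult.assoc)
 assume "y \<in> {v. in_L2 L v}"
 then show "inner_L2 L (x + y) z = inner_L2 L x z + inner_L2 L y z"
  unfolding inner_L2_def plus_fun_apply distrib_right
  by (intro set_integral_add in_L2_product_integrable xz) auto
qed

lemma nrm_L2: "semi_inner.nrm (inner_L2 L) v = norm_L2 L v"
 by (simp add: semi_inner.nrm_def[OF semi_inner_L2] norm_L2_def)

lemma inner_L2_cong:
 "(!!x. x \<in> {0..L} ==> v x = v' x) ==> (!!x. x \<in> {0..L} ==> w x = w' x) ==> inner_L2 L v w = inner_L2 L v' w'"
 unfolding inner_L2_def by (intro set_lebesgue_integral_cong) auto

lemma norm_L2_cong: "(!!x. x \<in> {0..L} ==> v x = v' x) ==> norm_L2 L v = norm_L2 L v'"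
 unfolding norm_L2_def by (metis inner_L2_cong)

lemma norm_L2_sq: "(norm_L2 L v)\<^sup>2 = (LINT x:{0..L}|lebesgue. (v x)\<^sup>2)"
 using semi_inner.ip_nonneg[OF semi_inner_L2, of v L]
 by (simp add: norm_L2_def inner_L2_def power2_eq_square set_lebesgue_integral_def)

lemma norm_L2_nonneg [simp]: "0 <= norm_L2 L v"
 unfolding norm_L2_def inner_L2_def set_lebesgue_integral_def
 by (intro real_sqrt_ge_zero integral_nonneg_AE) auto

lemma in_L2_mono:
 assumes v: "set_borel_measurable lebesgue {0..L} v" and g: "in_L2 L g"
  and le: "!!x. x \<in> {0..L} ==> \<bar>v x\<bar> <= g x"
 shows "in_L2 L v" and "norm_L2 L v <= norm_L2 L g"
proof -
 have sq: "(v x)\<^sup>2 <= (g x)\<^sup>2" if "x \<in> {0..L}" for x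
  using le[OF that] by (simp add: abs_le_square_iff[symmetric])
 have "set_integrable lebesgue {0..L} (%x. (v x)\<^sup>2)"
  unfolding set_integrable_def
 proof (rule Bochner_Integration.integrable_bound)
  show "integrable lebesgue (%x. indicator {0..L} x *\<^sub>R (g x)\<^sup>2)"
   using g by (simp add: in_L2_def set_integrable_def)
  have "(%x. indicator {0..L} x *\<^sub>R (v x)\<^sup>2) = (%x. (indicator {0..L} x *\<^sub>R v x)\<^sup>2)"
   by (auto simp: fun_eq_iff indicator_def)
  then show "(%x. indicator {0..L} x *\<^sub>R (v x)\<^sup>2) \<in> borel_measurable lebesgue"
   using v by (simp add: set_borel_measurable_def)
 qed (use sq in \<open>auto simp: indicator_def\<close>)
 then show v2: "in_L2 L v" using v by (simp add: in_L2_def)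
 have "(norm_L2 L v)\<^sup>2 <= (norm_L2 L g)\<^sup>2"
  unfolding norm_L2_sq using v2 g sq by (intro set_integral_mono) (auto simp: in_L2_def)
 then show "norm_L2 L v <= norm_L2 L g" by (rule power2_le_imp_le) simp
qed

lemma in_L2_const: "in_L2 L (%x. c)"
proof -
 have "integrable lborel (indicat_real {0..L})"
  by (intro integrable_real_indicator) (auto simp: emeasure_lborel_Icc_eq)
 then have i: "integrable lebesgue (indicat_real {0..L})" by (simp add: integrable_completion)
 then have "(%x. indicat_real {0..L} x * c) \<in> borel_measurable lebesgue" by measurable
 then show ?thesis using i unfolding in_L2_def set_borel_measurable_def set_integrable_def by simp
qed

lemma norm_L2_const: "0 <= L ==> norm_L2 L (%x. c) = \<bar>c\<bar> * sqrt L"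
 by (simp add: norm_L2_def inner_L2_def set_lebesgue_integral_def real_sqrt_mult mult.commute)

lemma in_L2_bounded:
 assumes "set_borel_measurable lebesgue {0..L} v" "!!x. x \<in> {0..L} ==> \<bar>v x\<bar> <= c" "0 <= L"
 shows "in_L2 L v" "norm_L2 L v <= c * sqrt L"
proof -
 have "0 <= c" using assms(2)[of 0] assms(3) by auto
 then show "in_L2 L v" "norm_L2 L v <= c * sqrt L"
  using in_L2_mono[OF assms(1) in_L2_const assms(2)] norm_L2_const[OF assms(3), of c] by auto
qed

lemma set_borel_measurable_lebesgue_continuous:
 "continuous_on {a..b} v ==> set_borel_measurable lebesgue {a..b} (v :: real => real)"
 unfolding set_borel_measurable_def
 using borel_measurable_continuous_on_indicator[of "{a..b}" v] by (auto simp: measurable_completion)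

lemma in_L2_continuous:
 assumes "continuous_on {0..L} v" shows "in_L2 L v"
proof (cases "0 <= L")
 case True
 have "bounded (v ` {0..L})"
  using compact_imp_bounded[OF compact_continuous_image[OF assms compact_Icc]] .
 then obtain c where "\<forall>x\<in>{0..L}. \<bar>v x\<bar> <= c" unfolding bounded_iff by force

 then show ?thesis
  using in_L2_bounded(1)[OF set_borel_measurable_lebesgue_continuous[OF assms] _ True] by blast
next
 case False
 then show ?thesis by (simp add: in_L2_def set_borel_measurable_def set_integrable_def)
qed

section \<open>Piecewise linear elements: hat functions, interpolation and its error\<close>

lemma partition_mono:
 fixes P :: "nat => real"
 assumes "!!i. i < M ==> P i <= P (Suc i)" "i <= j" "j <= M"
 shows "P i <= P j"
 using assms(2,3)
proof (induction j)
 case (Suc j)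
 then show ?case using assms(1)[of j] by (cases "i = Suc j") (auto intro: order_trans)
qed auto

lemma absolutely_integrable_partition:
 fixes P :: "nat => real" and f :: "real => real"
 assumes P: "!!i. i < M ==> P i <= P (Suc i)"
  and f: "!!i. i < M ==> f absolutely_integrable_on {P i..P (Suc i)}"
 shows "f absolutely_integrable_on {P 0..P M}"
  and "(LINT x:{P 0..P M}|lebesgue. f x) = (\<Sum>i<M. LINT x:{P i..P (Suc i)}|lebesgue. f x)"
proof -
 have *: "n <= M ==> f absolutely_integrable_on {P 0..P n} & integral {P 0..P n} f = (\<Sum>i<n. integral {P i..P (Suc i)} f)" for n
 proof (induction n)
  case (Suc n)
  have le: "P 0 <= P n" "P n <= P (Suc n)" using partition_mono[of M P 0 n] P Suc by auto
  have f': "f absolutely_integrable_on {P n..P (Suc n)}" using f Suc by auto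
  have i: "f integrable_on {P 0..P (Suc n)}" "(%x. norm (f x)) integrable_on {P 0..P (Suc n)}"
   using Suc f' le by (auto simp: absolutely_integrable_on_def intro!: Henstock_Kurzweil_Integration.integrable_combine[OF le])
  moreover have "integral {P 0..P (Suc n)} f = integral {P 0..P n} f + integral {P n..P (Suc n)} f"
   using Henstock_Kurzweil_Integration.integral_combine[OF le i(1)] by simp
  ultimately show ?case using Suc by (simp add: absolutely_integrable_on_def)
 qed (use integrable_on_refl[of f "P 0"] integrable_on_refl[of "%x. norm (f x)" "P 0"] in
   \<open>auto simp: absolutely_integrable_on_def\<close>)
 show "f absolutely_integrable_on {P 0..P M}" using * by auto
 then show "(LINT x:{P 0..P M}|lebesgue. f x) = (\<Sum>i<M. LINT x:{P i..P (Suc i)}|lebesgue. f x)"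
  using *[of M] f by (simp add: set_lebesgue_integral_eq_integral)
qed

definition hat :: "real => real => real => real => real" where
 "hat a m b x = max 0 (min ((x - a) / (m - a)) ((b - x) / (b - m)))"

text \<open>The jump of the slope at \<open>m\<close> of the interpolant of \<open>u\<close> at \<open>a < m < b\<close>, that is,
 minus the pairing of \<open>u'\<close> with the derivative of the hat function.\<close>

definition hat_jump :: "(real => real) => real => real => real => real" where
 "hat_jump u a m b = (u b - u m) / (b - m) - (u m - u a) / (m - a)"

lemma hat_left: assumes "a < m" "m < b" "x <= m" shows "hat a m b x = max 0 ((x - a) / (m - a))"
proof -
 have "(x - a) / (m - a) <= 1" "1 <= (b - x) / (b - m)" using assms by (auto simp: divide_simps)
 then show ?thesis by (simp add: hat_def)
qed

lemma hat_right: assumes "a < m" "m < b" "m <= x" shows "hat a m b x = max 0 ((b - x) / (b - m))"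
proof -
 have "1 <= (x - a) / (m - a)" "(b - x) / (b - m) <= 1" using assms by (auto simp: divide_simps)
 then show ?thesis by (simp add: hat_def)
qed

lemma hat_bounds: assumes "a < m" "m < b" shows "0 <= hat a m b x & hat a m b x <= 1"
proof (cases "x <= m")
 case True then show ?thesis using assms hat_left[OF assms True] by (auto simp: divide_simps)
next
 case False then show ?thesis using assms hat_right[OF assms, of x] by (auto simp: divide_simps)
qed

lemma hat_outside: assumes "a < m" "m < b" "x <= a \<or> b <= x" shows "hat a m b x = 0"
proof (cases "x <= m")
 case True then show ?thesis using assms hat_left[OF assms(1,2) True] by (auto simp: divide_simps max_def)
next
 case False then show ?thesis using assms hat_right[OF assms(1,2), of x] by (auto simp: divide_simps max_def)
qed

lemma continuous_on_hat: "continuous_on S (hat a m b)"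
 unfolding hat_def divide_inverse by (intro continuous_intros)

lemma in_L2_hat: "in_L2 L (hat a m b)"
 by (rule in_L2_continuous[OF continuous_on_hat])

locale fe_partition =
 fixes L :: real and M :: nat and P :: "nat => real"
 assumes part: "is_partition L M P"
begin

abbreviation "h \<equiv> mesh_size M P"

lemma M_pos: "0 < M" and P_0: "P 0 = 0" and P_M: "P M = L" and P_Suc: "i < M ==> P i < P (Suc i)"
 using part by (auto simp: is_partition_def)

lemma P_le: "i <= j ==> j <= M ==> P i <= P j"
 by (rule partition_mono[of M]) (auto intro: less_imp_le P_Suc)

lemma P_less: "i < j ==> j <= M ==> P i < P j"
 using P_le[of "Suc i" j] P_Suc[of i] by simp

lemma P_range: "i <= M ==> 0 <= P i & P i <= L"
 using P_le[of 0 i] P_le[of i M] by (simp add: P_0 P_M)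

lemma L_pos: "0 < L"
 using P_less[of 0 M] M_pos by (simp add: P_0 P_M)

lemma h_ge: "i < M ==> P (Suc i) - P i <= h"
 unfolding mesh_size_def by (intro Max_ge) auto

lemma h_pos: "0 < h"
 using h_ge[of 0] P_Suc[of 0] M_pos by linarith

lemma cell_exists:
 assumes "x \<in> {0..L}" shows "\<exists>i<M. x \<in> {P i..P (Suc i)}"
proof -
 have "n <= M ==> x <= P n ==> 0 < n ==> \<exists>i<n. x \<in> {P i..P (Suc i)}" for n
 proof (induction n)
  case (Suc n)
  show ?case
  proof (cases "P n <= x")
   case True then show ?thesis using Suc by (intro exI[of _ n]) auto
  next
   case False
   then have "0 < n" using assms P_0 by (cases n) auto
   then show ?thesis using Suc False by (auto intro: less_SucI)
  qed
 qed simp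
 then show ?thesis using assms M_pos by (auto simp: P_M)
qed

definition hatf :: "nat => real => real" where
 "hatf i = hat (P (i - 1)) (P i) (P (Suc i))"

definition basis :: "(real => real) set" where "basis = hatf ` {1..<M}"

lemma finite_basis: "finite basis" by (simp add: basis_def)

lemma hatf_cell:
 assumes i: "i \<in> {1..<M}" and j: "j < M" and x: "x \<in> {P j..P (Suc j)}"
 shows "hatf i x = (if i = j then (P (Suc j) - x) / (P (Suc j) - P j)
  else if i = Suc j then (x - P j) / (P (Suc j) - P j) else 0)"
proof -
 obtain i' where i': "i = Suc i'" using i by (cases i) auto
 have lt: "P i' < P i" "P i < P (Suc i)" using P_Suc[of i'] P_Suc[of i] i i' by auto
 consider "i = j" | "i = Suc j" | "Suc i <= j" | "Suc (Suc j) <= i" by linarith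
 then show ?thesis
 proof cases
  case 1
  then have "hat (P i') (P i) (P (Suc i)) x = (P (Suc j) - x) / (P (Suc j) - P j)"
   using lt x hat_right[OF lt, of x] by (auto simp: divide_simps max_def)
  then show ?thesis using 1 i' by (auto simp: hatf_def)
 next
  case 2
  then have "hat (P i') (P i) (P (Suc i)) x = (x - P j) / (P (Suc j) - P j)"
   using lt x i' hat_left[OF lt, of x] by (auto simp: divide_simps max_def)
  then show ?thesis using 2 by (simp add: hatf_def i')
 next
  case 3
  then have "P (Suc i) <= x" using P_le[of "Suc i" j] x j by auto
  then have "hat (P i') (P i) (P (Suc i)) x = 0" using lt by (auto intro: hat_outside)
  then show ?thesis using 3 by (simp add: hatf_def i')
 next
  case 4
  then have "x <= P i'" using P_le[of "Suc j" i'] x j i i' by auto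
  then have "hat (P i') (P i) (P (Suc i)) x = 0" using lt by (auto intro: hat_outside)
  then show ?thesis using 4 by (simp add: hatf_def i')
 qed
qed

lemma hatf_node:
 assumes "i \<in> {1..<M}" "j <= M" shows "hatf i (P j) = (if i = j then 1 else 0)"
proof (cases "j < M")
 case True
 then show ?thesis using hatf_cell[OF assms(1) True, of "P j"] P_Suc[OF True] by auto
next
 case False
 then obtain l where "j = Suc l" "l < M" using assms(2) M_pos by (cases j) auto
 then show ?thesis using hatf_cell[OF assms(1), of l "P j"] P_Suc[of l] assms(1) False by auto
qed

lemma subspace_fe_space: "subspace (fe_space L M P)"
proof -
 have "v + w \<in> fe_space L M P" if v: "v \<in> fe_space L M P" and w: "w \<in> fe_space L M P" for v w
 proof -
  have "\<exists>c d. \<forall>x\<in>{P i..P (Suc i)}. (v + w) x = c + d * x" if i: "i < M" for i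
  proof -
   obtain c d c' d' where "\<forall>x\<in>{P i..P (Suc i)}. v x = c + d * x" "\<forall>x\<in>{P i..P (Suc i)}. w x = c' + d' * x"
    using v w i unfolding fe_space_def by blast
   then show ?thesis by (intro exI[of _ "c + c'"] exI[of _ "d + d'"]) (auto simp: algebra_simps)
  qed
  moreover have "continuous_on {0..L} (v + w)"
   using v w continuous_on_add[of "{0..L}" v w] by (auto simp: fe_space_def plus_fun_def)
  ultimately show ?thesis using v w by (auto simp: fe_space_def)
 qed
 moreover have "c *\<^sub>R v \<in> fe_space L M P" if v: "v \<in> fe_space L M P" for c v
 proof -
  have "\<exists>c' d. \<forall>x\<in>{P i..P (Suc i)}. (c *\<^sub>R v) x = c' + d * x" if i: "i < M" for i
  proof -
   obtain c' d where "\<forall>x\<in>{P i..P (Suc i)}. v x = c' + d * x"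
    using v i unfolding fe_space_def by blast
   then show ?thesis by (intro exI[of _ "c * c'"] exI[of _ "c * d"]) (auto simp: algebra_simps)
  qed
  moreover have "continuous_on {0..L} (c *\<^sub>R v)"
   using v by (auto simp: fe_space_def scaleR_fun_def intro!: continuous_intros)
  ultimately show ?thesis using v by (auto simp: fe_space_def)
 qed
 moreover have "0 \<in> fe_space L M P"
  by (auto simp: fe_space_def zero_fun_def intro!: exI[of _ "0::real"])
 ultimately show ?thesis by (auto simp: subspace_def)
qed

lemma hatf_fe_space: assumes i: "i \<in> {1..<M}" shows "hatf i \<in> fe_space L M P"
proof -
 have "\<exists>c d. \<forall>x\<in>{P j..P (Suc j)}. hatf i x = c + d * x" if j: "j < M" for j
 proof -
  consider "i = j" | "i = Suc j" "i ~= j" | "i ~= j" "i ~= Suc j" by blast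
  then show ?thesis
  proof cases
   case 1
   then show ?thesis using hatf_cell[OF i j]
    by (intro exI[of _ "P (Suc j) / (P (Suc j) - P j)"] exI[of _ "- 1 / (P (Suc j) - P j)"]) (auto simp: diff_divide_distrib)
  next
   case 2
   then show ?thesis using hatf_cell[OF i j]
    by (intro exI[of _ "- P j / (P (Suc j) - P j)"] exI[of _ "1 / (P (Suc j) - P j)"]) (auto simp: diff_divide_distrib)
  next
   case 3
   then show ?thesis using hatf_cell[OF i j] by (intro exI[of _ 0]) auto
  qed
 qed
 moreover have "hatf i 0 = 0" "hatf i L = 0"
  using hatf_node[OF i, of 0] hatf_node[OF i, of M] i by (auto simp: P_0 P_M)
 ultimately show ?thesis by (auto simp: fe_space_def hatf_def continuous_on_hat)
qed

lemma span_basis_fe_space: "span basis \<subseteq> fe_space L M P"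
 by (rule span_minimal[OF _ subspace_fe_space]) (auto simp: basis_def hatf_fe_space)

lemma fe_space_L2: "v \<in> fe_space L M P ==> in_L2 L v"
 by (rule in_L2_continuous) (simp add: fe_space_def)

definition interp :: "(real => real) => real => real" where
 "interp v = (\<Sum>i=1..<M. v (P i) *\<^sub>R hatf i)"

lemma interp_span: "interp v \<in> span basis"
 unfolding interp_def by (intro span_sum span_scale span_base) (auto simp: basis_def)

lemma interp_diff: "interp (%x. v x - w x) = interp v - interp w"
 by (simp add: interp_def scaleR_diff_left sum_subtractf)

lemma interp_cell:
 assumes v: "v 0 = 0" "v L = 0" and j: "j < M" and x: "x \<in> {P j..P (Suc j)}"
 shows "interp v x = (v (P j) * (P (Suc j) - x) + v (P (Suc j)) * (x - P j)) / (P (Suc j) - P j)"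
proof -
 define l r where "l = (P (Suc j) - x) / (P (Suc j) - P j)" and "r = (x - P j) / (P (Suc j) - P j)"
 have "interp v x = (\<Sum>i=1..<M. v (P i) * hatf i x)"
  by (simp add: interp_def sum_fun_apply)
 also have "... = (\<Sum>i=1..<M. (if i = j then v (P j) * l else 0) + (if i = Suc j then v (P (Suc j)) * r else 0))"
  using hatf_cell[OF _ j x] by (intro sum.cong) (auto simp: l_def r_def)
 also have "... = (if j \<in> {1..<M} then v (P j) * l else 0) + (if Suc j \<in> {1..<M} then v (P (Suc j)) * r else 0)"
  by (simp add: sum.distrib)
 also have "... = v (P j) * l + v (P (Suc j)) * r"
 proof -
  have "j \<notin> {1..<M} ==> v (P j) = 0" using j v P_0 by (cases j) auto
  moreover have "Suc j \<notin> {1..<M} ==> v (P (Suc j)) = 0" using j v P_M by (cases "Suc j = M") auto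
  ultimately show ?thesis by auto
 qed
 finally show ?thesis by (simp add: l_def r_def add_divide_distrib)
qed

text \<open>Elements of \<open>fe_space\<close> are unrestricted outside [0, L] and so need not lie
  in \<open>span basis\<close>; their interpolants do and agree with them on [0, L].\<close>

lemma interp_fe_space:
 assumes v: "v \<in> fe_space L M P" and x: "x \<in> {0..L}" shows "interp v x = v x"
proof -
 obtain j where j: "j < M" "x \<in> {P j..P (Suc j)}" using cell_exists[OF x] by auto
 obtain c d where cd: "\<forall>x\<in>{P j..P (Suc j)}. v x = c + d * x" using v j unfolding fe_space_def by blast
 have "v (P j) = c + d * P j" "v (P (Suc j)) = c + d * P (Suc j)" "v x = c + d * x" using cd j P_Suc[OF j(1)] by auto
 moreover have "v 0 = 0" "v L = 0" using v by (auto simp: fe_space_def)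
 moreover have "(c + d * P j) * (P (Suc j) - x) + (c + d * P (Suc j)) * (x - P j) = (c + d * x) * (P (Suc j) - P j)"
  by (simp add: algebra_simps)
 ultimately show ?thesis
  using interp_cell[of v j x] j P_Suc[OF j(1)] by simp
qed

text \<open>The integral of w' v' for finite element functions, written with nodal values only. It
  is therefore meaningful for every function and unchanged by interpolation: in one dimension the
  interpolant is the elliptic projection.\<close>

definition fe_form :: "(real => real) => (real => real) => real" where
 "fe_form w v = (\<Sum>i<M. (w (P (Suc i)) - w (P i)) * (v (P (Suc i)) - v (P i)) / (P (Suc i) - P i))"

lemma semi_inner_fe_form: assumes "0 <= p" shows "semi_inner (span B) (%w v. p * fe_form w v)"
proof
 fix x y z :: "real => real" and c
 show "p * fe_form x y = p * fe_form y x" by (simp add: fe_form_def mult.commute)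
 show "0 <= p * fe_form x x"
  using assms P_Suc by (auto simp: fe_form_def less_imp_le intro!: mult_nonneg_nonneg sum_nonneg)
 have "fe_form (c *\<^sub>R x) z = c * fe_form x z"
  by (simp add: fe_form_def sum_distrib_left algebra_simps diff_divide_distrib)
 then show "p * fe_form (c *\<^sub>R x) z = c * (p * fe_form x z)" by simp
 have "fe_form (x + y) z = fe_form x z + fe_form y z"
  by (simp add: fe_form_def algebra_simps diff_divide_distrib add_divide_distrib sum.distrib sum_subtractf)
 then show "p * fe_form (x + y) z = p * fe_form x z + p * fe_form y z" by (simp add: distrib_left)
qed (rule subspace_span)

lemma fe_form_hatf:
 assumes i: "i \<in> {1..<M}"
 shows "fe_form u (hatf i) = - hat_jump u (P (i - 1)) (P i) (P (Suc i))"
proof -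
 obtain l where l: "i = Suc l" "Suc l < M" using i by (cases i) auto
 have "fe_form u (hatf i) = (\<Sum>j<M. (if j = l then (u (P i) - u (P l)) / (P i - P l) else 0)
   - (if j = i then (u (P (Suc i)) - u (P i)) / (P (Suc i) - P i) else 0))"
  unfolding fe_form_def using hatf_node[OF i] l by (intro sum.cong) (auto simp: minus_divide_left)
 also have "... = (u (P i) - u (P l)) / (P i - P l) - (u (P (Suc i)) - u (P i)) / (P (Suc i) - P i)"
  using l i by (simp add: sum_subtractf)
 finally show ?thesis by (simp add: hat_jump_def l)
qed

lemma fe_form_cong: "(!!i. i <= M ==> v (P i) = v' (P i)) ==> fe_form v w = fe_form v' w"
 by (auto simp: fe_form_def intro!: sum.cong)

lemma interp_node: "v 0 = 0 ==> v L = 0 ==> i <= M ==> interp v (P i) = v (P i)"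
proof -
 assume v: "v 0 = 0" "v L = 0" "i <= M"
 obtain j where j: "j < M" "P i \<in> {P j..P (Suc j)}" using cell_exists[of "P i"] P_range[OF v(3)] by auto
 have "i = j \<or> i = Suc j"
  using j v(3) P_less[of i j] P_less[of "Suc j" i] by (cases "i < j"; cases "Suc j < i") auto
 then show ?thesis using interp_cell[OF v(1,2) j] P_Suc[OF j(1)] by auto
qed

lemma deriv_fe_space:
 assumes v: "v \<in> fe_space L M P" and i: "i < M" and x: "P i < x" "x < P (Suc i)"
 shows "deriv v x = (v (P (Suc i)) - v (P i)) / (P (Suc i) - P i)"
proof -
 obtain c d where cd: "\<forall>x\<in>{P i..P (Suc i)}. v x = c + d * x" using v i unfolding fe_space_def by blast
 have "((%x. c + d * x) has_real_derivative d) (at x)" by (auto intro!: derivative_eq_intros)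
 then have "(v has_real_derivative d) (at x)"
  by (rule has_field_derivative_transform_within_open[of _ _ _ "{P i<..<P (Suc i)}"]) (use x cd in auto)
 moreover have "v (P i) = c + d * P i" "v (P (Suc i)) = c + d * P (Suc i)" using cd P_Suc[OF i] by auto
 then have "(v (P (Suc i)) - v (P i)) / (P (Suc i) - P i) = d" using P_Suc[OF i] by (simp add: field_simps)
 ultimately show ?thesis using DERIV_imp_deriv by simp
qed

text \<open>The slope formula for \<open>deriv\<close> holds in open cells only, so each cell
  integral is obtained from a constant by changing the integrand at the two end points.\<close>

lemma inner_deriv_fe_space:
 assumes w: "w \<in> fe_space L M P" and v: "v \<in> fe_space L M P"
 shows "inner_L2 L (deriv w) (deriv v) = fe_form w v"
proof -
 define s where "s u i = (u (P (Suc i)) - u (P i)) / (P (Suc i) - P i)" for u :: "real => real" and i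
 have cell: "((%x. deriv w x * deriv v x) has_integral (P (Suc i) - P i) * (s w i * s v i)) {P i..P (Suc i)}"
  "((%x. \<bar>deriv w x * deriv v x\<bar>) has_integral (P (Suc i) - P i) * \<bar>s w i * s v i\<bar>) {P i..P (Suc i)}" if i: "i < M" for i
 proof -
  have d: "deriv w x = s w i & deriv v x = s v i" if "x \<in> box (P i) (P (Suc i))" for x
   using that deriv_fe_space[OF w i] deriv_fe_space[OF v i] by (auto simp: s_def box_real)
  have 1: "((%x. s w i * s v i) has_integral (P (Suc i) - P i) * (s w i * s v i)) (cbox (P i) (P (Suc i)))"
   using has_integral_const_real[of "s w i * s v i" "P i" "P (Suc i)"] P_Suc[OF i] by simp
  have 2: "((%x. \<bar>s w i * s v i\<bar>) has_integral (P (Suc i) - P i) * \<bar>s w i * s v i\<bar>) (cbox (P i) (P (Suc i)))"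
   using has_integral_const_real[of "\<bar>s w i * s v i\<bar>" "P i" "P (Suc i)"] P_Suc[OF i] by simp
  show "((%x. deriv w x * deriv v x) has_integral (P (Suc i) - P i) * (s w i * s v i)) {P i..P (Suc i)}"
   using has_integral_spike_interior[OF 1, of "%x. deriv w x * deriv v x"] d by simp
  show "((%x. \<bar>deriv w x * deriv v x\<bar>) has_integral (P (Suc i) - P i) * \<bar>s w i * s v i\<bar>) {P i..P (Suc i)}"
   using has_integral_spike_interior[OF 2, of "%x. \<bar>deriv w x * deriv v x\<bar>"] d by simp
 qed
 then have abs: "(%x. deriv w x * deriv v x) absolutely_integrable_on {P i..P (Suc i)}" if "i < M" for i
  using that by (auto simp: absolutely_integrable_on_def has_integral_integrable)
 have "inner_L2 L (deriv w) (deriv v) = (\<Sum>i<M. LINT x:{P i..P (Suc i)}|lebesgue. deriv w x * deriv v x)"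
  unfolding inner_L2_def using absolutely_integrable_partition(2)[of M P, OF less_imp_le[OF P_Suc] abs]
  by (simp add: P_0 P_M)
 also have "... = (\<Sum>i<M. (P (Suc i) - P i) * (s w i * s v i))"
  using cell abs by (intro sum.cong) (auto simp: set_lebesgue_integral_eq_integral integral_unique)
 also have "... = fe_form w v"
  unfolding fe_form_def s_def using P_Suc by (intro sum.cong) (auto simp: less_imp_neq[THEN not_sym])
 finally show ?thesis .
qed

end

lemma hat_jump_diff: "hat_jump (%x. u x - w x) a m b = hat_jump u a m b - hat_jump w a m b"
 by (simp add: hat_jump_def diff_divide_distrib)

context fe_partition begin

text \<open>At x in a cell [a, b] the error is - (x - a) (b - x) / (b - a) times the slope jump of u
  at a < x < b. That jump pairs G with the hat with nodes a, x, b, whose squared norm is at most b -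
  a.\<close>

lemma cell_error:
 assumes u: "u 0 = 0" "u L = 0" and G: "in_L2 L G" and i: "i < M" and x: "x \<in> {P i..P (Suc i)}"
  and hat: "!!a m b. 0 <= a ==> a < m ==> m < b ==> b <= L ==> hat_jump u a m b = inner_L2 L G (hat a m b)"
 shows "(u x - interp u x)\<^sup>2 <= h ^ 3 * (LINT y:{P i..P (Suc i)}|lebesgue. (G y)\<^sup>2)"
proof (cases "P i < x & x < P (Suc i)")
 case False
 then have "x = P i \<or> x = P (Suc i)" using x by auto
 then have "interp u x = u x" using interp_node[OF u] i by auto
 moreover have "0 <= (LINT y:{P i..P (Suc i)}|lebesgue. (G y)\<^sup>2)"
  unfolding set_lebesgue_integral_def by (intro integral_nonneg_AE) auto
 ultimately show ?thesis using h_pos by simp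
next
 case True
 define a b where "a = P i" and "b = P (Suc i)"
 have ab: "a < x" "x < b" "b - a <= h" "0 <= a" "b <= L"
  using True h_ge[OF i] P_range[of i] P_range[of "Suc i"] i by (auto simp: a_def b_def)
 define Q where "Q = hat_jump u a x b"
 have err: "u x - interp u x = - ((x - a) * (b - x) / (b - a)) * Q"
 proof -
  have "Q * ((x - a) * (b - x)) = (u b - u x) * (x - a) - (u x - u a) * (b - x)"
   using ab by (simp add: Q_def hat_jump_def divide_simps)
  moreover have "interp u x * (b - a) = u a * (b - x) + u b * (x - a)"
   using interp_cell[OF u i x] ab by (simp add: a_def b_def)
  ultimately have "(u x - interp u x) * (b - a) = - (Q * ((x - a) * (b - x)))" by (simp add: algebra_simps)
  then show ?thesis using ab by (simp add: field_simps)
 qed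
 interpret L2: semi_inner "{v. in_L2 L v}" "inner_L2 L" by (rule semi_inner_L2)
 \<comment> \<open>G is cut off to the cell before Cauchy-Schwarz, so that only the mass of G on
   this cell appears and the cells can be summed.\<close>
 define Gi where "Gi y = indicator {a..b} y * G y" for y
 have Gi: "in_L2 L Gi"
 proof (rule in_L2_mono)
  have "(%y. indicator {0..L} y *\<^sub>R Gi y) = (%y. indicator {a..b} y * (indicator {0..L} y *\<^sub>R G y))"
   by (auto simp: Gi_def fun_eq_iff)
  then show "set_borel_measurable lebesgue {0..L} Gi"
   using G unfolding in_L2_def set_borel_measurable_def by (auto intro!: borel_measurable_times borel_measurable_indicator)
  show "in_L2 L (%y. \<bar>G y\<bar>)"
  proof -
   have "(%y. indicator {0..L} y *\<^sub>R \<bar>G y\<bar>) = (%y. \<bar>indicator {0..L} y *\<^sub>R G y\<bar>)"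
    by (auto simp: fun_eq_iff indicator_def)
   then show ?thesis using G by (auto simp: in_L2_def set_borel_measurable_def)
  qed
 qed (auto simp: Gi_def indicator_def)
 define chi where "chi y = indicator {a..b} y * hat a x b y" for y
 have chi_eq: "chi = hat a x b"
 proof
  show "chi y = hat a x b y" for y
   using hat_outside[of a x b y] ab by (cases "y \<in> {a..b}") (auto simp: chi_def)
 qed
 have "Q = inner_L2 L G (hat a x b)" unfolding Q_def using hat ab by auto
 also have "... = inner_L2 L Gi (hat a x b)"
  unfolding inner_L2_def chi_eq[symmetric]
  by (intro set_lebesgue_integral_cong) (auto simp: Gi_def chi_def indicator_def)
 finally have "Q\<^sup>2 <= inner_L2 L Gi Gi * inner_L2 L (hat a x b) (hat a x b)"
  using L2.Cauchy_Schwarz_sq[of Gi "hat a x b"] Gi in_L2_hat by simp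
 also have "inner_L2 L Gi Gi = (LINT y:{a..b}|lebesgue. (G y)\<^sup>2)"
  unfolding inner_L2_def set_lebesgue_integral_def using ab
  by (intro Bochner_Integration.integral_cong) (auto simp: Gi_def indicator_def power2_eq_square)
 finally have Q0: "Q\<^sup>2 <= (LINT y:{a..b}|lebesgue. (G y)\<^sup>2) * inner_L2 L (hat a x b) (hat a x b)" .
 have hat2: "inner_L2 L (hat a x b) (hat a x b) <= b - a"
 proof -
  have "inner_L2 L (hat a x b) (hat a x b) <= (LINT y:{0..L}|lebesgue. indicator {a..b} y)"
   unfolding inner_L2_def
  proof (rule set_integral_mono)
   show "set_integrable lebesgue {0..L} (%y. hat a x b y * hat a x b y)"
    by (intro in_L2_product_integrable in_L2_hat)
   have "integrable lborel (indicat_real {a..b})"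
    by (intro integrable_real_indicator) (auto simp: emeasure_lborel_Icc_eq)
   moreover have "(%y. indicator {0..L} y *\<^sub>R indicator {a..b} y) = (indicator {a..b} :: real => real)"
    using ab by (auto simp: indicator_def fun_eq_iff)
   ultimately show "set_integrable lebesgue {0..L} (indicat_real {a..b})"
    by (simp add: set_integrable_def integrable_completion)
   show "hat a x b y * hat a x b y <= indicator {a..b} y" for y
    using hat_bounds[of a x b y] hat_outside[of a x b y] ab
    by (cases "y \<in> {a..b}") (auto simp: mult_le_one)
  qed
  also have "... = measure lebesgue {a..b}"
  proof -
   have "(%y. indicator {0..L} y *\<^sub>R indicator {a..b} y) = (indicator {a..b} :: real => real)"
    using ab by (auto simp: indicator_def fun_eq_iff)
   then show ?thesis by (simp add: set_lebesgue_integral_def)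
  qed
  finally show ?thesis using ab by simp
 qed
 have Q: "Q\<^sup>2 <= (LINT y:{a..b}|lebesgue. (G y)\<^sup>2) * (b - a)"
 proof -
  have "0 <= (LINT y:{a..b}|lebesgue. (G y)\<^sup>2)"
   unfolding set_lebesgue_integral_def by (intro integral_nonneg_AE) auto
  with Q0 hat2 show ?thesis by (meson mult_left_mono order_trans)
 qed
 have I0: "0 <= (LINT y:{a..b}|lebesgue. (G y)\<^sup>2)"
  unfolding set_lebesgue_integral_def by (intro integral_nonneg_AE) auto
 have c: "0 <= (x - a) * (b - x) / (b - a)" "(x - a) * (b - x) / (b - a) <= h"
 proof -
  show "0 <= (x - a) * (b - x) / (b - a)" using ab by auto
  have "(x - a) * (b - x) <= (b - a) * (b - x)" using ab by (intro mult_right_mono) auto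
  then have "(x - a) * (b - x) / (b - a) <= b - x" using ab by (simp add: divide_le_eq mult.commute)
  then show "(x - a) * (b - x) / (b - a) <= h" using ab by linarith
 qed
 have "(u x - interp u x)\<^sup>2 = ((x - a) * (b - x) / (b - a))\<^sup>2 * Q\<^sup>2" unfolding err power_mult_distrib power2_minus ..
 also have "... <= h\<^sup>2 * ((LINT y:{a..b}|lebesgue. (G y)\<^sup>2) * (b - a))"
  using Q c by (intro mult_mono power_mono) auto
 also have "... <= h\<^sup>2 * ((LINT y:{a..b}|lebesgue. (G y)\<^sup>2) * h)"
  using ab I0 by (intro mult_left_mono) auto
 finally show ?thesis by (simp add: a_def b_def power2_eq_square power3_eq_cube mult_ac)
qed

text \<open>The pointwise bound h^3 times the local mass of G, integrated over a cell of length at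
  most h, gives h^4. The hypothesis \<open>hat\<close> stands for u'' = G; it holds for weak
  derivatives and, for p > 0, directly through the delay equation.\<close>

theorem interpolation_error:
 assumes u: "continuous_on {0..L} u" "u 0 = 0" "u L = 0" and G: "in_L2 L G"
  and hat: "!!a m b. 0 <= a ==> a < m ==> m < b ==> b <= L ==> hat_jump u a m b = inner_L2 L G (hat a m b)"
 shows "norm_L2 L (%x. u x - interp u x) <= h\<^sup>2 * norm_L2 L G"
proof -
 have "interp u \<in> fe_space L M P" using interp_span span_basis_fe_space by auto
 then have c: "continuous_on {0..L} (%x. u x - interp u x)"
  using u by (intro continuous_intros) (auto simp: fe_space_def)
 then have e2: "in_L2 L (%x. u x - interp u x)" by (rule in_L2_continuous)
 have cell_abs: "f absolutely_integrable_on {P i..P (Suc i)}"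
  if "i < M" "f absolutely_integrable_on {0..L}" for f :: "real => real" and i
 proof -
  have "{P i..P (Suc i)} \<subseteq> {0..L}" using P_range[of i] P_range[of "Suc i"] that(1) by auto
  then show ?thesis using set_integrable_subset[OF that(2)] by auto
 qed
 have "(norm_L2 L (%x. u x - interp u x))\<^sup>2 = (\<Sum>i<M. LINT x:{P i..P (Suc i)}|lebesgue. (u x - interp u x)\<^sup>2)"
  unfolding norm_L2_sq
  using absolutely_integrable_partition(2)[of M P "%x. (u x - interp u x)\<^sup>2"] P_Suc cell_abs e2
  by (simp add: in_L2_def P_0 P_M less_imp_le)
 also have "... <= (\<Sum>i<M. h ^ 4 * (LINT x:{P i..P (Suc i)}|lebesgue. (G x)\<^sup>2))"
 proof (rule sum_mono)
  fix i assume "i \<in> {..<M}"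
  then have i: "i < M" by simp
  define I where "I = (LINT x:{P i..P (Suc i)}|lebesgue. (G x)\<^sup>2)"
  have I0: "0 <= I" unfolding I_def set_lebesgue_integral_def by (intro integral_nonneg_AE) auto
  have "(LINT x:{P i..P (Suc i)}|lebesgue. (u x - interp u x)\<^sup>2) <= (LINT x:{P i..P (Suc i)}|lebesgue. h ^ 3 * I)"
  proof (rule set_integral_mono)
   show "set_integrable lebesgue {P i..P (Suc i)} (%x. (u x - interp u x)\<^sup>2)"
    using cell_abs[OF i] e2 by (auto simp: in_L2_def)
   show "set_integrable lebesgue {P i..P (Suc i)} (%x. h ^ 3 * I)"
    by (rule absolutely_integrable_continuous_real) (intro continuous_intros)
  qed (use cell_error[OF u(2,3) G i _ hat] I_def in auto)
  also have "... = (P (Suc i) - P i) * (h ^ 3 * I)"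
   using P_Suc[OF i] by (simp add: set_lebesgue_integral_def)
  also have "... <= h * (h ^ 3 * I)" using h_ge[OF i] h_pos I0 by (intro mult_right_mono) auto
  finally show "(LINT x:{P i..P (Suc i)}|lebesgue. (u x - interp u x)\<^sup>2) <= h ^ 4 * I"
   by (simp add: power_numeral_reduce mult_ac)
 qed
 also have "... = h ^ 4 * (norm_L2 L G)\<^sup>2"
  unfolding norm_L2_sq sum_distrib_left[symmetric]
  using absolutely_integrable_partition(2)[of M P "%x. (G x)\<^sup>2"] P_Suc cell_abs G
  by (simp add: in_L2_def P_0 P_M less_imp_le)
 also have "... = (h\<^sup>2 * norm_L2 L G)\<^sup>2" by (simp add: power_mult_distrib)
 finally show ?thesis by (rule power2_le_imp_le) simp
qed

end

section \<open>Smoothed hat functions and the slope jump of a function with weak second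
  derivative\<close>

text \<open>The hat function is approximated by \<open>C\<^sup>2\<close> functions: \<open>ramp \<epsilon>\<close> is the second difference of
 \<open>x\<^sub>+\<^sup>3 / 6\<close>, that is, \<open>x\<^sub>+\<close> smoothed by a tent of width \<open>2 \<epsilon>\<close>.\<close>

definition cube_plus :: "real => real" where "cube_plus x = (max 0 x) ^ 3 / 6"

lemma cube_plus_deriv: "(cube_plus has_real_derivative (max 0 x)\<^sup>2 / 2) (at x)"
proof (cases "x = 0")
 case True
 have "((%y::real. (max 0 y) ^ 3 / 6 / y) \<longlongrightarrow> 0) (at 0)"
 proof (rule Lim_null_comparison)
  show "\<forall>\<^sub>F y in at (0::real). norm ((max 0 y) ^ 3 / 6 / y) <= y\<^sup>2"
   by (rule always_eventually) (auto simp: max_def power2_eq_square power3_eq_cube)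
  show "((%y::real. y\<^sup>2) \<longlongrightarrow> 0) (at 0)" by (auto intro!: tendsto_eq_intros)
 qed
 then show ?thesis using True by (simp add: cube_plus_def[abs_def] has_field_derivative_iff)
next
 case False
 show ?thesis
 proof (cases "x > 0")
  case True
  have "((%x. x ^ 3 / 6) has_real_derivative (max 0 x)\<^sup>2 / 2) (at x)"
   using True by (auto intro!: derivative_eq_intros)
  then show ?thesis
   by (rule has_field_derivative_transform_within_open[of _ _ _ "{0<..}"]) (use True in \<open>auto simp: cube_plus_def\<close>)
 next
  case nF: False
  have "((%x. 0) has_real_derivative (max 0 x)\<^sup>2 / 2) (at x)"
   using nF by (auto intro!: derivative_eq_intros)
  then show ?thesis
   by (rule has_field_derivative_transform_within_open[of _ _ _ "{..<0}"]) (use nF False in \<open>auto simp: cube_plus_def\<close>)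
 qed
qed

lemma square_plus_deriv: "((%x. (max 0 x)\<^sup>2 / 2) has_real_derivative max 0 x) (at x)"
proof (cases "x = 0")
 case True
 have "((%y::real. (max 0 y) ^ 2 / 2 / y) \<longlongrightarrow> 0) (at 0)"
 proof (rule Lim_null_comparison)
  show "\<forall>\<^sub>F y in at (0::real). norm ((max 0 y) ^ 2 / 2 / y) <= \<bar>y\<bar>"
   by (rule always_eventually) (auto simp: max_def power2_eq_square)
  show "((%y::real. \<bar>y\<bar>) \<longlongrightarrow> 0) (at 0)" by (auto intro!: tendsto_eq_intros)
 qed
 then show ?thesis using True by (simp add: has_field_derivative_iff)
next
 case False
 show ?thesis
 proof (cases "x > 0")
  case True
  have "((%x. x ^ 2 / 2) has_real_derivative (max 0 x)) (at x)"
   using True by (auto intro!: derivative_eq_intros)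
  then show ?thesis
   by (rule has_field_derivative_transform_within_open[of _ _ _ "{0<..}"]) (use True in auto)
 next
  case nF: False
  have "((%x. 0) has_real_derivative (max 0 x)) (at x)"
   using nF by (auto intro!: derivative_eq_intros)
  then show ?thesis
   by (rule has_field_derivative_transform_within_open[of _ _ _ "{..<0}"]) (use nF False in auto)
 qed
qed

definition ramp :: "real => real => real" where
 "ramp e x = (cube_plus (x + e) - 2 * cube_plus x + cube_plus (x - e)) / e\<^sup>2"

definition ramp1 :: "real => real => real" where
 "ramp1 e x = ((max 0 (x + e))\<^sup>2 / 2 - 2 * ((max 0 x)\<^sup>2 / 2) + (max 0 (x - e))\<^sup>2 / 2) / e\<^sup>2"

definition ramp2 :: "real => real => real" where
 "ramp2 e x = (max 0 (x + e) - 2 * max 0 x + max 0 (x - e)) / e\<^sup>2"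

lemma ramp_deriv: "(ramp e has_real_derivative ramp1 e x) (at x)"
proof -
 have "((%x. cube_plus (x + c)) has_real_derivative (max 0 (x + c))\<^sup>2 / 2) (at x)" for c
  by (rule iffD1[OF DERIV_shift]) (rule cube_plus_deriv)
 from DERIV_cdivide[OF DERIV_add[OF DERIV_diff[OF this[of e] DERIV_cmult[OF this[of 0], of 2]] this[of "- e"]], of "e\<^sup>2"]
 show ?thesis unfolding ramp_def[abs_def] ramp1_def by simp
qed

lemma ramp1_deriv: "(ramp1 e has_real_derivative ramp2 e x) (at x)"
proof -
 have "((%x. (max 0 (x + c))\<^sup>2 / 2) has_real_derivative max 0 (x + c)) (at x)" for c
  by (rule iffD1[OF DERIV_shift[of "%x. (max 0 x)\<^sup>2 / 2"]]) (rule square_plus_deriv)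
 from DERIV_cdivide[OF DERIV_add[OF DERIV_diff[OF this[of e] DERIV_cmult[OF this[of 0], of 2]] this[of "- e"]], of "e\<^sup>2"]
 show ?thesis unfolding ramp1_def[abs_def] ramp2_def by simp
qed

lemma ramp_left: "0 < e ==> x <= - e ==> ramp e x = 0"
 by (simp add: ramp_def cube_plus_def)

lemma ramp_right: "0 < e ==> e <= x ==> ramp e x = x"
 by (simp add: ramp_def cube_plus_def power3_eq_cube power2_eq_square field_simps)

lemma ramp1_left: "0 < e ==> x <= - e ==> ramp1 e x = 0"
 by (simp add: ramp1_def)

lemma ramp1_right: "0 < e ==> e <= x ==> ramp1 e x = 1"
 by (simp add: ramp1_def power2_eq_square field_simps)

lemma ramp2_outside: "0 < e ==> x \<notin> {-e..e} ==> ramp2 e x = 0"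
 by (auto simp: ramp2_def)

lemma ramp2_nonneg: "0 < e ==> 0 <= ramp2 e x"
 by (auto simp: ramp2_def max_def)

lemma ramp2_has_integral:
 assumes "0 < e" "A <= c - e" "c + e <= B"
 shows "((%x. ramp2 e (x - c)) has_integral 1) {A..B}"
proof -
 have "((%x. ramp2 e (x - c)) has_integral (ramp1 e (B - c) - ramp1 e (A - c))) {A..B}"
 proof (rule fundamental_theorem_of_calculus)
  show "A <= B" using assms by simp
  fix x assume "x \<in> {A..B}"
  have "((%x. ramp1 e (x - c)) has_real_derivative ramp2 e (x - c) * 1) (at x)"
   by (rule DERIV_chain'[OF _ ramp1_deriv]) (auto intro!: derivative_eq_intros)
  then show "((%x. ramp1 e (x - c)) has_vector_derivative ramp2 e (x - c)) (at x within {A..B})"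
   by (simp add: has_real_derivative_iff_has_vector_derivative has_vector_derivative_at_within)
 qed
 then show ?thesis using ramp1_left[of e "A - c"] ramp1_right[of e "B - c"] assms by simp
qed

lemma ramp_approx:
 assumes e: "0 < e" shows "\<bar>ramp e x - max 0 x\<bar> <= 2 * e"
proof -
 consider "x <= - e" | "e <= x" | "- e < x" "x <= 0" | "0 < x" "x < e" by linarith
 then show ?thesis
 proof cases
  case 3
  then have "(x + e) ^ 3 <= e ^ 3" by (intro power_mono) auto
  moreover have "ramp e x = (x + e) ^ 3 / 6 / e\<^sup>2" using 3 e by (simp add: ramp_def cube_plus_def)
  moreover have "0 <= (x + e) ^ 3" using 3 by simp
  moreover have "e ^ 3 / 6 / e\<^sup>2 <= e" using e by (simp add: power3_eq_cube power2_eq_square)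
  ultimately have "0 <= ramp e x" "ramp e x <= e"
   using e divide_right_mono[of "(x + e) ^ 3" "e ^ 3" "6 * e\<^sup>2"] by auto
  then show ?thesis using 3 by simp
 next
  case 4
  have "(x + e) ^ 3 <= (2 * e) ^ 3" "(2 * x) ^ 3 <= (x + e) ^ 3" using 4 by (intro power_mono; simp)+
  moreover have aux: "8 * X <= Y ==> Y <= 8 * Z ==> 0 <= X ==> 0 <= Y - 2 * X & Y - 2 * X <= 8 * Z" for X Y Z :: real
   by auto
  moreover have "0 <= x ^ 3" using 4 by (intro zero_le_power) simp
  ultimately have *: "0 <= (x + e) ^ 3 - 2 * x ^ 3" "(x + e) ^ 3 - 2 * x ^ 3 <= 8 * e ^ 3"
   using aux[of "x ^ 3" "(x + e) ^ 3" "e ^ 3"] by (auto simp: power_mult_distrib)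
  have eq: "ramp e x = ((x + e) ^ 3 - 2 * x ^ 3) / (6 * e\<^sup>2)" using 4 e by (simp add: ramp_def cube_plus_def field_simps)
  have "0 <= ramp e x" unfolding eq using * by simp
  moreover have "ramp e x <= 8 * e ^ 3 / (6 * e\<^sup>2)" unfolding eq using * by (intro divide_right_mono) auto
  moreover have "8 * e ^ 3 / (6 * e\<^sup>2) <= 2 * e" using e by (simp add: power3_eq_cube power2_eq_square)
  ultimately show ?thesis using 4 by auto
 qed (use ramp_left ramp_right e in auto)
qed

lemma continuous_on_ramp2: "continuous_on S (ramp2 e)"
 unfolding ramp2_def divide_inverse by (intro continuous_intros)

lemma continuous_on_ramp: "continuous_on S (ramp e)" "continuous_on S (ramp1 e)"
 by (auto intro!: DERIV_continuous_on has_field_derivative_at_within[OF ramp_deriv] has_field_derivative_at_within[OF ramp1_deriv])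

text \<open>\<open>ramp2 e\<close> is a nonnegative kernel of mass one supported in [-e, e], so the
  pairing is an average of values of u near c.\<close>

lemma ramp2_average:
 assumes u: "continuous_on {0..L} u" and e: "0 < e" "0 <= c - e" "c + e <= L"
  and close: "!!x. x \<in> {c-e..c+e} ==> \<bar>u x - z\<bar> <= \<eta>"
 shows "\<bar>inner_L2 L u (%x. ramp2 e (x - c)) - z\<bar> <= \<eta>"
proof -
 have cr: "continuous_on {0..L} (%x. ramp2 e (x - c))"
  by (rule continuous_on_compose2[OF continuous_on_ramp2]) (auto intro!: continuous_intros)
 have "(%x. u x * ramp2 e (x - c)) absolutely_integrable_on {0..L}"
  by (intro absolutely_integrable_continuous_real continuous_intros u cr)
 then have "inner_L2 L u (%x. ramp2 e (x - c)) = integral {0..L} (%x. u x * ramp2 e (x - c))"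
  by (simp add: inner_L2_def set_lebesgue_integral_eq_integral)
 moreover have r: "((%x. ramp2 e (x - c)) has_integral 1) {0..L}" using e by (intro ramp2_has_integral) auto
 then have "((%x. z * ramp2 e (x - c)) has_integral z) {0..L}" using has_integral_mult_right[OF r, of z] by simp
 then have "integral {0..L} (%x. u x * ramp2 e (x - c)) - z = integral {0..L} (%x. u x * ramp2 e (x - c) - z * ramp2 e (x - c))"
  using integral_diff[of "%x. u x * ramp2 e (x - c)" "{0..L}" "%x. z * ramp2 e (x - c)"]
   integral_unique[of "%x. z * ramp2 e (x - c)" z "{0..L}"]
   integrable_continuous_interval[OF continuous_on_mult[OF u cr]]
  by (auto simp: has_integral_integrable simp del: integral_mult_right)
 moreover have "norm (integral {0..L} (%x. u x * ramp2 e (x - c) - z * ramp2 e (x - c))) <= integral {0..L} (%x. \<eta> * ramp2 e (x - c))"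
 proof (rule integral_norm_bound_integral)
  fix x assume "x \<in> {0..L}"
  have "\<bar>u x - z\<bar> * ramp2 e (x - c) <= \<eta> * ramp2 e (x - c)"
   using close[of x] ramp2_nonneg[OF e(1), of "x - c"] ramp2_outside[OF e(1), of "x - c"]
   by (cases "x \<in> {c-e..c+e}") (auto intro: mult_right_mono)
  then show "norm (u x * ramp2 e (x - c) - z * ramp2 e (x - c)) <= \<eta> * ramp2 e (x - c)"
   using ramp2_nonneg[OF e(1), of "x - c"] by (simp add: abs_mult flip: left_diff_distrib)
 qed (auto intro!: integrable_continuous_interval continuous_intros u cr)
 moreover have "integral {0..L} (%x. \<eta> * ramp2 e (x - c)) = \<eta>"
  using has_integral_mult_right[OF r, of \<eta>] integral_unique[OF r] by simp
 ultimately show ?thesis by (simp only: real_norm_def)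
qed

text \<open>The hat is approximated by admissible test functions. Both weak derivatives move to the
  ramps, whose second derivatives average u near the three nodes; on the other side the smoothed
  hats converge boundedly and dominated convergence applies.\<close>

theorem hat_jump_weak:
 assumes u: "continuous_on {0..L} u" and H2: "H2_derivs L u g1 g2"
  and ab: "0 <= a" "a < m" "m < b" "b <= L"
 shows "hat_jump u a m b = inner_L2 L g2 (hat a m b)"
proof -
 \<comment> \<open>The factor 1 / 8 keeps the shifted outer nodes at distance at least 4 \<delta>
   from m, which bounds the slopes \<open>c1\<close> and \<open>c2\<close> uniformly in n.\<close>
 define \<delta> where "\<delta> = min (m - a) (b - m) / 8"
 define e where "e n = \<delta> / (real n + 1)" for n
 have \<delta>: "0 < \<delta>" "8 * \<delta> <= m - a" "8 * \<delta> <= b - m" using ab by (auto simp: \<delta>_def)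
 have e: "0 < e n" "e n <= \<delta>" for n using \<delta> by (auto simp: e_def field_simps)
 have e_lim: "e \<longlonglongrightarrow> 0" unfolding e_def by real_asymp
 \<comment> \<open>The outer nodes move inwards by twice the smoothing width, so that the support
   stays in [a + e n, b - e n], compactly inside (0, L) even if a = 0 or b = L.\<close>
 define A where "A n = a + 2 * e n" for n
 define B where "B n = b - 2 * e n" for n
 have AB: "A n < m" "m < B n" "4 * \<delta> <= m - A n" "4 * \<delta> <= B n - m" for n
  using e[of n] \<delta> by (auto simp: A_def B_def)
 have A_lim: "A \<longlonglongrightarrow> a" and B_lim: "B \<longlonglongrightarrow> b" unfolding A_def B_def using e_lim by (auto intro!: tendsto_eq_intros)
 define c1 where "c1 n = 1 / (m - A n)" for n
 define c2 where "c2 n = 1 / (B n - m)" for n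
 have c_lim: "c1 \<longlonglongrightarrow> 1 / (m - a)" "c2 \<longlonglongrightarrow> 1 / (b - m)"
  unfolding c1_def c2_def using A_lim B_lim ab by (auto intro!: tendsto_intros)
 define comb where "comb r n x = c1 n * r (e n) (x - A n) - (c1 n + c2 n) * r (e n) (x - m) + c2 n * r (e n) (x - B n)"
  for r :: "real => real => real" and n x
 have comb_deriv: "(comb r n has_real_derivative comb r' n x) (at x)"
  if "!!e x. (r e has_real_derivative r' e x) (at x)" for r r' n x
 proof -
  have s: "((%x. r (e n) (x - c)) has_real_derivative r' (e n) (x - c)) (at x)" for c
   using DERIV_shift[of "r (e n)" "r' (e n) (x - c)" x "- c"] that by simp
  show ?thesis unfolding comb_def[abs_def]
   by (intro DERIV_add DERIV_diff DERIV_cmult s)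
 qed
 have supp: "comb ramp n x = 0 & comb ramp1 n x = 0" if x: "x \<notin> {a + e n..b - e n}" for n x
 proof (cases "x < a + e n")
  case True
  then have "x - A n <= - e n" "x - m <= - e n" "x - B n <= - e n" using AB[of n] e[of n] \<delta> by (auto simp: A_def)
  then show ?thesis using e ramp_left ramp1_left by (simp add: comb_def)
 next
  case False
  then have "e n <= x - A n" "e n <= x - m" "e n <= x - B n" using AB[of n] e[of n] \<delta> x by (auto simp: B_def)
  moreover have "c1 n * (x - A n) - (c1 n + c2 n) * (x - m) + c2 n * (x - B n) = 0"
  proof -
   have "c1 n * (m - A n) = 1" "c2 n * (B n - m) = 1" using AB[of n] by (auto simp: c1_def c2_def)
   then show ?thesis by (simp add: algebra_simps)
  qed
  ultimately show ?thesis using e ramp_right ramp1_right by (simp add: comb_def)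
 qed
 have shift_cont: "continuous_on S (comb r n)" if "!!e. continuous_on UNIV (r e)" for r n S
  unfolding comb_def[abs_def]
  by (intro continuous_intros continuous_on_compose2[OF that]) auto
 have test: "test_function L (comb ramp n) (comb ramp1 n)" "test_function L (comb ramp1 n) (comb ramp2 n)" for n
 proof -
  have "\<exists>c d. 0 < c & c < d & d < L & (\<forall>x. x \<notin> {c..d} --> comb ramp n x = 0 & comb ramp1 n x = 0)"
   using supp[of _ n] e[of n] ab \<delta> by (intro exI[of _ "a + e n"] exI[of _ "b - e n"]) auto
  then show "test_function L (comb ramp n) (comb ramp1 n)" "test_function L (comb ramp1 n) (comb ramp2 n)"
   unfolding test_function_def
   using comb_deriv[of ramp ramp1, OF ramp_deriv] comb_deriv[of ramp1 ramp2, OF ramp1_deriv]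
    shift_cont[of ramp1, OF continuous_on_ramp(2)] shift_cont[of ramp2, OF continuous_on_ramp2]
   by blast+
 qed
 have g: "in_L2 L u" "in_L2 L g2" "weak_deriv L u g1" "weak_deriv L g1 g2" using H2 by (auto simp: H2_derivs_def)
 have weak: "inner_L2 L u (comb ramp2 n) = inner_L2 L g2 (comb ramp n)" for n
  using g(3,4) test[of n] unfolding weak_deriv_def by fastforce
 interpret L2: semi_inner "{v. in_L2 L v}" "inner_L2 L" by (rule semi_inner_L2)
 have comb_fun: "comb r n = c1 n *\<^sub>R (%x. r (e n) (x - A n)) - (c1 n + c2 n) *\<^sub>R (%x. r (e n) (x - m)) + c2 n *\<^sub>R (%x. r (e n) (x - B n))" for r n
  by (auto simp: comb_def fun_eq_iff)
 have r2: "in_L2 L (%x. ramp2 (e n) (x - c))" for n c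
  by (intro in_L2_continuous continuous_on_compose2[OF continuous_on_ramp2[of UNIV]] continuous_intros) auto
 define U where "U n c = inner_L2 L u (%x. ramp2 (e n) (x - c))" for n c
 have lhs: "inner_L2 L u (comb ramp2 n) = c1 n * U n (A n) - (c1 n + c2 n) * U n m + c2 n * U n (B n)" for n
  unfolding comb_fun U_def using g r2 by (simp add: L2.ip_add_right L2.ip_diff_right L2.ip_scale_right in_L2_scale L2.W_intros(2)[simplified])
 have U_lim: "(%n. U n (C n)) \<longlonglongrightarrow> u c" if C: "!!n. \<bar>C n - c\<bar> <= 2 * e n" "!!n. 0 <= C n - e n" "!!n. C n + e n <= L" and c: "c \<in> {0..L}" for C c
 proof (rule LIMSEQ_I)
  fix r :: real assume "0 < r"
  obtain d where d: "0 < d" "!!x. x \<in> {0..L} ==> dist x c < d ==> dist (u x) (u c) < r / 2"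
   using u c \<open>0 < r\<close> unfolding continuous_on_iff by (meson half_gt_zero)
  obtain n0 where n0: "!!n. n \<ge> n0 ==> e n < d / 3"
   using LIMSEQ_D[OF e_lim, of "d / 3"] d(1) e by (metis (no_types, lifting) abs_of_pos diff_zero divide_pos_pos real_norm_def zero_less_numeral)
  have "norm (U n (C n) - u c) < r" if "n \<ge> n0" for n
  proof -
   have "\<bar>U n (C n) - u c\<bar> <= r / 2" unfolding U_def
   proof (rule ramp2_average[OF u e(1) C(2,3)])
    fix x assume "x \<in> {C n - e n..C n + e n}"
    then have "\<bar>x - c\<bar> <= 3 * e n" "x \<in> {0..L}" using C[of n] by auto
    then show "\<bar>u x - u c\<bar> <= r / 2" using d(2)[of x] n0[OF that] by (auto simp: dist_real_def less_imp_le)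
   qed
   then show ?thesis using \<open>0 < r\<close> by simp
  qed
  then show "\<exists>n0. \<forall>n\<ge>n0. norm (U n (C n) - u c) < r" by blast
 qed
 have U: "(%n. U n (A n)) \<longlonglongrightarrow> u a" "(%n. U n m) \<longlonglongrightarrow> u m" "(%n. U n (B n)) \<longlonglongrightarrow> u b"
 proof -
  have *: "0 <= A n - e n" "A n + e n <= L" "0 <= m - e n" "m + e n <= L" "0 <= B n - e n" "B n + e n <= L" for n
   using e[of n] \<delta> ab by (auto simp: A_def B_def)
  show "(%n. U n (A n)) \<longlonglongrightarrow> u a" by (rule U_lim) (use * e ab in \<open>auto simp: A_def less_imp_le\<close>)
  show "(%n. U n m) \<longlonglongrightarrow> u m" by (rule U_lim) (use * e ab in \<open>auto simp: less_imp_le\<close>)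
  show "(%n. U n (B n)) \<longlonglongrightarrow> u b" by (rule U_lim) (use * e ab in \<open>auto simp: B_def less_imp_le\<close>)
 qed
 have lim1: "(%n. inner_L2 L u (comb ramp2 n)) \<longlonglongrightarrow> 1 / (m - a) * u a - (1 / (m - a) + 1 / (b - m)) * u m + 1 / (b - m) * u b"
  unfolding lhs by (intro tendsto_intros c_lim U)
 have hat_eq: "hat a m b x = 1 / (m - a) * max 0 (x - a) - (1 / (m - a) + 1 / (b - m)) * max 0 (x - m) + 1 / (b - m) * max 0 (x - b)" for x
 proof (cases "x <= m")
  case True
  then show ?thesis using ab hat_left[OF ab(2,3) True] by (auto simp: max_def divide_simps)
 next
  case False
  have "1 / (m - a) * (x - a) - (1 / (m - a) + 1 / (b - m)) * (x - m) = 1 - (x - m) / (b - m)"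
   using ab by (simp add: divide_simps) (simp add: algebra_simps)
  also have "... = (b - x) / (b - m)" using ab by (simp add: divide_simps)
  finally show ?thesis using False ab hat_right[OF ab(2,3), of x] by (auto simp: max_def) (simp_all add: divide_simps)
 qed
 have ramp_lim: "(%n. ramp (e n) (x - C n)) \<longlonglongrightarrow> max 0 (x - c)" if "C \<longlonglongrightarrow> c" for C c x
 proof -
  have "(%n. ramp (e n) (x - C n) - max 0 (x - C n)) \<longlonglongrightarrow> 0"
   by (rule Lim_null_comparison[of _ "%n. 2 * e n"]) (use ramp_approx e e_lim in \<open>auto intro!: tendsto_eq_intros\<close>)
  moreover have "(%n. max 0 (x - C n)) \<longlonglongrightarrow> max 0 (x - c)" by (intro tendsto_intros that)
  ultimately show ?thesis using tendsto_add by fastforce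
 qed
 have comb_lim: "(%n. comb ramp n x) \<longlonglongrightarrow> hat a m b x" for x
  unfolding comb_def hat_eq by (intro tendsto_intros c_lim ramp_lim A_lim B_lim)
 define K where "K = 4 * (1 / (4 * \<delta>)) * (L + 2 * \<delta>)"
 have comb_bound: "\<bar>comb ramp n x\<bar> <= K" if x: "x \<in> {0..L}" for n x
 proof -
  have c: "0 <= c1 n" "c1 n <= 1 / (4 * \<delta>)" "0 <= c2 n" "c2 n <= 1 / (4 * \<delta>)"
   using AB[of n] \<delta> by (auto simp: c1_def c2_def intro!: divide_left_mono)
  have r: "\<bar>ramp (e n) (x - c)\<bar> <= L + 2 * \<delta>" if "0 <= c" for c
   using ramp_approx[OF e(1)[of n], of "x - c"] e(2)[of n] x that by auto
  have "\<bar>comb ramp n x\<bar> <= c1 n * \<bar>ramp (e n) (x - A n)\<bar> + (c1 n + c2 n) * \<bar>ramp (e n) (x - m)\<bar> + c2 n * \<bar>ramp (e n) (x - B n)\<bar>"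
   unfolding comb_def using c by (auto simp: abs_mult intro!: order_trans[OF abs_triangle_ineq] order_trans[OF abs_triangle_ineq4])
  also have "... <= 1 / (4 * \<delta>) * (L + 2 * \<delta>) + (1 / (4 * \<delta>) + 1 / (4 * \<delta>)) * (L + 2 * \<delta>) + 1 / (4 * \<delta>) * (L + 2 * \<delta>)"
   using c r[of "A n"] r[of m] r[of "B n"] ab e[of n] AB[of n] \<delta>
   by (intro add_mono mult_mono) (auto simp: A_def)
  also have "... = K" using \<delta> by (simp add: K_def field_simps)
  finally show ?thesis .
 qed
 have lim2: "(%n. inner_L2 L g2 (comb ramp n)) \<longlonglongrightarrow> inner_L2 L g2 (hat a m b)"
  unfolding inner_L2_def set_lebesgue_integral_def
 proof (rule integral_dominated_convergence)
  have cm: "in_L2 L (comb ramp n)" for n by (intro in_L2_continuous shift_cont continuous_on_ramp)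
  show "(%x. indicator {0..L} x *\<^sub>R (g2 x * hat a m b x)) \<in> borel_measurable lebesgue"
   using in_L2_product_integrable[OF g(2) in_L2_hat, of a m b] by (auto simp: set_integrable_def)
  show "(%x. indicator {0..L} x *\<^sub>R (g2 x * comb ramp n x)) \<in> borel_measurable lebesgue" for n
   using in_L2_product_integrable[OF g(2) cm, of n] by (auto simp: set_integrable_def)
  have "set_integrable lebesgue {0..L} g2" using in_L2_product_integrable[OF g(2) in_L2_const[of L 1]] by simp
  then show "integrable lebesgue (%x. K * \<bar>indicator {0..L} x *\<^sub>R g2 x\<bar>)" by (auto simp: set_integrable_def)
  show "AE x in lebesgue. (%n. indicator {0..L} x *\<^sub>R (g2 x * comb ramp n x)) \<longlonglongrightarrow> indicator {0..L} x *\<^sub>R (g2 x * hat a m b x)"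
   by (intro AE_I2 tendsto_intros comb_lim)
  show "AE x in lebesgue. norm (indicator {0..L} x *\<^sub>R (g2 x * comb ramp n x)) <= K * \<bar>indicator {0..L} x *\<^sub>R g2 x\<bar>" for n
   using comb_bound[of _ n] by (intro AE_I2) (auto simp: indicator_def abs_mult mult.commute[of K] intro!: mult_left_mono)
 qed
 have "inner_L2 L g2 (hat a m b) = 1 / (m - a) * u a - (1 / (m - a) + 1 / (b - m)) * u m + 1 / (b - m) * u b"
  using LIMSEQ_unique[OF lim2] lim1 weak by simp
 then show ?thesis by (simp add: hat_jump_def algebra_simps diff_divide_distrib)
qed

section \<open>Beta integrals, Fubini on a triangle and uniqueness of densities\<close>

text \<open>The problem is stated with \<open>lebesgue\<close>, whereas product measures are formed
  from \<open>lborel\<close>; for Borel integrands the two agree.\<close>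

lemma set_lebesgue_lborel:
 fixes f :: "real => real"
 assumes f: "f \<in> borel_measurable borel" and S: "S \<in> sets borel"
 shows "set_integrable lebesgue S f \<longleftrightarrow> set_integrable lborel S f"
  and "(LINT x:S|lebesgue. f x) = (LINT x:S|lborel. f x)"
proof -
 have "(%x. indicator S x *\<^sub>R f x) \<in> borel_measurable lborel"
  using f S by auto
 then show "set_integrable lebesgue S f \<longleftrightarrow> set_integrable lborel S f"
  "(LINT x:S|lebesgue. f x) = (LINT x:S|lborel. f x)"
  by (auto simp: set_integrable_def set_lebesgue_integral_def integrable_completion integral_completion)
qed

lemma Beta_integral_scaled:
 fixes r t a b :: real
 assumes "0 < a" "0 < b" "r < t"
 shows "((%s. (t - s) powr (b - 1) * (s - r) powr (a - 1)) has_integral (t - r) powr (a + b - 1) * Beta a b) {r..t}"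
proof -
 define m where "m = 1 / (t - r)"
 have m: "0 < m" using assms by (simp add: m_def)
 have ends: "(0 - - r * m) /\<^sub>R m = r" "(1 - - r * m) /\<^sub>R m = t"
  using assms by (auto simp: m_def divide_simps)
 have "((%x. (m * x + - r * m) powr (a - 1) * (1 - (m * x + - r * m)) powr (b - 1)) has_integral (Beta a b / m)) {r..t}"
  using has_integral_affinity'[of "%t. t powr (a - 1) * (1 - t) powr (b - 1)" "Beta a b" 0 1 m "- r * m"]
   has_integral_Beta_real[OF assms(1,2)] m unfolding ends
  by (simp add: inverse_eq_divide)
 then have "((%x. (t - r) powr (a - 1) * (t - r) powr (b - 1) * ((m * x + - r * m) powr (a - 1) * (1 - (m * x + - r * m)) powr (b - 1)))
  has_integral (t - r) powr (a - 1) * (t - r) powr (b - 1) * (Beta a b / m)) {r..t}"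
  by (rule has_integral_mult_right)
 also have "(t - r) powr (a - 1) * (t - r) powr (b - 1) * (Beta a b / m) = (t - r) powr (a + b - 1) * Beta a b"
 proof -
  have "(t - r) powr (a - 1) * (t - r) powr (b - 1) * (t - r) = (t - r) powr (a - 1) * (t - r) powr (b - 1) * (t - r) powr 1"
   using assms by simp
  also have "... = (t - r) powr (a + b - 1)" by (simp only: powr_add[symmetric]) (simp add: algebra_simps)
  finally show ?thesis by (simp add: m_def mult_ac)
 qed
 finally show ?thesis
 proof (rule has_integral_eq[rotated])
  fix x assume x: "x \<in> {r..t}"
  have "m * x + - r * m = (x - r) / (t - r)" "1 - (x - r) / (t - r) = (t - x) / (t - r)"
   using assms by (auto simp: m_def diff_divide_distrib) (simp add: divide_simps)
  then show "(t - r) powr (a - 1) * (t - r) powr (b - 1) * ((m * x + - r * m) powr (a - 1) * (1 - (m * x + - r * m)) powr (b - 1))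
   = (t - x) powr (b - 1) * (x - r) powr (a - 1)"
   using assms x by (simp add: powr_divide)
 qed
qed

lemma Beta_one_right: "0 < a ==> Beta 1 a = 1 / (a::real)" and Beta_one_left: "0 < a ==> Beta a 1 = 1 / (a::real)"
 using Gamma_add_one_real[of a] Gamma_real_pos[of a] by (auto simp: Beta_def add.commute less_imp_neq[THEN not_sym])

lemma powr_integral_right:
 fixes r t b :: real
 assumes "0 < b" "r <= t"
 shows "((%s. (t - s) powr (b - 1)) has_integral (t - r) powr b / b) {r..t}"
proof (cases "r = t")
 case False
 have "((%s. (t - s) powr (b - 1) * (s - r) powr (1 - 1)) has_integral (t - r) powr b / b) {r..t}"
  using Beta_integral_scaled[of 1 b r t] assms False by (simp add: Beta_one_right)
 then show ?thesis
  by (rule has_integral_spike[of "{r}", rotated 2]) auto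
qed (use assms has_integral_refl in auto)

lemma powr_integral_left:
 fixes r t a :: real
 assumes "0 < a" "r <= t"
 shows "((%s. (s - r) powr (a - 1)) has_integral (t - r) powr a / a) {r..t}"
proof (cases "r = t")
 case False
 have "((%s. (t - s) powr (1 - 1) * (s - r) powr (a - 1)) has_integral (t - r) powr a / a) {r..t}"
  using Beta_integral_scaled[of a 1 r t] assms False by (simp add: Beta_one_left)
 then show ?thesis
  by (rule has_integral_spike[of "{t}", rotated 2]) auto
qed (use assms has_integral_refl in auto)

lemma has_integral_nonneg_lebesgue:
 fixes f :: "real => real"
 assumes "(f has_integral I) S" "!!x. x \<in> S ==> 0 <= f x"
 shows "set_integrable lebesgue S f" "(LINT x:S|lebesgue. f x) = I"
 using nonnegative_absolutely_integrable_1[of f S] assms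
 by (auto simp: set_lebesgue_integral_eq_integral integral_unique has_integral_integrable)

lemmas Beta_lebesgue = has_integral_nonneg_lebesgue[OF Beta_integral_scaled, simplified]
lemmas powr_right_lebesgue = has_integral_nonneg_lebesgue[OF powr_integral_right, simplified]
lemmas powr_left_lebesgue = has_integral_nonneg_lebesgue[OF powr_integral_left, simplified]

lemma set_integral_abs_le:
 fixes f g :: "real => real"
 assumes "set_integrable lebesgue S g" "set_borel_measurable lebesgue S f" "!!x. x \<in> S ==> \<bar>f x\<bar> <= g x"
 shows "set_integrable lebesgue S f" "\<bar>LINT x:S|lebesgue. f x\<bar> <= (LINT x:S|lebesgue. g x)"
proof -
 show f: "set_integrable lebesgue S f"
  unfolding set_integrable_def
  by (rule Bochner_Integration.integrable_bound[OF assms(1)[unfolded set_integrable_def]])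
   (use assms(2,3) in \<open>force simp: set_borel_measurable_def indicator_def\<close>)+
 have "\<bar>LINT x:S|lebesgue. f x\<bar> <= (LINT x:S|lebesgue. \<bar>f x\<bar>)"
  using set_integral_norm_bound[OF f] by simp
 also have "... <= (LINT x:S|lebesgue. g x)"
  using assms(1,3) f by (intro set_integral_mono) (auto intro: set_integrable_abs)
 finally show "\<bar>LINT x:S|lebesgue. f x\<bar> <= (LINT x:S|lebesgue. g x)" .
qed

lemma borel_set_borel_measurable:
 "f \<in> borel_measurable borel ==> S \<in> sets borel ==> set_borel_measurable lebesgue S (f :: real => real)"
 unfolding set_borel_measurable_def by (auto intro!: measurable_completion)

text \<open>Absolute integrability on l <= r <= s <= t follows by integrating the nonnegative kernel
  in s first, which gives a bounded \<kappa> r against an integrable g. The kernel conditions are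
  posed for l < r < t only, so singular kernels qualify; the two omitted values of r form a null
  set.\<close>

lemma triangle_Fubini:
 fixes k :: "real => real => real" and g \<kappa> :: "real => real"
 assumes k[measurable]: "(%(s, r). k s r) \<in> borel_measurable borel" and k0: "!!s r. 0 <= k s r"
  and g[measurable]: "g \<in> borel_measurable borel" and gi: "set_integrable lebesgue {l..t} g"
  and ki: "!!r. l < r ==> r < t ==> set_integrable lebesgue {r..t} (%s. k s r)"
  and kv: "!!r. l < r ==> r < t ==> (LINT s:{r..t}|lebesgue. k s r) = \<kappa> r"
  and kb: "!!r. l < r ==> r < t ==> \<kappa> r <= B"
 shows "set_integrable lebesgue {l..t} (%s. LINT r:{l..s}|lebesgue. k s r * g r)"
  and "(LINT s:{l..t}|lebesgue. LINT r:{l..s}|lebesgue. k s r * g r) = (LINT r:{l..t}|lebesgue. \<kappa> r * g r)"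
  and "(%s. LINT r:{l..s}|lebesgue. k s r * g r) \<in> borel_measurable borel"
proof -
 have k': "(%p. k (fst p) (snd p)) \<in> borel_measurable (borel \<Otimes>\<^sub>M borel)"
  using k unfolding borel_prod by (simp add: case_prod_beta')
 have ksec: "(%s. k s r) \<in> borel_measurable borel" "(%r. k s r) \<in> borel_measurable borel" for r s
  using measurable_compose[OF _ k', of "%s. (s, r)" borel] measurable_compose[OF _ k', of "%r. (s, r)" borel] by auto
 define f where "f r s = (if l <= r & r <= s & s <= t then k s r * g r else 0)" for r s
 have fm: "(%p. f (fst p) (snd p)) \<in> borel_measurable (borel \<Otimes>\<^sub>M borel)"
 proof -
  have "(%p. k (snd p) (fst p)) \<in> borel_measurable (borel \<Otimes>\<^sub>M borel)"
   using measurable_compose[OF _ k', of "%p. (snd p, fst p)" "borel \<Otimes>\<^sub>M borel"] by simp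
  then show ?thesis unfolding f_def by measurable
 qed
 then have fm': "(%p. f (fst p) (snd p)) \<in> borel_measurable (lborel \<Otimes>\<^sub>M lborel)"
  by (simp cong: measurable_cong_sets)
 have kil: "set_integrable lborel {r..t} (%s. k s r)" "(LINT s:{r..t}|lborel. k s r) = \<kappa> r" if "l < r" "r < t" for r
  using ki[OF that] kv[OF that] set_lebesgue_lborel[OF ksec(1), of "{r..t}" r] by auto
 have kap0: "0 <= \<kappa> r" if "l < r" "r < t" for r
  using kil(2)[OF that] k0 unfolding set_lebesgue_integral_def
  by (metis (no_types, lifting) AE_I2 indicator_pos_le integral_nonneg_AE scaleR_nonneg_nonneg)
 have slice: "f r = (%s. g r * (indicator {r..t} s *\<^sub>R k s r))" if "l < r" "r < t" for r
  using that by (auto simp: f_def fun_eq_iff indicator_def)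
 have f_int: "integrable lborel (f r)" if "l < r" "r < t" for r
  unfolding slice[OF that] using kil(1)[OF that] by (auto simp: set_integrable_def)
 have f_val: "(\<integral>s. f r s \<partial>lborel) = \<kappa> r * g r" if "l < r" "r < t" for r
  unfolding slice[OF that] using kil(2)[OF that] by (simp add: set_lebesgue_integral_def mult.commute)
 have f_norm: "(\<integral>s. norm (f r s) \<partial>lborel) = \<kappa> r * \<bar>g r\<bar>" if "l < r" "r < t" for r
 proof -
  have "(%s. norm (f r s)) = (%s. \<bar>g r\<bar> * (indicator {r..t} s *\<^sub>R k s r))"
   unfolding slice[OF that] using k0 by (auto simp: abs_mult indicator_def)
  then show ?thesis using kil(2)[OF that] by (simp add: set_lebesgue_integral_def mult.commute)
 qed
 have f_out: "f r = (%s. 0)" if "r < l \<or> t < r" for r using that by (auto simp: f_def fun_eq_iff)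
 have gil: "set_integrable lborel {l..t} g" using gi set_lebesgue_lborel[OF g] by auto
 have ae_in: "AE r in lborel. r ~= l & r ~= t" using AE_lborel_singleton[of l] AE_lborel_singleton[of t] by auto
 have nm: "(%r. \<integral>s. norm (f r s) \<partial>lborel) \<in> borel_measurable lborel"
  using fm' by (intro lborel.borel_measurable_lebesgue_integral) (simp add: case_prod_beta)
 have F: "integrable (lborel \<Otimes>\<^sub>M lborel) (%p. f (fst p) (snd p))"
 proof (rule lborel_pair.Fubini_integrable[OF fm'])
  have "integrable lborel (%r. B * (indicator {l..t} r *\<^sub>R g r))" using gil by (auto simp: set_integrable_def)
  then have "integrable lborel (%r. \<integral>s. norm (f r s) \<partial>lborel)"
  proof (rule Bochner_Integration.integrable_bound[OF _ nm])
   show "AE r in lborel. norm (\<integral>s. norm (f r s) \<partial>lborel) <= norm (B * (indicator {l..t} r *\<^sub>R g r))"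
    using ae_in
   proof eventually_elim
    case (elim r)
    show ?case
    proof (cases "l < r & r < t")
     case True
     then have r: "l < r" "r < t" by auto
     have "\<kappa> r * \<bar>g r\<bar> <= \<bar>B\<bar> * \<bar>g r\<bar>" using kb[OF r] kap0[OF r] by (intro mult_right_mono) auto
     then show ?thesis using f_norm[OF r] kap0[OF r] True by (simp add: abs_mult)
    next
     case False
     then show ?thesis using f_out[of r] elim by auto
    qed
   qed
  qed
  then show "integrable lborel (%x. \<integral>y. norm (f (fst (x, y)) (snd (x, y))) \<partial>lborel)" by simp
  show "AE x in lborel. integrable lborel (%y. f (fst (x, y)) (snd (x, y)))"
   using ae_in
  proof eventually_elim
   case (elim r)
   then show ?case using f_int[of r] f_out[of r] by (cases "l < r & r < t") auto
  qed
 qed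
 then have F': "integrable (lborel \<Otimes>\<^sub>M lborel) (%(r, s). f r s)" by (simp add: case_prod_beta')
 have inner: "indicator {l..t} s *\<^sub>R (LINT r:{l..s}|lebesgue. k s r * g r) = (\<integral>r. f r s \<partial>lborel)" for s
 proof -
  have m: "(%r. k s r * g r) \<in> borel_measurable borel" using ksec by auto
  have "(LINT r:{l..s}|lebesgue. k s r * g r) = (LINT r:{l..s}|lborel. k s r * g r)"
   by (rule set_lebesgue_lborel(2)[OF m]) simp
  moreover have "(%r. f r s) = (%r. indicator {l..t} s *\<^sub>R (indicator {l..s} r *\<^sub>R (k s r * g r)))"
   by (auto simp: f_def fun_eq_iff indicator_def)
  ultimately show ?thesis by (simp add: set_lebesgue_integral_def)
 qed
 have im: "(%s. LINT r:{l..s}|lebesgue. k s r * g r) \<in> borel_measurable borel"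
 proof -
  have "(LINT r:{l..s}|lebesgue. k s r * g r) = (\<integral>r. (if l <= r & r <= s then k s r * g r else 0) \<partial>lborel)" for s
  proof -
   have m: "(%r. k s r * g r) \<in> borel_measurable borel" using ksec by auto
   have "(LINT r:{l..s}|lebesgue. k s r * g r) = (LINT r:{l..s}|lborel. k s r * g r)"
    by (rule set_lebesgue_lborel(2)[OF m]) simp
   then show ?thesis unfolding set_lebesgue_integral_def
    by (simp only:) (intro Bochner_Integration.integral_cong, auto simp: indicator_def)
  qed
  moreover have "(%s. \<integral>r. (if l <= r & r <= s then k s r * g r else 0) \<partial>lborel) \<in> borel_measurable borel"
  proof (rule lborel.borel_measurable_lebesgue_integral)
   have [measurable]: "(%p. k (fst p) (snd p)) \<in> borel_measurable (borel \<Otimes>\<^sub>M lborel)"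
    using k' by (simp cong: measurable_cong_sets)
   have "(%p. if l <= snd p & snd p <= fst p then k (fst p) (snd p) * g (snd p) else 0) \<in> borel_measurable (borel \<Otimes>\<^sub>M lborel)"
    by measurable
   then show "(%(s, r). if l <= r & r <= s then k s r * g r else 0) \<in> borel_measurable (borel \<Otimes>\<^sub>M lborel)"
    by (simp add: case_prod_beta)
  qed
  ultimately show ?thesis by simp
 qed
 show "(%s. LINT r:{l..s}|lebesgue. k s r * g r) \<in> borel_measurable borel" by (rule im)
 have "integrable lborel (%s. \<integral>r. f r s \<partial>lborel)" by (rule lborel_pair.integrable_snd[OF F'])
 then have i: "set_integrable lborel {l..t} (%s. LINT r:{l..s}|lebesgue. k s r * g r)"
  unfolding set_integrable_def inner .
 then show "set_integrable lebesgue {l..t} (%s. LINT r:{l..s}|lebesgue. k s r * g r)"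
  using set_lebesgue_lborel(1)[OF im] by simp
 have "(LINT s:{l..t}|lebesgue. LINT r:{l..s}|lebesgue. k s r * g r) = (LINT s:{l..t}|lborel. LINT r:{l..s}|lebesgue. k s r * g r)"
  by (rule set_lebesgue_lborel(2)[OF im]) simp
 also have "... = (\<integral>s. (\<integral>r. f r s \<partial>lborel) \<partial>lborel)"
  unfolding set_lebesgue_integral_def inner[unfolded set_lebesgue_integral_def] ..
 also have "... = (\<integral>r. (\<integral>s. f r s \<partial>lborel) \<partial>lborel)"
  by (rule lborel_pair.Fubini_integral[OF F'])
 also have "... = (\<integral>r. indicator {l..t} r *\<^sub>R (\<kappa> r * g r) \<partial>lebesgue)"
 proof -
  define c where "c r = (\<integral>s. f r s \<partial>lborel)" for r
  have cm: "c \<in> borel_measurable lborel" unfolding c_def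
   using fm' by (intro lborel.borel_measurable_lebesgue_integral) (simp add: case_prod_beta)
  have "AE r in lborel. c r = indicator {l..t} r *\<^sub>R (\<kappa> r * g r)" using ae_in
  proof eventually_elim
   case (elim r)
   then show ?case using f_val[of r] f_out[of r] by (cases "l < r & r < t") (auto simp: c_def)
  qed
  then have ae: "AE r in lebesgue. c r = indicator {l..t} r *\<^sub>R (\<kappa> r * g r)" by (simp add: AE_completion_iff)
  have cm': "c \<in> borel_measurable lebesgue" using cm by (rule measurable_completion)
  have "(\<integral>r. c r \<partial>lborel) = (\<integral>r. c r \<partial>lebesgue)" using integral_completion[OF cm] by simp
  also have "... = (\<integral>r. indicator {l..t} r *\<^sub>R (\<kappa> r * g r) \<partial>lebesgue)"
   by (rule integral_cong_AE[OF cm' borel_measurable_AE[OF cm' ae] ae])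
  finally show ?thesis by (simp add: c_def)
 qed
 finally show "(LINT s:{l..t}|lebesgue. LINT r:{l..s}|lebesgue. k s r * g r) = (LINT r:{l..t}|lebesgue. \<kappa> r * g r)"
  by (simp add: set_lebesgue_integral_def)
qed

text \<open>Vanishing integrals over all [0, t] say that the measures with densities given by the
  positive and negative part of g agree on all half-lines, hence are equal, and densities are unique
  almost everywhere.\<close>

lemma AE_zero_if_integrals_zero:
 fixes g :: "real => real"
 assumes g[measurable]: "g \<in> borel_measurable borel" and gi: "set_integrable lborel {0..T} g"
  and z: "!!t. 0 < t ==> t <= T ==> (LINT s:{0..t}|lborel. g s) = 0"
 shows "AE s in lborel. s \<in> {0..T} --> g s = 0"
proof -
 define P where "P s = indicator {0..T} s * max 0 (g s)" for s
 define N where "N s = indicator {0..T} s * max 0 (- g s)" for s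
 have [measurable]: "P \<in> borel_measurable borel" "N \<in> borel_measurable borel"
  unfolding P_def N_def by measurable
 have g': "integrable lborel (%s. indicator {0..T} s * g s)" using gi by (simp add: set_integrable_def)
 have PN: "integrable lborel P" "integrable lborel N"
  by (auto intro!: Bochner_Integration.integrable_bound[OF g'] simp: P_def N_def indicator_def)
 have tail: "(\<integral>s. indicator {x<..} s * P s \<partial>lborel) = (\<integral>s. indicator {x<..} s * N s \<partial>lborel)" for x
 proof -
  have i: "integrable lborel (%s. indicator {x<..} s * P s)" "integrable lborel (%s. indicator {x<..} s * N s)"
   by (rule Bochner_Integration.integrable_bound[OF PN(1)]; auto simp: indicator_def)
    (rule Bochner_Integration.integrable_bound[OF PN(2)]; auto simp: indicator_def)
  have "(\<integral>s. indicator {x<..} s * P s \<partial>lborel) - (\<integral>s. indicator {x<..} s * N s \<partial>lborel)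
    = (\<integral>s. indicator {x<..} s * (indicator {0..T} s * g s) \<partial>lborel)"
   by (subst Bochner_Integration.integral_diff[OF i, symmetric], intro Bochner_Integration.integral_cong)
    (auto simp: P_def N_def indicator_def)
  also have "... = 0"
  proof (cases "T <= x")
   case True
   then have "indicator {x<..} s * (indicator {0..T} s * g s) = 0" for s by (auto simp: indicator_def)
   then show ?thesis by (simp only: Bochner_Integration.integral_zero)
  next
   case nT: False
   have full: "(\<integral>s. indicator {0..t} s * g s \<partial>lborel) = 0" if "t <= T" for t
   proof (cases "0 < t")
    case True then show ?thesis using z[OF True that] by (simp add: set_lebesgue_integral_def)
   next
    case False
    have "AE s in lborel. indicator {0..t} s * g s = 0"
     using AE_lborel_singleton[of "0::real"] by eventually_elim (use False in \<open>auto simp: indicator_def\<close>)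
    then show ?thesis by (rule integral_eq_zero_AE)
   qed
   have ix: "integrable lborel (%s. indicator {0..x} s * g s)"
    by (rule Bochner_Integration.integrable_bound[OF g']) (use nT in \<open>auto simp: indicator_def\<close>)
   have "(\<integral>s. indicator {x<..} s * (indicator {0..T} s * g s) \<partial>lborel)
     = (\<integral>s. indicator {0..T} s * g s - indicator {0..x} s * g s \<partial>lborel)"
    by (intro Bochner_Integration.integral_cong) (use nT in \<open>auto simp: indicator_def\<close>)
   also have "... = 0" using full[of T] full[of x] nT by (simp add: Bochner_Integration.integral_diff[OF g' ix])
   finally show ?thesis .
  qed
  finally show ?thesis by simp
 qed
 have em: "emeasure (density lborel (%s. ennreal (Q s))) {x<..} = ennreal (\<integral>s. indicator {x<..} s * Q s \<partial>lborel)"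
  if [measurable]: "Q \<in> borel_measurable borel" and Q: "integrable lborel Q" "!!s. 0 <= Q s" for Q and x :: real
 proof -
  have "emeasure (density lborel (%s. ennreal (Q s))) {x<..} = (\<integral>\<^sup>+s. ennreal (Q s) * indicator {x<..} s \<partial>lborel)"
   by (rule emeasure_density) (use borel_open[OF open_greaterThan, of x] in auto)
  also have "... = (\<integral>\<^sup>+s. ennreal (indicator {x<..} s * Q s) \<partial>lborel)"
   by (intro nn_integral_cong) (auto simp: indicator_def)
  also have "... = ennreal (\<integral>s. indicator {x<..} s * Q s \<partial>lborel)"
   by (rule nn_integral_eq_integral)
    (auto intro!: Bochner_Integration.integrable_bound[OF Q(1)] simp: indicator_def Q(2))
  finally show ?thesis .
 qed
 have P0: "0 <= P s" "0 <= N s" for s by (auto simp: P_def N_def indicator_def)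
 have "density lborel (%s. ennreal (P s)) = density lborel (%s. ennreal (N s))"
  by (rule measure_eqI_lessThan) (use PN P0 tail in \<open>auto simp: em\<close>)
 then have "AE s in lborel. ennreal (P s) = ennreal (N s)"
  by (subst (asm) sigma_finite_measure.density_unique_iff[OF sigma_finite_lborel]) auto
 then show ?thesis
  by eventually_elim (auto simp: P_def N_def max_def split: if_splits)
qed

section \<open>Fractional integrals: Hoelder continuity and Abel inversion\<close>

lemma frac_integral_eq:
 "frac_integral \<gamma> z t = (LINT s:{0..t}|lebesgue. (t - s) powr (\<gamma> - 1) * z s) / Gamma \<gamma>"
 by (simp add: frac_integral_def flip: set_integral_divide_zero)

lemma absolutely_integrable_singleton: "f absolutely_integrable_on {a}" for f :: "real => real"
 unfolding absolutely_integrable_on_def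
 using has_integral_refl(2)[of f a] has_integral_refl(2)[of "%x. norm (f x)" a] by (auto intro: has_integral_integrable)

lemma frac_integral_0: "frac_integral \<gamma> z 0 = 0"
 using has_integral_refl(2)[of "%s. (0 - s) powr (\<gamma> - 1) / Gamma \<gamma> * z s" "0::real"]
 by (simp add: frac_integral_def set_lebesgue_integral_eq_integral(2)[OF absolutely_integrable_singleton] integral_unique)

lemma frac_integral_cong: "(!!s. s \<in> {0..t} ==> z s = z' s) ==> frac_integral \<gamma> z t = frac_integral \<gamma> z' t"
 unfolding frac_integral_def by (intro set_lebesgue_integral_cong) auto

lemma powr_kernel_integrable:
 fixes t :: real and z :: "real => real"
 assumes "0 < \<gamma>" "0 <= t" "z \<in> borel_measurable borel" "!!s. s \<in> {0..t} ==> \<bar>z s\<bar> <= Z"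
 shows "set_integrable lebesgue {0..t} (%s. (t - s) powr (\<gamma> - 1) * z s)"
proof (rule set_integral_abs_le(1))
 show "set_integrable lebesgue {0..t} (%s. Z * (t - s) powr (\<gamma> - 1))"
  using powr_right_lebesgue(1)[of \<gamma> 0 t] assms by (intro set_integrable_mult_right) auto
 show "set_borel_measurable lebesgue {0..t} (%s. (t - s) powr (\<gamma> - 1) * z s)"
  using assms(3) by (intro borel_set_borel_measurable) auto
qed (use assms in \<open>auto simp: abs_mult mult.commute[of _ "_ powr _"] intro!: mult_left_mono\<close>)

lemma powr_kernel_integrable_singular:
 fixes t :: real and z :: "real => real"
 assumes "0 < \<gamma>" "0 < \<alpha>" "0 <= t" "z \<in> borel_measurable borel" "!!s. s \<in> {0..t} ==> \<bar>z s\<bar> <= Z * s powr (\<alpha> - 1)"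
 shows "set_integrable lebesgue {0..t} (%s. (t - s) powr (\<gamma> - 1) * z s)"
proof (cases "t = 0")
 case True
 then show ?thesis by (simp add: absolutely_integrable_singleton)
next
 case False
 show ?thesis
 proof (rule set_integral_abs_le(1))
  show "set_integrable lebesgue {0..t} (%s. Z * ((t - s) powr (\<gamma> - 1) * s powr (\<alpha> - 1)))"
   using Beta_lebesgue(1)[of \<alpha> \<gamma> 0 t] assms False by (intro set_integrable_mult_right) auto
  show "set_borel_measurable lebesgue {0..t} (%s. (t - s) powr (\<gamma> - 1) * z s)"
   using assms(4) by (intro borel_set_borel_measurable) auto
  fix s assume "s \<in> {0..t}"
  then show "\<bar>(t - s) powr (\<gamma> - 1) * z s\<bar> <= Z * ((t - s) powr (\<gamma> - 1) * s powr (\<alpha> - 1))"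
   using mult_left_mono[OF assms(5), of s "(t - s) powr (\<gamma> - 1)"] by (simp add: abs_mult mult_ac)
 qed
qed

text \<open>The increment is the integral over [s, t] plus the effect of changing the kernel on
  [0, s]. Each of the two kernels has mass at most (t - s)^(1 - \<alpha>) / (1 - \<alpha>), whence
  the factor 2.\<close>

lemma frac_integral_Holder:
 assumes \<alpha>: "0 < \<alpha>" "\<alpha> < 1" and z: "z \<in> borel_measurable borel" and st: "0 <= s" "s <= t"
  and Z: "!!r. r \<in> {0..t} ==> \<bar>z r\<bar> <= Z"
 shows "\<bar>frac_integral (1 - \<alpha>) z t - frac_integral (1 - \<alpha>) z s\<bar> <= 2 * Z / ((1 - \<alpha>) * Gamma (1 - \<alpha>)) * (t - s) powr (1 - \<alpha>)"
proof (cases "s = t")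
 case True then show ?thesis by simp
next
 case False
 then have lt: "s < t" using st by simp
 have Z0: "0 <= Z" using Z[of 0] st by fastforce
 have G: "0 < Gamma (1 - \<alpha>)" using \<alpha> by (intro Gamma_real_pos) auto
 define K where "K t r = (t - r) powr (- \<alpha>) * z r" for t r
 have Kt: "K t absolutely_integrable_on {0..t}" "K s absolutely_integrable_on {0..s}"
  using powr_kernel_integrable[of "1 - \<alpha>" t z Z] powr_kernel_integrable[of "1 - \<alpha>" s z Z] \<alpha> z Z st
  by (auto simp: K_def[abs_def])
 have Kts: "K t absolutely_integrable_on {0..s}" "K t absolutely_integrable_on {s..t}"
  using set_integrable_subset[OF Kt(1), of "{0..s}"] set_integrable_subset[OF Kt(1), of "{s..t}"] st by auto
 have split: "integral {0..t} (K t) = integral {0..s} (K t) + integral {s..t} (K t)"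
  using Henstock_Kurzweil_Integration.integral_combine[of 0 s t "K t"] st Kt(1)
  by (simp add: set_lebesgue_integral_eq_integral(1))
 have p: "((%r. (t - r) powr (- \<alpha>)) has_integral (t - s) powr (1 - \<alpha>) / (1 - \<alpha>)) {s..t}"
  "((%r. (t - r) powr (- \<alpha>)) has_integral t powr (1 - \<alpha>) / (1 - \<alpha>)) {0..t}"
  "((%r. (s - r) powr (- \<alpha>)) has_integral s powr (1 - \<alpha>) / (1 - \<alpha>)) {0..s}"
  using powr_integral_right[of "1 - \<alpha>" s t] powr_integral_right[of "1 - \<alpha>" 0 t] powr_integral_right[of "1 - \<alpha>" 0 s] \<alpha> st by auto
 have b1: "norm (integral {s..t} (K t)) <= integral {s..t} (%r. Z * (t - r) powr (- \<alpha>))"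
 proof (rule integral_norm_bound_integral)
  show "K t integrable_on {s..t}" using Kts by (simp add: set_lebesgue_integral_eq_integral(1))
  show "(%r. Z * (t - r) powr - \<alpha>) integrable_on {s..t}"
   using has_integral_mult_right[OF p(1), of Z] by (rule has_integral_integrable)
  fix r assume "r \<in> {s..t}"
  then show "norm (K t r) <= Z * (t - r) powr - \<alpha>"
   using Z[of r] st by (auto simp: K_def abs_mult mult.commute[of Z] intro!: mult_left_mono)
 qed
 also have "... = Z * ((t - s) powr (1 - \<alpha>) / (1 - \<alpha>))"
  using integral_unique[OF has_integral_mult_right[OF p(1), of Z]] by simp
 finally have b1: "\<bar>integral {s..t} (K t)\<bar> <= Z * ((t - s) powr (1 - \<alpha>) / (1 - \<alpha>))" by simp
 \<comment> \<open>At r = s the power (s - r) powr (- \<alpha>) evaluates to 0 instead of infinity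
   and the difference would be negative; overwriting this one value keeps d nonnegative.\<close>
 define d where "d r = (if r = s then 0 else (s - r) powr (- \<alpha>) - (t - r) powr (- \<alpha>))" for r
 have p4: "((%r. (t - r) powr (- \<alpha>)) has_integral (t powr (1 - \<alpha>) - (t - s) powr (1 - \<alpha>)) / (1 - \<alpha>)) {0..s}"
 proof -
  have i: "(%r. (t - r) powr (- \<alpha>)) integrable_on {0..s}"
   by (rule integrable_subinterval_real[OF has_integral_integrable[OF p(2)]]) (use st in auto)
  moreover have "integral {0..s} (%r. (t - r) powr (- \<alpha>)) + integral {s..t} (%r. (t - r) powr (- \<alpha>)) = integral {0..t} (%r. (t - r) powr (- \<alpha>))"
   using st has_integral_integrable[OF p(2)] by (intro Henstock_Kurzweil_Integration.integral_combine) auto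
  ultimately show ?thesis
   using p by (auto simp: has_integral_iff diff_divide_distrib)
 qed
 have dI: "(d has_integral (s powr (1 - \<alpha>) - (t powr (1 - \<alpha>) - (t - s) powr (1 - \<alpha>))) / (1 - \<alpha>)) {0..s}"
  unfolding diff_divide_distrib[of "s powr _"]
  by (rule has_integral_spike[OF negligible_sing[of s] _ has_integral_diff[OF p(3) p4]]) (auto simp: d_def)
 have b2: "norm (integral {0..s} (%r. d r * z r)) <= integral {0..s} (%r. Z * d r)"
 proof (rule integral_norm_bound_integral)
  show "(%r. d r * z r) integrable_on {0..s}"
  proof (rule integrable_spike[OF _ negligible_sing[of s]])
   show "(%r. K s r - K t r) integrable_on {0..s}"
    using Kt Kts by (auto intro!: integrable_diff simp: set_lebesgue_integral_eq_integral(1))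
  qed (auto simp: d_def K_def algebra_simps)
  show "(%r. Z * d r) integrable_on {0..s}"
   using has_integral_mult_right[OF dI, of Z] by (rule has_integral_integrable)
  fix r assume r: "r \<in> {0..s}"
  have "0 <= d r" using r lt \<alpha> by (auto simp: d_def powr_minus_divide intro!: divide_left_mono powr_mono2)
  then show "norm (d r * z r) <= Z * d r"
   using Z[of r] r st by (auto simp: abs_mult mult.commute[of Z] intro!: mult_left_mono)
 qed
 also have "... = Z * ((s powr (1 - \<alpha>) - (t powr (1 - \<alpha>) - (t - s) powr (1 - \<alpha>))) / (1 - \<alpha>))"
  using integral_unique[OF has_integral_mult_right[OF dI, of Z]] by simp
 also have "... <= Z * ((t - s) powr (1 - \<alpha>) / (1 - \<alpha>))"
  using Z0 \<alpha> st by (intro mult_left_mono divide_right_mono) (auto intro: powr_mono2)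
 finally have b2: "\<bar>integral {0..s} (%r. d r * z r)\<bar> <= Z * ((t - s) powr (1 - \<alpha>) / (1 - \<alpha>))" by simp
 have "integral {0..s} (%r. d r * z r) = integral {0..s} (%r. K s r - K t r)"
  by (rule integral_spike[OF negligible_sing[of s]]) (auto simp: d_def K_def algebra_simps)
 also have "... = integral {0..s} (K s) - integral {0..s} (K t)"
  using Kt Kts by (intro integral_diff) (auto simp: set_lebesgue_integral_eq_integral(1))
 finally have "integral {0..t} (K t) - integral {0..s} (K s) = integral {s..t} (K t) - integral {0..s} (%r. d r * z r)"
  using split by simp
 then have bound: "\<bar>integral {0..t} (K t) - integral {0..s} (K s)\<bar> <= 2 * Z * ((t - s) powr (1 - \<alpha>) / (1 - \<alpha>))"
  using b1 b2 by linarith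
 have "frac_integral (1 - \<alpha>) z t = integral {0..t} (K t) / Gamma (1 - \<alpha>)" "frac_integral (1 - \<alpha>) z s = integral {0..s} (K s) / Gamma (1 - \<alpha>)"
  using Kt by (auto simp: frac_integral_eq K_def[abs_def] set_lebesgue_integral_eq_integral)
 then have "\<bar>frac_integral (1 - \<alpha>) z t - frac_integral (1 - \<alpha>) z s\<bar> = \<bar>integral {0..t} (K t) - integral {0..s} (K s)\<bar> / Gamma (1 - \<alpha>)"
  by (simp only: diff_divide_distrib[symmetric] abs_divide abs_of_pos[OF G])
 moreover have "\<bar>integral {0..t} (K t) - integral {0..s} (K s)\<bar> / Gamma (1 - \<alpha>) <= 2 * Z * ((t - s) powr (1 - \<alpha>) / (1 - \<alpha>)) / Gamma (1 - \<alpha>)"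
  using bound G by (intro divide_right_mono) auto
 ultimately show ?thesis by simp
qed

text \<open>The fractional integral of order 1 - \<alpha>, applied to that of order \<alpha>, is the
  plain integral of v. A nonzero limit of the latter at 0 contributes the multiple of s^(-\<alpha>).
  Its coefficient is written with integrals over all of [0, T], which makes it a Borel function of a
  parameter.\<close>

theorem Abel_inversion:
 assumes \<alpha>: "0 < \<alpha>" "\<alpha> < 1" and T: "0 < T"
  and v[measurable]: "v \<in> borel_measurable borel" and D[measurable]: "D \<in> borel_measurable borel"
  and Db: "!!s. s \<in> {0..T} ==> \<bar>D s\<bar> <= C * s powr (\<alpha> - 1)"
  and vi: "!!r. r \<in> {0<..T} ==> set_integrable lebesgue {0..r} (%s. (r - s) powr (\<alpha> - 1) * v s)"
  and der: "!!t. t \<in> {0<..T} ==> (frac_integral \<alpha> v has_real_derivative D t) (at t within {0..T})"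
 shows "AE s in lborel. s \<in> {0..T} --> v s =
  (((LINT s:{0..T}|lebesgue. v s) - (LINT s:{0..T}|lebesgue. frac_integral (1 - \<alpha>) D s)) * (1 - \<alpha>) / T powr (1 - \<alpha>)) * s powr (- \<alpha>)
   + frac_integral (1 - \<alpha>) D s"
proof -
 have Ga: "0 < Gamma \<alpha>" and G: "0 < Gamma (1 - \<alpha>)" using \<alpha> by (auto intro!: Gamma_real_pos)
 have vint: "set_integrable lebesgue {0..T} v"
  unfolding set_integrable_def
 proof (rule Bochner_Integration.integrable_bound)
  show "integrable lebesgue (%s. T powr (1 - \<alpha>) * (indicator {0..T} s *\<^sub>R ((T - s) powr (\<alpha> - 1) * v s)))"
   using vi[of T] T by (auto simp: set_integrable_def)
  show "(%s. indicator {0..T} s *\<^sub>R v s) \<in> borel_measurable lebesgue"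
   using borel_set_borel_measurable[OF v, of "{0..T}"] by (simp add: set_borel_measurable_def)
  have "AE s in lebesgue. s ~= T" using AE_lborel_singleton[of T] by (simp add: AE_completion_iff)
  then show "AE s in lebesgue. norm (indicator {0..T} s *\<^sub>R v s) <= norm (T powr (1 - \<alpha>) * (indicator {0..T} s *\<^sub>R ((T - s) powr (\<alpha> - 1) * v s)))"
  proof eventually_elim
   case (elim s)
   show ?case
   proof (cases "s \<in> {0..T}")
    case True
    then have s: "0 <= s" "s < T" using elim by auto
    have "1 = T powr (1 - \<alpha>) * T powr (\<alpha> - 1)" using T by (simp flip: powr_add)
    also have "... <= T powr (1 - \<alpha>) * (T - s) powr (\<alpha> - 1)"
     using s \<alpha> by (intro mult_left_mono powr_mono2') auto
    finally have "1 * \<bar>v s\<bar> <= T powr (1 - \<alpha>) * (T - s) powr (\<alpha> - 1) * \<bar>v s\<bar>" by (intro mult_right_mono) auto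
    then show ?thesis using True by (simp add: abs_mult mult.assoc)
   qed simp
  qed
 qed
 have Dint: "set_integrable lebesgue {0..T} D"
  using set_integral_abs_le(1)[OF _ borel_set_borel_measurable[OF D, of "{0..T}"], of "%s. C * s powr (\<alpha> - 1)"] Db
   powr_left_lebesgue(1)[of \<alpha> 0 T] \<alpha> T by (auto intro!: set_integrable_mult_right)
 have sub: "set_integrable lebesgue {0..t} g" if "set_integrable lebesgue {0..T} g" "t <= T" for g :: "real => real" and t
  using set_integrable_subset[OF that(1), of "{0..t}"] that(2) by auto
 define V where "V = frac_integral \<alpha> v"
 define ID where "ID t = (LINT s:{0..t}|lebesgue. D s)" for t
 \<comment> \<open>This is the limit of V at 0 from the right, not V 0 = 0: the derivative is given
   for t > 0 only, so V may jump at 0.\<close>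
 define c0 where "c0 = V T - ID T"
 have ID_HK: "ID t = integral {0..t} D" "D integrable_on {0..t}" if "t <= T" for t
  unfolding ID_def using set_lebesgue_integral_eq_integral[OF sub[OF Dint that]] by simp_all
 have V: "V t = c0 + ID t" if t: "0 < t" "t <= T" for t
 proof -
  have "(D has_integral (V T - V t)) {t..T}"
  proof (rule fundamental_theorem_of_calculus)
   fix x assume x: "x \<in> {t..T}"
   have "(V has_real_derivative D x) (at x within {t..T})"
    unfolding V_def by (rule has_field_derivative_subset[OF der]) (use x t in auto)
   then show "(V has_vector_derivative D x) (at x within {t..T})"
    by (simp add: has_real_derivative_iff_has_vector_derivative)
  qed (use t in simp)
  then have "V T - V t = integral {t..T} D" by (simp add: integral_unique)
  moreover have "integral {0..t} D + integral {t..T} D = integral {0..T} D"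
   using t ID_HK(2)[of T] by (intro Henstock_Kurzweil_Integration.integral_combine) auto
  ultimately show ?thesis using ID_HK(1)[of t] ID_HK(1)[of T] t by (simp add: c0_def)
 qed
 define E where "E = frac_integral (1 - \<alpha>) D"
 have km: "(%(s, r). (t - s) powr (- \<alpha>) * (s - r) powr (\<alpha> - 1)) \<in> borel_measurable borel" for t :: real
  unfolding borel_prod[symmetric] by measurable
 have km2: "(%(s::real, r::real). (t - s) powr (- \<alpha>)) \<in> borel_measurable borel" for t :: real
  unfolding borel_prod[symmetric] by measurable
 have km3: "(%(s::real, r). (s - r) powr (- \<alpha>)) \<in> borel_measurable borel"
  unfolding borel_prod[symmetric] by measurable
 have BetaG: "Beta \<alpha> (1 - \<alpha>) = Gamma \<alpha> * Gamma (1 - \<alpha>)" by (simp add: Beta_def)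
 have F1: "(LINT s:{0..t}|lebesgue. (t - s) powr (- \<alpha>) * V s) = Gamma (1 - \<alpha>) * (LINT s:{0..t}|lebesgue. v s)"
  "set_integrable lebesgue {0..t} (%s. (t - s) powr (- \<alpha>) * V s)" if t: "0 < t" "t <= T" for t
 proof -
  have *: "set_integrable lebesgue {0..t} (%s. LINT r:{0..s}|lebesgue. (t - s) powr (- \<alpha>) * (s - r) powr (\<alpha> - 1) * v r)"
  "(LINT s:{0..t}|lebesgue. LINT r:{0..s}|lebesgue. (t - s) powr (- \<alpha>) * (s - r) powr (\<alpha> - 1) * v r)
    = (LINT r:{0..t}|lebesgue. Gamma \<alpha> * Gamma (1 - \<alpha>) * v r)"
  proof -
   have i: "set_integrable lebesgue {r..t} (%s. (t - s) powr (- \<alpha>) * (s - r) powr (\<alpha> - 1))"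
    "(LINT s:{r..t}|lebesgue. (t - s) powr (- \<alpha>) * (s - r) powr (\<alpha> - 1)) = Gamma \<alpha> * Gamma (1 - \<alpha>)" if "0 < r" "r < t" for r
    using Beta_lebesgue[of \<alpha> "1 - \<alpha>" r t] \<alpha> that by (auto simp: BetaG)
   note F = triangle_Fubini[OF km _ v sub[OF vint t(2)] i order_refl]
   show "set_integrable lebesgue {0..t} (%s. LINT r:{0..s}|lebesgue. (t - s) powr (- \<alpha>) * (s - r) powr (\<alpha> - 1) * v r)"
   "(LINT s:{0..t}|lebesgue. LINT r:{0..s}|lebesgue. (t - s) powr (- \<alpha>) * (s - r) powr (\<alpha> - 1) * v r)
     = (LINT r:{0..t}|lebesgue. Gamma \<alpha> * Gamma (1 - \<alpha>) * v r)"
    using F(1,2) by auto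
  qed
  have inner: "(LINT r:{0..s}|lebesgue. (t - s) powr (- \<alpha>) * (s - r) powr (\<alpha> - 1) * v r) = Gamma \<alpha> * ((t - s) powr (- \<alpha>) * V s)" for s
   using Ga by (simp add: V_def frac_integral_eq mult.assoc)
  have "Gamma \<alpha> * (LINT s:{0..t}|lebesgue. (t - s) powr (- \<alpha>) * V s) = Gamma \<alpha> * (Gamma (1 - \<alpha>) * (LINT s:{0..t}|lebesgue. v s))"
   using *(2) unfolding inner by (simp add: mult.assoc)
  then show "(LINT s:{0..t}|lebesgue. (t - s) powr (- \<alpha>) * V s) = Gamma (1 - \<alpha>) * (LINT s:{0..t}|lebesgue. v s)" using Ga by simp
  have "set_integrable lebesgue {0..t} (%s. (1 / Gamma \<alpha>) * (Gamma \<alpha> * ((t - s) powr (- \<alpha>) * V s)))"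
   using *(1) unfolding inner by (intro set_integrable_mult_right) auto
  then show "set_integrable lebesgue {0..t} (%s. (t - s) powr (- \<alpha>) * V s)" using Ga by simp
 qed
 have pr: "set_integrable lebesgue {r..t} (%s. (t - s) powr (- \<alpha>))" "(LINT s:{r..t}|lebesgue. (t - s) powr (- \<alpha>)) = (t - r) powr (1 - \<alpha>) / (1 - \<alpha>)"
  "set_integrable lebesgue {r..t} (%s. (s - r) powr (- \<alpha>))" "(LINT s:{r..t}|lebesgue. (s - r) powr (- \<alpha>)) = (t - r) powr (1 - \<alpha>) / (1 - \<alpha>)"
  if "r <= t" for r t :: real
  using powr_right_lebesgue[of "1 - \<alpha>" r t] powr_left_lebesgue[of "1 - \<alpha>" r t] \<alpha> that by auto
 \<comment> \<open>Both sides reduce to the integral of (t - r)^(1 - \<alpha>) / (1 - \<alpha>) * D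
   r, because (t - s)^(-\<alpha>) and (s - r)^(-\<alpha>) have the same integral over s in
   [r, t].\<close>
 have F2: "(LINT s:{0..t}|lebesgue. (t - s) powr (- \<alpha>) * ID s) = Gamma (1 - \<alpha>) * (LINT s:{0..t}|lebesgue. E s)"
  "set_integrable lebesgue {0..t} (%s. (t - s) powr (- \<alpha>) * ID s)" "set_integrable lebesgue {0..t} E" "E \<in> borel_measurable borel"
  if t: "0 < t" "t <= T" for t
 proof -
  have b: "(t - r) powr (1 - \<alpha>) / (1 - \<alpha>) <= t powr (1 - \<alpha>) / (1 - \<alpha>)" if "0 < r" "r < t" for r
   using that \<alpha> by (intro divide_right_mono powr_mono2) auto
  note A = triangle_Fubini[OF km2 _ D sub[OF Dint t(2)] pr(1,2) b]
  note B = triangle_Fubini[OF km3 _ D sub[OF Dint t(2)] pr(3,4) b]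
  have innerB: "(LINT r:{0..s}|lebesgue. (s - r) powr (- \<alpha>) * D r) = Gamma (1 - \<alpha>) * E s" for s
   using G by (simp add: E_def frac_integral_eq)
  have innerA: "(LINT r:{0..s}|lebesgue. (t - s) powr (- \<alpha>) * D r) = (t - s) powr (- \<alpha>) * ID s" for s
   by (simp add: ID_def)
  show "(LINT s:{0..t}|lebesgue. (t - s) powr (- \<alpha>) * ID s) = Gamma (1 - \<alpha>) * (LINT s:{0..t}|lebesgue. E s)"
   using A(2) B(2) unfolding innerA innerB by simp
  show "set_integrable lebesgue {0..t} (%s. (t - s) powr (- \<alpha>) * ID s)" using A(1) unfolding innerA by simp
  have "set_integrable lebesgue {0..t} (%s. (1 / Gamma (1 - \<alpha>)) * (Gamma (1 - \<alpha>) * E s))"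
   using B(1) unfolding innerB by (intro set_integrable_mult_right) auto
  then show "set_integrable lebesgue {0..t} E" using G by simp
  have "(%s. (1 / Gamma (1 - \<alpha>)) * (Gamma (1 - \<alpha>) * E s)) \<in> borel_measurable borel"
   using B(3) unfolding innerB by (rule borel_measurable_times[OF borel_measurable_const]) simp_all
  moreover have "(%s. (1 / Gamma (1 - \<alpha>)) * (Gamma (1 - \<alpha>) * E s)) = E" using G by auto
  ultimately show "E \<in> borel_measurable borel" by (simp only:)
 qed
 have Em: "E \<in> borel_measurable borel" and Ei: "set_integrable lebesgue {0..T} E" using F2(3,4)[of T] T by auto
 have main: "Gamma (1 - \<alpha>) * (LINT s:{0..t}|lebesgue. v s) = c0 * (t powr (1 - \<alpha>) / (1 - \<alpha>)) + Gamma (1 - \<alpha>) * (LINT s:{0..t}|lebesgue. E s)"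
  if t: "0 < t" "t <= T" for t
 proof -
  have "(LINT s:{0..t}|lebesgue. (t - s) powr (- \<alpha>) * V s) = integral {0..t} (%s. (t - s) powr (- \<alpha>) * V s)"
   using F1(2)[OF t] by (simp add: set_lebesgue_integral_eq_integral)
  also have "... = integral {0..t} (%s. c0 * (t - s) powr (- \<alpha>) + (t - s) powr (- \<alpha>) * ID s)"
   by (rule integral_spike[OF negligible_sing[of 0]]) (use V t in \<open>auto simp: algebra_simps\<close>)
  also have "... = (LINT s:{0..t}|lebesgue. c0 * (t - s) powr (- \<alpha>) + (t - s) powr (- \<alpha>) * ID s)"
   using F2(2)[OF t] pr(1)[of 0 t] t by (subst set_lebesgue_integral_eq_integral) (auto intro!: set_integral_add set_integrable_mult_right)
  also have "... = c0 * (t powr (1 - \<alpha>) / (1 - \<alpha>)) + (LINT s:{0..t}|lebesgue. (t - s) powr (- \<alpha>) * ID s)"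
   using F2(2)[OF t] pr(1,2)[of 0 t] t by (subst set_integral_add) (auto intro!: set_integrable_mult_right)
  finally show ?thesis using F1(1)[OF t] F2(1)[OF t] by simp
 qed
 define c where "c = c0 / Gamma (1 - \<alpha>)"
 have c: "((LINT s:{0..T}|lebesgue. v s) - (LINT s:{0..T}|lebesgue. E s)) * (1 - \<alpha>) / T powr (1 - \<alpha>) = c"
 proof -
  have "Gamma (1 - \<alpha>) * ((LINT s:{0..T}|lebesgue. v s) - (LINT s:{0..T}|lebesgue. E s)) = c0 * (T powr (1 - \<alpha>) / (1 - \<alpha>))"
   using main[of T] T by (simp add: right_diff_distrib)
  then have "(LINT s:{0..T}|lebesgue. v s) - (LINT s:{0..T}|lebesgue. E s) = c0 * (T powr (1 - \<alpha>) / (1 - \<alpha>)) / Gamma (1 - \<alpha>)"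
   using G by (metis less_numeral_extra(3) nonzero_mult_div_cancel_left)
  then have "(LINT s:{0..T}|lebesgue. v s) - (LINT s:{0..T}|lebesgue. E s) = c * (T powr (1 - \<alpha>) / (1 - \<alpha>))"
   by (simp add: c_def)
  then show ?thesis using \<alpha> T by simp
 qed
 define g where "g s = v s - (c * s powr (- \<alpha>) + E s)" for s
 have gm: "g \<in> borel_measurable borel" unfolding g_def using Em by measurable
 have p0: "set_integrable lebesgue {0..t} (%s. s powr (- \<alpha>))" "(LINT s:{0..t}|lebesgue. s powr (- \<alpha>)) = t powr (1 - \<alpha>) / (1 - \<alpha>)" if "0 <= t" for t
  using pr(3,4)[of 0 t] that by auto
 have gi: "set_integrable lebesgue {0..T} g"
  unfolding g_def using vint Ei p0(1)[of T] T by (intro set_integral_diff(1) set_integral_add(1) set_integrable_mult_right) auto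
 have "AE s in lborel. s \<in> {0..T} --> g s = 0"
 proof (rule AE_zero_if_integrals_zero[OF gm])
  show "set_integrable lborel {0..T} g" using gi set_lebesgue_lborel(1)[OF gm] by simp
  fix t assume t: "0 < t" "t <= T"
  have "(LINT s:{0..t}|lborel. g s) = (LINT s:{0..t}|lebesgue. g s)" using set_lebesgue_lborel(2)[OF gm] by simp
  also have "... = (LINT s:{0..t}|lebesgue. v s) - (c * (t powr (1 - \<alpha>) / (1 - \<alpha>)) + (LINT s:{0..t}|lebesgue. E s))"
   unfolding g_def using sub[OF vint t(2)] sub[OF Ei t(2)] p0[of t] t
   by (subst set_integral_diff(2), simp, intro set_integral_add(1) set_integrable_mult_right, auto)
  also have "... = 0"
  proof -
   have "c0 = Gamma (1 - \<alpha>) * c" using G by (simp add: c_def)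
   then have "Gamma (1 - \<alpha>) * (LINT s:{0..t}|lebesgue. v s) = Gamma (1 - \<alpha>) * (c * (t powr (1 - \<alpha>) / (1 - \<alpha>)) + (LINT s:{0..t}|lebesgue. E s))"
    using main[OF t] by (simp add: distrib_left mult.assoc)
   then show ?thesis using G by simp
  qed
  finally show "(LINT s:{0..t}|lborel. g s) = 0" .
 qed
 then show ?thesis
  unfolding E_def[symmetric] c by eventually_elim (simp add: g_def)
qed

lemma powr_subadditive:
 fixes x y :: real
 assumes "0 <= x" "0 <= y" "0 <= c" "c <= 1"
 shows "(x + y) powr c <= x powr c + y powr c"
proof (cases "x + y = 0")
 case True then show ?thesis by simp
next
 case False
 then have p: "0 < x + y" using assms by simp
 have le: "z / (x + y) <= (z / (x + y)) powr c" if "0 <= z" "z <= x + y" for z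
 proof (cases "z = 0")
  case False
  then have "(z / (x + y)) powr 1 <= (z / (x + y)) powr c"
   using that assms p by (intro powr_mono') auto
  then show ?thesis using that p by simp
 qed simp
 have "1 = x / (x + y) + y / (x + y)" using p by (simp add: add_divide_distrib[symmetric])
 also have "... <= (x / (x + y)) powr c + (y / (x + y)) powr c" using le[of x] le[of y] assms by simp
 finally have "(x + y) powr c * 1 <= (x + y) powr c * ((x / (x + y)) powr c + (y / (x + y)) powr c)"
  by (intro mult_left_mono) auto
 also have "... = x powr c + y powr c"
  using assms p by (simp add: distrib_left powr_divide)
 finally show ?thesis by simp
qed

lemma powr_diff_le:
 fixes s t :: real
 assumes "0 <= s" "s <= t" "0 <= c" "c <= 1"
 shows "t powr c - s powr c <= (t - s) powr c"
 using powr_subadditive[of "t - s" s c] assms by simp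

lemma has_RL_derivative_cong:
 assumes "!!s. s \<in> {0..T} ==> v s = v' s" "0 < t" "t <= T" "has_RL_derivative T \<alpha> v D t"
 shows "has_RL_derivative T \<alpha> v' D t"
proof -
 have "set_integrable lebesgue {0..r} (%s. (r - s) powr (\<alpha> - 1) * v s)
  \<longleftrightarrow> set_integrable lebesgue {0..r} (%s. (r - s) powr (\<alpha> - 1) * v' s)" if "r \<in> {0<..T}" for r
  using assms(1) that by (intro set_integrable_cong) auto
 moreover have "frac_integral \<alpha> v r = frac_integral \<alpha> v' r" if "r \<in> {0..T}" for r
  using assms(1) that by (intro frac_integral_cong) auto
 ultimately show ?thesis
  using assms(2-) has_field_derivative_transform_within[of "frac_integral \<alpha> v" D t "{0..T}" 1 "frac_integral \<alpha> v'"]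
  unfolding has_RL_derivative_def by auto
qed

lemma borel_frac_integral:
 fixes D :: "real => real => real"
 assumes D: "(%p. D (fst p) (snd p)) \<in> borel_measurable borel"
 shows "(%p. frac_integral \<gamma> (D (fst p)) (snd p)) \<in> borel_measurable borel"
proof -
 have D': "(%p. D (fst p) (snd p)) \<in> borel_measurable (borel \<Otimes>\<^sub>M borel)" using D by (simp add: borel_prod)
 have sec: "(%s. D x s) \<in> borel_measurable borel" for x
  using measurable_compose[OF _ D', of "%s. (x, s)" borel] by simp
 have eq: "frac_integral \<gamma> (D x) t = (\<integral>s. (if 0 <= s & s <= t then (t - s) powr (\<gamma> - 1) / Gamma \<gamma> * D x s else 0) \<partial>lborel)" for x t
 proof -
  have m: "(%s. (t - s) powr (\<gamma> - 1) / Gamma \<gamma> * D x s) \<in> borel_measurable borel" using sec by simp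
  have "frac_integral \<gamma> (D x) t = (LINT s:{0..t}|lborel. (t - s) powr (\<gamma> - 1) / Gamma \<gamma> * D x s)"
   unfolding frac_integral_def by (rule set_lebesgue_lborel(2)[OF m]) simp
  then show ?thesis unfolding set_lebesgue_integral_def
   by (simp only:) (intro Bochner_Integration.integral_cong, auto simp: indicator_def)
 qed
 have "(%p. \<integral>s. (if 0 <= s & s <= snd p then (snd p - s) powr (\<gamma> - 1) / Gamma \<gamma> * D (fst p) s else 0) \<partial>lborel)
   \<in> borel_measurable (borel \<Otimes>\<^sub>M borel)"
 proof (rule lborel.borel_measurable_lebesgue_integral)
  have [measurable]: "(%q. D (fst (fst q)) (snd q)) \<in> borel_measurable ((borel \<Otimes>\<^sub>M borel) \<Otimes>\<^sub>M lborel)"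
  proof -
   have "(%q. (fst (fst q), snd q)) \<in> ((borel \<Otimes>\<^sub>M borel) \<Otimes>\<^sub>M lborel) \<rightarrow>\<^sub>M (borel \<Otimes>\<^sub>M borel)" by measurable
   from measurable_compose[OF this D'] show ?thesis by simp
  qed
  have "(%q. if 0 <= snd q & snd q <= snd (fst q) then (snd (fst q) - snd q) powr (\<gamma> - 1) / Gamma \<gamma> * D (fst (fst q)) (snd q) else 0)
   \<in> borel_measurable ((borel \<Otimes>\<^sub>M borel) \<Otimes>\<^sub>M lborel)"
   by measurable
  then show "(%(p, s). if 0 <= s & s <= snd p then (snd p - s) powr (\<gamma> - 1) / Gamma \<gamma> * D (fst p) s else 0)
   \<in> borel_measurable ((borel \<Otimes>\<^sub>M borel) \<Otimes>\<^sub>M lborel)"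
   by (simp add: case_prod_beta')
 qed
 then show ?thesis unfolding eq by (simp add: borel_prod)
qed

text \<open>u and f are given on closed rectangles only; composing with the clamp extends them
  continuously to the plane and so makes them jointly Borel.\<close>

definition clamp_real :: "real => real => real => real" where
 "clamp_real l r y = max l (min r y)"

lemma clamp_real_id: "y \<in> {l..r} ==> clamp_real l r y = y"
 by (simp add: clamp_real_def)

lemma clamp_real_in: "l <= r ==> clamp_real l r y \<in> {l..r}"
 by (simp add: clamp_real_def)

lemma borel_clamped:
 assumes g: "continuous_on ({0..L} \<times> {t0..t1}) (%(x, t). g x t)" and "0 <= L" "t0 <= t1"
 shows "(%p. g (clamp_real 0 L (fst p)) (clamp_real t0 t1 (snd p)) :: real) \<in> borel_measurable borel"
proof -
 have "continuous_on UNIV (%p. (clamp_real 0 L (fst p), clamp_real t0 t1 (snd p)))"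
  unfolding clamp_real_def by (intro continuous_intros)
 then have "continuous_on UNIV (%p. (%(x, t). g x t) (clamp_real 0 L (fst p), clamp_real t0 t1 (snd p)))"
  by (rule continuous_on_compose2[OF g]) (use assms clamp_real_in in auto)
 then show ?thesis by (intro borel_measurable_continuous_onI) simp
qed

section \<open>The delay problem: constants, measurability and Hoelder continuity in time\<close>

text \<open>The constants defined in this context depend on its parameters alone; this is how
  independence of the mesh and of the time step is ensured.\<close>

locale delay_problem =
 fixes \<alpha> L p a b \<tau> :: real and K m :: nat
  and f \<phi> d\<phi> u Y Y1 Y2 :: "real => real => real"
  and \<gamma> :: "nat => real => real" and \<gamma>t :: "real => real"
  and CY C\<phi> :: real
 assumes \<alpha>: "0 < \<alpha>" "\<alpha> < 1" and L: "0 < L" and p: "0 <= p" and a: "a <= 0" and \<tau>: "0 < \<tau>" and K: "0 < K"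
  and f_cont: "continuous_on ({0..L} \<times> {0..real K * \<tau>}) (%(x, t). f x t)"
  and solution: "delay_solution \<alpha> L p a b \<tau> K f \<phi> u"
  and m_def: "m = (LEAST i. 0 < i & (real i + 1) * \<alpha> > 1)"
  and decomposition: "!!x t. x \<in> {0..L} ==> t \<in> {0..real K * \<tau>} ==>
     u x t = \<gamma> 0 x + (\<Sum>j=1..m. \<gamma> j x * t powr (real j * \<alpha>)) + \<gamma>t x * t + Y x t"
  and gamma_bounded: "!!j. j <= m ==> bounded (\<gamma> j ` {0..L})"
  and gammat_bounded: "bounded (\<gamma>t ` {0..L})"
  and Y_zero: "!!x. x \<in> {0..L} ==> Y x 0 = 0 & Y1 x 0 = 0"
  and Y_deriv: "!!x t. x \<in> {0..L} ==> t \<in> {0..real K * \<tau>} ==>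
     (Y x has_real_derivative Y1 x t) (at t within {0..real K * \<tau>})"
  and Y1_cont: "!!x. x \<in> {0..L} ==> continuous_on {0..real K * \<tau>} (Y1 x)"
  and Y1_bound: "!!x t. x \<in> {0..L} ==> t \<in> {0..real K * \<tau>} ==>
     \<bar>Y1 x t\<bar> <= CY * (1 + t powr ((real m + 1) * \<alpha> - 1))"
  and Y2_deriv: "!!x t. x \<in> {0..L} ==> t \<in> {0..real K * \<tau>} ==>
     Y1 x t - Y1 x 0 = (LINT s:{0..t}|lebesgue. Y2 x s)"
  and Y2_L1: "!!x. x \<in> {0..L} ==> set_integrable lebesgue {0..real K * \<tau>} (Y2 x)"
  and Y2_L1_L2: "in_L1_L2 (real K * \<tau>) L Y2"
  and u_H2_bounded: "p = 0 ==> \<exists>B. \<forall>t\<in>{0..real K * \<tau>}. H2_norm_le L (%x. u x t) B"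
  and phi_deriv: "!!x t. x \<in> {0..L} ==> t \<in> {-\<tau>..0} ==>
     (\<phi> x has_real_derivative d\<phi> x t) (at t within {-\<tau>..0})"
  and dphi_cont: "!!x. x \<in> {0..L} ==> continuous_on {-\<tau>..0} (d\<phi> x)"
  and dphi_bound: "!!x t. x \<in> {0..L} ==> t \<in> {-\<tau>..0} ==> \<bar>d\<phi> x t\<bar> <= C\<phi>"
begin

definition T :: real where "T = real K * \<tau>"

lemma T_pos: "0 < T" and \<tau>_le_T: "\<tau> <= T"
 using K \<tau> by (auto simp: T_def)

lemma G_pos: "0 < Gamma (1 - \<alpha>)"
 using \<alpha> by (intro Gamma_real_pos) auto

text \<open>Minimality of m gives m \<alpha> <= 1, so all exponents j \<alpha> of the singular sum
  lie between \<alpha> and 1.\<close>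

lemma m_props: "0 < m" "1 < (real m + 1) * \<alpha>" "real m * \<alpha> <= 1"
proof -
 obtain i :: nat where "1 / \<alpha> < real i" using reals_Archimedean2 by blast
 then have "1 < real i * \<alpha>" using \<alpha> by (simp add: field_simps)
 then have ex: "0 < i & (real i + 1) * \<alpha> > 1" using \<alpha> by (cases i) (auto simp: algebra_simps)
 have "0 < m & (real m + 1) * \<alpha> > 1" unfolding m_def by (rule LeastI[of _ i]) (rule ex)
 then show m: "0 < m" "1 < (real m + 1) * \<alpha>" by auto
 show "real m * \<alpha> <= 1"
 proof (cases "m = 1")
  case False
  then have "\<not> (0 < m - 1 & (real (m - 1) + 1) * \<alpha> > 1)"
   using not_less_Least[of "m - 1" "%i. 0 < i & (real i + 1) * \<alpha> > 1"] m(1) by (simp add: m_def[symmetric])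
  then show ?thesis using m(1) False by (simp add: of_nat_diff)
 qed (use \<alpha> in simp)
qed

lemma j\<alpha>: assumes "j \<in> {1..m}" shows "\<alpha> <= real j * \<alpha>" "real j * \<alpha> <= 1"
proof -
 show "\<alpha> <= real j * \<alpha>" using assms \<alpha> by simp
 have "real j * \<alpha> <= real m * \<alpha>" using assms \<alpha> by (intro mult_right_mono) auto
 then show "real j * \<alpha> <= 1" using m_props(3) by linarith
qed

lemma gamma_bound_exists: "\<exists>C\<ge>0. (\<forall>j\<le>m. \<forall>x\<in>{0..L}. \<bar>\<gamma> j x\<bar> <= C) & (\<forall>x\<in>{0..L}. \<bar>\<gamma>t x\<bar> <= C)"
proof -
 have "bounded (\<Union>j\<le>m. \<gamma> j ` {0..L})" using gamma_bounded by auto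
 then have "bounded ((\<Union>j\<le>m. \<gamma> j ` {0..L}) \<union> \<gamma>t ` {0..L})" using gammat_bounded by (rule bounded_Un[THEN iffD2, OF conjI])
 then obtain C where C: "\<forall>y\<in>(\<Union>j\<le>m. \<gamma> j ` {0..L}) \<union> \<gamma>t ` {0..L}. norm y <= C"
  unfolding bounded_iff ..
 have g: "\<bar>\<gamma> j x\<bar> <= C" if "j <= m" "x \<in> {0..L}" for j x
  using bspec[OF C, of "\<gamma> j x"] that by force
 have gt: "\<bar>\<gamma>t x\<bar> <= C" if "x \<in> {0..L}" for x
  using bspec[OF C, of "\<gamma>t x"] that by auto
 have "0 <= C" using gt[of 0] L abs_ge_zero[of "\<gamma>t 0"] by (auto intro: order_trans)
 then show ?thesis using g gt by (intro exI[of _ C]) auto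
qed

definition C\<gamma> :: real where
 "C\<gamma> = (SOME C. 0 <= C & (\<forall>j\<le>m. \<forall>x\<in>{0..L}. \<bar>\<gamma> j x\<bar> <= C) & (\<forall>x\<in>{0..L}. \<bar>\<gamma>t x\<bar> <= C))"

lemma C\<gamma>: "0 <= C\<gamma>" "j <= m ==> x \<in> {0..L} ==> \<bar>\<gamma> j x\<bar> <= C\<gamma>" "x \<in> {0..L} ==> \<bar>\<gamma>t x\<bar> <= C\<gamma>"
proof -
 have "0 <= C\<gamma> & (\<forall>j\<le>m. \<forall>x\<in>{0..L}. \<bar>\<gamma> j x\<bar> <= C\<gamma>) & (\<forall>x\<in>{0..L}. \<bar>\<gamma>t x\<bar> <= C\<gamma>)"
  unfolding C\<gamma>_def by (rule someI_ex) (rule gamma_bound_exists)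
 then show "0 <= C\<gamma>" "j <= m ==> x \<in> {0..L} ==> \<bar>\<gamma> j x\<bar> <= C\<gamma>" "x \<in> {0..L} ==> \<bar>\<gamma>t x\<bar> <= C\<gamma>" by auto
qed

definition CY1 :: real where "CY1 = \<bar>CY\<bar> * (1 + T powr ((real m + 1) * \<alpha> - 1))"

lemma CY1: "0 <= CY1" "x \<in> {0..L} ==> t \<in> {0..T} ==> \<bar>Y1 x t\<bar> <= CY1"
proof -
 show "0 <= CY1" by (simp add: CY1_def)
 assume x: "x \<in> {0..L}" and t: "t \<in> {0..T}"
 have "\<bar>Y1 x t\<bar> <= CY * (1 + t powr ((real m + 1) * \<alpha> - 1))" using Y1_bound x t by (simp add: T_def)
 also have "... <= \<bar>CY\<bar> * (1 + t powr ((real m + 1) * \<alpha> - 1))" by (intro mult_right_mono add_nonneg_nonneg) auto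
 also have "... <= CY1" unfolding CY1_def using t m_props by (intro mult_left_mono add_left_mono powr_mono2) auto
 finally show "\<bar>Y1 x t\<bar> <= CY1" .
qed

lemma u_cont: "continuous_on ({0..L} \<times> {-\<tau>..T}) (%(x, t). u x t)"
 and u_init: "x \<in> {0..L} ==> t \<in> {-\<tau>..0} ==> u x t = \<phi> x t"
 and u_bd: "t \<in> {-\<tau>..T} ==> u 0 t = 0 & u L t = 0"
 using solution by (auto simp: delay_solution_def T_def)

lemma u_cont_x: "t \<in> {-\<tau>..T} ==> continuous_on {0..L} (%x. u x t)"
proof -
 assume t: "t \<in> {-\<tau>..T}"
 have "continuous_on {0..L} (%x. (x, t))" by (intro continuous_intros)
 have "continuous_on {0..L} (%x. (%(x, t). u x t) (x, t))"
  by (rule continuous_on_compose2[OF u_cont \<open>continuous_on {0..L} (%x. (x, t))\<close>]) (use t in auto)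
 then show ?thesis by simp
qed

lemma u_cont_t: "x \<in> {0..L} ==> continuous_on {-\<tau>..T} (u x)"
proof -
 assume x: "x \<in> {0..L}"
 have "continuous_on {-\<tau>..T} (%t. (x, t))" by (intro continuous_intros)
 have "continuous_on {-\<tau>..T} (%t. (%(x, t). u x t) (x, t))"
  by (rule continuous_on_compose2[OF u_cont \<open>continuous_on {-\<tau>..T} (%t. (x, t))\<close>]) (use x in auto)
 then show ?thesis by simp
qed

lemma compact_bound:
 fixes t0 t1 :: real
 assumes "continuous_on ({0..L} \<times> {t0..t1}) (%(x, t). g x t :: real)"
 shows "\<exists>C\<ge>0. \<forall>x\<in>{0..L}. \<forall>t\<in>{t0..t1}. \<bar>g x t\<bar> <= C"
proof -
 have "bounded ((%(x, t). g x t) ` ({0..L} \<times> {t0..t1}))"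
  by (intro compact_imp_bounded compact_continuous_image assms compact_Times compact_Icc)
 then obtain C where "\<forall>y\<in>(%(x, t). g x t) ` ({0..L} \<times> {t0..t1}). \<bar>y\<bar> <= C"
  unfolding bounded_iff real_norm_def by blast
 then show ?thesis by (intro exI[of _ "\<bar>C\<bar>"]) force
qed

definition Cuf :: real where
 "Cuf = (SOME C. 0 <= C & (\<forall>x\<in>{0..L}. \<forall>t\<in>{-\<tau>..T}. \<bar>u x t\<bar> <= C) & (\<forall>x\<in>{0..L}. \<forall>t\<in>{0..T}. \<bar>f x t\<bar> <= C))"

lemma Cuf: "0 <= Cuf" "x \<in> {0..L} ==> t \<in> {-\<tau>..T} ==> \<bar>u x t\<bar> <= Cuf" "x \<in> {0..L} ==> t \<in> {0..T} ==> \<bar>f x t\<bar> <= Cuf"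
proof -
 obtain C1 where C1: "0 <= C1" "\<forall>x\<in>{0..L}. \<forall>t\<in>{-\<tau>..T}. \<bar>u x t\<bar> <= C1" using compact_bound[OF u_cont] by auto
 obtain C2 where C2: "0 <= C2" "\<forall>x\<in>{0..L}. \<forall>t\<in>{0..T}. \<bar>f x t\<bar> <= C2" using compact_bound[OF f_cont] by (auto simp: T_def)
 have "\<exists>C. 0 <= C & (\<forall>x\<in>{0..L}. \<forall>t\<in>{-\<tau>..T}. \<bar>u x t\<bar> <= C) & (\<forall>x\<in>{0..L}. \<forall>t\<in>{0..T}. \<bar>f x t\<bar> <= C)"
  using C1 C2 by (intro exI[of _ "C1 + C2"]) (force intro: add_increasing2 add_increasing)
 then have "0 <= Cuf & (\<forall>x\<in>{0..L}. \<forall>t\<in>{-\<tau>..T}. \<bar>u x t\<bar> <= Cuf) & (\<forall>x\<in>{0..L}. \<forall>t\<in>{0..T}. \<bar>f x t\<bar> <= Cuf)"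
  unfolding Cuf_def by (rule someI_ex)
 then show "0 <= Cuf" "x \<in> {0..L} ==> t \<in> {-\<tau>..T} ==> \<bar>u x t\<bar> <= Cuf" "x \<in> {0..L} ==> t \<in> {0..T} ==> \<bar>f x t\<bar> <= Cuf" by auto
qed

text \<open>The singular part of \<open>\<partial>\<^sub>t u\<close> and \<open>\<partial>\<^sub>t u\<close> itself, for \<open>t > 0\<close>.\<close>

definition z_sing :: "real => real => real" where
 "z_sing x t = (\<Sum>j=1..m. \<gamma> j x * (real j * \<alpha>) * t powr (real j * \<alpha> - 1)) + \<gamma>t x"

definition ut :: "real => real => real" where
 "ut x t = z_sing x t + Y1 x t"

lemma ut_deriv:
 assumes x: "x \<in> {0..L}" and t: "0 < t" "t <= T"
 shows "(u x has_real_derivative ut x t) (at t within {0..T})"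
proof -
 have 1: "((%t. \<Sum>j=1..m. \<gamma> j x * t powr (real j * \<alpha>)) has_real_derivative
   (\<Sum>j=1..m. \<gamma> j x * (real j * \<alpha> * t powr (real j * \<alpha> - 1)))) (at t within {0..T})"
  using t by (intro DERIV_sum DERIV_cmult has_field_derivative_at_within[OF has_real_derivative_powr]) auto
 have 2: "((%t. \<gamma> 0 x + (\<Sum>j=1..m. \<gamma> j x * t powr (real j * \<alpha>)) + \<gamma>t x * t + Y x t) has_real_derivative
  0 + (\<Sum>j=1..m. \<gamma> j x * (real j * \<alpha> * t powr (real j * \<alpha> - 1))) + \<gamma>t x * 1 + Y1 x t) (at t within {0..T})"
  using Y_deriv[of x t] x t
  by (intro DERIV_add DERIV_const DERIV_cmult DERIV_ident 1) (auto simp: T_def)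
 have "(u x has_real_derivative 0 + (\<Sum>j=1..m. \<gamma> j x * (real j * \<alpha> * t powr (real j * \<alpha> - 1))) + \<gamma>t x * 1 + Y1 x t) (at t within {0..T})"
  by (rule has_field_derivative_transform_within[OF 2, of 1]) (use x t decomposition in \<open>auto simp: T_def\<close>)
 then show ?thesis by (simp add: ut_def z_sing_def mult.assoc)
qed

text \<open>Every term of the time derivative, the bounded ones included, is dominated by the
  strongest singularity t^(\<alpha> - 1) at the cost of a power of T.\<close>

definition Cz :: real where
 "Cz = (\<Sum>j=1..m. C\<gamma> * T powr (real j * \<alpha> - \<alpha>)) + (C\<gamma> + CY1) * T powr (1 - \<alpha>)"

lemma powr_le_sing:
 assumes "0 < t" "t <= T" "c <= e" shows "t powr e <= T powr (e - c) * t powr c"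
proof -
 have "t powr e = t powr (e - c) * t powr c" by (simp flip: powr_add)
 also have "... <= T powr (e - c) * t powr c" using assms by (intro mult_right_mono powr_mono2) auto
 finally show ?thesis .
qed

lemma z_sing_bound:
 assumes x: "x \<in> {0..L}" and t: "0 < t" "t <= T"
 shows "\<bar>z_sing x t\<bar> <= Cz * t powr (\<alpha> - 1)" "\<bar>ut x t\<bar> <= Cz * t powr (\<alpha> - 1)"
proof -
 have "\<bar>\<gamma> j x * (real j * \<alpha>) * t powr (real j * \<alpha> - 1)\<bar> <= C\<gamma> * T powr (real j * \<alpha> - \<alpha>) * t powr (\<alpha> - 1)" if j: "j \<in> {1..m}" for j
 proof -
  have "\<bar>\<gamma> j x * (real j * \<alpha>)\<bar> <= C\<gamma> * 1"
   unfolding abs_mult[of "\<gamma> j x"] using C\<gamma>(1) C\<gamma>(2)[of j x] j\<alpha>[OF j] \<alpha> x j by (intro mult_mono) auto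
  moreover have "t powr (real j * \<alpha> - 1) <= T powr (real j * \<alpha> - \<alpha>) * t powr (\<alpha> - 1)"
   using powr_le_sing[OF t, of "\<alpha> - 1" "real j * \<alpha> - 1"] j\<alpha>[OF j] by simp
  ultimately show ?thesis
   unfolding abs_mult[of _ "_ powr _"] mult.assoc[of C\<gamma>] using C\<gamma>(1) by (intro mult_mono) auto
 qed
 then have "\<bar>\<Sum>j=1..m. \<gamma> j x * (real j * \<alpha>) * t powr (real j * \<alpha> - 1)\<bar> <= (\<Sum>j=1..m. C\<gamma> * T powr (real j * \<alpha> - \<alpha>)) * t powr (\<alpha> - 1)"
  unfolding sum_distrib_right by (intro order_trans[OF sum_abs] sum_mono) auto
 moreover have "1 <= T powr (1 - \<alpha>) * t powr (\<alpha> - 1)"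
  using powr_le_sing[OF t, of "\<alpha> - 1" 0] \<alpha> t by simp
 then have "C\<gamma> * 1 <= C\<gamma> * (T powr (1 - \<alpha>) * t powr (\<alpha> - 1))" "CY1 * 1 <= CY1 * (T powr (1 - \<alpha>) * t powr (\<alpha> - 1))"
  using C\<gamma>(1) CY1(1) by (intro mult_left_mono; simp)+
 moreover have "\<bar>\<gamma>t x\<bar> <= C\<gamma>" "\<bar>Y1 x t\<bar> <= CY1" using C\<gamma>(3) CY1(2) x t by auto
 ultimately show "\<bar>z_sing x t\<bar> <= Cz * t powr (\<alpha> - 1)" "\<bar>ut x t\<bar> <= Cz * t powr (\<alpha> - 1)"
  using CY1(1) unfolding z_sing_def ut_def Cz_def distrib_right mult.assoc by linarith+
qed

lemma Cz_nonneg: "0 <= Cz"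
 unfolding Cz_def using C\<gamma>(1) CY1(1) by (intro add_nonneg_nonneg sum_nonneg mult_nonneg_nonneg) auto

definition uc :: "real => real => real" where "uc x t = u (clamp_real 0 L x) (clamp_real (-\<tau>) T t)"
definition fc :: "real => real => real" where "fc x t = f (clamp_real 0 L x) (clamp_real 0 T t)"

lemma uc_borel: "(%p. uc (fst p) (snd p)) \<in> borel_measurable borel"
 unfolding uc_def using L T_pos \<tau> by (intro borel_clamped u_cont) auto

lemma fc_borel: "(%p. fc (fst p) (snd p)) \<in> borel_measurable borel"
 unfolding fc_def using L T_pos f_cont by (intro borel_clamped) (auto simp: T_def)

lemma uc_eq: "x \<in> {0..L} ==> t \<in> {-\<tau>..T} ==> uc x t = u x t"
 and fc_eq: "x \<in> {0..L} ==> t \<in> {0..T} ==> fc x t = f x t"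
 by (auto simp: uc_def fc_def clamp_real_id)

definition utc :: "real => real => real" where
 "utc x t = (if 0 <= x & x <= L & 0 < t & t <= T then ut x t else 0)"

text \<open>The coefficients \<gamma> j are only bounded, so measurability in x cannot be read off
  the decomposition; it comes from difference quotients of the continuous u.\<close>

lemma utc_borel: "(%p. utc (fst p) (snd p)) \<in> borel_measurable borel"
proof (rule borel_measurable_LIMSEQ_real)
 \<comment> \<open>The backward step t / (n + 2) keeps the second time inside (0, t), which also
   covers the one-sided derivative at T.\<close>
 define q where "q n pp = (if 0 <= fst pp & fst pp <= L & 0 < snd pp & snd pp <= T then
  (uc (fst pp) (snd pp) - uc (fst pp) (snd pp - snd pp / (real n + 2))) / (snd pp / (real n + 2)) else 0)" for n and pp :: "real \<times> real"
 show "q n \<in> borel_measurable borel" for n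
 proof -
  have [measurable]: "(%p. uc (fst p) (snd p)) \<in> borel_measurable (borel \<Otimes>\<^sub>M borel)" using uc_borel by (simp add: borel_prod)
  have [measurable]: "(%p. uc (fst p) (snd p - snd p / (real n + 2))) \<in> borel_measurable (borel \<Otimes>\<^sub>M borel)"
  proof -
   have "(%p. (fst p, snd p - snd p / (real n + 2))) \<in> (borel \<Otimes>\<^sub>M borel) \<rightarrow>\<^sub>M (borel \<Otimes>\<^sub>M (borel :: real measure))" by measurable
   from measurable_compose[OF this, of "%p. uc (fst p) (snd p)"] show ?thesis by simp
  qed
  have "q n \<in> borel_measurable (borel \<Otimes>\<^sub>M borel)" unfolding q_def by measurable
  then show ?thesis by (simp add: borel_prod)
 qed
 fix pp :: "real \<times> real"
 obtain x t where pp: "pp = (x, t)" by (cases pp)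
 show "(%n. q n pp) \<longlonglongrightarrow> utc (fst pp) (snd pp)"
 proof (cases "0 <= x & x <= L & 0 < t & t <= T")
  case True
  then have x: "x \<in> {0..L}" and t: "0 < t" "t <= T" by auto
  define s where "s n = t - t / (real n + 2)" for n
  have s: "s n \<in> {0..T} - {t}" for n
  proof -
   have "0 < t / (real n + 2)" "t / (real n + 2) <= t" using t by (auto simp: divide_le_eq)
   then have "0 <= s n" "s n <= T" "s n ~= t" unfolding s_def using t by linarith+
   then show ?thesis by simp
  qed
  have s_lim: "s \<longlonglongrightarrow> t" unfolding s_def by real_asymp
  have "((%y. (u x y - u x t) / (y - t)) \<longlongrightarrow> ut x t) (at t within {0..T})"
   using ut_deriv[OF x t] by (simp add: has_field_derivative_iff)
  moreover have "filterlim s (at t within {0..T}) sequentially"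
   using s s_lim by (auto simp: filterlim_at)
  ultimately have "(%n. (u x (s n) - u x t) / (s n - t)) \<longlonglongrightarrow> ut x t" by (rule filterlim_compose)
  moreover have "(u x (s n) - u x t) / (s n - t) = q n pp" for n
  proof -
   have "uc x (s n) = u x (s n)" "uc x t = u x t" using s[of n] x t \<tau> by (auto intro!: uc_eq)
   then have q: "q n pp = (u x t - u x (s n)) / (t / (real n + 2))"
    using True by (simp add: q_def pp s_def[symmetric] del: divide_divide_eq_right)
   have st: "s n - t = - (t / (real n + 2))" by (simp add: s_def)
   have "(A - C) / (- c) = (C - A) / c" for A C c :: real
    using minus_divide_divide[of "C - A" c] by simp
   then show ?thesis unfolding st q .
  qed
  ultimately show ?thesis using True by (simp add: utc_def pp)
 next
  case False
  then show ?thesis by (auto simp: q_def utc_def pp)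
 qed
qed

text \<open>The right-hand side of the equation without the Laplacian, set to zero outside
 \<open>[0, L] \<times> (0, T]\<close>.\<close>

definition D :: "real => real => real" where
 "D x t = (if 0 <= x & x <= L & 0 < t & t <= T then ut x t - b * u x (t - \<tau>) - f x t else 0)"

lemma D_borel: "(%p. D (fst p) (snd p)) \<in> borel_measurable borel"
proof -
 have [measurable]: "(%p. uc (fst p) (snd p - \<tau>)) \<in> borel_measurable (borel \<Otimes>\<^sub>M borel)"
 proof -
  have 1: "(%p. uc (fst p) (snd p)) \<in> borel_measurable (borel \<Otimes>\<^sub>M borel)" using uc_borel by (simp add: borel_prod)
  have "(%p. (fst p, snd p - \<tau>)) \<in> (borel \<Otimes>\<^sub>M borel) \<rightarrow>\<^sub>M (borel \<Otimes>\<^sub>M (borel :: real measure))" by measurable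
  from measurable_compose[OF this 1] show ?thesis by simp
 qed
 have [measurable]: "(%p. utc (fst p) (snd p)) \<in> borel_measurable (borel \<Otimes>\<^sub>M borel)"
  "(%p. fc (fst p) (snd p)) \<in> borel_measurable (borel \<Otimes>\<^sub>M borel)" using utc_borel fc_borel by (simp_all add: borel_prod)
 have "(%p. D (fst p) (snd p)) = (%p. if 0 <= fst p & fst p <= L & 0 < snd p & snd p <= T then
   utc (fst p) (snd p) - b * uc (fst p) (snd p - \<tau>) - fc (fst p) (snd p) else 0)"
  using \<tau> by (auto simp: fun_eq_iff D_def utc_def uc_eq fc_eq)
 also have "... \<in> borel_measurable (borel \<Otimes>\<^sub>M borel)" by measurable
 finally show ?thesis by (simp add: borel_prod)
qed

lemma borel_section: "(%p. g (fst p) (snd p)) \<in> borel_measurable borel ==> g (x::real) \<in> borel_measurable (borel :: real measure)"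
 "(%p. g (fst p) (snd p)) \<in> borel_measurable borel ==> (%x. g x t) \<in> borel_measurable (borel :: real measure)"
 for g :: "real => real => real"
 using measurable_compose[of "%s. (x, s)" borel "borel \<Otimes>\<^sub>M borel" "%p. g (fst p) (snd p)" borel]
  measurable_compose[of "%s. (s, t)" borel "borel \<Otimes>\<^sub>M borel" "%p. g (fst p) (snd p)" borel]
 by (auto simp: borel_prod)

definition CD :: real where "CD = Cz + (\<bar>b\<bar> + 1) * Cuf * T powr (1 - \<alpha>)"

lemma D_bound: "s \<in> {0..T} ==> \<bar>D x s\<bar> <= CD * s powr (\<alpha> - 1)"
proof -
 assume s: "s \<in> {0..T}"
 show ?thesis
 proof (cases "0 <= x & x <= L & 0 < s")
  case True
  then have x: "x \<in> {0..L}" and s': "0 < s" "s <= T" using s by auto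
  have "1 <= T powr (1 - \<alpha>) * s powr (\<alpha> - 1)" using powr_le_sing[OF s', of "\<alpha> - 1" 0] \<alpha> s' by simp
  then have c: "(\<bar>b\<bar> + 1) * Cuf * 1 <= (\<bar>b\<bar> + 1) * Cuf * (T powr (1 - \<alpha>) * s powr (\<alpha> - 1))"
   using Cuf(1) by (intro mult_left_mono) auto
  have "\<bar>u x (s - \<tau>)\<bar> <= Cuf" "\<bar>f x s\<bar> <= Cuf" using Cuf(2)[OF x, of "s - \<tau>"] Cuf(3)[OF x s] s' \<tau> by auto
  then have "\<bar>b * u x (s - \<tau>)\<bar> <= \<bar>b\<bar> * Cuf" "\<bar>f x s\<bar> <= Cuf" by (auto simp: abs_mult intro: mult_left_mono)
  then show ?thesis using z_sing_bound(2)[OF x s'] c True s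
   by (simp add: D_def CD_def distrib_right mult.assoc)
 next
  case False
  have "0 <= CD" unfolding CD_def using Cz_nonneg Cuf(1) by (intro add_nonneg_nonneg mult_nonneg_nonneg) auto
  then show ?thesis using False by (auto simp: D_def)
 qed
qed

definition E :: "real => real => real" where "E x t = frac_integral (1 - \<alpha>) (D x) t"

lemma E_borel: "(%p. E (fst p) (snd p)) \<in> borel_measurable borel"
 unfolding E_def by (rule borel_frac_integral[OF D_borel])

lemma utc_bound: "\<bar>utc x t\<bar> <= Cz * t powr (\<alpha> - 1)"
 using z_sing_bound(2)[of x t] Cz_nonneg by (auto simp: utc_def)

text \<open>u is continuous up to t = 0, so the interior form of the fundamental theorem applies
  although the derivative may blow up there.\<close>

lemma utc_has_integral:
 assumes x: "x \<in> {0..L}" and st: "0 <= s" "s <= t" "t <= T"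
 shows "(utc x has_integral (u x t - u x s)) {s..t}"
proof (rule fundamental_theorem_of_calculus_interior)
 show "continuous_on {s..t} (u x)"
  by (rule continuous_on_subset[OF u_cont_t[OF x]]) (use st \<tau> in auto)
 fix y assume y: "y \<in> {s<..<t}"
 then have "at y within {0..T} = at y" using st by (intro at_within_Icc_at) auto
 then show "(u x has_vector_derivative utc x y) (at y)"
  using ut_deriv[OF x, of y] y st x by (simp add: utc_def has_real_derivative_iff_has_vector_derivative)
qed (use st in simp)

lemma sing_has_integral:
 assumes "0 <= s" "s <= t"
 shows "((%r. Cz * r powr (\<alpha> - 1)) has_integral Cz * ((t powr \<alpha> - s powr \<alpha>) / \<alpha>)) {s..t}"
proof (rule has_integral_mult_right)
 have "((%r. r powr (\<alpha> - 1)) has_integral (t powr \<alpha> / \<alpha> - s powr \<alpha> / \<alpha>)) {s..t}"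
 proof (rule fundamental_theorem_of_calculus_interior)
  show "continuous_on {s..t} (%r. r powr \<alpha> / \<alpha>)"
   using assms \<alpha> by (intro continuous_on_divide continuous_on_powr' continuous_intros) auto
  fix y assume y: "y \<in> {s<..<t}"
  then have "((%r. r powr \<alpha> / \<alpha>) has_real_derivative \<alpha> * y powr (\<alpha> - 1) / \<alpha>) (at y)"
   using assms by (intro DERIV_cdivide has_real_derivative_powr) auto
  then show "((%r. r powr \<alpha> / \<alpha>) has_vector_derivative y powr (\<alpha> - 1)) (at y)"
   using \<alpha> by (simp add: has_real_derivative_iff_has_vector_derivative)
 qed (use assms in simp)
 then show "((%r. r powr (\<alpha> - 1)) has_integral (t powr \<alpha> - s powr \<alpha>) / \<alpha>) {s..t}"
  by (simp add: diff_divide_distrib)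
qed

lemma u_Holder:
 assumes x: "x \<in> {0..L}" and st: "0 <= s" "s <= t" "t <= T"
 shows "\<bar>u x t - u x s\<bar> <= Cz / \<alpha> * (t - s) powr \<alpha>"
proof -
 note i = utc_has_integral[OF assms] and j = sing_has_integral[OF st(1,2)]
 have "norm (integral {s..t} (utc x)) <= integral {s..t} (%r. Cz * r powr (\<alpha> - 1))"
  using utc_bound by (intro integral_norm_bound_integral has_integral_integrable[OF i] has_integral_integrable[OF j]) auto
 then have "\<bar>u x t - u x s\<bar> <= Cz * ((t powr \<alpha> - s powr \<alpha>) / \<alpha>)"
  using integral_unique[OF i] integral_unique[OF j] by simp
 also have "... <= Cz * ((t - s) powr \<alpha> / \<alpha>)"
  using Cz_nonneg \<alpha> st powr_diff_le[of s t \<alpha>] by (intro mult_left_mono divide_right_mono) auto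
 finally show ?thesis by simp
qed

text \<open>The bounded part of \<open>D\<close>, left after removal of the powers t^(j \<alpha> -
  1).\<close>

definition Z :: "real => real => real" where
 "Z x t = (if 0 <= x & x <= L & 0 < t & t <= T then \<gamma>t x + Y1 x t - b * u x (t - \<tau>) - f x t else 0)"

definition CZ :: real where "CZ = C\<gamma> + CY1 + \<bar>b\<bar> * Cuf + Cuf"

lemma Z_bound: "\<bar>Z x t\<bar> <= CZ"
proof (cases "0 <= x & x <= L & 0 < t & t <= T")
 case True
 then have x: "x \<in> {0..L}" and t: "t \<in> {0..T}" by auto
 have "\<bar>u x (t - \<tau>)\<bar> <= Cuf" using Cuf(2)[OF x, of "t - \<tau>"] True \<tau> by auto
 then have "\<bar>b * u x (t - \<tau>)\<bar> <= \<bar>b\<bar> * Cuf" by (auto simp: abs_mult intro: mult_left_mono)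
 then show ?thesis using C\<gamma>(3)[OF x] CY1(2)[OF x t] Cuf(3)[OF x t] True
  by (simp add: Z_def CZ_def)
next
 case False
 have "0 <= CZ" unfolding CZ_def using C\<gamma>(1) CY1(1) Cuf(1) by (intro add_nonneg_nonneg mult_nonneg_nonneg) auto
 then show ?thesis using False by (auto simp: Z_def)
qed

lemma D_split:
 assumes x: "x \<in> {0..L}" and t: "t \<in> {0..T}"
 shows "D x t = (\<Sum>j=1..m. \<gamma> j x * (real j * \<alpha>) * t powr (real j * \<alpha> - 1)) + Z x t"
 using x t by (auto simp: D_def Z_def ut_def z_sing_def)

lemma Z_borel: "x \<in> {0..L} ==> Z x \<in> borel_measurable borel"
proof -
 assume x: "x \<in> {0..L}"
 have [measurable]: "D x \<in> borel_measurable borel" by (rule borel_section(1)[OF D_borel])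
 have "Z x = (%t. if 0 <= t & t <= T then D x t - (\<Sum>j=1..m. \<gamma> j x * (real j * \<alpha>) * t powr (real j * \<alpha> - 1)) else 0)"
  using x D_split[OF x] by (auto simp: fun_eq_iff Z_def)
 also have "... \<in> borel_measurable borel" by measurable
 finally show ?thesis .
qed

text \<open>Fractional integration of order 1 - \<alpha> maps t^(j \<alpha> - 1) to a multiple of
  t^(j \<alpha> - \<alpha>) by a Beta integral; only the bounded part remains as an
  integral.\<close>

lemma E_expand:
 assumes x: "x \<in> {0..L}" and t: "0 < t" "t <= T"
 shows "E x t = (\<Sum>j=1..m. \<gamma> j x * (real j * \<alpha>) * (t powr (real j * \<alpha> - \<alpha>) * Beta (real j * \<alpha>) (1 - \<alpha>))) / Gamma (1 - \<alpha>)
  + frac_integral (1 - \<alpha>) (Z x) t"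
proof -
 have ZI: "(%s. (t - s) powr (- \<alpha>) * Z x s) absolutely_integrable_on {0..t}"
  using powr_kernel_integrable[of "1 - \<alpha>" t "Z x" CZ] Z_borel[OF x] Z_bound \<alpha> t by simp
 have DI: "(%s. (t - s) powr (- \<alpha>) * D x s) absolutely_integrable_on {0..t}"
  using powr_kernel_integrable_singular[of "1 - \<alpha>" \<alpha> t "D x" CD] borel_section(1)[OF D_borel] D_bound \<alpha> t by simp
 have "((%s. (\<Sum>j=1..m. \<gamma> j x * (real j * \<alpha>) * ((t - s) powr (- \<alpha>) * s powr (real j * \<alpha> - 1))) + (t - s) powr (- \<alpha>) * Z x s)
   has_integral (\<Sum>j=1..m. \<gamma> j x * (real j * \<alpha>) * (t powr (real j * \<alpha> - \<alpha>) * Beta (real j * \<alpha>) (1 - \<alpha>)))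
    + integral {0..t} (%s. (t - s) powr (- \<alpha>) * Z x s)) {0..t}"
 proof (intro has_integral_add has_integral_sum has_integral_mult_right)
  show "((%s. (t - s) powr (- \<alpha>) * s powr (real j * \<alpha> - 1)) has_integral t powr (real j * \<alpha> - \<alpha>) * Beta (real j * \<alpha>) (1 - \<alpha>)) {0..t}"
   if "j \<in> {1..m}" for j
   using Beta_integral_scaled[of "real j * \<alpha>" "1 - \<alpha>" 0 t] that \<alpha> t by simp
  show "((%s. (t - s) powr (- \<alpha>) * Z x s) has_integral integral {0..t} (%s. (t - s) powr (- \<alpha>) * Z x s)) {0..t}"
   using set_lebesgue_integral_eq_integral(1)[OF ZI] by (rule integrable_integral)
 qed simp
 then have "((%s. (t - s) powr (- \<alpha>) * D x s)
   has_integral (\<Sum>j=1..m. \<gamma> j x * (real j * \<alpha>) * (t powr (real j * \<alpha> - \<alpha>) * Beta (real j * \<alpha>) (1 - \<alpha>)))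
    + integral {0..t} (%s. (t - s) powr (- \<alpha>) * Z x s)) {0..t}"
 proof (rule has_integral_eq[rotated])
  fix s assume "s \<in> {0..t}"
  then show "(\<Sum>j=1..m. \<gamma> j x * (real j * \<alpha>) * ((t - s) powr (- \<alpha>) * s powr (real j * \<alpha> - 1))) + (t - s) powr (- \<alpha>) * Z x s = (t - s) powr (- \<alpha>) * D x s"
   using D_split[OF x, of s] t by (simp add: distrib_left sum_distrib_left mult_ac)
 qed
 then have "(LINT s:{0..t}|lebesgue. (t - s) powr (- \<alpha>) * D x s)
   = (\<Sum>j=1..m. \<gamma> j x * (real j * \<alpha>) * (t powr (real j * \<alpha> - \<alpha>) * Beta (real j * \<alpha>) (1 - \<alpha>)))
    + (LINT s:{0..t}|lebesgue. (t - s) powr (- \<alpha>) * Z x s)"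
  using set_lebesgue_integral_eq_integral(2)[OF DI] set_lebesgue_integral_eq_integral(2)[OF ZI] by (simp add: integral_unique)
 then show ?thesis by (simp add: E_def frac_integral_eq add_divide_distrib)
qed

definition CE :: real where
 "CE = (\<Sum>j=1..m. C\<gamma> * (T powr (real j * \<alpha> - \<alpha> - \<alpha>) * Beta (real j * \<alpha>) (1 - \<alpha>))) / Gamma (1 - \<alpha>) + 2 * CZ / ((1 - \<alpha>) * Gamma (1 - \<alpha>))"

lemma Beta_pos: "0 < a' ==> 0 < b' ==> 0 < Beta a' (b' :: real)"
 by (simp add: Beta_def Gamma_real_pos)

text \<open>For j = 1 the exponent j \<alpha> - \<alpha> is 0, so the most singular source
  contributes a constant; for j >= 2 it is at least \<alpha>, and the bounded part gives the
  exponent 1 - \<alpha>. The restriction s > 0 matters, since E x 0 = 0 in general differs from the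
  limit at 0.\<close>

lemma E_Holder:
 assumes x: "x \<in> {0..L}" and st: "0 < s" "s <= t" "t <= T"
 shows "\<bar>E x t - E x s\<bar> <= CE * ((t - s) powr \<alpha> + (t - s) powr (1 - \<alpha>))"
proof -
 define Q where "Q j r = \<gamma> j x * (real j * \<alpha>) * (r powr (real j * \<alpha> - \<alpha>) * Beta (real j * \<alpha>) (1 - \<alpha>))" for j r
 have pd: "\<bar>t powr (real j * \<alpha> - \<alpha>) - s powr (real j * \<alpha> - \<alpha>)\<bar> <= T powr (real j * \<alpha> - \<alpha> - \<alpha>) * (t - s) powr \<alpha>" if j: "j \<in> {1..m}" for j
 proof (cases "j = 1 \<or> s = t")
  case True
  then show ?thesis using st by auto
 next
  case False
  then have "2 <= j" using j by auto
  then have "2 * \<alpha> <= real j * \<alpha>" using \<alpha> by (intro mult_right_mono) auto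
  then have e: "\<alpha> <= real j * \<alpha> - \<alpha>" "real j * \<alpha> - \<alpha> <= 1" using j\<alpha>[OF j] \<alpha> by auto
  have "0 <= t powr (real j * \<alpha> - \<alpha>) - s powr (real j * \<alpha> - \<alpha>)" using st e \<alpha> by (simp add: powr_mono2)
  moreover have "t powr (real j * \<alpha> - \<alpha>) - s powr (real j * \<alpha> - \<alpha>) <= (t - s) powr (real j * \<alpha> - \<alpha>)"
   using st e \<alpha> by (intro powr_diff_le) auto
  moreover have "(t - s) powr (real j * \<alpha> - \<alpha>) <= T powr (real j * \<alpha> - \<alpha> - \<alpha>) * (t - s) powr \<alpha>"
   using False st e by (intro powr_le_sing) auto
  ultimately show ?thesis by simp
 qed
 have Qd: "\<bar>Q j t - Q j s\<bar> <= C\<gamma> * (T powr (real j * \<alpha> - \<alpha> - \<alpha>) * Beta (real j * \<alpha>) (1 - \<alpha>)) * (t - s) powr \<alpha>" if j: "j \<in> {1..m}" for j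
 proof -
  have B: "0 < Beta (real j * \<alpha>) (1 - \<alpha>)" using j \<alpha> by (intro Beta_pos) auto
  have "\<bar>\<gamma> j x * (real j * \<alpha>)\<bar> <= C\<gamma> * 1"
   unfolding abs_mult[of "\<gamma> j x"] using C\<gamma>(1) C\<gamma>(2)[of j x] j\<alpha>[OF j] \<alpha> x j by (intro mult_mono) auto
  moreover have "Q j t - Q j s = \<gamma> j x * (real j * \<alpha>) * ((t powr (real j * \<alpha> - \<alpha>) - s powr (real j * \<alpha> - \<alpha>)) * Beta (real j * \<alpha>) (1 - \<alpha>))"
   by (simp add: Q_def algebra_simps)
  moreover have "\<bar>(t powr (real j * \<alpha> - \<alpha>) - s powr (real j * \<alpha> - \<alpha>)) * Beta (real j * \<alpha>) (1 - \<alpha>)\<bar> <= T powr (real j * \<alpha> - \<alpha> - \<alpha>) * (t - s) powr \<alpha> * Beta (real j * \<alpha>) (1 - \<alpha>)"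
   using pd[OF j] B by (simp add: abs_mult mult_right_mono)
  ultimately have "\<bar>Q j t - Q j s\<bar> <= C\<gamma> * 1 * (T powr (real j * \<alpha> - \<alpha> - \<alpha>) * (t - s) powr \<alpha> * Beta (real j * \<alpha>) (1 - \<alpha>))"
   using C\<gamma>(1) by (simp only: abs_mult[of "\<gamma> j x * (real j * \<alpha>)"]) (intro mult_mono, auto)
  then show ?thesis by (simp add: mult_ac)
 qed
 have fr: "\<bar>frac_integral (1 - \<alpha>) (Z x) t - frac_integral (1 - \<alpha>) (Z x) s\<bar> <= 2 * CZ / ((1 - \<alpha>) * Gamma (1 - \<alpha>)) * (t - s) powr (1 - \<alpha>)"
  using frac_integral_Holder[OF \<alpha> Z_borel[OF x], of s t CZ] st Z_bound by simp
 have "E x t - E x s = (\<Sum>j=1..m. Q j t - Q j s) / Gamma (1 - \<alpha>) + (frac_integral (1 - \<alpha>) (Z x) t - frac_integral (1 - \<alpha>) (Z x) s)"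
  using E_expand[OF x, of t] E_expand[OF x, of s] st by (simp add: Q_def sum_subtractf diff_divide_distrib)
 then have "\<bar>E x t - E x s\<bar> <= \<bar>\<Sum>j=1..m. Q j t - Q j s\<bar> / Gamma (1 - \<alpha>) + \<bar>frac_integral (1 - \<alpha>) (Z x) t - frac_integral (1 - \<alpha>) (Z x) s\<bar>"
  using G_pos abs_triangle_ineq[of "(\<Sum>j=1..m. Q j t - Q j s) / Gamma (1 - \<alpha>)"] by (simp add: abs_divide)
 also have "\<bar>\<Sum>j=1..m. Q j t - Q j s\<bar> <= (\<Sum>j=1..m. C\<gamma> * (T powr (real j * \<alpha> - \<alpha> - \<alpha>) * Beta (real j * \<alpha>) (1 - \<alpha>))) * (t - s) powr \<alpha>"
  unfolding sum_distrib_right by (intro order_trans[OF sum_abs] sum_mono Qd)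
 finally have "\<bar>E x t - E x s\<bar> <= (\<Sum>j=1..m. C\<gamma> * (T powr (real j * \<alpha> - \<alpha> - \<alpha>) * Beta (real j * \<alpha>) (1 - \<alpha>))) / Gamma (1 - \<alpha>) * (t - s) powr \<alpha>
   + 2 * CZ / ((1 - \<alpha>) * Gamma (1 - \<alpha>)) * (t - s) powr (1 - \<alpha>)"
  using fr G_pos by (simp add: divide_right_mono)
 also have "... <= CE * (t - s) powr \<alpha> + CE * (t - s) powr (1 - \<alpha>)"
 proof -
  have "0 <= (\<Sum>j=1..m. C\<gamma> * (T powr (real j * \<alpha> - \<alpha> - \<alpha>) * Beta (real j * \<alpha>) (1 - \<alpha>))) / Gamma (1 - \<alpha>)"
   using C\<gamma>(1) G_pos \<alpha> Beta_pos by (intro divide_nonneg_pos sum_nonneg mult_nonneg_nonneg) (auto intro: less_imp_le)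
  moreover have "0 <= CZ" using Z_bound[of 0 0] by (auto intro: order_trans[OF abs_ge_zero])
  then have "0 <= 2 * CZ / ((1 - \<alpha>) * Gamma (1 - \<alpha>))" using \<alpha> G_pos by simp
  ultimately show ?thesis unfolding CE_def by (intro add_mono mult_right_mono) auto
 qed
 finally show ?thesis by (simp add: distrib_left)
qed

definition CE0 :: real where "CE0 = CD * Beta \<alpha> (1 - \<alpha>) / Gamma (1 - \<alpha>)"

lemma E_bound:
 assumes t: "0 < t" "t <= T" shows "\<bar>E x t\<bar> <= CE0"
proof -
 have i: "set_integrable lebesgue {0..t} (%s. CD * ((t - s) powr (- \<alpha>) * s powr (\<alpha> - 1)))"
  "(LINT s:{0..t}|lebesgue. CD * ((t - s) powr (- \<alpha>) * s powr (\<alpha> - 1))) = CD * Beta \<alpha> (1 - \<alpha>)"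
  using Beta_lebesgue[of \<alpha> "1 - \<alpha>" 0 t] \<alpha> t by (auto intro!: set_integrable_mult_right)
 have m: "set_borel_measurable lebesgue {0..t} (%s. (t - s) powr (- \<alpha>) * D x s)"
  using borel_section(1)[OF D_borel, of x] by (intro borel_set_borel_measurable) auto
 have "\<bar>LINT s:{0..t}|lebesgue. (t - s) powr (- \<alpha>) * D x s\<bar> <= CD * Beta \<alpha> (1 - \<alpha>)"
  unfolding i(2)[symmetric]
 proof (rule set_integral_abs_le(2)[OF i(1) m])
  fix s assume "s \<in> {0..t}"
  then show "\<bar>(t - s) powr (- \<alpha>) * D x s\<bar> <= CD * ((t - s) powr (- \<alpha>) * s powr (\<alpha> - 1))"
   using mult_left_mono[OF D_bound, of s "(t - s) powr (- \<alpha>)" x] t by (simp add: abs_mult mult_ac)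
 qed
 then show ?thesis using G_pos by (simp add: E_def CE0_def frac_integral_eq abs_divide divide_right_mono)
qed

end

section \<open>The weak equation p u_xx + a u = E at every positive time\<close>

context delay_problem begin

lemma AE_interval_exists:
 assumes "AE s in lborel. Q s" "l < (r::real)" shows "\<exists>s\<in>{l<..<r}. Q s"
proof (rule ccontr)
 assume "\<not> ?thesis"
 then have "AE s in lborel. s \<notin> {l<..<r}" using assms(1) by (auto elim: eventually_mono)
 then have "emeasure lborel {l<..<r} = 0" by (subst (asm) AE_iff_null_sets[symmetric]) auto
 then show False using assms(2) by simp
qed

lemma borel_param_integral:
 fixes g :: "real => real => real"
 assumes g: "(%p. g (fst p) (snd p)) \<in> borel_measurable borel"
 shows "(%x. LINT s:{c..d}|lebesgue. g x s) \<in> borel_measurable borel"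
proof -
 have g': "(%p. g (fst p) (snd p)) \<in> borel_measurable (borel \<Otimes>\<^sub>M borel)" using g by (simp add: borel_prod)
 have sec: "g x \<in> borel_measurable borel" for x
  using measurable_compose[OF _ g', of "%s. (x, s)" borel] by simp
 have eq: "(LINT s:{c..d}|lebesgue. g x s) = (\<integral>s. indicator {c..d} s * g x s \<partial>lborel)" for x
  using set_lebesgue_lborel(2)[OF sec, of "{c..d}" x] by (simp add: set_lebesgue_integral_def)
 have [measurable]: "(%p. g (fst p) (snd p)) \<in> borel_measurable (borel \<Otimes>\<^sub>M lborel)"
  using g' by (simp cong: measurable_cong_sets)
 have "(%p. indicator {c..d} (snd p) * g (fst p) (snd p)) \<in> borel_measurable (borel \<Otimes>\<^sub>M lborel)"
  by measurable
 then show ?thesis unfolding eq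
  by (intro lborel.borel_measurable_lebesgue_integral) (simp add: case_prod_beta')
qed

lemma in_L2_E: "0 < t ==> t <= T ==> in_L2 L (%x. E x t)"
 using borel_section(2)[OF E_borel] E_bound L
 by (intro in_L2_bounded(1)[of L "%x. E x t" CE0] borel_set_borel_measurable) auto

lemma in_L2_u: "t \<in> {-\<tau>..T} ==> in_L2 L (%x. u x t)"
 by (intro in_L2_continuous u_cont_x)

text \<open>Abel inversion gives v = c(x) s^(-\<alpha>) + E for almost every x and s, where v = p
  u_xx + a u. Testing with the hat replaces u_xx by a slope jump of u, so the tested defect
  \<Lambda> is bounded and Hoelder continuous in s: boundedness near 0 removes the singular term,
  continuity removes the exceptional times.\<close>

theorem weak_equation:
 assumes ab: "0 <= x1" "x1 < x2" "x2 < x3" "x3 <= L" and t: "0 < t" "t <= T"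
 shows "p * hat_jump (%x. u x t) x1 x2 x3 + a * inner_L2 L (%x. u x t) (hat x1 x2 x3) = inner_L2 L (%x. E x t) (hat x1 x2 x3)"
proof -
 interpret L2: semi_inner "{v. in_L2 L v}" "inner_L2 L" by (rule semi_inner_L2)
 obtain lap where lap: "set_borel_measurable borel ({0..L} \<times> {0..T}) (%(x, t). lap x t)"
  "!!t. 0 < t ==> t <= T ==> \<exists>g. H2_derivs L (%x. u x t) g (%x. lap x t)"
  "AE x in lebesgue. x \<in> {0<..<L} -->
       (\<forall>t\<in>{0<..T}. \<exists>ut D.
         (u x has_real_derivative ut) (at t within {0..T})
         & has_RL_derivative T \<alpha> (%s. p * lap x s + a * u x s) D t
         & ut = D + b * u x (t - \<tau>) + f x t)"
  using solution unfolding delay_solution_def T_def by fastforce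
 define lapc where "lapc x s = indicator ({0..L} \<times> {0..T}) (x, s) * lap x s" for x s
 have lapc_borel: "(%p. lapc (fst p) (snd p)) \<in> borel_measurable borel"
  using lap(1) unfolding lapc_def set_borel_measurable_def by (simp add: case_prod_beta')
 have lapc_eq: "lapc x s = lap x s" if "x \<in> {0..L}" "s \<in> {0..T}" for x s using that by (simp add: lapc_def)
 define v where "v x s = p * lapc x s + a * uc x s" for x s
 have v_borel: "(%p. v (fst p) (snd p)) \<in> borel_measurable borel"
  unfolding v_def using lapc_borel uc_borel by measurable
 define c where "c x = ((LINT s:{0..T}|lebesgue. v x s) - (LINT s:{0..T}|lebesgue. E x s)) * (1 - \<alpha>) / T powr (1 - \<alpha>)" for x
 have c_borel: "c \<in> borel_measurable borel"
  unfolding c_def using borel_param_integral[OF v_borel] borel_param_integral[OF E_borel] by measurable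
 define Q where "Q x s \<longleftrightarrow> (0 < x & x < L & 0 <= s & s <= T --> v x s = c x * s powr (- \<alpha>) + E x s)" for x s
 have "AE x in lborel. x \<in> {0<..<L} -->
       (\<forall>t\<in>{0<..T}. \<exists>ut D.
         (u x has_real_derivative ut) (at t within {0..T})
         & has_RL_derivative T \<alpha> (%s. p * lap x s + a * u x s) D t
         & ut = D + b * u x (t - \<tau>) + f x t)"
  using lap(3) by (simp only: AE_completion_iff)
 then have AEx: "AE x in lborel. AE s in lborel. Q x s"
 proof eventually_elim
  case (elim x)
  show ?case
  proof (cases "0 < x & x < L")
   case True
   then have x: "x \<in> {0..L}" by auto
   \<comment> \<open>Derivatives within [0, T] are unique, so the one supplied by the equation is
     \<open>ut\<close>, and the Riemann-Liouville derivative is the explicit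
     \<open>D\<close>.\<close>
   have RL: "has_RL_derivative T \<alpha> (v x) (D x t) t" if t: "0 < t" "t <= T" for t
   proof -
    have "t \<in> {0<..T}" "x \<in> {0<..<L}" using t True by auto
    then obtain ut' D' where d: "(u x has_real_derivative ut') (at t within {0..T})"
     "has_RL_derivative T \<alpha> (%s. p * lap x s + a * u x s) D' t" "ut' = D' + b * u x (t - \<tau>) + f x t"
     using elim by blast
    have "at t within {0..T} ~= bot" using t T_pos by (simp add: trivial_limit_within islimpt_Icc)
    then have "ut' = ut x t"
     using vector_derivative_unique_within[of t "{0..T}" "u x" ut' "ut x t"] d(1) ut_deriv[OF x t]
     by (simp add: has_real_derivative_iff_has_vector_derivative)
    then have "D' = D x t" using d(3) x t by (simp add: D_def)
    then show ?thesis
     using has_RL_derivative_cong[OF _ t d(2), of "v x"] x \<tau> by (auto simp: v_def lapc_eq uc_eq)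
   qed
   have "AE s in lborel. s \<in> {0..T} --> v x s = c x * s powr (- \<alpha>) + E x s"
    unfolding c_def E_def
   proof (rule Abel_inversion[OF \<alpha> T_pos])
    show "v x \<in> borel_measurable borel" by (rule borel_section(1)[OF v_borel])
    show "D x \<in> borel_measurable borel" by (rule borel_section(1)[OF D_borel])
    show "\<bar>D x s\<bar> <= CD * s powr (\<alpha> - 1)" if "s \<in> {0..T}" for s using D_bound[OF that] .
    show "set_integrable lebesgue {0..r} (%s. (r - s) powr (\<alpha> - 1) * v x s)" if "r \<in> {0<..T}" for r
     using RL[of r] that by (auto simp: has_RL_derivative_def)
    show "(frac_integral \<alpha> (v x) has_real_derivative D x t) (at t within {0..T})" if "t \<in> {0<..T}" for t
     using RL[of t] that by (auto simp: has_RL_derivative_def)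
   qed
   then show ?thesis by eventually_elim (simp add: Q_def)
  next
   case False
   then have "Q x s" for s by (auto simp: Q_def)
   then show ?thesis by simp
  qed
 qed
 \<comment> \<open>The exceptional set of times depends on x. Joint measurability of Q, including
   that of c, permits exchanging the two almost-everywhere quantifiers, so that at a good time
   almost all x can be integrated.\<close>
 have "AE s in lborel. AE x in lborel. Q x s"
 proof (rule lborel_pair.AE_commute[THEN iffD1, OF _ AEx])
  have [measurable]: "(%p. v (fst p) (snd p)) \<in> borel_measurable (borel \<Otimes>\<^sub>M borel)"
   "(%p. E (fst p) (snd p)) \<in> borel_measurable (borel \<Otimes>\<^sub>M borel)" "c \<in> borel_measurable borel"
   using v_borel E_borel c_borel by (simp_all add: borel_prod)
  have "{pp \<in> space (borel \<Otimes>\<^sub>M borel). Q (fst pp) (snd pp)} \<in> sets (borel \<Otimes>\<^sub>M borel)"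
   unfolding Q_def by measurable
  then show "{pp \<in> space (lborel \<Otimes>\<^sub>M lborel). Q (fst pp) (snd pp)} \<in> sets (lborel \<Otimes>\<^sub>M lborel)"
   by (simp add: space_pair_measure cong: sets_pair_measure_cong)
 qed
 then have AEs: "AE s in lborel. AE x in lborel. Q x s" .
 define ht where "ht = hat x1 x2 x3"
 have ht: "in_L2 L ht" unfolding ht_def by (rule in_L2_hat)
 define \<Lambda> where "\<Lambda> s = p * hat_jump (%x. u x s) x1 x2 x3 + a * inner_L2 L (%x. u x s) ht - inner_L2 L (%x. E x s) ht" for s
 have v_L2: "in_L2 L (%x. v x s)" "inner_L2 L (%x. v x s) ht = p * hat_jump (%x. u x s) x1 x2 x3 + a * inner_L2 L (%x. u x s) ht"
  if s: "0 < s" "s <= T" for s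
 proof -
  obtain g where g: "H2_derivs L (%x. u x s) g (%x. lap x s)" using lap(2)[OF s] by auto
  then have l2: "in_L2 L (%x. lap x s)" by (simp add: H2_derivs_def)
  have us: "in_L2 L (%x. u x s)" using in_L2_u s \<tau> by simp
  have w: "in_L2 L (p *\<^sub>R (%x. lap x s) + a *\<^sub>R (%x. u x s))"
   using l2 us by (intro in_L2_add in_L2_scale)
  have eq: "v x s = (p *\<^sub>R (%x. lap x s) + a *\<^sub>R (%x. u x s)) x" if "x \<in> {0..L}" for x
   using that s \<tau> by (simp add: v_def lapc_eq uc_eq)
  show "in_L2 L (%x. v x s)"
  proof -
   have "(%x. indicator {0..L} x *\<^sub>R v x s) = (%x. indicator {0..L} x *\<^sub>R (p *\<^sub>R (%x. lap x s) + a *\<^sub>R (%x. u x s)) x)"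
    "(%x. indicator {0..L} x *\<^sub>R (v x s)\<^sup>2) = (%x. indicator {0..L} x *\<^sub>R ((p *\<^sub>R (%x. lap x s) + a *\<^sub>R (%x. u x s)) x)\<^sup>2)"
    using eq by (auto simp: fun_eq_iff indicator_def)
   then show ?thesis using w unfolding in_L2_def set_borel_measurable_def set_integrable_def by simp
  qed
  have "inner_L2 L (%x. v x s) ht = inner_L2 L (p *\<^sub>R (%x. lap x s) + a *\<^sub>R (%x. u x s)) ht"
   using eq by (intro inner_L2_cong) auto
  also have "... = p * inner_L2 L (%x. lap x s) ht + a * inner_L2 L (%x. u x s) ht"
   using l2 us ht by (simp add: L2.ip_add L2.ip_scale in_L2_scale)
  also have "inner_L2 L (%x. lap x s) ht = hat_jump (%x. u x s) x1 x2 x3"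
   unfolding ht_def using hat_jump_weak[OF _ g ab] u_cont_x[of s] s \<tau> by simp
  finally show "inner_L2 L (%x. v x s) ht = p * hat_jump (%x. u x s) x1 x2 x3 + a * inner_L2 L (%x. u x s) ht" .
 qed
 have ae_L: "AE x in lebesgue. x ~= 0 & x ~= L"
  using AE_lborel_singleton[of 0] AE_lborel_singleton[of L] by (simp add: AE_completion_iff)
 \<comment> \<open>Integrability of c is not known in advance; at a single good time s, c =
   s^\<alpha> (v - E), and both functions on the right are in L2.\<close>
 have c_int: "set_integrable lebesgue {0..L} (%x. c x * ht x)"
 proof -
  obtain s where s: "s \<in> {0<..<T}" "AE x in lborel. Q x s" using AE_interval_exists[OF AEs T_pos] by auto
  have "set_integrable lebesgue {0..L} (%x. s powr \<alpha> * (v x s * ht x - E x s * ht x))"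
   using v_L2(1)[of s] in_L2_E[of s] s(1) ht by (intro set_integrable_mult_right set_integral_diff(1) in_L2_product_integrable) auto
  moreover have "(%x. indicator {0..L} x *\<^sub>R (c x * ht x)) \<in> borel_measurable lebesgue"
  proof -
   have "ht \<in> borel_measurable borel" unfolding ht_def by (intro borel_measurable_continuous_onI continuous_on_hat)
   then show ?thesis using c_borel by (intro measurable_completion) auto
  qed
  moreover have "AE x in lebesgue. indicator {0..L} x *\<^sub>R (c x * ht x) = indicator {0..L} x *\<^sub>R (s powr \<alpha> * (v x s * ht x - E x s * ht x))"
   using ae_L AE_completion[OF s(2)]
  proof eventually_elim
   case (elim x)
   have "c x = s powr \<alpha> * (v x s - E x s)" if "0 < x" "x < L"
    using elim(2) that s(1) by (simp add: Q_def powr_minus)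
   then have "c x * ht x = s powr \<alpha> * (v x s * ht x - E x s * ht x)" if "0 < x" "x < L"
    using that by (simp only:) (simp add: algebra_simps)
   then show ?case using elim(1) by (auto simp: indicator_def)
  qed
  ultimately show ?thesis unfolding set_integrable_def
   by (subst integrable_cong_AE) (auto simp: set_integrable_def dest: borel_measurable_integrable)
 qed
 define \<kappa> where "\<kappa> = inner_L2 L c ht"
 have good: "AE s in lborel. 0 < s & s <= T --> \<Lambda> s = s powr (- \<alpha>) * \<kappa>"
  using AEs
 proof eventually_elim
  case (elim s)
  show ?case
  proof
   assume s: "0 < s & s <= T"
   have i: "set_integrable lebesgue {0..L} (%x. v x s * ht x)" "set_integrable lebesgue {0..L} (%x. E x s * ht x)"
    using v_L2(1)[of s] in_L2_E[of s] s ht by (auto intro: in_L2_product_integrable)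
   have "(LINT x:{0..L}|lebesgue. v x s * ht x) = (LINT x:{0..L}|lebesgue. s powr (- \<alpha>) * (c x * ht x) + E x s * ht x)"
    unfolding set_lebesgue_integral_def
   proof (rule integral_cong_AE)
    show "(%x. indicator {0..L} x *\<^sub>R (v x s * ht x)) \<in> borel_measurable lebesgue"
     using i(1) by (auto simp: set_integrable_def)
    have "set_integrable lebesgue {0..L} (%x. s powr (- \<alpha>) * (c x * ht x) + E x s * ht x)"
     by (intro set_integral_add set_integrable_mult_right c_int i)
    then show "(%x. indicator {0..L} x *\<^sub>R (s powr (- \<alpha>) * (c x * ht x) + E x s * ht x)) \<in> borel_measurable lebesgue"
     by (auto simp: set_integrable_def)
    show "AE x in lebesgue. indicator {0..L} x *\<^sub>R (v x s * ht x) = indicator {0..L} x *\<^sub>R (s powr (- \<alpha>) * (c x * ht x) + E x s * ht x)"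
     using ae_L AE_completion[OF elim]
    proof eventually_elim
     case (elim x)
     have "v x s * ht x = s powr (- \<alpha>) * (c x * ht x) + E x s * ht x" if "0 < x" "x < L"
      using elim(2) that s by (simp only: Q_def) (simp add: algebra_simps)
     then show ?case using elim(1) by (auto simp: indicator_def)
    qed
   qed
   also have "... = s powr (- \<alpha>) * \<kappa> + inner_L2 L (%x. E x s) ht"
    unfolding \<kappa>_def inner_L2_def using c_int i(2) by (subst set_integral_add(2)) (auto intro!: set_integrable_mult_right)
   finally show "\<Lambda> s = s powr (- \<alpha>) * \<kappa>"
    using v_L2(2)[of s] s by (simp add: \<Lambda>_def inner_L2_def)
  qed
 qed
 define nht where "nht = norm_L2 L ht"
 have ip: "\<bar>inner_L2 L w ht\<bar> <= k * sqrt L * nht" if "in_L2 L w" "!!x. x \<in> {0..L} ==> \<bar>w x\<bar> <= k" for w k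
 proof -
  have "\<bar>inner_L2 L w ht\<bar> <= norm_L2 L w * nht"
   using L2.Cauchy_Schwarz[of w ht] that(1) ht by (simp add: nrm_L2 nht_def)
  also have "... <= k * sqrt L * nht"
   using in_L2_bounded(2)[of L w k] that L by (intro mult_right_mono) (auto simp: nht_def in_L2_def)
  finally show ?thesis .
 qed
 have hj: "\<bar>hat_jump w x1 x2 x3\<bar> <= k * (2 / (x3 - x2) + 2 / (x2 - x1))" if "!!x. x \<in> {0..L} ==> \<bar>w x\<bar> <= k" for w k
 proof -
  have "\<bar>(w x3 - w x2) / (x3 - x2)\<bar> <= 2 * k / (x3 - x2)" "\<bar>(w x2 - w x1) / (x2 - x1)\<bar> <= 2 * k / (x2 - x1)"
   using that[of x1] that[of x2] that[of x3] ab by (auto simp: abs_divide intro!: divide_right_mono)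
  then have "\<bar>hat_jump w x1 x2 x3\<bar> <= 2 * k / (x3 - x2) + 2 * k / (x2 - x1)" unfolding hat_jump_def by linarith
  also have "... = k * (2 / (x3 - x2) + 2 / (x2 - x1))" by (simp add: distrib_left mult.commute)
  finally show ?thesis .
 qed
 define J where "J = 2 / (x3 - x2) + 2 / (x2 - x1)"
 define B where "B = p * (Cuf * J) + \<bar>a\<bar> * (Cuf * sqrt L * nht) + CE0 * sqrt L * nht"
 have \<Lambda>_bound: "\<bar>\<Lambda> s\<bar> <= B" if s: "0 < s" "s <= T" for s
 proof -
  have "\<bar>inner_L2 L (%x. u x s) ht\<bar> <= Cuf * sqrt L * nht" using s \<tau> Cuf(2) by (intro ip in_L2_u) auto
  then have 1: "\<bar>a * inner_L2 L (%x. u x s) ht\<bar> <= \<bar>a\<bar> * (Cuf * sqrt L * nht)" unfolding abs_mult by (intro mult_left_mono) auto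
  have "\<bar>hat_jump (%x. u x s) x1 x2 x3\<bar> <= Cuf * J" unfolding J_def using s \<tau> Cuf(2) by (intro hj) auto
  then have 2: "\<bar>p * hat_jump (%x. u x s) x1 x2 x3\<bar> <= p * (Cuf * J)" using p by (simp add: abs_mult mult_left_mono)
  have 3: "\<bar>inner_L2 L (%x. E x s) ht\<bar> <= CE0 * sqrt L * nht" using s E_bound by (intro ip in_L2_E) auto
  show ?thesis unfolding \<Lambda>_def B_def using 1 2 3 by linarith
 qed
 \<comment> \<open>At almost every small s one has \<kappa> = s^\<alpha> \<Lambda> s with \<Lambda>
   bounded by B, and the right-hand side tends to 0.\<close>
 have \<kappa>0: "\<kappa> = 0"
 proof -
  have "\<bar>\<kappa>\<bar> <= B * d powr \<alpha>" if d: "0 < d" "d <= T" for d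
  proof -
   obtain s where s: "0 < s" "s < d" "\<Lambda> s = s powr (- \<alpha>) * \<kappa>" using AE_interval_exists[OF good d(1)] d by auto
   have "\<kappa> = s powr \<alpha> * \<Lambda> s" using s(1) by (simp add: s(3) powr_minus)
   then have "\<bar>\<kappa>\<bar> = s powr \<alpha> * \<bar>\<Lambda> s\<bar>" by (simp add: abs_mult)
   also have "... <= d powr \<alpha> * B" using \<Lambda>_bound[of s] s d \<alpha> by (intro mult_mono powr_mono2) auto
   finally show ?thesis by (simp add: mult.commute)
  qed
  moreover have "((%d. B * d powr \<alpha>) \<longlongrightarrow> 0) (at_right 0)" using \<alpha> by real_asymp
  moreover have "\<forall>\<^sub>F d in at_right 0. 0 < d & d <= T"
   using T_pos by (auto simp: eventually_at_right[OF T_pos] intro!: exI[of _ T])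
  ultimately have "\<bar>\<kappa>\<bar> <= 0"
   by (intro tendsto_lowerbound[of _ 0 "at_right 0" "\<bar>\<kappa>\<bar>"]) (auto elim: eventually_mono)
  then show ?thesis by simp
 qed
 define K where "K = p * (Cz / \<alpha> * J) + \<bar>a\<bar> * (Cz / \<alpha> * sqrt L * nht) + CE * sqrt L * nht"
 have \<Lambda>_Holder: "\<bar>\<Lambda> t - \<Lambda> s\<bar> <= K * ((t - s) powr \<alpha> + (t - s) powr (1 - \<alpha>))" if s: "0 < s" "s <= t" for s
 proof -
  define \<omega> where "\<omega> = (t - s) powr \<alpha> + (t - s) powr (1 - \<alpha>)"
  have us: "\<bar>u x t - u x s\<bar> <= Cz / \<alpha> * \<omega>" if "x \<in> {0..L}" for x
  proof -
   have "\<bar>u x t - u x s\<bar> <= Cz / \<alpha> * (t - s) powr \<alpha>" using u_Holder[OF that, of s t] s t by simp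
   also have "... <= Cz / \<alpha> * \<omega>" using Cz_nonneg \<alpha> by (intro mult_left_mono) (auto simp: \<omega>_def)
   finally show ?thesis .
  qed
  have L2u: "in_L2 L (%x. u x t)" "in_L2 L (%x. u x s)" "in_L2 L (%x. E x t)" "in_L2 L (%x. E x s)"
   using in_L2_u in_L2_E s t \<tau> by auto
  then have L2d: "in_L2 L (%x. u x t - u x s)" "in_L2 L (%x. E x t - E x s)"
   using L2.W_intros(2)[of "%x. u x t" "%x. u x s"] L2.W_intros(2)[of "%x. E x t" "%x. E x s"] by (auto simp: fun_diff_def)
  have d: "inner_L2 L (%x. u x t) ht - inner_L2 L (%x. u x s) ht = inner_L2 L (%x. u x t - u x s) ht"
   "inner_L2 L (%x. E x t) ht - inner_L2 L (%x. E x s) ht = inner_L2 L (%x. E x t - E x s) ht"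
   using L2.ip_diff[of "%x. u x t" "%x. u x s" ht] L2.ip_diff[of "%x. E x t" "%x. E x s" ht] L2u ht by (auto simp: fun_diff_def)
  have eq: "\<Lambda> t - \<Lambda> s = p * hat_jump (%x. u x t - u x s) x1 x2 x3 + a * inner_L2 L (%x. u x t - u x s) ht - inner_L2 L (%x. E x t - E x s) ht"
   unfolding \<Lambda>_def hat_jump_diff d[symmetric] by (simp add: algebra_simps)
  have "\<bar>inner_L2 L (%x. u x t - u x s) ht\<bar> <= Cz / \<alpha> * \<omega> * sqrt L * nht" using us by (intro ip L2d) auto
  then have 1: "\<bar>a * inner_L2 L (%x. u x t - u x s) ht\<bar> <= \<bar>a\<bar> * (Cz / \<alpha> * \<omega> * sqrt L * nht)" unfolding abs_mult by (intro mult_left_mono) auto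
  have "\<bar>hat_jump (%x. u x t - u x s) x1 x2 x3\<bar> <= Cz / \<alpha> * \<omega> * J" unfolding J_def using us by (intro hj) auto
  then have 2: "\<bar>p * hat_jump (%x. u x t - u x s) x1 x2 x3\<bar> <= p * (Cz / \<alpha> * \<omega> * J)"
   unfolding abs_mult abs_of_nonneg[OF p] using p by (intro mult_left_mono)
  have 3: "\<bar>inner_L2 L (%x. E x t - E x s) ht\<bar> <= CE * \<omega> * sqrt L * nht"
   unfolding \<omega>_def using E_Holder s t by (intro ip L2d) auto
  have "\<bar>\<Lambda> t - \<Lambda> s\<bar> <= p * (Cz / \<alpha> * \<omega> * J) + \<bar>a\<bar> * (Cz / \<alpha> * \<omega> * sqrt L * nht) + CE * \<omega> * sqrt L * nht"
   unfolding eq using 1 2 3 by linarith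
  also have "... = K * \<omega>" by (simp add: K_def algebra_simps)
  finally show ?thesis by (simp add: \<omega>_def)
 qed
 \<comment> \<open>Times with \<Lambda> s = 0 exist arbitrarily close below t, so Hoelder continuity
   carries the equation to t itself.\<close>
 have "\<bar>\<Lambda> t\<bar> <= \<bar>K\<bar> * (d powr \<alpha> + d powr (1 - \<alpha>))" if d: "0 < d" "d < t" for d
 proof -
  obtain s where s: "t - d < s" "s < t" "\<Lambda> s = 0" using AE_interval_exists[OF good, of "t - d" t] d t by (auto simp: \<kappa>0)
  have "\<bar>\<Lambda> t\<bar> <= K * ((t - s) powr \<alpha> + (t - s) powr (1 - \<alpha>))" using \<Lambda>_Holder[of s] s d by simp
  also have "... <= \<bar>K\<bar> * ((t - s) powr \<alpha> + (t - s) powr (1 - \<alpha>))" by (intro mult_right_mono) auto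
  also have "... <= \<bar>K\<bar> * (d powr \<alpha> + d powr (1 - \<alpha>))" using s \<alpha> by (intro mult_left_mono add_mono powr_mono2) auto
  finally show ?thesis .
 qed
 moreover have "((%d. \<bar>K\<bar> * (d powr \<alpha> + d powr (1 - \<alpha>))) \<longlongrightarrow> 0) (at_right 0)"
 proof -
  have "((%d. \<bar>K\<bar> * (d powr \<alpha> + d powr (1 - \<alpha>))) \<longlongrightarrow> \<bar>K\<bar> * (0 + 0)) (at_right 0)"
   by (intro tendsto_intros) (use \<alpha> in real_asymp)+
  then show ?thesis by simp
 qed
 moreover have "\<forall>\<^sub>F d in at_right 0. 0 < d & d < t"
  using t(1) by (auto simp: eventually_at_right[OF t(1)] intro!: exI[of _ t])
 ultimately have "\<bar>\<Lambda> t\<bar> <= 0"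
  by (intro tendsto_lowerbound[of _ 0 "at_right 0" "\<bar>\<Lambda> t\<bar>"]) (auto elim: eventually_mono)
 then show ?thesis by (simp add: \<Lambda>_def ht_def)
qed

end

section \<open>The time grid: kernels of the discrete operators and their errors\<close>

locale grid =
 fixes \<alpha> \<rho> :: real and n :: nat
 assumes \<alpha>: "0 < \<alpha>" "\<alpha> < 1" and \<rho>: "0 < \<rho>"
begin

definition A :: "nat => real" where "A j = \<rho> powr (-\<alpha>) * g_coeff (\<alpha> - 1) j"

abbreviation tt :: "nat => real" where "tt k \<equiv> real k * \<rho>"

lemma A_pos: "0 < A j"
 using g_coeff_neg_pos[of "\<alpha> - 1" j] \<alpha> \<rho> by (simp add: A_def)

lemma sum_A: "\<rho> * (\<Sum>i\<le>j. A i) = \<rho> powr (1 - \<alpha>) * g_coeff (\<alpha> - 2) j"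
proof -
 have "\<rho> * \<rho> powr (-\<alpha>) = \<rho> powr (1 - \<alpha>)" using \<rho> powr_add[of \<rho> 1 "-\<alpha>"] by simp
 then show ?thesis
  using sum_g_coeff[of "\<alpha> - 1" j] by (simp add: A_def flip: sum_distrib_left mult.assoc)
qed

lemma cell_exists_grid:
 assumes "0 < r" "r <= tt n" obtains i where "1 <= i" "i <= n" "tt (i - 1) < r" "r <= tt i"
proof -
 define i where "i = (LEAST k. r <= tt k)"
 have i1: "r <= tt i" unfolding i_def by (rule LeastI[of _ n]) (rule assms(2))
 have i2: "i <= n" unfolding i_def by (rule Least_le) (rule assms(2))
 have i0: "i ~= 0" using i1 assms(1) by (auto intro: ccontr)
 then have "\<not> r <= tt (i - 1)" using not_less_Least[of "i - 1" "%k. r <= tt k"] by (simp add: i_def)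
 then show ?thesis using that[of i] i0 i1 i2 by simp
qed

text \<open>The integral of the exact kernel (t_n - s)^(-\<alpha>) / Gamma (1 - \<alpha>) over
  [r, t_n]; \<open>kap1\<close> and \<open>stepS\<close> are its discrete counterparts for the
  derivative and for the delay term.\<close>

definition kap2 :: "real => real" where "kap2 r = (tt n - r) powr (1 - \<alpha>) / Gamma (2 - \<alpha>)"

lemma Gamma_two: "Gamma (2 - \<alpha>) = (1 - \<alpha>) * Gamma (1 - \<alpha>)"
 using Gamma_add_one_real[of "1 - \<alpha>"] \<alpha> by simp

lemma Gamma_pos1: "0 < Gamma (1 - \<alpha>)" "0 < Gamma (2 - \<alpha>)"
 using \<alpha> by (auto intro!: Gamma_real_pos)

text \<open>Both quadratures of \<open>\<integral>\<^sub>r\<^sup>t (t - s)\<^sup>-\<^sup>\<alpha> ds\<close> lie between consecutive partial sums of the weights.\<close>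

lemma quadrature_error:
 assumes j: "i = n - j" "j <= n" and r: "tt i - \<rho> <= r" "r <= tt i"
  and q: "(if j = 0 then 0 else \<rho> * (\<Sum>i<j. A i)) <= q" "q <= \<rho> * (\<Sum>i\<le>j. A i)"
 shows "\<bar>q - kap2 r\<bar> <= 2 / (1 - \<alpha>) * (\<rho> * A j)"
proof -
 define x where "x = (tt n - r) / \<rho>"
 have ni: "real i = real n - real j" using j by simp
 have x: "real j <= x" "x <= real j + 1" using r \<rho> unfolding x_def ni by (auto simp: field_simps)
 have rp: "0 < \<rho> powr (1 - \<alpha>)" using \<rho> by simp
 have xk: "kap2 r = \<rho> powr (1 - \<alpha>) * (x powr (1 - \<alpha>)) / Gamma (2 - \<alpha>)"
 proof -
  have "tt n - r = \<rho> * x" using \<rho> by (simp add: x_def)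
  then show ?thesis using \<rho> x by (simp add: kap2_def powr_mult)
 qed
 \<comment> \<open>The lower bound on q involves the weights with index below j, hence the power of
   j - 1; for j = 0 there are none. The width j + 1 - lo <= 2 is the factor 2 of the result.\<close>
 define lo where "lo = (if j = 0 then 0 else real j - 1)"
 have lo: "0 <= lo" "lo <= real j" "real j + 1 - lo <= 2" by (auto simp: lo_def)
 have q1: "\<rho> powr (1 - \<alpha>) * lo powr (1 - \<alpha>) <= Gamma (2 - \<alpha>) * q"
 proof (cases "j = 0")
  case True then show ?thesis using q(1) Gamma_pos1 by (simp add: lo_def)
 next
  case False
  then obtain l where l: "j = Suc l" by (cases j) auto
  have "(real l) powr (1 - \<alpha>) <= Gamma (2 - \<alpha>) * g_coeff (\<alpha> - 2) l" using g_coeff2_Wendel(1)[OF \<alpha>] .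
  then have "\<rho> powr (1 - \<alpha>) * (real l) powr (1 - \<alpha>) <= \<rho> powr (1 - \<alpha>) * (Gamma (2 - \<alpha>) * g_coeff (\<alpha> - 2) l)"
   by (intro mult_left_mono) auto
  also have "... = Gamma (2 - \<alpha>) * (\<rho> * (\<Sum>i\<le>l. A i))" by (simp add: sum_A mult_ac)
  also have "... <= Gamma (2 - \<alpha>) * q"
   using q(1) Gamma_pos1 by (intro mult_left_mono) (auto simp: l lessThan_Suc_atMost)
  finally show ?thesis by (simp add: lo_def l)
 qed
 have q2: "Gamma (2 - \<alpha>) * q <= \<rho> powr (1 - \<alpha>) * (real j + 1) powr (1 - \<alpha>)"
 proof -
  have "Gamma (2 - \<alpha>) * q <= Gamma (2 - \<alpha>) * (\<rho> * (\<Sum>i\<le>j. A i))" using q(2) Gamma_pos1 by (intro mult_left_mono) auto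
  also have "... = \<rho> powr (1 - \<alpha>) * (Gamma (2 - \<alpha>) * g_coeff (\<alpha> - 2) j)" by (simp add: sum_A mult_ac)
  also have "... <= \<rho> powr (1 - \<alpha>) * (real j + 1) powr (1 - \<alpha>)"
   using g_coeff2_Wendel(2)[OF \<alpha>] by (intro mult_left_mono) auto
  finally show ?thesis .
 qed
 have x1: "lo powr (1 - \<alpha>) <= x powr (1 - \<alpha>)" "x powr (1 - \<alpha>) <= (real j + 1) powr (1 - \<alpha>)"
  using x lo \<alpha> by (auto intro!: powr_mono2)
 have "\<bar>Gamma (2 - \<alpha>) * q - \<rho> powr (1 - \<alpha>) * x powr (1 - \<alpha>)\<bar> <= \<rho> powr (1 - \<alpha>) * ((real j + 1) powr (1 - \<alpha>) - lo powr (1 - \<alpha>))"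
  using q1 q2 mult_left_mono[OF x1(1), of "\<rho> powr (1 - \<alpha>)"] mult_left_mono[OF x1(2), of "\<rho> powr (1 - \<alpha>)"]
  by (simp add: abs_le_iff right_diff_distrib)
 also have "... <= \<rho> powr (1 - \<alpha>) * (2 * (real j + 1) powr (- \<alpha>))"
 proof (rule mult_left_mono)
  have a1: "(real j + 1) powr (1 - \<alpha>) = (real j + 1) * (real j + 1) powr (- \<alpha>)"
   using powr_add[of "real j + 1" 1 "- \<alpha>"] by simp
  have a2: "lo * (real j + 1) powr (- \<alpha>) <= lo powr (1 - \<alpha>)"
  proof (cases "lo = 0")
   case False
   then have "lo powr (1 - \<alpha>) = lo * lo powr (- \<alpha>)" using lo powr_add[of lo 1 "- \<alpha>"] by simp
   then show ?thesis using lo False \<alpha> by (auto intro!: mult_left_mono powr_mono2')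
  qed simp
  have "(real j + 1) powr (1 - \<alpha>) - lo powr (1 - \<alpha>) <= (real j + 1 - lo) * (real j + 1) powr (- \<alpha>)"
   using a1 a2 by (simp add: left_diff_distrib)
  also have "... <= 2 * (real j + 1) powr (- \<alpha>)" using lo by (intro mult_right_mono) auto
  finally show "(real j + 1) powr (1 - \<alpha>) - lo powr (1 - \<alpha>) <= 2 * (real j + 1) powr (- \<alpha>)" .
 qed simp
 also have "... <= \<rho> powr (1 - \<alpha>) * (2 * (Gamma (1 - \<alpha>) * g_coeff (\<alpha> - 1) j))"
  using g_coeff_Wendel_lower[OF \<alpha>, of j] by (intro mult_left_mono) auto
 finally have "\<bar>Gamma (2 - \<alpha>) * q - \<rho> powr (1 - \<alpha>) * x powr (1 - \<alpha>)\<bar> <= 2 * Gamma (1 - \<alpha>) * (\<rho> powr (1 - \<alpha>) * g_coeff (\<alpha> - 1) j)"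
  by (simp add: mult_ac)
 also have "\<rho> powr (1 - \<alpha>) * g_coeff (\<alpha> - 1) j = \<rho> * A j"
  using \<rho> powr_add[of \<rho> 1 "-\<alpha>"] by (simp add: A_def)
 finally have b: "\<bar>Gamma (2 - \<alpha>) * q - \<rho> powr (1 - \<alpha>) * x powr (1 - \<alpha>)\<bar> <= 2 * Gamma (1 - \<alpha>) * (\<rho> * A j)" .
 have "q - kap2 r = (Gamma (2 - \<alpha>) * q - \<rho> powr (1 - \<alpha>) * x powr (1 - \<alpha>)) / Gamma (2 - \<alpha>)"
  using Gamma_pos1 by (simp add: xk diff_divide_distrib)
 then have "\<bar>q - kap2 r\<bar> <= 2 * Gamma (1 - \<alpha>) * (\<rho> * A j) / Gamma (2 - \<alpha>)"
  using b Gamma_pos1 by (simp add: abs_divide divide_right_mono)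
 also have "... = 2 / (1 - \<alpha>) * (\<rho> * A j)" using Gamma_pos1(1) \<alpha> by (simp add: Gamma_two less_imp_neq[THEN not_sym])
 finally show ?thesis .
qed

text \<open>Kernel of the discrete derivative: by \<open>cells_sum\<close>, a weighted sum of
  increments is the integral of \<open>stepK\<close> times the derivative.\<close>

definition stepK :: "real => real" where
 "stepK s = (\<Sum>k=1..n. A (n - k) * indicator {tt (k - 1)<..tt k} s)"

definition kap1 :: "real => real" where
 "kap1 r = (\<Sum>k=1..n. A (n - k) * (max 0 (tt k - r) - max 0 (tt (k - 1) - r)))"

text \<open>Kernel of the delay quadrature: \<rho> times the weighted sum of values w (t_k) of a
  primitive w of w' with w 0 = 0 is the integral of \<open>stepS\<close> times w'.\<close>

definition stepS :: "real => real" where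
 "stepS r = \<rho> * (\<Sum>k=0..n. A (n - k) * (if r <= tt k then 1 else 0))"

lemma tt_mono: "i <= j ==> tt i <= tt j"
 using \<rho> by (simp add: mult_right_mono)

lemma tt_pred: "k < i ==> tt k <= tt (i - 1)"
 by (rule tt_mono) simp

lemma tt_diff: "1 <= i ==> tt (i - 1) = tt i - \<rho>"
 by (simp add: of_nat_diff algebra_simps)

lemma stepK_cell: assumes "1 <= i" "i <= n" "tt (i - 1) < s" "s <= tt i" shows "stepK s = A (n - i)"
proof -
 have "stepK s = (\<Sum>k=1..n. if k = i then A (n - i) else 0)"
  unfolding stepK_def
 proof (rule sum.cong)
  fix k assume k: "k \<in> {1..n}"
  consider "k = i" | "k < i" | "i < k" by linarith
  then show "A (n - k) * indicator {tt (k - 1)<..tt k} s = (if k = i then A (n - i) else 0)"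
  proof cases
   case 1 then show ?thesis using assms by simp
  next
   case 2 then show ?thesis using assms(3) tt_pred[OF 2] by (auto simp: indicator_def)
  next
   case 3 then show ?thesis using assms(4) tt_pred[OF 3] by (auto simp: indicator_def)
  qed
 qed simp
 then show ?thesis using assms by simp
qed

lemma kap1_cell: assumes "1 <= i" "i <= n" "tt (i - 1) < s" "s <= tt i"
 shows "kap1 s = \<rho> * (\<Sum>j<n - i. A j) + A (n - i) * (tt i - s)"
proof -
 have "kap1 s = (\<Sum>k=1..n. (if i < k then A (n - k) * \<rho> else 0) + (if k = i then A (n - i) * (tt i - s) else 0))"
  unfolding kap1_def
 proof (rule sum.cong)
  fix k assume k: "k \<in> {1..n}"
  consider "k = i" | "k < i" | "i < k" by linarith
  then show "A (n - k) * (max 0 (tt k - s) - max 0 (tt (k - 1) - s)) = (if i < k then A (n - k) * \<rho> else 0) + (if k = i then A (n - i) * (tt i - s) else 0)"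
  proof cases
   case 1 then show ?thesis using assms by simp
  next
   case 2
   have "tt (k - 1) <= tt k" by (rule tt_mono) simp
   then show ?thesis using assms(3) tt_pred[OF 2] 2 by simp
  next
   case 3
   have "s <= tt (k - 1)" "s <= tt k" using assms(4) tt_pred[OF 3] tt_mono[of i k] 3 by linarith+
   then have "max 0 (tt k - s) - max 0 (tt (k - 1) - s) = \<rho>" using tt_diff[of k] k by simp
   then show ?thesis using 3 by simp
  qed
 qed simp
 also have "... = (\<Sum>k\<in>{1..n}. if i < k then A (n - k) * \<rho> else 0) + A (n - i) * (tt i - s)"
  using assms by (simp add: sum.distrib)
 also have "(\<Sum>k\<in>{1..n}. if i < k then A (n - k) * \<rho> else 0) = (\<Sum>k\<in>{i<..n}. A (n - k) * \<rho>)"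
  by (rule sum.mono_neutral_cong_right) auto
 also have "... = (\<Sum>j<n - i. A j * \<rho>)"
  by (rule sum.reindex_bij_witness[of _ "%j. n - j" "%k. n - k"]) auto
 finally show ?thesis by (simp add: sum_distrib_left mult.commute)
qed

lemma stepS_cell: assumes "1 <= i" "i <= n" "tt (i - 1) < s" "s <= tt i"
 shows "stepS s = \<rho> * (\<Sum>j\<le>n - i. A j)"
proof -
 have "(\<Sum>k=0..n. A (n - k) * (if s <= tt k then 1 else 0)) = (\<Sum>k\<in>{i..n}. A (n - k))"
 proof (rule sum.mono_neutral_cong_right)
  show "\<forall>k\<in>{0..n} - {i..n}. A (n - k) * (if s <= tt k then 1 else 0) = 0"
  proof
   fix k assume "k \<in> {0..n} - {i..n}"
   then have "k < i" by auto
   then show "A (n - k) * (if s <= tt k then 1 else 0) = 0" using assms(3) tt_pred[of k i] by auto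
  qed
  fix k assume "k \<in> {i..n}"
  then have "tt i <= tt k" by (intro tt_mono) auto
  then show "A (n - k) * (if s <= tt k then 1 else 0) = A (n - k)" using assms(4) by auto
 qed auto
 also have "... = (\<Sum>j\<le>n - i. A j)"
  by (rule sum.reindex_bij_witness[of _ "%j. n - j" "%k. n - k"]) (use assms in auto)
 finally show ?thesis by (simp add: stepS_def)
qed

text \<open>The error is expressed by the weight A (n - i) itself rather than by a power, so that
  convolution with the inverse weights later collapses the resulting sums.\<close>

lemma kap_errors:
 assumes i: "1 <= i" "i <= n" "tt (i - 1) < s" "s <= tt i"
 shows "\<bar>kap1 s - kap2 s\<bar> <= 2 / (1 - \<alpha>) * (\<rho> * A (n - i))"
  and "\<bar>stepS s - kap2 s\<bar> <= 2 / (1 - \<alpha>) * (\<rho> * A (n - i))"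
proof -
 have s: "tt i - \<rho> <= s" using i tt_diff[of i] by simp
 have sum_le: "(\<Sum>j\<le>n - i. A j) = (\<Sum>j<n - i. A j) + A (n - i)"
  by (simp flip: lessThan_Suc_atMost)
 have S0: "0 <= (\<Sum>j<n - i. A j)" using A_pos by (intro sum_nonneg) (auto intro: less_imp_le)
 have "0 <= A (n - i) * (tt i - s)" "A (n - i) * (tt i - s) <= A (n - i) * \<rho>"
  using A_pos[of "n - i"] i s by (auto intro!: mult_left_mono)
 then show "\<bar>kap1 s - kap2 s\<bar> <= 2 / (1 - \<alpha>) * (\<rho> * A (n - i))"
  using i s kap1_cell[OF i] sum_le S0 \<rho>
  by (intro quadrature_error[of i]) (auto simp: distrib_left mult.commute)
 show "\<bar>stepS s - kap2 s\<bar> <= 2 / (1 - \<alpha>) * (\<rho> * A (n - i))"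
  using i s stepS_cell[OF i] sum_le S0 A_pos[of "n - i"] \<rho>
  by (intro quadrature_error[of i]) (auto simp: distrib_left mult.commute intro: mult_nonneg_nonneg add_nonneg_nonneg)
qed

lemma A_le_powr:
 assumes i: "1 <= i" "i <= n" "tt (i - 1) < s" "s <= tt i" "s < tt n"
 shows "A (n - i) <= (tt n - s) powr (- \<alpha>)"
proof -
 have "A (n - i) <= \<rho> powr (-\<alpha>) * (real (n - i) + 1) powr (- \<alpha>)"
  unfolding A_def using g_coeff_upper[of \<alpha> "n - i"] \<alpha> by (intro mult_left_mono) auto
 also have "... = (\<rho> * (real (n - i) + 1)) powr (- \<alpha>)" using \<rho> by (simp add: powr_mult)
 also have "... <= (tt n - s) powr (- \<alpha>)"
  using i \<alpha> \<rho> tt_diff[of i] by (intro powr_mono2') (auto simp: of_nat_diff algebra_simps)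
 finally show ?thesis .
qed

lemma kap1_error_powr:
 assumes s: "0 < s" "s < tt n"
 shows "\<bar>kap1 s - kap2 s\<bar> <= 2 / (1 - \<alpha>) * (\<rho> * (tt n - s) powr (- \<alpha>))"
proof -
 obtain i where i: "1 <= i" "i <= n" "tt (i - 1) < s" "s <= tt i" using cell_exists_grid[of s] s by auto
 have "2 / (1 - \<alpha>) * (\<rho> * A (n - i)) <= 2 / (1 - \<alpha>) * (\<rho> * (tt n - s) powr (- \<alpha>))"
  using A_le_powr[OF i s(2)] \<alpha> \<rho> by (intro mult_left_mono) auto
 then show ?thesis using kap_errors(1)[OF i] by linarith
qed

definition C3 :: real where "C3 = (Gamma (1 - \<alpha>) + 4) / Gamma (1 - \<alpha>)"

text \<open>On a cell with j >= 1 both kernels lie between (j + 1)^(-\<alpha>) and j^(-\<alpha>) up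
  to scaling, and Bernoulli bounds this gap by j^(-1 - \<alpha>). In the last cell j = 0 one has x
  <= 1, and x^(-1 - \<alpha>) dominates each kernel separately.\<close>

lemma stepK_error:
 assumes s: "0 < s" "s < tt n"
 shows "\<bar>stepK s - (tt n - s) powr (- \<alpha>) / Gamma (1 - \<alpha>)\<bar> <= C3 * (\<rho> * (tt n - s) powr (- 1 - \<alpha>))"
proof -
 obtain i where i: "1 <= i" "i <= n" "tt (i - 1) < s" "s <= tt i" using cell_exists_grid[of s] s by auto
 define j where "j = n - i"
 define x where "x = (tt n - s) / \<rho>"
 have x0: "0 < x" using s \<rho> by (simp add: x_def)
 have x: "real j <= x" "x <= real j + 1"
  using i \<rho> tt_diff[of i] by (auto simp: x_def j_def of_nat_diff field_simps)
 have txr: "tt n - s = \<rho> * x" using \<rho> by (simp add: x_def)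
 have key: "\<bar>Gamma (1 - \<alpha>) * g_coeff (\<alpha> - 1) j - x powr (- \<alpha>)\<bar> <= (Gamma (1 - \<alpha>) + 4) * x powr (- 1 - \<alpha>)"
 proof (cases "j = 0")
  case True
  then have "x <= 1" using x by simp
  then have "1 <= x powr (- 1 - \<alpha>)" "x powr (- \<alpha>) <= x powr (- 1 - \<alpha>)"
   using x0 \<alpha> powr_mono'[of "- 1 - \<alpha>" 0 x] by (auto intro: powr_mono')
  then have "Gamma (1 - \<alpha>) * 1 <= Gamma (1 - \<alpha>) * x powr (- 1 - \<alpha>)" "x powr (- \<alpha>) <= 4 * x powr (- 1 - \<alpha>)" "0 <= x powr (- \<alpha>)"
   using Gamma_pos1(1) by (auto intro!: mult_left_mono)
  moreover have "\<bar>Gamma (1 - \<alpha>) * g_coeff (\<alpha> - 1) j - x powr (- \<alpha>)\<bar> <= Gamma (1 - \<alpha>) + x powr (- \<alpha>)"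
   using True Gamma_pos1(1) by (simp add: abs_le_iff)
  ultimately show ?thesis unfolding distrib_right by linarith
 next
  case False
  then have j1: "1 <= j" by simp
  have lo: "(real j + 1) powr (- \<alpha>) <= Gamma (1 - \<alpha>) * g_coeff (\<alpha> - 1) j" by (rule g_coeff_Wendel_lower[OF \<alpha>])
  have hi: "Gamma (1 - \<alpha>) * g_coeff (\<alpha> - 1) j <= real j powr (- \<alpha>)" by (rule g_coeff_Wendel_upper[OF \<alpha> j1])
  have "(real j + 1) powr (- \<alpha>) <= x powr (- \<alpha>)" "x powr (- \<alpha>) <= real j powr (- \<alpha>)"
   using x x0 j1 \<alpha> by (auto intro!: powr_mono2')
  then have "\<bar>Gamma (1 - \<alpha>) * g_coeff (\<alpha> - 1) j - x powr (- \<alpha>)\<bar> <= real j powr (- \<alpha>) - (real j + 1) powr (- \<alpha>)"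
   using lo hi by (simp add: abs_le_iff)
  also have "... <= real j powr (- 1 - \<alpha>)"
  proof -
   define y where "y = 1 / real j"
   have y: "0 < y" using j1 by (simp add: y_def)
   have "(1 + y) powr \<alpha> <= 1 + \<alpha> * y" using powr_Bernoulli_le[of \<alpha> y] \<alpha> y by simp
   also have "... <= 1 + y" using \<alpha> y by (simp add: mult_left_le_one_le)
   finally have "1 / (1 + y) <= (1 + y) powr (- \<alpha>)"
    using y by (simp add: powr_minus divide_simps)
   moreover have "1 - y <= 1 / (1 + y)" using y by (simp add: field_simps)
   ultimately have "1 - y <= (1 + y) powr (- \<alpha>)" by linarith
   then have "real j powr (- \<alpha>) * (1 - y) <= real j powr (- \<alpha>) * (1 + y) powr (- \<alpha>)" by (intro mult_left_mono) auto
   also have "... = (real j * (1 + y)) powr (- \<alpha>)" using y by (simp add: powr_mult)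
   also have "real j * (1 + y) = real j + 1" using j1 by (simp add: y_def distrib_left)
   finally have "real j powr (- \<alpha>) - (real j + 1) powr (- \<alpha>) <= real j powr (- \<alpha>) * y" by (simp add: algebra_simps)
   also have "... = real j powr (- 1 - \<alpha>)"
    using j1 powr_add[of "real j" "-1" "- \<alpha>"] by (simp add: y_def powr_minus field_simps)
   finally show ?thesis .
  qed
  \<comment> \<open>From x <= j + 1 <= 2 j; the factor 4 is the bound for 2^(1 + \<alpha>).\<close>
  also have "... <= 4 * x powr (- 1 - \<alpha>)"
  proof -
   have "(2 * real j) powr (- 1 - \<alpha>) <= x powr (- 1 - \<alpha>)"
    using x x0 j1 \<alpha> by (intro powr_mono2') auto
   then have "2 powr (- 1 - \<alpha>) * real j powr (- 1 - \<alpha>) <= x powr (- 1 - \<alpha>)" by (simp add: powr_mult)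
   moreover have "2 powr (-2) <= (2::real) powr (- 1 - \<alpha>)" using \<alpha> by (intro powr_mono) auto
   then have "1 / 4 <= (2::real) powr (- 1 - \<alpha>)" by (simp add: powr_minus)
   then have "1 / 4 * real j powr (- 1 - \<alpha>) <= 2 powr (- 1 - \<alpha>) * real j powr (- 1 - \<alpha>)" by (intro mult_right_mono) auto
   ultimately show ?thesis by linarith
  qed
  also have "... <= (Gamma (1 - \<alpha>) + 4) * x powr (- 1 - \<alpha>)" using Gamma_pos1(1) by (intro mult_right_mono) auto
  finally show ?thesis .
 qed
 have "stepK s - (tt n - s) powr (- \<alpha>) / Gamma (1 - \<alpha>) = \<rho> powr (-\<alpha>) * ((Gamma (1 - \<alpha>) * g_coeff (\<alpha> - 1) j - x powr (- \<alpha>)) / Gamma (1 - \<alpha>))"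
  using stepK_cell[OF i] \<rho> x0 Gamma_pos1(1) by (simp add: A_def j_def[symmetric] txr powr_mult diff_divide_distrib right_diff_distrib)
 then have "\<bar>stepK s - (tt n - s) powr (- \<alpha>) / Gamma (1 - \<alpha>)\<bar> = \<rho> powr (-\<alpha>) * (\<bar>Gamma (1 - \<alpha>) * g_coeff (\<alpha> - 1) j - x powr (- \<alpha>)\<bar> / Gamma (1 - \<alpha>))"
  using Gamma_pos1(1) by (simp add: abs_mult)
 also have "... <= \<rho> powr (-\<alpha>) * ((Gamma (1 - \<alpha>) + 4) * x powr (- 1 - \<alpha>) / Gamma (1 - \<alpha>))"
  using key Gamma_pos1(1) by (intro mult_left_mono divide_right_mono) auto
 also have "... = C3 * (\<rho> powr (-\<alpha>) * x powr (- 1 - \<alpha>))" by (simp add: C3_def)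
 also have "\<rho> powr (-\<alpha>) * x powr (- 1 - \<alpha>) = \<rho> * (tt n - s) powr (- 1 - \<alpha>)"
 proof -
  have "\<rho> * \<rho> powr (- 1 - \<alpha>) = \<rho> powr (-\<alpha>)" using \<rho> powr_add[of \<rho> 1 "- 1 - \<alpha>"] by simp
  then show ?thesis unfolding txr using \<rho> x0 by (simp add: powr_mult mult.assoc[symmetric])
 qed
 finally show ?thesis .
qed

definition ker :: "real => real" where "ker s = (tt n - s) powr (- \<alpha>) / Gamma (1 - \<alpha>)"

lemma borel_kernels: "stepK \<in> borel_measurable borel" "kap1 \<in> borel_measurable borel" "kap2 \<in> borel_measurable borel"
 "stepS \<in> borel_measurable borel" "ker \<in> borel_measurable borel"
 unfolding stepK_def kap1_def kap2_def stepS_def ker_def by measurable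

lemma tt_n_nonneg: "0 <= tt n" using \<rho> by simp

lemma kernels_nonneg: "0 <= stepK s" "0 <= ker s"
 using A_pos Gamma_pos1 by (auto simp: stepK_def ker_def intro!: sum_nonneg mult_nonneg_nonneg intro: less_imp_le)

lemma ker_integral: assumes "r <= tt n"
 shows "set_integrable lebesgue {r..tt n} ker" "(LINT s:{r..tt n}|lebesgue. ker s) = kap2 r"
 using powr_right_lebesgue[of "1 - \<alpha>" r "tt n"] assms \<alpha>
 by (auto simp: ker_def[abs_def] kap2_def Gamma_two)

lemma indicator_interval_integral:
 fixes r c d :: real assumes "c <= d" "d <= e"
 shows "set_integrable lebesgue {r..e} (indicat_real {c<..d})"
  "(LINT s:{r..e}|lebesgue. indicat_real {c<..d} s) = max 0 (d - r) - max 0 (c - r)"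
proof -
 have eq: "(%s. indicat_real {r..e} s *\<^sub>R indicat_real {c<..d} s) = indicat_real ({r..e} \<inter> {c<..d})"
  by (auto simp: indicator_def fun_eq_iff)
 have "{r..e} \<inter> {c<..d} \<in> sets lborel" by auto
 moreover have "emeasure lborel ({r..e} \<inter> {c<..d}) < \<infinity>"
 proof -
  have "emeasure lborel ({r..e} \<inter> {c<..d}) <= emeasure lborel {c..d}" by (intro emeasure_mono) auto
  then show ?thesis by (auto simp: emeasure_lborel_Icc_eq split: if_splits intro: le_less_trans)
 qed
 ultimately have "integrable lborel (indicat_real ({r..e} \<inter> {c<..d}))" by (intro integrable_real_indicator)
 then show "set_integrable lebesgue {r..e} (indicat_real {c<..d})"
  unfolding set_integrable_def eq by (subst integrable_completion) auto
 have "(LINT s:{r..e}|lebesgue. indicat_real {c<..d} s) = measure lborel ({r..e} \<inter> {c<..d})"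
  unfolding set_lebesgue_integral_def eq by (subst integral_completion) auto
 also have "... = max 0 (d - r) - max 0 (c - r)"
 proof (cases "r <= c")
  case True
  then have "{r..e} \<inter> {c<..d} = {c<..d}" using assms by auto
  then show ?thesis using True assms by simp
 next
  case False
  show ?thesis
  proof (cases "r <= d")
   case True
   then have "{r..e} \<inter> {c<..d} = {r..d}" using assms False by auto
   then show ?thesis using True False by simp
  next
   case nd: False
   then have "{r..e} \<inter> {c<..d} = {}" by auto
   then show ?thesis using nd False by simp
  qed
 qed
 finally show "(LINT s:{r..e}|lebesgue. indicat_real {c<..d} s) = max 0 (d - r) - max 0 (c - r)" .
qed

lemma set_integral_sum_lebesgue:
 fixes f :: "'b => real => real"
 assumes "finite I" "!!i. i \<in> I ==> set_integrable lebesgue S (f i)"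
 shows "(LINT x:S|lebesgue. \<Sum>i\<in>I. f i x) = (\<Sum>i\<in>I. LINT x:S|lebesgue. f i x)"
 unfolding set_lebesgue_integral_def scaleR_sum_right
 by (rule Bochner_Integration.integral_sum) (use assms in \<open>auto simp: set_integrable_def\<close>)

lemma stepK_integral:
 shows "set_integrable lebesgue {r..tt n} stepK" "(LINT s:{r..tt n}|lebesgue. stepK s) = kap1 r"
proof -
 have i: "set_integrable lebesgue {r..tt n} (indicat_real {tt (k - 1)<..tt k})"
  "(LINT s:{r..tt n}|lebesgue. indicat_real {tt (k - 1)<..tt k} s) = max 0 (tt k - r) - max 0 (tt (k - 1) - r)" if "k \<in> {1..n}" for k
  using indicator_interval_integral[of "tt (k - 1)" "tt k" "tt n" r] tt_mono[of "k - 1" k] tt_mono[of k n] that by auto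
 show "set_integrable lebesgue {r..tt n} stepK"
  unfolding stepK_def[abs_def] by (intro absolutely_integrable_sum set_integrable_mult_right i) auto
 have "(LINT s:{r..tt n}|lebesgue. stepK s) = (\<Sum>k=1..n. LINT s:{r..tt n}|lebesgue. A (n - k) * indicat_real {tt (k - 1)<..tt k} s)"
  unfolding stepK_def using i by (intro set_integral_sum_lebesgue) (auto intro!: set_integrable_mult_right)
 also have "... = kap1 r" unfolding kap1_def using i by (intro sum.cong) auto
 finally show "(LINT s:{r..tt n}|lebesgue. stepK s) = kap1 r" .
qed

lemma kap1_bound: "kap1 r <= (\<Sum>k=1..n. A (n - k) * \<rho>)"
 unfolding kap1_def
proof (intro sum_mono mult_left_mono)
 fix k assume "k \<in> {1..n}"
 then have "tt (k - 1) = tt k - \<rho>" using tt_diff[of k] by simp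
 then show "max 0 (tt k - r) - max 0 (tt (k - 1) - r) <= \<rho>" using \<rho> by (simp add: max_def)
qed (use A_pos in \<open>auto intro: less_imp_le\<close>)

text \<open>Integration by parts in the form of \<open>triangle_Fubini\<close>: z is z l plus the
  integral of z', and integrating the kernels first produces \<open>kap1\<close> and
  \<open>kap2\<close>.\<close>

lemma by_parts:
 assumes l: "0 <= l" "l <= tt n" and z'[measurable]: "z' \<in> borel_measurable borel"
  and z'i: "set_integrable lebesgue {l..tt n} z'"
  and z: "!!s. s \<in> {l..tt n} ==> z s = z l + (LINT r:{l..s}|lebesgue. z' r)"
 shows "set_integrable lebesgue {l..tt n} (%s. (stepK s - ker s) * z s)"
  and "(LINT s:{l..tt n}|lebesgue. (stepK s - ker s) * z s)
   = z l * (kap1 l - kap2 l) + (LINT r:{l..tt n}|lebesgue. (kap1 r - kap2 r) * z' r)"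
  and "set_integrable lebesgue {l..tt n} (%r. (kap1 r - kap2 r) * z' r)"
proof -
 note [measurable] = borel_kernels
 have m: "(%(s, r::real). stepK s) \<in> borel_measurable borel" "(%(s, r::real). ker s) \<in> borel_measurable borel"
  using measurable_compose[OF measurable_fst borel_kernels(1), of "borel :: real measure"]
   measurable_compose[OF measurable_fst borel_kernels(5), of "borel :: real measure"]
  by (simp_all add: borel_prod case_prod_beta')
 have kb2: "kap2 r <= kap2 l" if "l < r" "r < tt n" for r
  unfolding kap2_def using that \<alpha> Gamma_pos1 by (intro divide_right_mono powr_mono2) auto
 note F1 = triangle_Fubini[OF m(1) kernels_nonneg(1) z' z'i stepK_integral kap1_bound]
 note F2 = triangle_Fubini[OF m(2) kernels_nonneg(2) z' z'i ker_integral kb2]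
 have i1: "set_integrable lebesgue {l..tt n} (%s. stepK s * (LINT r:{l..s}|lebesgue. z' r))"
  "(LINT s:{l..tt n}|lebesgue. stepK s * (LINT r:{l..s}|lebesgue. z' r)) = (LINT r:{l..tt n}|lebesgue. kap1 r * z' r)"
  using F1(1,2) by simp_all
 have i2: "set_integrable lebesgue {l..tt n} (%s. ker s * (LINT r:{l..s}|lebesgue. z' r))"
  "(LINT s:{l..tt n}|lebesgue. ker s * (LINT r:{l..s}|lebesgue. z' r)) = (LINT r:{l..tt n}|lebesgue. kap2 r * z' r)"
  using F2(1,2) by simp_all
 have j: "set_integrable lebesgue {l..tt n} (%s. (stepK s - ker s) * z l)"
  "(LINT s:{l..tt n}|lebesgue. (stepK s - ker s) * z l) = z l * (kap1 l - kap2 l)"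
  using stepK_integral[of l] ker_integral[OF l(2)] by (auto intro!: set_integrable_mult_left set_integral_diff(1) simp: set_integral_diff(2))
 define R where "R s = (stepK s - ker s) * (LINT r:{l..s}|lebesgue. z' r)" for s
 have R: "set_integrable lebesgue {l..tt n} R"
  "(LINT s:{l..tt n}|lebesgue. R s) = (LINT r:{l..tt n}|lebesgue. kap1 r * z' r) - (LINT r:{l..tt n}|lebesgue. kap2 r * z' r)"
  unfolding R_def left_diff_distrib using i1 i2 by (auto intro!: set_integral_diff(1) simp: set_integral_diff(2))
 have eq: "(stepK s - ker s) * z s = (stepK s - ker s) * z l + R s" if "s \<in> {l..tt n}" for s
  unfolding R_def by (subst z[OF that]) (simp add: distrib_left)
 have "set_integrable lebesgue {l..tt n} (%s. (stepK s - ker s) * z l + R s)" using j(1) R(1) by (rule set_integral_add(1))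
 then show "set_integrable lebesgue {l..tt n} (%s. (stepK s - ker s) * z s)"
  by (rule set_integrable_cong[THEN iffD1, rotated 3]) (use eq in auto)
 have k1: "\<bar>kap1 r\<bar> <= (\<Sum>k=1..n. A (n - k) * \<rho>)" for r
 proof -
  have "0 <= kap1 r" unfolding kap1_def
  proof (intro sum_nonneg mult_nonneg_nonneg)
   fix k assume "k \<in> {1..n}"
   then show "0 <= max 0 (tt k - r) - max 0 (tt (k - 1) - r)" using tt_mono[of "k - 1" k] by (simp add: max_def)
  qed (use A_pos in \<open>auto intro: less_imp_le\<close>)
  then show ?thesis using kap1_bound[of r] by simp
 qed
 have k2: "\<bar>kap2 r\<bar> <= kap2 l" if "r \<in> {l..tt n}" for r
  unfolding kap2_def using that \<alpha> Gamma_pos1 by (auto intro!: divide_right_mono powr_mono2)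
 have ki: "set_integrable lebesgue {l..tt n} (%r. kap1 r * z' r)" "set_integrable lebesgue {l..tt n} (%r. kap2 r * z' r)"
 proof -
  have ab: "set_integrable lebesgue {l..tt n} (%r. \<bar>z' r\<bar>)" using z'i by (rule set_integrable_abs)
  show "set_integrable lebesgue {l..tt n} (%r. kap1 r * z' r)"
   by (rule set_integral_abs_le(1)[of _ "%r. (\<Sum>k=1..n. A (n - k) * \<rho>) * \<bar>z' r\<bar>"])
    (use ab k1 in \<open>auto simp: abs_mult intro!: set_integrable_mult_right mult_right_mono borel_set_borel_measurable\<close>)
  show "set_integrable lebesgue {l..tt n} (%r. kap2 r * z' r)"
   by (rule set_integral_abs_le(1)[of _ "%r. kap2 l * \<bar>z' r\<bar>"])
    (use ab k2 in \<open>auto simp: abs_mult intro!: set_integrable_mult_right mult_right_mono borel_set_borel_measurable\<close>)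
 qed
 show "set_integrable lebesgue {l..tt n} (%r. (kap1 r - kap2 r) * z' r)"
  unfolding left_diff_distrib using ki by (rule set_integral_diff(1))
 have "(LINT s:{l..tt n}|lebesgue. (stepK s - ker s) * z s) = (LINT s:{l..tt n}|lebesgue. (stepK s - ker s) * z l + R s)"
  by (rule set_lebesgue_integral_cong) (use eq in auto)
 also have "... = z l * (kap1 l - kap2 l) + ((LINT r:{l..tt n}|lebesgue. kap1 r * z' r) - (LINT r:{l..tt n}|lebesgue. kap2 r * z' r))"
  using j R by (simp add: set_integral_add(2))
 also have "... = z l * (kap1 l - kap2 l) + (LINT r:{l..tt n}|lebesgue. (kap1 r - kap2 r) * z' r)"
  unfolding left_diff_distrib using ki by (simp add: set_integral_diff(2))
 finally show "(LINT s:{l..tt n}|lebesgue. (stepK s - ker s) * z s)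
   = z l * (kap1 l - kap2 l) + (LINT r:{l..tt n}|lebesgue. (kap1 r - kap2 r) * z' r)" .
qed

lemma cell_subset: "i < n ==> {tt i..tt (Suc i)} \<subseteq> {0..tt n}"
 using tt_mono[of 0 i] tt_mono[of "Suc i" n] by auto

lemma cells_sum:
 assumes z: "set_integrable lebesgue {0..tt n} z"
 shows "set_integrable lebesgue {0..tt n} (%s. stepK s * z s)"
  and "(\<Sum>k=1..n. A (n - k) * (LINT s:{tt (k - 1)..tt k}|lebesgue. z s)) = (LINT s:{0..tt n}|lebesgue. stepK s * z s)"
proof -
 have cell: "((%s. stepK s * z s) absolutely_integrable_on {tt i..tt (Suc i)})
  & (LINT s:{tt i..tt (Suc i)}|lebesgue. stepK s * z s) = A (n - Suc i) * (LINT s:{tt i..tt (Suc i)}|lebesgue. z s)" if i: "i < n" for i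
 proof -
  have zi: "z absolutely_integrable_on {tt i..tt (Suc i)}"
   using set_integrable_subset[OF z _ cell_subset[OF i]] by simp
  then have Az: "(%s. A (n - Suc i) * z s) absolutely_integrable_on {tt i..tt (Suc i)}" by (rule set_integrable_mult_right)
  have eq: "stepK s * z s = A (n - Suc i) * z s" if "s \<in> {tt i..tt (Suc i)} - {tt i}" for s
   using stepK_cell[of "Suc i" s] that i by simp
  have "(%s. stepK s * z s) absolutely_integrable_on {tt i..tt (Suc i)}"
   by (rule absolutely_integrable_spike[OF Az negligible_sing[of "tt i"]]) (metis eq)
  moreover from this have "(LINT s:{tt i..tt (Suc i)}|lebesgue. stepK s * z s) = integral {tt i..tt (Suc i)} (%s. stepK s * z s)"
   by (rule set_lebesgue_integral_eq_integral(2))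
  moreover have "... = integral {tt i..tt (Suc i)} (%s. A (n - Suc i) * z s)"
   by (rule integral_spike[OF negligible_sing[of "tt i"]]) (metis eq)
  ultimately show ?thesis using set_lebesgue_integral_eq_integral(2)[OF zi] by simp
 qed
 have le: "i < n ==> tt i <= tt (Suc i)" for i by (rule tt_mono) simp
 note P = absolutely_integrable_partition[of n "%k. tt k" "%s. stepK s * z s", OF le]
 show "set_integrable lebesgue {0..tt n} (%s. stepK s * z s)" using P(1) cell by simp
 have "(LINT s:{0..tt n}|lebesgue. stepK s * z s) = (\<Sum>i<n. A (n - Suc i) * (LINT s:{tt i..tt (Suc i)}|lebesgue. z s))"
  using P(2) cell by simp
 also have "... = (\<Sum>k=1..n. A (n - k) * (LINT s:{tt (k - 1)..tt k}|lebesgue. z s))"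
  by (rule sum.reindex_bij_witness[of _ "%k. k - 1" Suc]) auto
 finally show "(\<Sum>k=1..n. A (n - k) * (LINT s:{tt (k - 1)..tt k}|lebesgue. z s)) = (LINT s:{0..tt n}|lebesgue. stepK s * z s)" ..
qed

text \<open>The cellwise bound says |F| <= c \<rho> \<open>stepK\<close>, and
  \<open>cells_sum\<close> turns the integral of \<open>stepK\<close> times |g| back into a weighted
  sum.\<close>

lemma cellwise_bound:
 assumes F: "F \<in> borel_measurable borel" and g: "set_integrable lebesgue {0..tt n} g" "g \<in> borel_measurable borel"
  and b: "!!i s. 1 <= i ==> i <= n ==> tt (i - 1) < s ==> s <= tt i ==> \<bar>F s\<bar> <= c * (\<rho> * A (n - i))"
 shows "\<bar>LINT s:{0..tt n}|lebesgue. F s * g s\<bar> <= c * \<rho> * (\<Sum>i=1..n. A (n - i) * (LINT s:{tt (i - 1)..tt i}|lebesgue. \<bar>g s\<bar>))"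
proof -
 have ab: "set_integrable lebesgue {0..tt n} (%s. \<bar>g s\<bar>)" using g(1) by (rule set_integrable_abs)
 \<comment> \<open>The point 0 lies in no half-open cell, so nothing is known of F there while
   \<open>stepK\<close> vanishes; F is set to 0 at this single point.\<close>
 define F' where "F' s = (if s = 0 then 0 else F s)" for s
 have F'm: "F' \<in> borel_measurable borel" unfolding F'_def using F by measurable
 have le: "\<bar>F' s * g s\<bar> <= (c * \<rho>) * (stepK s * \<bar>g s\<bar>)" if s: "s \<in> {0..tt n}" for s
 proof (cases "s = 0")
  case True
  have "stepK 0 = 0" unfolding stepK_def
  proof (intro sum.neutral ballI)
   fix k assume "k \<in> {1..n}"
   show "A (n - k) * indicator {tt (k - 1)<..tt k} 0 = 0" using tt_mono[of 0 "k - 1"] by (auto simp: indicator_def)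
  qed
  then show ?thesis using True by (simp add: F'_def)
 next
  case False
  then obtain i where i: "1 <= i" "i <= n" "tt (i - 1) < s" "s <= tt i" using cell_exists_grid[of s] s by auto
  have "\<bar>F' s\<bar> <= c * \<rho> * stepK s" using b[OF i] stepK_cell[OF i] False by (simp add: F'_def mult.assoc)
  then show ?thesis using mult_right_mono[of "\<bar>F' s\<bar>" "c * \<rho> * stepK s" "\<bar>g s\<bar>"] by (simp add: abs_mult mult.assoc)
 qed
 note C = cells_sum[OF ab]
 have "set_borel_measurable lebesgue {0..tt n} (%s. F' s * g s)"
  using F'm g(2) by (intro borel_set_borel_measurable) auto
 note B = set_integral_abs_le[OF set_integrable_mult_right[of "c * \<rho>", OF C(1)] this le]
 have "(LINT s:{0..tt n}|lebesgue. F s * g s) = (LINT s:{0..tt n}|lebesgue. F' s * g s)"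
 proof -
  have ae: "AE s in lebesgue. s ~= (0::real)" using AE_lborel_singleton[of "0::real"] by (simp add: AE_completion_iff)
  show ?thesis unfolding set_lebesgue_integral_def
  proof (rule integral_cong_AE)
   show "(%s. indicator {0..tt n} s *\<^sub>R (F s * g s)) \<in> borel_measurable lebesgue"
    "(%s. indicator {0..tt n} s *\<^sub>R (F' s * g s)) \<in> borel_measurable lebesgue"
    using F F'm g(2) by (auto intro!: measurable_completion)
   show "AE s in lebesgue. indicator {0..tt n} s *\<^sub>R (F s * g s) = indicator {0..tt n} s *\<^sub>R (F' s * g s)"
    using ae by eventually_elim (simp add: F'_def)
  qed
 qed
 then have "\<bar>LINT s:{0..tt n}|lebesgue. F s * g s\<bar> <= (LINT s:{0..tt n}|lebesgue. (c * \<rho>) * (stepK s * \<bar>g s\<bar>))"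
  using B(2) by simp
 also have "... = c * \<rho> * (LINT s:{0..tt n}|lebesgue. stepK s * \<bar>g s\<bar>)" by simp
 finally show ?thesis unfolding C(2) .
qed

text \<open>As z vanishes at 0, integration by parts leaves no boundary term, and only integrals of
  |z'| over cells enter: integrable z' suffices.\<close>

lemma truncation_smooth:
 assumes z': "z' \<in> borel_measurable borel" "set_integrable lebesgue {0..tt n} z'"
  and z: "!!s. s \<in> {0..tt n} ==> z s = (LINT r:{0..s}|lebesgue. z' r)"
 shows "\<bar>LINT s:{0..tt n}|lebesgue. (stepK s - ker s) * z s\<bar>
  <= 2 / (1 - \<alpha>) * \<rho> * (\<Sum>i=1..n. A (n - i) * (LINT s:{tt (i - 1)..tt i}|lebesgue. \<bar>z' s\<bar>))"
proof -
 have z0: "z 0 = 0" using z[of 0] tt_n_nonneg set_lebesgue_integral_eq_integral(2)[OF absolutely_integrable_singleton, of 0 z'] by simp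
 have "(LINT s:{0..tt n}|lebesgue. (stepK s - ker s) * z s) = (LINT r:{0..tt n}|lebesgue. (kap1 r - kap2 r) * z' r)"
  using by_parts(2)[OF order_refl tt_n_nonneg z', of z] z z0 by simp
 then show ?thesis
  using cellwise_bound[of "%r. kap1 r - kap2 r" z' "2 / (1 - \<alpha>)"] borel_kernels z' kap_errors(1) by simp
qed

lemma ker_by_parts:
 assumes w': "w' \<in> borel_measurable borel" "set_integrable lebesgue {0..tt n} w'"
  and w: "!!s. s \<in> {0..tt n} ==> w s = (LINT r:{0..s}|lebesgue. w' r)"
 shows "(LINT s:{0..tt n}|lebesgue. ker s * w s) = (LINT r:{0..tt n}|lebesgue. kap2 r * w' r)"
  and "set_integrable lebesgue {0..tt n} (%r. kap2 r * w' r)"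
proof -
 have ab: "set_integrable lebesgue {0..tt n} (%r. \<bar>w' r\<bar>)" using w'(2) by (rule set_integrable_abs)
 note [measurable] = borel_kernels
 have m: "(%(s, r::real). ker s) \<in> borel_measurable borel"
  using measurable_compose[OF measurable_fst borel_kernels(5), of "borel :: real measure"]
  by (simp add: borel_prod case_prod_beta')
 have kb2: "kap2 r <= kap2 0" if "0 < r" "r < tt n" for r
  unfolding kap2_def using that \<alpha> Gamma_pos1 by (intro divide_right_mono powr_mono2) auto
 have "(LINT s:{0..tt n}|lebesgue. ker s * w s) = (LINT s:{0..tt n}|lebesgue. LINT r:{0..s}|lebesgue. ker s * w' r)"
  using w by (intro set_lebesgue_integral_cong) auto
 also have "... = (LINT r:{0..tt n}|lebesgue. kap2 r * w' r)"
  by (rule triangle_Fubini(2)[OF m kernels_nonneg(2) w' ker_integral kb2]) auto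
 finally show "(LINT s:{0..tt n}|lebesgue. ker s * w s) = (LINT r:{0..tt n}|lebesgue. kap2 r * w' r)" .
 have k2: "\<bar>kap2 r\<bar> <= kap2 0" if "r \<in> {0..tt n}" for r
  unfolding kap2_def using that \<alpha> Gamma_pos1 by (auto intro!: divide_right_mono powr_mono2)
 show "set_integrable lebesgue {0..tt n} (%r. kap2 r * w' r)"
  by (rule set_integral_abs_le(1)[of _ "%r. kap2 0 * \<bar>w' r\<bar>"])
   (use ab k2 w'(1) borel_kernels(3) in \<open>auto simp: abs_mult intro!: set_integrable_mult_right mult_right_mono borel_set_borel_measurable\<close>)
qed

lemma quadrature_smooth:
 assumes w': "w' \<in> borel_measurable borel" "set_integrable lebesgue {0..tt n} w'"
  and w: "!!s. s \<in> {0..tt n} ==> w s = (LINT r:{0..s}|lebesgue. w' r)"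
 shows "\<bar>\<rho> * (\<Sum>k=0..n. A (n - k) * w (tt k)) - (LINT s:{0..tt n}|lebesgue. ker s * w s)\<bar>
  <= 2 / (1 - \<alpha>) * \<rho> * (\<Sum>i=1..n. A (n - i) * (LINT s:{tt (i - 1)..tt i}|lebesgue. \<bar>w' s\<bar>))"
proof -
 have trm: "set_integrable lebesgue {0..tt n} (%r. (if r <= tt k then 1 else 0) * w' r)"
  "(LINT r:{0..tt n}|lebesgue. (if r <= tt k then 1 else 0) * w' r) = w (tt k)" if k: "k <= n" for k
 proof -
  have eq: "(%r. indicator {0..tt n} r *\<^sub>R ((if r <= tt k then 1 else 0) * w' r)) = (%r. indicator {0..tt k} r *\<^sub>R w' r)"
   using tt_mono[OF k] by (auto simp: indicator_def fun_eq_iff)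
  have "set_integrable lebesgue {0..tt k} w'" using tt_mono[OF k] by (intro set_integrable_subset[OF w'(2)]) auto
  then show "set_integrable lebesgue {0..tt n} (%r. (if r <= tt k then 1 else 0) * w' r)" unfolding set_integrable_def eq .
  show "(LINT r:{0..tt n}|lebesgue. (if r <= tt k then 1 else 0) * w' r) = w (tt k)"
   using w[of "tt k"] tt_mono[OF k] \<rho> unfolding set_lebesgue_integral_def eq by simp
 qed
 have S: "\<rho> * (\<Sum>k=0..n. A (n - k) * w (tt k)) = (LINT r:{0..tt n}|lebesgue. stepS r * w' r)"
  "set_integrable lebesgue {0..tt n} (%r. stepS r * w' r)"
 proof -
  have i: "set_integrable lebesgue {0..tt n} (%r. \<rho> * A (n - k) * ((if r <= tt k then 1 else 0) * w' r))" if "k \<in> {0..n}" for k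
   using trm(1)[of k] that by (intro set_integrable_mult_right) auto
  have eq: "stepS r * w' r = (\<Sum>k=0..n. \<rho> * A (n - k) * ((if r <= tt k then 1 else 0) * w' r))" for r
   by (simp only: stepS_def sum_distrib_left sum_distrib_right mult.assoc)
  show "set_integrable lebesgue {0..tt n} (%r. stepS r * w' r)" unfolding eq using i by (intro absolutely_integrable_sum) auto
  have "(LINT r:{0..tt n}|lebesgue. stepS r * w' r) = (\<Sum>k=0..n. LINT r:{0..tt n}|lebesgue. \<rho> * A (n - k) * ((if r <= tt k then 1 else 0) * w' r))"
   unfolding eq using i by (intro set_integral_sum_lebesgue) auto
  also have "... = (\<Sum>k=0..n. \<rho> * A (n - k) * w (tt k))" using trm(2) by (intro sum.cong) auto
  finally show "\<rho> * (\<Sum>k=0..n. A (n - k) * w (tt k)) = (LINT r:{0..tt n}|lebesgue. stepS r * w' r)"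
   by (simp add: sum_distrib_left mult.assoc)
 qed
 note I = ker_by_parts[OF w' w]
 have "\<rho> * (\<Sum>k=0..n. A (n - k) * w (tt k)) - (LINT s:{0..tt n}|lebesgue. ker s * w s) = (LINT r:{0..tt n}|lebesgue. (stepS r - kap2 r) * w' r)"
  unfolding left_diff_distrib using S I by (simp add: set_integral_diff(2))
 then show ?thesis
  using cellwise_bound[of "%r. stepS r - kap2 r" w' "2 / (1 - \<alpha>)"] borel_kernels w' kap_errors(2) by simp
qed

definition C4 :: real where
 "C4 = 8 * C3 / \<alpha> + 4 / (1 - \<alpha>) + 8 / ((1 - \<alpha>) * (1 - \<alpha>))"

text \<open>Near \<open>s = 0\<close> the kernel error is \<open>O(\<rho> t\<^sup>-\<^sup>1\<^sup>-\<^sup>\<alpha>)\<close>; on the second half of the interval one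
 integrates by parts.\<close>

lemma truncation_singular:
 assumes n: "1 <= n" and z: "z \<in> borel_measurable borel" and z': "z' \<in> borel_measurable borel"
  and b: "!!s. 0 < s ==> s <= tt n ==> \<bar>z s\<bar> <= B * s powr (\<alpha> - 1)"
  and b': "!!s. 0 < s ==> s <= tt n ==> \<bar>z' s\<bar> <= B * s powr (\<alpha> - 2)"
  and d: "!!s. 0 < s ==> (z has_real_derivative z' s) (at s)"
 shows "\<bar>LINT s:{0..tt n}|lebesgue. (stepK s - ker s) * z s\<bar> <= C4 * B * \<rho> / tt n"
  and "set_integrable lebesgue {0..tt n} (%s. (stepK s - ker s) * z s)"
proof -
 define t where "t = tt n"
 have t: "0 < t" using n \<rho> by (simp add: t_def)
 define l where "l = t / 2"
 have l: "0 < l" "l < t" "t - l = l" "t = 2 * l" using t by (auto simp: l_def)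
 have "0 <= B * t powr (\<alpha> - 1)" using order_trans[OF abs_ge_zero b[of t]] t by (simp add: t_def)
 then have B0: "0 <= B" using t by (simp add: zero_le_mult_iff)
 have C30: "0 <= C3" using Gamma_pos1 by (simp add: C3_def)
 define h where "h s = (stepK s - ker s) * z s" for s
 have hm: "h \<in> borel_measurable borel" unfolding h_def using borel_kernels z by measurable
 \<comment> \<open>At s = 0 the majorant s powr (\<alpha> - 1) evaluates to 0, so the integrand is
   set to 0 there before the comparison.\<close>
 define h' where "h' s = (if s = 0 then 0 else h s)" for s
 have h'm: "h' \<in> borel_measurable borel" unfolding h'_def using hm by measurable
 define c where "c = C3 * (\<rho> * l powr (- 1 - \<alpha>)) * B"
 have le1: "\<bar>h' s\<bar> <= c * s powr (\<alpha> - 1)" if s: "s \<in> {0..l}" for s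
 proof (cases "s = 0")
  case False
  then have s0: "0 < s" "s < tt n" using s l by (auto simp: t_def)
  have "(tt n - s) powr (- 1 - \<alpha>) <= l powr (- 1 - \<alpha>)"
   using s l \<alpha> by (intro powr_mono2') (auto simp: t_def)
  then have "C3 * (\<rho> * (tt n - s) powr (- 1 - \<alpha>)) <= C3 * (\<rho> * l powr (- 1 - \<alpha>))" using C30 \<rho> by (intro mult_left_mono) auto
  then have "\<bar>stepK s - ker s\<bar> <= C3 * (\<rho> * l powr (- 1 - \<alpha>))" using stepK_error[OF s0] by (simp add: ker_def)
  then have "\<bar>h s\<bar> <= C3 * (\<rho> * l powr (- 1 - \<alpha>)) * (B * s powr (\<alpha> - 1))"
   unfolding h_def abs_mult using b[of s] s0 C30 \<rho> by (intro mult_mono) auto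
  then show ?thesis using False by (simp add: h'_def c_def mult.assoc)
 qed (simp add: h'_def)
 have p1: "set_integrable lebesgue {0..l} (%s. c * s powr (\<alpha> - 1))" "(LINT s:{0..l}|lebesgue. c * s powr (\<alpha> - 1)) = c * (l powr \<alpha> / \<alpha>)"
  using powr_left_lebesgue[of \<alpha> 0 l] l \<alpha> by auto
 note I1 = set_integral_abs_le[OF p1(1) borel_set_borel_measurable[OF h'm] le1]
 have "h' absolutely_integrable_on {0..l}" using I1(1) by simp
 then have i1: "h absolutely_integrable_on {0..l}"
  by (rule absolutely_integrable_spike[OF _ negligible_sing[of 0]]) (simp add: h'_def)
 have v1: "\<bar>integral {0..l} h\<bar> <= c * (l powr \<alpha> / \<alpha>)"
 proof -
  have "integral {0..l} h = integral {0..l} h'" by (rule integral_spike[OF negligible_sing[of 0]]) (auto simp: h'_def)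
  then show ?thesis using I1 p1(2) by (simp add: set_lebesgue_integral_eq_integral)
 qed
 have z'i: "set_integrable lebesgue {l..tt n} z'"
 proof (rule set_integral_abs_le(1)[of _ "%s. B * l powr (\<alpha> - 2)"])
  show "set_integrable lebesgue {l..tt n} (%s. B * l powr (\<alpha> - 2))"
   by (rule absolutely_integrable_continuous_real) (intro continuous_intros)
  show "set_borel_measurable lebesgue {l..tt n} z'" using z' by (intro borel_set_borel_measurable) auto
  fix s assume s: "s \<in> {l..tt n}"
  have "\<bar>z' s\<bar> <= B * s powr (\<alpha> - 2)" using b'[of s] s l by auto
  also have "... <= B * l powr (\<alpha> - 2)" using B0 s l \<alpha> by (intro mult_left_mono powr_mono2') auto
  finally show "\<bar>z' s\<bar> <= B * l powr (\<alpha> - 2)" .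
 qed
 have zl: "z s = z l + (LINT r:{l..s}|lebesgue. z' r)" if s: "s \<in> {l..tt n}" for s
 proof -
  have "(z' has_integral (z s - z l)) {l..s}"
  proof (rule fundamental_theorem_of_calculus)
   show "l <= s" using s by simp
   fix x assume "x \<in> {l..s}"
   then show "(z has_vector_derivative z' x) (at x within {l..s})"
    using d[of x] l by (auto simp: has_real_derivative_iff_has_vector_derivative intro: has_vector_derivative_at_within)
  qed
  moreover have "set_integrable lebesgue {l..s} z'" using s by (intro set_integrable_subset[OF z'i]) auto
  ultimately show ?thesis by (simp add: set_lebesgue_integral_eq_integral integral_unique)
 qed
 have ll: "0 <= l" "l <= tt n" using l by (auto simp: t_def)
 note BP = by_parts[OF ll z' z'i zl]
 have i2: "h absolutely_integrable_on {l..t}" using BP(1) by (simp add: h_def[abs_def] t_def)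
 have kerr: "\<bar>kap1 r - kap2 r\<bar> <= 2 / (1 - \<alpha>) * (\<rho> * (t - r) powr (- \<alpha>))" if "l <= r" "r < t" for r
  using kap1_error_powr[of r] that l by (simp add: t_def)
 have v2: "\<bar>z l * (kap1 l - kap2 l)\<bar> <= B * l powr (\<alpha> - 1) * (2 / (1 - \<alpha>) * (\<rho> * l powr (- \<alpha>)))"
  unfolding abs_mult using b[of l] kerr[of l] l B0 by (intro mult_mono) (auto simp: t_def)
 define g where "g r = (if r = t then 0 else (kap1 r - kap2 r) * z' r)" for r
 have gm: "g \<in> borel_measurable borel" unfolding g_def using borel_kernels z' by measurable
 define c2 where "c2 = 2 / (1 - \<alpha>) * \<rho> * (B * l powr (\<alpha> - 2))"
 have le2: "\<bar>g r\<bar> <= c2 * (t - r) powr (- \<alpha>)" if r: "r \<in> {l..t}" for r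
 proof (cases "r = t")
  case False
  then have r': "l <= r" "r < t" using r by auto
  have "\<bar>z' r\<bar> <= B * r powr (\<alpha> - 2)" using b'[of r] r' l by (auto simp: t_def)
  also have "... <= B * l powr (\<alpha> - 2)" using B0 r' l \<alpha> by (intro mult_left_mono powr_mono2') auto
  finally have "\<bar>(kap1 r - kap2 r) * z' r\<bar> <= 2 / (1 - \<alpha>) * (\<rho> * (t - r) powr (- \<alpha>)) * (B * l powr (\<alpha> - 2))"
   unfolding abs_mult using kerr[OF r'] \<alpha> \<rho> by (intro mult_mono) auto
  then show ?thesis using False by (simp add: g_def c2_def mult_ac)
 qed (simp add: g_def)
 have p2: "set_integrable lebesgue {l..t} (%r. c2 * (t - r) powr (- \<alpha>))" "(LINT r:{l..t}|lebesgue. c2 * (t - r) powr (- \<alpha>)) = c2 * (l powr (1 - \<alpha>) / (1 - \<alpha>))"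
  using powr_right_lebesgue[of "1 - \<alpha>" l t] l \<alpha> by auto
 note I2 = set_integral_abs_le[OF p2(1) borel_set_borel_measurable[OF gm] le2]
 have v3: "\<bar>LINT r:{l..t}|lebesgue. (kap1 r - kap2 r) * z' r\<bar> <= c2 * (l powr (1 - \<alpha>) / (1 - \<alpha>))"
 proof -
  have "(LINT r:{l..t}|lebesgue. (kap1 r - kap2 r) * z' r) = integral {l..t} (%r. (kap1 r - kap2 r) * z' r)"
   using BP(3) by (simp add: set_lebesgue_integral_eq_integral t_def)
  also have "... = integral {l..t} g" by (rule integral_spike[OF negligible_sing[of t]]) (auto simp: g_def)
  finally show ?thesis using I2 p2(2) by (simp add: set_lebesgue_integral_eq_integral)
 qed
 have comb: "h absolutely_integrable_on {0..t}" "integral {0..t} h = integral {0..l} h + integral {l..t} h"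
 proof -
  have "h integrable_on {0..t}" "(%x. norm (h x)) integrable_on {0..t}"
   using i1 i2 l Henstock_Kurzweil_Integration.integrable_combine[of 0 l t h]
    Henstock_Kurzweil_Integration.integrable_combine[of 0 l t "%x. norm (h x)"]
   unfolding absolutely_integrable_on_def by linarith+
  then show "h absolutely_integrable_on {0..t}" by (simp add: absolutely_integrable_on_def)
  show "integral {0..t} h = integral {0..l} h + integral {l..t} h"
   using Henstock_Kurzweil_Integration.integral_combine[OF _ _ \<open>h integrable_on {0..t}\<close>, of l] l by simp
 qed
 then show "set_integrable lebesgue {0..tt n} (%s. (stepK s - ker s) * z s)" by (simp add: h_def[abs_def] t_def)
 \<comment> \<open>In each of the three pieces the exponents of l add up to -1, so all are multiples
   of B \<rho> / l with l = t / 2.\<close>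
 have lp: "l powr (- 1 - \<alpha>) * l powr \<alpha> = 1 / l" "l powr (\<alpha> - 1) * l powr (- \<alpha>) = 1 / l" "l powr (\<alpha> - 2) * l powr (1 - \<alpha>) = 1 / l"
  unfolding powr_add[symmetric] using l(1) by (simp_all add: powr_minus_divide)
 have e1: "c * (l powr \<alpha> / \<alpha>) = C3 / \<alpha> * B * \<rho> * (1 / l)"
  unfolding c_def lp(1)[symmetric] by simp
 have e2: "B * l powr (\<alpha> - 1) * (2 / (1 - \<alpha>) * (\<rho> * l powr (- \<alpha>))) = 2 / (1 - \<alpha>) * B * \<rho> * (1 / l)"
  unfolding lp(2)[symmetric] by simp
 have e3: "c2 * (l powr (1 - \<alpha>) / (1 - \<alpha>)) = 2 / ((1 - \<alpha>) * (1 - \<alpha>)) * B * \<rho> * (1 / l)"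
  unfolding c2_def lp(3)[symmetric] by simp
 have alg: "x * B * \<rho> * (1 / l) + y * B * \<rho> * (1 / l) + w * B * \<rho> * (1 / l) = (2 * x + 2 * y + 2 * w) * (B * \<rho> / (2 * l))" for x y w
  using l(1) by (simp add: field_simps)
 have abs3: "\<bar>x + (y + w)\<bar> <= e + e' + e''" if "\<bar>x\<bar> <= e" "\<bar>y\<bar> <= e'" "\<bar>w\<bar> <= e''" for x y w e e' e'' :: real
  using that by linarith
 have "integral {l..t} h = z l * (kap1 l - kap2 l) + (LINT r:{l..t}|lebesgue. (kap1 r - kap2 r) * z' r)"
  using BP(2) i2 by (simp add: set_lebesgue_integral_eq_integral h_def[abs_def] t_def)
 then have tot: "integral {0..t} h = integral {0..l} h + (z l * (kap1 l - kap2 l) + (LINT r:{l..t}|lebesgue. (kap1 r - kap2 r) * z' r))"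
  by (simp only: comb(2))
 have "\<bar>integral {0..t} h\<bar> <= C3 / \<alpha> * B * \<rho> * (1 / l) + 2 / (1 - \<alpha>) * B * \<rho> * (1 / l) + 2 / ((1 - \<alpha>) * (1 - \<alpha>)) * B * \<rho> * (1 / l)"
  unfolding tot unfolding e1[symmetric] unfolding e2[symmetric] unfolding e3[symmetric]
  by (rule abs3[OF v1 v2 v3])
 also have "... = (2 * C3 / \<alpha> + 4 / (1 - \<alpha>) + 4 / ((1 - \<alpha>) * (1 - \<alpha>))) * (B * \<rho> / t)"
  using alg[of "C3 / \<alpha>" "2 / (1 - \<alpha>)" "2 / ((1 - \<alpha>) * (1 - \<alpha>))"] unfolding l(4) by (simp only: times_divide_eq_right) simp
 also have "... <= C4 * (B * \<rho> / t)"
 proof (rule mult_right_mono)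
  have "2 * C3 / \<alpha> <= 8 * C3 / \<alpha>" "4 / ((1 - \<alpha>) * (1 - \<alpha>)) <= 8 / ((1 - \<alpha>) * (1 - \<alpha>))"
   using C30 \<alpha> by (auto intro!: divide_right_mono)
  then show "2 * C3 / \<alpha> + 4 / (1 - \<alpha>) + 4 / ((1 - \<alpha>) * (1 - \<alpha>)) <= C4" unfolding C4_def by linarith
 qed (use B0 \<rho> t in auto)
 finally show "\<bar>LINT s:{0..tt n}|lebesgue. (stepK s - ker s) * z s\<bar> <= C4 * B * \<rho> / tt n"
  using comb(1) \<rho> by (simp add: set_lebesgue_integral_eq_integral h_def[abs_def] t_def)
qed

end

section \<open>Truncation of the time derivative and regularity of the delayed term\<close>

context delay_problem begin

definition Y2c :: "real => real => real" where "Y2c x t = indicator ({0..L} \<times> {0..T}) (x, t) * Y2 x t"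

lemma Y2c_borel: "(%p. Y2c (fst p) (snd p)) \<in> borel_measurable borel"
 using Y2_L1_L2 unfolding in_L1_L2_def Y2c_def set_borel_measurable_def T_def by (simp add: case_prod_beta')

lemma Y2c_eq: "x \<in> {0..L} ==> t \<in> {0..T} ==> Y2c x t = Y2 x t" by (simp add: Y2c_def)

lemma Y2c_integrable: "x \<in> {0..L} ==> set_integrable lebesgue {0..T} (Y2c x)"
proof -
 assume x: "x \<in> {0..L}"
 have "(%s. indicator {0..T} s *\<^sub>R Y2c x s) = (%s. indicator {0..T} s *\<^sub>R Y2 x s)"
  using x by (auto simp: fun_eq_iff indicator_def Y2c_eq)
 then show ?thesis using Y2_L1[OF x] unfolding set_integrable_def T_def by simp
qed

lemma Y1_integral: "x \<in> {0..L} ==> t \<in> {0..T} ==> Y1 x t = (LINT s:{0..t}|lebesgue. Y2c x s)"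
 using Y2_deriv[of x t] Y_zero[of x]
 by (subst set_lebesgue_integral_cong[of _ _ _ "Y2 x"]) (auto simp: Y2c_eq T_def)

definition zd :: "real => real => real" where
 "zd x t = (\<Sum>j=1..m. \<gamma> j x * (real j * \<alpha>) * ((real j * \<alpha> - 1) * t powr (real j * \<alpha> - 2)))"

lemma z_sing_deriv: "0 < t ==> (z_sing x has_real_derivative zd x t) (at t)"
 unfolding z_sing_def[abs_def] zd_def
 by (auto intro!: derivative_eq_intros simp: mult_ac diff_diff_eq)

lemma zd_bound:
 assumes x: "x \<in> {0..L}" and t: "0 < t" "t <= T"
 shows "\<bar>zd x t\<bar> <= Cz * t powr (\<alpha> - 2)"
proof -
 have "\<bar>zd x t\<bar> <= (\<Sum>j=1..m. \<bar>\<gamma> j x * (real j * \<alpha>) * ((real j * \<alpha> - 1) * t powr (real j * \<alpha> - 2))\<bar>)"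
  unfolding zd_def by (rule sum_abs)
 also have "... <= (\<Sum>j=1..m. C\<gamma> * T powr (real j * \<alpha> - \<alpha>) * t powr (\<alpha> - 2))"
 proof (rule sum_mono)
  fix j assume j: "j \<in> {1..m}"
  have "t powr (real j * \<alpha> - 2) <= T powr (real j * \<alpha> - \<alpha>) * t powr (\<alpha> - 2)"
   using powr_le_sing[OF t, of "\<alpha> - 2" "real j * \<alpha> - 2"] j\<alpha>[OF j] by simp
  moreover have "\<bar>\<gamma> j x\<bar> <= C\<gamma>" using C\<gamma>(2)[of j x] j x by auto
  moreover have "\<bar>(real j * \<alpha>) * (real j * \<alpha> - 1)\<bar> <= 1 * 1"
   unfolding abs_mult using j\<alpha>[OF j] \<alpha> by (intro mult_mono) auto
  ultimately have "\<bar>\<gamma> j x\<bar> * (\<bar>(real j * \<alpha>) * (real j * \<alpha> - 1)\<bar> * t powr (real j * \<alpha> - 2)) <= C\<gamma> * (1 * (T powr (real j * \<alpha> - \<alpha>) * t powr (\<alpha> - 2)))"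
   using C\<gamma>(1) by (intro mult_mono mult_nonneg_nonneg) auto
  then show "\<bar>\<gamma> j x * (real j * \<alpha>) * ((real j * \<alpha> - 1) * t powr (real j * \<alpha> - 2))\<bar> <= C\<gamma> * T powr (real j * \<alpha> - \<alpha>) * t powr (\<alpha> - 2)"
   by (simp add: abs_mult mult_ac)
 qed
 also have "... <= Cz * t powr (\<alpha> - 2)"
  unfolding Cz_def sum_distrib_right[symmetric] using C\<gamma>(1) CY1(1) by (intro mult_right_mono) auto
 finally show ?thesis .
qed

text \<open>The power part of the derivative gives a multiple of \<rho> / t_n = 1 / n; the part Y1,
  being the integral of Y2, contributes cell integrals of |Y2| only.\<close>

lemma truncation_derivative:
 fixes N n :: nat
 defines "\<rho> \<equiv> \<tau> / real N"
 assumes x: "x \<in> {0..L}" and N: "0 < N" and n: "n \<in> {1..K * N}"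
 shows "\<bar>(\<Sum>k=1..n. grid.A \<alpha> \<rho> (n - k) * (u x (real k * \<rho>) - u x (real (k - 1) * \<rho>)))
   - (LINT s:{0..real n * \<rho>}|lebesgue. grid.ker \<alpha> \<rho> n s * utc x s)\<bar>
  <= grid.C4 \<alpha> * Cz / real n
   + 2 / (1 - \<alpha>) * \<rho> * (\<Sum>i=1..n. grid.A \<alpha> \<rho> (n - i) * (LINT s:{real (i - 1) * \<rho>..real i * \<rho>}|lebesgue. \<bar>Y2c x s\<bar>))"
  and "set_integrable lebesgue {0..real n * \<rho>} (%s. grid.ker \<alpha> \<rho> n s * utc x s)"
proof -
 have \<rho>: "0 < \<rho>" using \<tau> N by (simp add: \<rho>_def)
 interpret grid \<alpha> \<rho> n by unfold_locales (use \<alpha> \<rho> in auto)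
 have "real n <= real (K * N)" using n by (subst of_nat_le_iff) simp
 then have "real n * \<rho> <= real (K * N) * \<rho>" using \<rho> by (intro mult_right_mono) auto
 then have nT: "tt n <= T" using N by (simp add: T_def \<rho>_def)
 have tk: "0 <= tt k" "tt k <= T" if "k <= n" for k using order_trans[OF tt_mono[OF that] nT] \<rho> by auto
 define z where "z s = (if 0 < s then z_sing x s else 0)" for s
 have zb: "z \<in> borel_measurable borel" unfolding z_def z_sing_def by measurable
 have zdb: "zd x \<in> borel_measurable borel" unfolding zd_def by measurable
 have zder: "(z has_real_derivative zd x s) (at s)" if "0 < s" for s
  by (rule has_field_derivative_transform_within_open[OF z_sing_deriv[OF that], of "{0<..}"]) (use that in \<open>auto simp: z_def\<close>)
 have n1: "1 <= n" using n by simp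
 have zB: "\<bar>z s\<bar> <= Cz * s powr (\<alpha> - 1)" "\<bar>zd x s\<bar> <= Cz * s powr (\<alpha> - 2)" if "0 < s" "s <= tt n" for s
  using z_sing_bound(1)[OF x, of s] zd_bound[OF x, of s] that nT by (auto simp: z_def)
 note S1 = truncation_singular[OF n1 zb zdb zB zder]
 have Yi: "set_integrable lebesgue {0..tt n} (Y2c x)"
  using nT by (intro set_integrable_subset[OF Y2c_integrable[OF x]]) auto
 have Yb: "Y2c x \<in> borel_measurable borel" by (rule borel_section(1)[OF Y2c_borel])
 have Y1: "Y1 x s = (LINT r:{0..s}|lebesgue. Y2c x r)" if "s \<in> {0..tt n}" for s
  using that nT by (intro Y1_integral x) auto
 note S2 = truncation_smooth[OF Yb Yi Y1]
 have Y10: "Y1 x 0 = 0" using Y_zero x by blast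
 have S3: "set_integrable lebesgue {0..tt n} (%s. (stepK s - ker s) * Y1 x s)"
  using by_parts(1)[OF order_refl tt_n_nonneg Yb Yi, of "Y1 x"] Y1 Y10 by simp
 have split: "utc x s = z s + Y1 x s" if "s \<in> {0..tt n}" for s
  using that nT x Y10 by (auto simp: utc_def z_def ut_def)
 have ui: "set_integrable lebesgue {0..tt n} (utc x)"
 proof (rule set_integral_abs_le(1)[of _ "%s. Cz * s powr (\<alpha> - 1)"])
  show "set_integrable lebesgue {0..tt n} (%s. Cz * s powr (\<alpha> - 1))"
   using powr_left_lebesgue(1)[of \<alpha> 0 "tt n"] \<alpha> \<rho> by auto
 qed (use utc_bound borel_section(1)[OF utc_borel] in \<open>auto intro!: borel_set_borel_measurable\<close>)
 note C = cells_sum[OF ui]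
 have sum: "(\<Sum>k=1..n. A (n - k) * (u x (tt k) - u x (tt (k - 1)))) = (LINT s:{0..tt n}|lebesgue. stepK s * utc x s)"
  unfolding C(2)[symmetric]
 proof (intro sum.cong refl arg_cong2[where f = "(*)"])
  fix k assume k: "k \<in> {1..n}"
  have le: "tt (k - 1) <= tt k" by (rule tt_mono) simp
  have "set_integrable lebesgue {tt (k - 1)..tt k} (utc x)"
   using k tk[of "k - 1"] tt_mono[of k n] by (intro set_integrable_subset[OF ui]) auto
  then show "u x (tt k) - u x (tt (k - 1)) = (LINT s:{tt (k - 1)..tt k}|lebesgue. utc x s)"
   using integral_unique[OF utc_has_integral[OF x tk(1) le tk(2)]] k
   by (subst set_lebesgue_integral_eq_integral) auto
 qed
 have di: "set_integrable lebesgue {0..tt n} (%s. (stepK s - ker s) * utc x s)"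
  and de: "(LINT s:{0..tt n}|lebesgue. (stepK s - ker s) * utc x s) = (LINT s:{0..tt n}|lebesgue. (stepK s - ker s) * z s) + (LINT s:{0..tt n}|lebesgue. (stepK s - ker s) * Y1 x s)"
 proof -
  have eq: "indicator {0..tt n} s *\<^sub>R ((stepK s - ker s) * utc x s) = indicator {0..tt n} s *\<^sub>R ((stepK s - ker s) * z s + (stepK s - ker s) * Y1 x s)" for s
   using split[of s] by (auto simp: indicator_def distrib_left)
  show "set_integrable lebesgue {0..tt n} (%s. (stepK s - ker s) * utc x s)"
   using set_integral_add(1)[OF S1(2) S3] unfolding set_integrable_def eq .
  show "(LINT s:{0..tt n}|lebesgue. (stepK s - ker s) * utc x s) = (LINT s:{0..tt n}|lebesgue. (stepK s - ker s) * z s) + (LINT s:{0..tt n}|lebesgue. (stepK s - ker s) * Y1 x s)"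
   using set_integral_add(2)[OF S1(2) S3] unfolding set_lebesgue_integral_def eq .
 qed
 have "set_integrable lebesgue {0..tt n} (%s. stepK s * utc x s - (stepK s - ker s) * utc x s)"
  by (rule set_integral_diff(1)[OF C(1) di])
 then show ki: "set_integrable lebesgue {0..tt n} (%s. ker s * utc x s)" by (simp add: algebra_simps)
 have "(LINT s:{0..tt n}|lebesgue. stepK s * utc x s) - (LINT s:{0..tt n}|lebesgue. ker s * utc x s) = (LINT s:{0..tt n}|lebesgue. (stepK s - ker s) * utc x s)"
  using set_integral_diff(2)[OF C(1) ki] by (simp add: left_diff_distrib)
 moreover have "C4 * Cz * \<rho> / tt n = C4 * Cz / real n" using \<rho> by simp
 ultimately show "\<bar>(\<Sum>k=1..n. A (n - k) * (u x (tt k) - u x (tt (k - 1)))) - (LINT s:{0..tt n}|lebesgue. ker s * utc x s)\<bar>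
  <= C4 * Cz / real n + 2 / (1 - \<alpha>) * \<rho> * (\<Sum>i=1..n. A (n - i) * (LINT s:{tt (i - 1)..tt i}|lebesgue. \<bar>Y2c x s\<bar>))"
  using S1(1) S2 unfolding sum de by linarith
qed

definition dphic :: "real => real => real" where "dphic x s = d\<phi> x (clamp_real (-\<tau>) 0 s)"

definition wd :: "real => real => real" where "wd x s = dphic x (s - \<tau>) + utc x (s - \<tau>)"

text \<open>The function whose quadrature is actually formed once \<open>H_corr\<close> is added to
  the delay term; \<open>F_rhs\<close> compensates exactly. It vanishes at s = 0, and its derivative
  \<open>wd\<close> is the constant continuation of d\<phi> beyond 0 plus the derivative of u, both
  shifted by \<tau>.\<close>

definition wdelay :: "real => real => real" where
 "wdelay x s = u x (s - \<tau>) - \<phi> x (-\<tau>) + max 0 (s - \<tau>) * d\<phi> x 0"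

definition Bw :: "real => real" where
 "Bw s = C\<phi> + (if \<tau> < s then Cz * (s - \<tau>) powr (\<alpha> - 1) else 0)"

lemma C\<phi>_nonneg: "0 <= C\<phi>"
 using order_trans[OF abs_ge_zero dphi_bound[of 0 0]] L \<tau> by simp

lemma Bw_nonneg: "0 <= Bw s" using C\<phi>_nonneg Cz_nonneg by (simp add: Bw_def)

lemma continuous_dphic: "x \<in> {0..L} ==> continuous_on UNIV (dphic x)"
 unfolding dphic_def[abs_def]
 by (rule continuous_on_compose2[OF dphi_cont])
  (use clamp_real_in[of "-\<tau>" 0] \<tau> in \<open>auto simp: clamp_real_def[abs_def] intro!: continuous_intros\<close>)

lemma wd_borel: "x \<in> {0..L} ==> wd x \<in> borel_measurable borel"
proof -
 assume x: "x \<in> {0..L}"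
 have [measurable]: "dphic x \<in> borel_measurable borel" using continuous_dphic[OF x] by (rule borel_measurable_continuous_onI)
 have [measurable]: "utc x \<in> borel_measurable borel" by (rule borel_section(1)[OF utc_borel])
 show ?thesis unfolding wd_def[abs_def] by measurable
qed

lemma wd_bound: "x \<in> {0..L} ==> \<bar>wd x s\<bar> <= Bw s"
proof -
 assume x: "x \<in> {0..L}"
 have "\<bar>dphic x (s - \<tau>)\<bar> <= C\<phi>" unfolding dphic_def using x \<tau> clamp_real_in[of "-\<tau>" 0 "s - \<tau>"] by (intro dphi_bound) auto
 moreover have "utc x (s - \<tau>) = 0" if "s <= \<tau>" using that by (simp add: utc_def)
 ultimately show ?thesis using utc_bound[of x "s - \<tau>"] by (auto simp: wd_def Bw_def)
qed

lemma Bw_integrable: "set_integrable lebesgue {0..T} Bw"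
proof -
 have 1: "set_integrable lebesgue {\<tau>..T} (%s. Cz * (s - \<tau>) powr (\<alpha> - 1))"
  using powr_left_lebesgue(1)[of \<alpha> \<tau> T] \<tau>_le_T \<alpha> by auto
 have 2: "set_integrable lebesgue {0..T} (%s. C\<phi>)" by (rule absolutely_integrable_continuous_real) (intro continuous_intros)
 have "set_integrable lebesgue {0..T} (%s. if \<tau> < s then Cz * (s - \<tau>) powr (\<alpha> - 1) else 0)"
 proof -
  have "(%s. indicator {0..T} s *\<^sub>R (if \<tau> < s then Cz * (s - \<tau>) powr (\<alpha> - 1) else 0)) = (%s. indicator {\<tau>..T} s *\<^sub>R (Cz * (s - \<tau>) powr (\<alpha> - 1)))"
   using \<tau> by (auto simp: indicator_def fun_eq_iff)
  then show ?thesis using 1 unfolding set_integrable_def by simp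
 qed
 from set_integral_add(1)[OF 2 this] show ?thesis by (simp add: Bw_def[abs_def])
qed

lemma wd_integrable: "x \<in> {0..L} ==> set_integrable lebesgue {0..T} (wd x)"
 by (rule set_integral_abs_le(1)[OF Bw_integrable borel_set_borel_measurable[OF wd_borel]]) (auto intro: wd_bound)

lemma wdelay_integral:
 assumes x: "x \<in> {0..L}" and s: "s \<in> {0..T}"
 shows "wdelay x s = (LINT r:{0..s}|lebesgue. wd x r)"
proof -
 have early: "(wd x has_integral (\<phi> x (s - \<tau>) - \<phi> x (-\<tau>))) {0..s}" if s: "0 <= s" "s <= \<tau>" for s
 proof -
  have "((%r. d\<phi> x (r - \<tau>)) has_integral (\<phi> x (s - \<tau>) - \<phi> x (0 - \<tau>))) {0..s}"
  proof (rule fundamental_theorem_of_calculus)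
   fix r assume r: "r \<in> {0..s}"
   have "((%r. \<phi> x (r - \<tau>)) has_real_derivative d\<phi> x (r - \<tau>)) (at r within {0..s})"
   proof -
    have 1: "(\<phi> x has_real_derivative d\<phi> x (r - \<tau>)) (at (r - \<tau>) within (%r. r - \<tau>) ` {0..s})"
     by (rule has_field_derivative_subset[OF phi_deriv[OF x]]) (use r s in auto)
    have 2: "((%r. r - \<tau>) has_real_derivative 1) (at r within {0..s})" by (auto intro!: derivative_eq_intros)
    show ?thesis using DERIV_image_chain[OF 1 2] by (simp add: o_def)
   qed
   then show "((%r. \<phi> x (r - \<tau>)) has_vector_derivative d\<phi> x (r - \<tau>)) (at r within {0..s})"
    by (simp add: has_real_derivative_iff_has_vector_derivative)
  qed (use s in simp)
  moreover have "wd x r = d\<phi> x (r - \<tau>)" if "r \<in> {0..s}" for r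
   using that s by (auto simp: wd_def dphic_def clamp_real_id utc_def)
  ultimately show ?thesis by (subst has_integral_cong) auto
 qed
 have "(wd x has_integral wdelay x s) {0..s}"
 proof (cases "s <= \<tau>")
  case True
  then show ?thesis using early[of s] s u_init[OF x, of "s - \<tau>"] by (auto simp: wdelay_def)
 next
  case False
  have 1: "(utc x has_integral (u x (s - \<tau>) - u x 0)) {0..s - \<tau>}"
   using utc_has_integral[OF x, of 0 "s - \<tau>"] False s \<tau> by auto
  have "((%r. utc x (r - \<tau>)) has_integral (u x (s - \<tau>) - u x 0)) {\<tau>..s}"
   using 1 has_integral_shift_Icc_real[of "%r. utc x (r - \<tau>)" \<tau> "u x (s - \<tau>) - u x 0" 0 "s - \<tau>"] by (simp add: o_def)
  moreover have "((%r. d\<phi> x 0) has_integral (s - \<tau>) * d\<phi> x 0) {\<tau>..s}"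
   using has_integral_const_real[of "d\<phi> x 0" \<tau> s] False by simp
  ultimately have "((%r. d\<phi> x 0 + utc x (r - \<tau>)) has_integral ((s - \<tau>) * d\<phi> x 0 + (u x (s - \<tau>) - u x 0))) {\<tau>..s}"
   by (intro has_integral_add)
  then have "(wd x has_integral ((s - \<tau>) * d\<phi> x 0 + (u x (s - \<tau>) - u x 0))) {\<tau>..s}"
   by (subst has_integral_cong[of _ _ "%r. d\<phi> x 0 + utc x (r - \<tau>)"]) (use \<tau> in \<open>auto simp: wd_def dphic_def clamp_real_def\<close>)
  then have "(wd x has_integral (\<phi> x 0 - \<phi> x (-\<tau>) + ((s - \<tau>) * d\<phi> x 0 + (u x (s - \<tau>) - u x 0)))) {0..s}"
   using early[of \<tau>] \<tau> False by (intro has_integral_combine[of 0 \<tau> s]) auto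
  then show ?thesis using False u_init[OF x, of 0] \<tau> by (simp add: wdelay_def algebra_simps)
 qed
 moreover have "set_integrable lebesgue {0..s} (wd x)" using s by (intro set_integrable_subset[OF wd_integrable[OF x]]) auto
 ultimately show ?thesis by (simp add: set_lebesgue_integral_eq_integral integral_unique)
qed


lemma Y2c_measurable [measurable (raw)]:
 assumes "f' \<in> borel_measurable M" "g' \<in> borel_measurable M"
 shows "(%z. Y2c (f' z) (g' z)) \<in> borel_measurable M"
proof -
 have c: "(%z. (f' z, g' z)) \<in> measurable M (borel \<Otimes>\<^sub>M borel)" using assms by measurable
 have m: "(%p. Y2c (fst p) (snd p)) \<in> borel_measurable (borel \<Otimes>\<^sub>M borel)" unfolding borel_prod by (rule Y2c_borel)
 show ?thesis using measurable_compose[OF c m] by simp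
qed

text \<open>Minkowski's integral inequality: the squared norm of the time integral is a triple
  integral over x, s, s'. Integrating in x first, Cauchy-Schwarz for almost all s and s' bounds it
  by a product of norms. Extended nonnegative integrals are used because finiteness is part of the
  claim.\<close>

lemma Minkowski_cell:
 assumes cd: "0 <= c" "d <= T"
 shows "in_L2 L (%x. LINT s:{c..d}|lebesgue. \<bar>Y2c x s\<bar>)"
  and "norm_L2 L (%x. LINT s:{c..d}|lebesgue. \<bar>Y2c x s\<bar>) <= (LINT s:{c..d}|lebesgue. norm_L2 L (%x. Y2 x s))"
proof -
 interpret L2: semi_inner "{v. in_L2 L v}" "inner_L2 L" by (rule semi_inner_L2)
 define G where "G x = (LINT s:{c..d}|lebesgue. \<bar>Y2c x s\<bar>)" for x
 define nn where "nn s = norm_L2 L (%x. Y2 x s)" for s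
 define I where "I = (LINT s:{c..d}|lebesgue. nn s)"
 have Gb: "G \<in> borel_measurable borel" unfolding G_def by (rule borel_param_integral, rule borel_measurable_abs, rule Y2c_borel)
 have G0: "0 <= G x" for x unfolding G_def set_lebesgue_integral_def by (intro integral_nonneg_AE) auto
 define h where "h x s = ennreal (indicator {c..d} s * \<bar>Y2c x s\<bar>)" for x s
 have hm [measurable]: "(%z. h (f' z) (g' z)) \<in> borel_measurable M" if [measurable]: "f' \<in> borel_measurable M" "g' \<in> borel_measurable M" for f' g' and M :: "'a measure"
  unfolding h_def by measurable
 have Gh: "ennreal (G x) = (\<integral>\<^sup>+ s. h x s \<partial>lborel)" for x
 proof (cases "x \<in> {0..L}")
  case True
  have "set_integrable lebesgue {c..d} (Y2c x)" using cd by (intro set_integrable_subset[OF Y2c_integrable[OF True]]) auto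
  then have "set_integrable lebesgue {c..d} (%s. \<bar>Y2c x s\<bar>)" by (rule set_integrable_abs)
  then have "integrable lebesgue (%s. indicator {c..d} s * \<bar>Y2c x s\<bar>)" by (simp add: set_integrable_def)
  from nn_integral_eq_integral[OF this] show ?thesis
   by (simp add: h_def G_def set_lebesgue_integral_def nn_integral_completion)
 next
  case False
  then have "Y2c x s = 0" for s by (auto simp: Y2c_def indicator_def)
  then show ?thesis by (simp add: h_def G_def)
 qed
 have ni: "set_integrable lebesgue {0..T} nn" and nQ: "AE t in lebesgue. t \<in> {0..T} --> in_L2 L (%x. Y2 x t)"
  using Y2_L1_L2 by (auto simp: in_L1_L2_def T_def nn_def[abs_def])
 have nic: "integrable lebesgue (%s. indicator {c..d} s * nn s)"
  using set_integrable_subset[OF ni, of "{c..d}"] cd by (simp add: set_integrable_def)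
 define e where "e s = ennreal (indicator {c..d} s * nn s)" for s
 have em [measurable]: "e \<in> borel_measurable lebesgue" unfolding e_def using borel_measurable_integrable[OF nic] by measurable
 have eI: "(\<integral>\<^sup>+ s. e s \<partial>lebesgue) = ennreal I"
  unfolding e_def I_def set_lebesgue_integral_def using nn_integral_eq_integral[OF nic] by (simp add: nn_def)
 have I0: "0 <= I" unfolding I_def set_lebesgue_integral_def nn_def by (intro integral_nonneg_AE) auto
 have prod: "(\<integral>\<^sup>+ x. h x s * h x s' \<partial>lborel) <= e s * e s'"
  if "s \<in> {0..T} --> in_L2 L (%x. Y2 x s)" "s' \<in> {0..T} --> in_L2 L (%x. Y2 x s')" for s s'
 proof (cases "s \<in> {c..d} & s' \<in> {c..d}")
  case True
  then have sT: "s \<in> {0..T}" "s' \<in> {0..T}" using cd by auto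
  have ab: "in_L2 L (%x. \<bar>Y2 x r\<bar>)" "norm_L2 L (%x. \<bar>Y2 x r\<bar>) = nn r" if "in_L2 L (%x. Y2 x r)" for r
  proof -
   have "set_borel_measurable lebesgue {0..L} (%x. \<bar>Y2 x r\<bar>)"
   proof -
    have "(%x. indicator {0..L} x *\<^sub>R \<bar>Y2 x r\<bar>) = (%x. \<bar>indicator {0..L} x *\<^sub>R Y2 x r\<bar>)" by (auto simp: abs_mult)
    then show ?thesis using that unfolding in_L2_def set_borel_measurable_def by (auto intro: borel_measurable_abs)
   qed
   then show "in_L2 L (%x. \<bar>Y2 x r\<bar>)" using that by (simp add: in_L2_def)
   show "norm_L2 L (%x. \<bar>Y2 x r\<bar>) = nn r" by (simp add: norm_L2_def inner_L2_def nn_def flip: abs_mult)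
  qed
  note v = ab[OF that(1)[rule_format, OF sT(1)]] and w = ab[OF that(2)[rule_format, OF sT(2)]]
  have pi: "integrable lebesgue (%x. indicator {0..L} x * (\<bar>Y2 x s\<bar> * \<bar>Y2 x s'\<bar>))"
   using in_L2_product_integrable[OF v(1) w(1)] by (simp add: set_integrable_def)
  have "h x s * h x s' = ennreal (indicator {0..L} x * (\<bar>Y2 x s\<bar> * \<bar>Y2 x s'\<bar>))" for x
   using True sT by (auto simp: h_def Y2c_def indicator_def ennreal_mult')
  then have "(\<integral>\<^sup>+ x. h x s * h x s' \<partial>lborel) = (\<integral>\<^sup>+ x. ennreal (indicator {0..L} x * (\<bar>Y2 x s\<bar> * \<bar>Y2 x s'\<bar>)) \<partial>lebesgue)"
   by (simp add: nn_integral_completion)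
  also have "... = ennreal (inner_L2 L (%x. \<bar>Y2 x s\<bar>) (%x. \<bar>Y2 x s'\<bar>))"
   unfolding inner_L2_def set_lebesgue_integral_def using nn_integral_eq_integral[OF pi] by simp
  also have "... <= ennreal (nn s * nn s')"
   using L2.Cauchy_Schwarz[of "%x. \<bar>Y2 x s\<bar>" "%x. \<bar>Y2 x s'\<bar>"] v w by (intro ennreal_leI) (simp add: nrm_L2)
  also have "... = e s * e s'" using True by (simp add: e_def ennreal_mult' nn_def)
  finally show ?thesis .
 qed (auto simp: h_def)
 have "(\<integral>\<^sup>+ x. ennreal ((G x)\<^sup>2) \<partial>lborel) = (\<integral>\<^sup>+ x. (\<integral>\<^sup>+ s. h x s \<partial>lborel) * (\<integral>\<^sup>+ s'. h x s' \<partial>lborel) \<partial>lborel)"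
  using G0 by (simp add: power2_eq_square ennreal_mult' flip: Gh)
 also have "... = (\<integral>\<^sup>+ x. \<integral>\<^sup>+ s. \<integral>\<^sup>+ s'. h x s * h x s' \<partial>lborel \<partial>lborel \<partial>lborel)"
  by (simp add: nn_integral_cmult nn_integral_multc)
 also have "... = (\<integral>\<^sup>+ s. \<integral>\<^sup>+ x. \<integral>\<^sup>+ s'. h x s * h x s' \<partial>lborel \<partial>lborel \<partial>lborel)"
  by (rule lborel_pair.Fubini') measurable
 also have "... = (\<integral>\<^sup>+ s. \<integral>\<^sup>+ s'. \<integral>\<^sup>+ x. h x s * h x s' \<partial>lborel \<partial>lborel \<partial>lborel)"
  by (intro nn_integral_cong lborel_pair.Fubini') measurable
 also have "... = (\<integral>\<^sup>+ s. \<integral>\<^sup>+ s'. \<integral>\<^sup>+ x. h x s * h x s' \<partial>lborel \<partial>lebesgue \<partial>lebesgue)"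
  by (simp add: nn_integral_completion)
 also have "... <= (\<integral>\<^sup>+ s. \<integral>\<^sup>+ s'. e s * e s' \<partial>lebesgue \<partial>lebesgue)"
 proof (rule nn_integral_mono_AE)
  show "AE s in lebesgue. (\<integral>\<^sup>+ s'. \<integral>\<^sup>+ x. h x s * h x s' \<partial>lborel \<partial>lebesgue) <= (\<integral>\<^sup>+ s'. e s * e s' \<partial>lebesgue)"
   using nQ
  proof eventually_elim
   case (elim s)
   show ?case using nQ by (intro nn_integral_mono_AE) (auto elim!: eventually_mono intro!: prod elim)
  qed
 qed
 also have "... = ennreal I * ennreal I" by (simp add: nn_integral_cmult nn_integral_multc eI)
 also have "... = ennreal (I\<^sup>2)" using I0 by (simp add: power2_eq_square ennreal_mult')
 finally have le: "(\<integral>\<^sup>+ x. ennreal ((G x)\<^sup>2) \<partial>lborel) <= ennreal (I\<^sup>2)" .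
 then have le': "(\<integral>\<^sup>+ x. ennreal (indicator {0..L} x * (G x)\<^sup>2) \<partial>lebesgue) <= ennreal (I\<^sup>2)"
  unfolding nn_integral_completion
  by (rule order_trans[rotated]) (auto intro!: nn_integral_mono simp: indicator_def)
 have m: "(%x. indicator {0..L} x * (G x)\<^sup>2) \<in> borel_measurable lebesgue"
  using borel_set_borel_measurable[of "%x. (G x)\<^sup>2" "{0..L}"] Gb by (simp add: set_borel_measurable_def)
 have gi: "integrable lebesgue (%x. indicator {0..L} x * (G x)\<^sup>2)"
  by (rule integrableI_nonneg[OF m]) (use le' in \<open>auto intro: le_less_trans\<close>)
 show "in_L2 L (%x. LINT s:{c..d}|lebesgue. \<bar>Y2c x s\<bar>)"
  unfolding in_L2_def using gi borel_set_borel_measurable[OF Gb, of "{0..L}"] by (simp add: G_def[abs_def] set_integrable_def)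
 have "ennreal ((norm_L2 L G)\<^sup>2) <= ennreal (I\<^sup>2)"
  using le' unfolding norm_L2_sq set_lebesgue_integral_def real_scaleR_def
  by (subst (asm) nn_integral_eq_integral[OF gi]) auto
 then have "(norm_L2 L G)\<^sup>2 <= I\<^sup>2" by (subst (asm) ennreal_le_iff) auto
 then have "norm_L2 L G <= I" by (rule power2_le_imp_le) (rule I0)
 then show "norm_L2 L (%x. LINT s:{c..d}|lebesgue. \<bar>Y2c x s\<bar>) <= (LINT s:{c..d}|lebesgue. norm_L2 L (%x. Y2 x s))"
  by (simp add: G_def[abs_def] I_def nn_def)
qed

end

section \<open>The residual of the exact solution\<close>

context grid begin

text \<open>With c = \<tau> this is the fractional integral of the ramp max 0 (s - \<tau>), the
  quantity by which \<open>F_rhs\<close> compensates the correction of the scheme.\<close>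

lemma ker_max:
 assumes c: "0 <= c"
 shows "(LINT s:{0..tt n}|lebesgue. ker s * max 0 (s - c)) = max 0 (tt n - c) powr (2 - \<alpha>) / Gamma (3 - \<alpha>)"
  and "set_integrable lebesgue {0..tt n} (%s. ker s * max 0 (s - c))"
proof -
 define w' :: "real => real" where "w' r = (if c <= r then 1 else 0)" for r
 have w'b: "w' \<in> borel_measurable borel" unfolding w'_def[abs_def] by measurable
 have eq: "(%r. indicator {0..s} r *\<^sub>R w' r) = (%r. indicator {c..s} r *\<^sub>R 1)" for s
  using c by (auto simp: w'_def indicator_def fun_eq_iff)
 have w'i: "set_integrable lebesgue {0..tt n} w'"
  unfolding set_integrable_def eq using absolutely_integrable_continuous_real[of c "tt n" "%r. 1 :: real"]
  by (simp add: set_integrable_def)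
 have w: "max 0 (s - c) = (LINT r:{0..s}|lebesgue. w' r)" for s
  unfolding set_lebesgue_integral_def eq by (cases "c <= s") auto
 have G3: "Gamma (3 - \<alpha>) = (2 - \<alpha>) * Gamma (2 - \<alpha>)"
  using Gamma_add_one_real[of "2 - \<alpha>"] \<alpha> by simp
 have "(LINT s:{0..tt n}|lebesgue. ker s * max 0 (s - c)) = (LINT r:{0..tt n}|lebesgue. kap2 r * w' r)"
  by (rule ker_by_parts(1)[OF w'b w'i w])
 also have "... = (LINT r:{c..tt n}|lebesgue. kap2 r)"
  unfolding set_lebesgue_integral_def using c
  by (intro arg_cong2[where f = lebesgue_integral] refl) (auto simp: w'_def indicator_def fun_eq_iff)
 also have "... = max 0 (tt n - c) powr (2 - \<alpha>) / Gamma (3 - \<alpha>)"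
 proof (cases "c <= tt n")
  case True
  have "(LINT r:{c..tt n}|lebesgue. kap2 r) = (LINT r:{c..tt n}|lebesgue. (tt n - r) powr (1 - \<alpha>)) / Gamma (2 - \<alpha>)"
   by (simp add: kap2_def[abs_def])
  also have "... = (tt n - c) powr (2 - \<alpha>) / (2 - \<alpha>) / Gamma (2 - \<alpha>)"
   using powr_right_lebesgue(2)[of "2 - \<alpha>" c "tt n"] True \<alpha> by simp
  finally show ?thesis using True by (simp add: G3)
 qed (simp add: set_lebesgue_integral_def)
 finally show "(LINT s:{0..tt n}|lebesgue. ker s * max 0 (s - c)) = max 0 (tt n - c) powr (2 - \<alpha>) / Gamma (3 - \<alpha>)" .
 have "\<bar>ker s * max 0 (s - c)\<bar> <= tt n * ker s" if "s \<in> {0..tt n}" for s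
  using that c kernels_nonneg(2)[of s] mult_right_mono[of "s - c" "tt n" "ker s"]
  by (auto simp: abs_mult max_def mult.commute)
 moreover have "(%s. ker s * max 0 (s - c)) \<in> borel_measurable borel" using borel_kernels(5) by measurable
 ultimately show "set_integrable lebesgue {0..tt n} (%s. ker s * max 0 (s - c))"
  by (intro set_integral_abs_le(1)[OF set_integrable_mult_right[OF ker_integral(1)[OF tt_n_nonneg]] borel_set_borel_measurable]) auto
qed

end

context delay_problem begin

text \<open>The exact solution inserted into the scheme, with p u_xx + a u replaced by
  \<open>E\<close>, to which it is equal in the weak sense.\<close>

definition residual :: "nat => nat => real => real" where
 "residual N n x =
  (let \<rho> = \<tau> / real N; un = (%k::int. %x. u x (of_int k * \<rho>))
   in discrete_deriv \<alpha> \<rho> un n x - b * J_delay \<alpha> \<rho> N un n x - b * H_corr \<alpha> \<tau> N \<phi> d\<phi> n x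
    - F_rhs \<alpha> b \<tau> N f \<phi> d\<phi> n x - E x (real n * \<rho>))"

text \<open>\<open>E\<close> is the integral of the kernel against the time derivative minus the
  delayed and source terms. The source cancels with that in \<open>F_rhs\<close>, and the
  corrections assemble \<open>wdelay\<close>, leaving one error for the derivative and one
  quadrature error.\<close>

lemma residual_eq:
 fixes N n :: nat
 defines "\<rho> \<equiv> \<tau> / real N"
 assumes x: "x \<in> {0..L}" and N: "0 < N" and n: "n \<in> {1..K * N}"
 shows "residual N n x = ((\<Sum>k=1..n. grid.A \<alpha> \<rho> (n - k) * (u x (real k * \<rho>) - u x (real (k - 1) * \<rho>)))
   - (LINT s:{0..real n * \<rho>}|lebesgue. grid.ker \<alpha> \<rho> n s * utc x s))
  - b * (\<rho> * (\<Sum>k=0..n. grid.A \<alpha> \<rho> (n - k) * wdelay x (real k * \<rho>)) - (LINT s:{0..real n * \<rho>}|lebesgue. grid.ker \<alpha> \<rho> n s * wdelay x s))"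
proof -
 have \<rho>: "0 < \<rho>" using \<tau> N by (simp add: \<rho>_def)
 have N\<rho>: "real N * \<rho> = \<tau>" using N by (simp add: \<rho>_def)
 interpret grid \<alpha> \<rho> n by unfold_locales (use \<alpha> \<rho> in auto)
 have "real n <= real (K * N)" using n by (subst of_nat_le_iff) simp
 then have "real n * \<rho> <= real (K * N) * \<rho>" using \<rho> by (intro mult_right_mono) auto
 then have nT: "tt n <= T" using N by (simp add: T_def \<rho>_def)
 have n1: "1 <= n" using n by simp
 define un where "un k x = u x (of_int k * \<rho>)" for k :: int and x
 have dd: "discrete_deriv \<alpha> \<rho> un n x = (\<Sum>k=1..n. A (n - k) * (u x (tt k) - u x (tt (k - 1))))"
  unfolding discrete_deriv_def A_def un_def using \<alpha> by (intro sum.cong refl) (auto simp: A_coeff_eq of_nat_diff)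
 have pw: "\<rho> powr (1 - \<alpha>) * g_coeff (\<alpha> - 1) j = \<rho> * A j" for j
  using \<rho> powr_add[of \<rho> 1 "-\<alpha>"] by (simp add: A_def)
 have J: "J_delay \<alpha> \<rho> N un n x = \<rho> * (\<Sum>k=0..n. A (n - k) * u x (tt k - \<tau>))"
  unfolding J_delay_def sum_distrib_left un_def mult.assoc[symmetric] pw
  by (intro sum.cong refl) (simp add: left_diff_distrib N\<rho>)
 have H: "H_corr \<alpha> \<tau> N \<phi> d\<phi> n x = \<rho> * (\<Sum>k=0..n. A (n - k) * (max 0 (tt k - \<tau>) * d\<phi> x 0)) - \<rho> * (\<Sum>k=0..n. A (n - k) * \<phi> x (-\<tau>))"
 proof -
  have k: "max 0 (tt k - \<tau>) = (if N <= k then tt k - \<tau> else 0)" for k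
   using mult_right_mono[of "real N" "real k" \<rho>] mult_right_mono[of "real k" "real N" \<rho>] \<rho> N\<rho> by (auto simp: max_def)
  have "(\<Sum>k=N..n. \<rho> powr (1 - \<alpha>) * g_coeff (\<alpha> - 1) (n - k) * (tt k - \<tau>)) = (\<Sum>k=0..n. \<rho> * A (n - k) * max 0 (tt k - \<tau>))"
   unfolding pw k by (intro sum.mono_neutral_cong_left) auto
  then have h1: "\<rho> powr (1 - \<alpha>) * (\<Sum>k=N..n. g_coeff (\<alpha> - 1) (n - k) * (tt k - \<tau>)) = \<rho> * (\<Sum>k=0..n. A (n - k) * max 0 (tt k - \<tau>))"
   by (simp add: sum_distrib_left mult.assoc)
  have h2: "\<rho> powr (1 - \<alpha>) * (\<Sum>k=0..n. g_coeff (\<alpha> - 1) (n - k)) = \<rho> * (\<Sum>k=0..n. A (n - k))"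
   by (simp add: sum_distrib_left pw)
  have s: "(\<Sum>k=0..n. A (n - k) * c) = (\<Sum>k=0..n. A (n - k)) * c" for c by (simp add: sum_distrib_right)
  have s': "(\<Sum>k=0..n. A (n - k) * (max 0 (tt k - \<tau>) * c)) = (\<Sum>k=0..n. A (n - k) * max 0 (tt k - \<tau>)) * c" for c
   by (simp add: sum_distrib_right mult.assoc)
  show ?thesis
   unfolding H_corr_def Let_def \<rho>_def[symmetric] mult.assoc h1 h2 s s' by (simp only: mult_ac)
 qed
 have JH: "J_delay \<alpha> \<rho> N un n x + H_corr \<alpha> \<tau> N \<phi> d\<phi> n x = \<rho> * (\<Sum>k=0..n. A (n - k) * wdelay x (tt k))"
  unfolding J H wdelay_def by (simp add: distrib_left right_diff_distrib sum.distrib sum_subtractf)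
 define ft where "ft = frac_integral (1 - \<alpha>) (f x) (tt n)"
 have F: "F_rhs \<alpha> b \<tau> N f \<phi> d\<phi> n x = ft + b * (tt n powr (1 - \<alpha>) / Gamma (2 - \<alpha>) * \<phi> x (-\<tau>)) - b * (max 0 (tt n - \<tau>) powr (2 - \<alpha>) / Gamma (3 - \<alpha>) * d\<phi> x 0)"
  unfolding F_rhs_def Let_def \<rho>_def[symmetric] ft_def[symmetric] using \<alpha> by (simp add: algebra_simps max_def)
 define q where "q s = uc x (s - \<tau>)" for s
 have uxb[measurable]: "uc x \<in> borel_measurable borel" by (rule borel_section(1)[OF uc_borel])
 have fxb: "fc x \<in> borel_measurable borel" by (rule borel_section(1)[OF fc_borel])
 have qb: "q \<in> borel_measurable borel" unfolding q_def[abs_def] by measurable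
 have q: "q s = u x (s - \<tau>)" if "s \<in> {0..tt n}" for s
  using that nT \<tau> x unfolding q_def by (intro uc_eq) auto
 have qB: "\<bar>q s\<bar> <= Cuf" if "s \<in> {0..tt n}" for s
  using q[OF that] Cuf(2)[OF x, of "s - \<tau>"] that nT \<tau> by auto
 have fB: "\<bar>fc x s\<bar> <= Cuf" "fc x s = f x s" if "s \<in> {0..tt n}" for s
  using fc_eq[OF x, of s] Cuf(3)[OF x, of s] that nT by auto
 have \<alpha>1: "0 < 1 - \<alpha>" using \<alpha> by simp
 have ks: "ker s * g = (1 / Gamma (1 - \<alpha>)) * ((tt n - s) powr (1 - \<alpha> - 1) * g)" for s g by (simp add: ker_def)
 have kq: "set_integrable lebesgue {0..tt n} (%s. ker s * q s)"
  unfolding ks by (intro set_integrable_mult_right) (intro powr_kernel_integrable[OF \<alpha>1 tt_n_nonneg qb qB], auto)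
 have kf: "set_integrable lebesgue {0..tt n} (%s. ker s * fc x s)"
  unfolding ks by (intro set_integrable_mult_right) (intro powr_kernel_integrable[OF \<alpha>1 tt_n_nonneg fxb fB(1)], auto)
 have ku: "set_integrable lebesgue {0..tt n} (%s. ker s * utc x s)"
  using truncation_derivative(2)[OF x N n] by (simp add: \<rho>_def)
 have ft: "ft = (LINT s:{0..tt n}|lebesgue. ker s * fc x s)"
  unfolding ft_def frac_integral_def ker_def using fB(2) by (intro set_lebesgue_integral_cong) auto
 have EI: "E x (tt n) = (LINT s:{0..tt n}|lebesgue. ker s * utc x s) - b * (LINT s:{0..tt n}|lebesgue. ker s * q s) - ft"
 proof -
  define G where "G s = ker s * utc x s - (b * (ker s * q s) + ker s * fc x s)" for s
  have bq: "set_integrable lebesgue {0..tt n} (%s. b * (ker s * q s))" using kq by (rule set_integrable_mult_right)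
  have s1: "set_integrable lebesgue {0..tt n} (%s. b * (ker s * q s) + ker s * fc x s)" using bq kf by (rule set_integral_add(1))
  have Gi: "set_integrable lebesgue {0..tt n} G" unfolding G_def[abs_def] using ku s1 by (rule set_integral_diff(1))
  have "(LINT s:{0..tt n}|lebesgue. G s) = (LINT s:{0..tt n}|lebesgue. ker s * utc x s) - (b * (LINT s:{0..tt n}|lebesgue. ker s * q s) + ft)"
   unfolding G_def using set_integral_diff(2)[OF ku s1] set_integral_add(2)[OF bq kf] ft by simp
  moreover have "E x (tt n) = (LINT s:{0..tt n}|lebesgue. G s)"
  proof -
   \<comment> \<open>At s = 0 \<open>D\<close> is zero by convention while the delayed and source
     terms in G need not be; one point is negligible for the integral.\<close>
   have eq: "ker s * D x s = G s" if "s \<in> {0..tt n} - {0}" for s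
    using that nT x q[of s] fB(2)[of s] by (auto simp: G_def D_def utc_def algebra_simps)
   have Di: "set_integrable lebesgue {0..tt n} (%s. ker s * D x s)"
    by (rule absolutely_integrable_spike[OF Gi negligible_sing[of 0]]) (use eq in auto)
   have "E x (tt n) = (LINT s:{0..tt n}|lebesgue. ker s * D x s)" by (simp add: E_def frac_integral_def ker_def)
   also have "... = integral {0..tt n} (%s. ker s * D x s)" using Di by (simp add: set_lebesgue_integral_eq_integral)
   also have "... = integral {0..tt n} G" by (rule integral_spike[OF negligible_sing[of 0]]) (use eq in auto)
   also have "... = (LINT s:{0..tt n}|lebesgue. G s)" using Gi by (simp add: set_lebesgue_integral_eq_integral)
   finally show ?thesis .
  qed
  ultimately show ?thesis by simp
 qed
 have W: "(LINT s:{0..tt n}|lebesgue. ker s * wdelay x s) = (LINT s:{0..tt n}|lebesgue. ker s * q s) - tt n powr (1 - \<alpha>) / Gamma (2 - \<alpha>) * \<phi> x (-\<tau>)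
   + max 0 (tt n - \<tau>) powr (2 - \<alpha>) / Gamma (3 - \<alpha>) * d\<phi> x 0"
 proof -
  have i2: "set_integrable lebesgue {0..tt n} (%s. ker s * \<phi> x (-\<tau>))"
   using ker_integral(1)[OF tt_n_nonneg] by (rule set_integrable_mult_left)
  have i3: "set_integrable lebesgue {0..tt n} (%s. ker s * max 0 (s - \<tau>) * d\<phi> x 0)"
   using ker_max(2)[of \<tau>] \<tau> by (intro set_integrable_mult_left) auto
  have "(LINT s:{0..tt n}|lebesgue. ker s * wdelay x s) = (LINT s:{0..tt n}|lebesgue. ker s * q s - ker s * \<phi> x (-\<tau>) + ker s * max 0 (s - \<tau>) * d\<phi> x 0)"
   by (intro set_lebesgue_integral_cong) (auto simp: wdelay_def q algebra_simps)
  also have "... = (LINT s:{0..tt n}|lebesgue. ker s * q s) - (LINT s:{0..tt n}|lebesgue. ker s * \<phi> x (-\<tau>)) + (LINT s:{0..tt n}|lebesgue. ker s * max 0 (s - \<tau>) * d\<phi> x 0)"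
   using set_integral_add(2)[OF set_integral_diff(1)[OF kq i2] i3] set_integral_diff(2)[OF kq i2] by simp
  also have "... = (LINT s:{0..tt n}|lebesgue. ker s * q s) - kap2 0 * \<phi> x (-\<tau>) + max 0 (tt n - \<tau>) powr (2 - \<alpha>) / Gamma (3 - \<alpha>) * d\<phi> x 0"
   using ker_integral(2)[OF tt_n_nonneg] ker_max(1)[of \<tau>] \<tau> by simp
  finally show ?thesis by (simp add: kap2_def)
 qed
 have res: "residual N n x = discrete_deriv \<alpha> \<rho> un n x - b * (J_delay \<alpha> \<rho> N un n x + H_corr \<alpha> \<tau> N \<phi> d\<phi> n x) - F_rhs \<alpha> b \<tau> N f \<phi> d\<phi> n x - E x (tt n)"
  unfolding residual_def Let_def \<rho>_def[symmetric] un_def[abs_def] by (simp add: algebra_simps)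
 have alg: "d - b * j - (ft + b * x1 - b * x2) - (U - b * Q - ft) = (d - U) - b * (j - (Q - x1 + x2))" for d j x1 x2 U Q
  by (simp add: algebra_simps)
 show ?thesis unfolding res JH dd F EI W by (rule alg)
qed

lemma residual_bound:
 fixes N n :: nat
 defines "\<rho> \<equiv> \<tau> / real N"
 assumes x: "x \<in> {0..L}" and N: "0 < N" and n: "n \<in> {1..K * N}"
 shows "\<bar>residual N n x\<bar> <= grid.C4 \<alpha> * Cz / real n
   + 2 / (1 - \<alpha>) * \<rho> * (\<Sum>i=1..n. grid.A \<alpha> \<rho> (n - i) * (LINT s:{real (i - 1) * \<rho>..real i * \<rho>}|lebesgue. \<bar>Y2c x s\<bar>))
   + \<bar>b\<bar> * (2 / (1 - \<alpha>) * \<rho> * (\<Sum>i=1..n. grid.A \<alpha> \<rho> (n - i) * (LINT s:{real (i - 1) * \<rho>..real i * \<rho>}|lebesgue. Bw s)))"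
proof -
 have \<rho>: "0 < \<rho>" using \<tau> N by (simp add: \<rho>_def)
 interpret grid \<alpha> \<rho> n by unfold_locales (use \<alpha> \<rho> in auto)
 have "real n <= real (K * N)" using n by (subst of_nat_le_iff) simp
 then have "real n * \<rho> <= real (K * N) * \<rho>" using \<rho> by (intro mult_right_mono) auto
 then have nT: "tt n <= T" using N by (simp add: T_def \<rho>_def)
 have wi: "set_integrable lebesgue {0..tt n} (wd x)" using nT by (intro set_integrable_subset[OF wd_integrable[OF x]]) auto
 have w: "wdelay x s = (LINT r:{0..s}|lebesgue. wd x r)" if "s \<in> {0..tt n}" for s
  using that nT by (intro wdelay_integral x) auto
 note q = quadrature_smooth[OF wd_borel[OF x] wi w]
 have "2 / (1 - \<alpha>) * \<rho> * (\<Sum>i=1..n. A (n - i) * (LINT s:{tt (i - 1)..tt i}|lebesgue. \<bar>wd x s\<bar>)) <= 2 / (1 - \<alpha>) * \<rho> * (\<Sum>i=1..n. A (n - i) * (LINT s:{tt (i - 1)..tt i}|lebesgue. Bw s))"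
 proof (intro mult_left_mono sum_mono)
  fix i assume i: "i \<in> {1..n}"
  have sub: "{tt (i - 1)..tt i} \<subseteq> {0..T}" using order_trans[OF tt_mono[of i n] nT] i \<rho> by auto
  show "(LINT s:{tt (i - 1)..tt i}|lebesgue. \<bar>wd x s\<bar>) <= (LINT s:{tt (i - 1)..tt i}|lebesgue. Bw s)"
   using sub by (intro set_integral_mono set_integrable_abs set_integrable_subset[OF wd_integrable[OF x]] set_integrable_subset[OF Bw_integrable] wd_bound x) auto
 qed (use \<alpha> \<rho> A_pos in \<open>auto intro: less_imp_le\<close>)
 with q have "\<bar>\<rho> * (\<Sum>k=0..n. A (n - k) * wdelay x (tt k)) - (LINT s:{0..tt n}|lebesgue. ker s * wdelay x s)\<bar> <= 2 / (1 - \<alpha>) * \<rho> * (\<Sum>i=1..n. A (n - i) * (LINT s:{tt (i - 1)..tt i}|lebesgue. Bw s))"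
  by (rule order_trans)
 then have 2: "\<bar>b * (\<rho> * (\<Sum>k=0..n. A (n - k) * wdelay x (tt k)) - (LINT s:{0..tt n}|lebesgue. ker s * wdelay x s))\<bar> <= \<bar>b\<bar> * (2 / (1 - \<alpha>) * \<rho> * (\<Sum>i=1..n. A (n - i) * (LINT s:{tt (i - 1)..tt i}|lebesgue. Bw s)))"
  unfolding abs_mult by (intro mult_left_mono) auto
 have abs2: "\<bar>y - z\<bar> <= e + e'" if "\<bar>y\<bar> <= e" "\<bar>z\<bar> <= e'" for y z e e' :: real using that by linarith
 show ?thesis
  unfolding residual_eq[OF x N n, folded \<rho>_def]
  by (rule abs2[OF truncation_derivative(1)[OF x N n, folded \<rho>_def] 2])
qed

end

section \<open>Elementary sums and a delayed discrete Gronwall inequality\<close>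

lemma sum_inverse_le_ln: "1 <= m ==> (\<Sum>k=1..m. 1 / real k) <= 1 + ln (real m)"
proof (induction m rule: nat_induct_at_least)
 case (Suc m)
 have "ln (real m / real (Suc m)) <= real m / real (Suc m) - 1" using Suc.hyps by (intro ln_le_minus_one) auto
 moreover have "ln (real m / real (Suc m)) = ln (real m) - ln (real (Suc m))" using Suc.hyps by (intro ln_divide_pos) auto
 moreover have "real m / real (Suc m) - 1 = - (1 / real (Suc m))" by (simp add: field_simps)
 ultimately show ?case using Suc.IH by simp
qed simp

text \<open>Bernoulli at -1 / (m + 1) shows that the increment of m^\<beta> dominates \<beta> (m +
  1)^(\<beta> - 1); the increments telescope.\<close>

lemma sum_powr_le:
 assumes \<beta>: "0 < \<beta>" "\<beta> <= 1"
 shows "(\<Sum>j=1..m. real j powr (\<beta> - 1)) <= real m powr \<beta> / \<beta>"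
proof (induction m)
 case (Suc m)
 let ?x = "real (Suc m)"
 have "real m powr \<beta> <= ?x powr \<beta> - \<beta> * ?x powr (\<beta> - 1)"
 proof (cases "m = 0")
  case False
  have eq: "1 + - (1 / ?x) = real m / ?x" by (simp add: field_simps)
  have "(real m / ?x) powr \<beta> <= 1 + \<beta> * (- (1 / ?x))"
   using powr_Bernoulli_le[of \<beta> "- (1 / ?x)"] \<beta> False unfolding eq by simp
  then have "?x powr \<beta> * (real m / ?x) powr \<beta> <= ?x powr \<beta> * (1 + \<beta> * (- (1 / ?x)))"
   by (intro mult_left_mono) auto
  moreover have "?x powr \<beta> * (real m / ?x) powr \<beta> = real m powr \<beta>" by (subst powr_mult[symmetric]) auto
  moreover have "?x powr (\<beta> - 1) = ?x powr \<beta> / ?x" by (simp add: powr_diff)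
  ultimately show ?thesis by (simp add: algebra_simps)
 qed (use \<beta> in simp)
 then have "\<beta> * (real m powr \<beta> / \<beta> + ?x powr (\<beta> - 1)) <= ?x powr \<beta>" using \<beta> by (simp add: distrib_left)
 then have "real m powr \<beta> / \<beta> + ?x powr (\<beta> - 1) <= ?x powr \<beta> / \<beta>" using \<beta> by (simp add: pos_le_divide_eq mult.commute)
 then show ?case using Suc.IH by simp
qed (use \<beta> in simp)

lemma sum_rev_nat: "(\<Sum>n=1..m. f (m - n)) = (\<Sum>j=1..m. f (j - 1 :: nat))" for f :: "nat => real"
 by (rule sum.reindex_bij_witness[of _ "%j. m + 1 - j" "%n. m + 1 - n"]) auto

lemma sum_weights_le:
 assumes \<alpha>: "0 < \<alpha>" "\<alpha> < 1"
 shows "(\<Sum>n=1..m. g_coeff (-\<alpha>) (m - n)) <= real m powr \<alpha> / \<alpha>"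
proof -
 have "(\<Sum>n=1..m. g_coeff (-\<alpha>) (m - n)) = (\<Sum>j=1..m. g_coeff (-\<alpha>) (j - 1))" by (rule sum_rev_nat)
 also have "... <= (\<Sum>j=1..m. real j powr (\<alpha> - 1))"
 proof (rule sum_mono)
  fix j assume "j \<in> {1..m}"
  then have "real (j - 1) + 1 = real j" by simp
  then show "g_coeff (-\<alpha>) (j - 1) <= real j powr (\<alpha> - 1)" using g_coeff_upper[of "1 - \<alpha>" "j - 1"] \<alpha> by simp
 qed
 also have "... <= real m powr \<alpha> / \<alpha>" using \<alpha> by (intro sum_powr_le) auto
 finally show ?thesis .
qed

text \<open>The estimate rests on \<open>1 / (n (m - n + 1)) = (1 / n + 1 / (m - n + 1)) / (m + 1)\<close>.\<close>

lemma sum_weights_harmonic_le: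
 assumes \<alpha>: "0 < \<alpha>" "\<alpha> < 1" and m: "1 <= m"
 shows "(\<Sum>n=1..m. g_coeff (-\<alpha>) (m - n) * (1 / real n)) <= 2 * real m powr (\<alpha> - 1) * (1 + ln (real m))"
proof -
 let ?H = "\<Sum>k=1..m. 1 / real k"
 have "(\<Sum>n=1..m. g_coeff (-\<alpha>) (m - n) * (1 / real n)) <= (\<Sum>n=1..m. real m powr (\<alpha> - 1) * (1 / real n + 1 / real (m - n + 1)))"
 proof (rule sum_mono)
  fix n assume n: "n \<in> {1..m}"
  define i where "i = real (m - n + 1)"
  have i: "1 <= i" "i <= real m" "real n + i = real m + 1" using n by (auto simp: i_def of_nat_diff)
  have "g_coeff (-\<alpha>) (m - n) <= i powr (\<alpha> - 1)" using g_coeff_upper[of "1 - \<alpha>" "m - n"] \<alpha> by (simp add: i_def add.commute)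
  also have "... = i powr \<alpha> / i" using i by (simp add: powr_diff)
  also have "... <= real m powr \<alpha> / i" using i \<alpha> by (intro divide_right_mono powr_mono2) auto
  finally have "g_coeff (-\<alpha>) (m - n) * (1 / real n) <= real m powr \<alpha> / i * (1 / real n)" by (intro mult_right_mono) auto
  also have "... = real m powr \<alpha> / (real m + 1) * (1 / real n + 1 / i)"
  proof -
   have "1 / real n + 1 / i = (real n + i) / (real n * i)" using i(1) n by (auto simp: add_divide_distrib)
   then show ?thesis unfolding i(3)[symmetric] using i n by simp
  qed
  also have "... <= real m powr \<alpha> / real m * (1 / real n + 1 / i)"
   using m i by (intro mult_right_mono divide_left_mono) auto
  finally show "g_coeff (-\<alpha>) (m - n) * (1 / real n) <= real m powr (\<alpha> - 1) * (1 / real n + 1 / real (m - n + 1))"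
   using m by (simp add: i_def powr_diff)
 qed
 also have "... = real m powr (\<alpha> - 1) * (?H + (\<Sum>n=1..m. 1 / real (m - n + 1)))"
  by (simp only: sum_distrib_left[symmetric] sum.distrib)
 also have "(\<Sum>n=1..m. 1 / real (m - n + 1)) = ?H"
  using sum_rev_nat[of "%j. 1 / real (j + 1)" m] by (auto intro: sum.cong simp: of_nat_diff)
 also have "real m powr (\<alpha> - 1) * (?H + ?H) <= real m powr (\<alpha> - 1) * (2 * (1 + ln (real m)))"
  using sum_inverse_le_ln[OF m] by (intro mult_left_mono) auto
 finally show ?thesis by (simp add: algebra_simps)
qed

text \<open>The Hoelder factor turns the kernel 1 / (k - j) into a multiple of (k - j)^(\<beta> -
  1), whose sum grows only like k^\<beta>; this is where the logarithm is avoided.\<close>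

lemma sum_Holder_weights:
 fixes \<rho> \<beta> :: real
 assumes \<beta>: "0 < \<beta>" "\<beta> <= 1" and \<rho>: "0 < \<rho>"
 shows "(\<Sum>j=1..<k. 1 / real (k - j) * (real k * \<rho> - real j * \<rho>) powr \<beta>) <= (real k * \<rho>) powr \<beta> / \<beta>"
proof -
 have "(\<Sum>j=1..<k. 1 / real (k - j) * (real k * \<rho> - real j * \<rho>) powr \<beta>) = (\<Sum>j=1..<k. \<rho> powr \<beta> * real (k - j) powr (\<beta> - 1))"
 proof (rule sum.cong[OF refl])
  fix j assume j: "j \<in> {1..<k}"
  have "real k * \<rho> - real j * \<rho> = real (k - j) * \<rho>" using j by (simp add: of_nat_diff left_diff_distrib)
  moreover have "real (k - j) powr (\<beta> - 1) = real (k - j) powr \<beta> / real (k - j)" using j by (simp add: powr_diff)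
  ultimately show "1 / real (k - j) * (real k * \<rho> - real j * \<rho>) powr \<beta> = \<rho> powr \<beta> * real (k - j) powr (\<beta> - 1)"
   using \<rho> by (simp add: powr_mult del: of_nat_diff)
 qed
 also have "... = \<rho> powr \<beta> * (\<Sum>i=1..k - 1. real i powr (\<beta> - 1))"
  unfolding sum_distrib_left by (rule sum.reindex_bij_witness[of _ "%i. k - i" "%j. k - j"]) auto
 also have "... <= \<rho> powr \<beta> * (real (k - 1) powr \<beta> / \<beta>)" using sum_powr_le[OF \<beta>] by (intro mult_left_mono) auto
 also have "... <= \<rho> powr \<beta> * (real k powr \<beta> / \<beta>)" using \<beta> by (intro mult_left_mono divide_right_mono powr_mono2) auto
 also have "... = (real k * \<rho>) powr \<beta> / \<beta>" using \<rho> by (simp add: powr_mult)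
 finally show ?thesis .
qed

text \<open>As N >= 1 the history sum ends before n, so the recursion is explicit and any c >= 0 is
  admissible.\<close>

lemma discrete_Gronwall:
 fixes e Q :: "nat => real"
 assumes c: "0 <= c" and N: "1 <= N" and e: "!!n. 0 <= e n" and Q: "!!n. n \<in> {1..M} ==> 0 <= Q n"
  and le: "!!n. n \<in> {1..M} ==> e n <= Q n + c * (\<Sum>k=1..n - N. e k)"
 shows "n <= M ==> (\<Sum>k=1..n. e k) <= exp (c * real n) * (\<Sum>k=1..n. Q k)"
proof (induction n)
 case (Suc n)
 have 1: "1 <= exp (c * real (Suc n))" and Qn: "0 <= Q (Suc n)" using c Q[of "Suc n"] Suc.prems by auto
 have S0: "0 <= (\<Sum>k=1..n. e k)" by (intro sum_nonneg e)
 have "(\<Sum>k=1..Suc n - N. e k) <= (\<Sum>k=1..n. e k)" using N e by (intro sum_mono2) auto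
 then have "e (Suc n) <= Q (Suc n) + c * (\<Sum>k=1..n. e k)"
  using le[of "Suc n"] Suc.prems mult_left_mono[OF _ c] by fastforce
 then have "(\<Sum>k=1..Suc n. e k) <= (1 + c) * (\<Sum>k=1..n. e k) + Q (Suc n)" by (simp add: distrib_right)
 also have "... <= exp c * (\<Sum>k=1..n. e k) + Q (Suc n)"
  using S0 exp_ge_add_one_self[of c] by (intro add_right_mono mult_right_mono) auto
 also have "... <= exp c * (exp (c * real n) * (\<Sum>k=1..n. Q k)) + exp (c * real (Suc n)) * Q (Suc n)"
  using Suc 1 Qn mult_right_mono[OF 1 Qn] by (intro add_mono mult_left_mono) auto
 also have "... = exp (c * real (Suc n)) * (\<Sum>k=1..Suc n. Q k)"
  by (simp add: distrib_left exp_add mult.assoc)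
 finally show ?case .
qed simp

lemma in_L2_cong: assumes "in_L2 L v" "!!x. x \<in> {0..L} ==> w x = v x" shows "in_L2 L w"
proof -
 have "(%x. indicator {0..L} x *\<^sub>R w x) = (%x. indicator {0..L} x *\<^sub>R v x)"
  "(%x. indicator {0..L} x *\<^sub>R (w x)\<^sup>2) = (%x. indicator {0..L} x *\<^sub>R (v x)\<^sup>2)"
  using assms(2) by (auto simp: fun_eq_iff indicator_def)
 then show ?thesis using assms(1) by (simp add: in_L2_def set_borel_measurable_def set_integrable_def)
qed

section \<open>The residual in L2 and its convolution with the inverse weights\<close>

context delay_problem begin

text \<open>Measurability in x comes from backward difference quotients of the continuous u at time
  0.\<close>

lemma in_L2_dphi0: "in_L2 L (%x. d\<phi> x 0)"
proof (rule in_L2_bounded(1)[where c = C\<phi>])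
 define y where "y i = - \<tau> / (real i + 1)" for i :: nat
 have y: "y i \<in> {-\<tau>..0} - {0}" for i using \<tau> by (auto simp: y_def field_simps)
 have y0: "y \<longlonglongrightarrow> 0" unfolding y_def by real_asymp
 define q where "q i x = (uc x (y i) - uc x 0) / (y i - 0)" for i x
 have "q i \<in> borel_measurable borel" for i unfolding q_def using borel_section(2)[OF uc_borel] by measurable
 then have qm: "set_borel_measurable lebesgue {0..L} (q i)" for i by (rule borel_set_borel_measurable) simp
 have lim: "(%i. indicator {0..L} x *\<^sub>R q i x) \<longlonglongrightarrow> indicator {0..L} x *\<^sub>R d\<phi> x 0" for x
 proof (cases "x \<in> {0..L}")
  case True
  have "((%s. (\<phi> x s - \<phi> x 0) / (s - 0)) \<longlongrightarrow> d\<phi> x 0) (at 0 within {-\<tau>..0})"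
   using phi_deriv[OF True, of 0] \<tau> by (simp add: has_field_derivative_iff)
  then have "(%i. (\<phi> x (y i) - \<phi> x 0) / (y i - 0)) \<longlonglongrightarrow> d\<phi> x 0"
   using y y0 unfolding tendsto_at_iff_sequentially by (auto simp: o_def)
  moreover have "uc x s = \<phi> x s" if "s \<in> {-\<tau>..0}" for s
   using that T_pos u_init[OF True that] uc_eq[OF True, of s] by auto
  ultimately show ?thesis using y \<tau> True by (simp add: q_def)
 qed simp
 show "set_borel_measurable lebesgue {0..L} (%x. d\<phi> x 0)"
  unfolding set_borel_measurable_def
  by (rule borel_measurable_LIMSEQ_real[OF lim]) (use qm in \<open>simp add: set_borel_measurable_def\<close>)
qed (use dphi_bound \<tau> L in auto)

lemma in_L2_phi: "t \<in> {-\<tau>..0} ==> in_L2 L (%x. \<phi> x t)"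
 using T_pos u_init by (intro in_L2_cong[OF in_L2_u[of t]]) auto

lemma in_L2_ft: assumes t: "0 <= t" "t <= T" shows "in_L2 L (%x. frac_integral (1 - \<alpha>) (f x) t)"
proof -
 define c where "c = 2 * Cuf / ((1 - \<alpha>) * Gamma (1 - \<alpha>)) * t powr (1 - \<alpha>)"
 define g where "g x = frac_integral (1 - \<alpha>) (fc x) t" for x
 have g: "g \<in> borel_measurable borel" unfolding g_def[abs_def]
  using borel_section(2)[OF borel_frac_integral[OF fc_borel], of "1 - \<alpha>" t] by simp
 have fcb: "\<bar>fc x s\<bar> <= Cuf" for x s
  unfolding fc_def using Cuf(3) clamp_real_in[of 0 L x] clamp_real_in[of 0 T s] L T_pos by auto
 have "\<bar>g x\<bar> <= c" for x
  using frac_integral_Holder[OF \<alpha> borel_section(1)[OF fc_borel] order_refl t(1), of x Cuf] fcb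
  by (simp add: g_def c_def frac_integral_0)
 then have "in_L2 L g" using L by (intro in_L2_bounded(1)[of L g c] borel_set_borel_measurable g) auto
 then show ?thesis
  by (rule in_L2_cong) (use t in \<open>auto simp: g_def fc_eq intro!: frac_integral_cong\<close>)
qed

lemma in_L2_H: "in_L2 L (H_corr \<alpha> \<tau> N \<phi> d\<phi> n)"
proof -
 interpret L2: semi_inner "{v. in_L2 L v}" "inner_L2 L" by (rule semi_inner_L2)
 obtain c c' where "H_corr \<alpha> \<tau> N \<phi> d\<phi> n = c *\<^sub>R (%x. d\<phi> x 0) - c' *\<^sub>R (%x. \<phi> x (-\<tau>))"
 proof
  let ?\<rho> = "\<tau> / real N"
  show "H_corr \<alpha> \<tau> N \<phi> d\<phi> n = (?\<rho> powr (1 - \<alpha>) * (\<Sum>k=N..n. g_coeff (\<alpha> - 1) (n - k) * (real k * ?\<rho> - \<tau>))) *\<^sub>R (%x. d\<phi> x 0)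
    - (?\<rho> powr (1 - \<alpha>) * (\<Sum>k=0..n. g_coeff (\<alpha> - 1) (n - k))) *\<^sub>R (%x. \<phi> x (-\<tau>))"
   by (rule ext) (simp add: H_corr_def Let_def mult_ac)
 qed
 moreover have "(%x. d\<phi> x 0) \<in> {v. in_L2 L v}" "(%x. \<phi> x (-\<tau>)) \<in> {v. in_L2 L v}"
  using in_L2_dphi0 in_L2_phi[of "-\<tau>"] \<tau> by auto
 ultimately have "H_corr \<alpha> \<tau> N \<phi> d\<phi> n \<in> {v. in_L2 L v}" by (simp only: L2.W_intros)
 then show ?thesis by simp
qed

lemma in_L2_F:
 assumes "real n * (\<tau> / real N) <= T" shows "in_L2 L (F_rhs \<alpha> b \<tau> N f \<phi> d\<phi> n)"
proof -
 interpret L2: semi_inner "{v. in_L2 L v}" "inner_L2 L" by (rule semi_inner_L2)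
 let ?t = "real n * (\<tau> / real N)"
 have "(%x. d\<phi> x 0) \<in> {v. in_L2 L v}" "(%x. \<phi> x (-\<tau>)) \<in> {v. in_L2 L v}" "(%x. frac_integral (1 - \<alpha>) (f x) ?t) \<in> {v. in_L2 L v}"
  using in_L2_dphi0 in_L2_phi[of "-\<tau>"] in_L2_ft[of ?t] assms \<tau> by auto
 moreover have "F_rhs \<alpha> b \<tau> N f \<phi> d\<phi> n = (%x. frac_integral (1 - \<alpha>) (f x) ?t) + (b * (?t powr (1 - \<alpha>) / Gamma (2 - \<alpha>))) *\<^sub>R (%x. \<phi> x (-\<tau>))
   - (if ?t <= \<tau> then 0 else b * ((?t - \<tau>) powr (2 - \<alpha>) / Gamma (3 - \<alpha>))) *\<^sub>R (%x. d\<phi> x 0)"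
  by (rule ext) (simp add: F_rhs_def Let_def algebra_simps)
 ultimately have "F_rhs \<alpha> b \<tau> N f \<phi> d\<phi> n \<in> {v. in_L2 L v}" by (simp only: L2.W_intros)
 then show ?thesis by simp
qed

text \<open>One integrable density in time that carries both contributions of kind \<open>A\<close>
  to the residual: the L2 norm of Y2 and the bound for the delayed derivative.\<close>

definition Vw :: "real => real" where
 "Vw s = norm_L2 L (%x. Y2 x s) + \<bar>b\<bar> * sqrt L * Bw s"

lemma Y2_norm_integrable: "set_integrable lebesgue {0..T} (%s. norm_L2 L (%x. Y2 x s))"
 using Y2_L1_L2 by (simp add: in_L1_L2_def T_def)

lemma Vw_nonneg: "0 <= Vw s" using Bw_nonneg L by (simp add: Vw_def)

lemma Vw_integrable: "set_integrable lebesgue {0..T} Vw"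
 unfolding Vw_def[abs_def] by (intro set_integral_add(1) Y2_norm_integrable set_integrable_mult_right Bw_integrable)

lemma residual_norm:
 fixes N n :: nat
 defines "\<rho> \<equiv> \<tau> / real N"
 assumes N: "0 < N" and n: "n \<in> {1..K * N}"
 shows "in_L2 L (residual N n)"
  and "norm_L2 L (residual N n) <= grid.C4 \<alpha> * Cz * sqrt L * (1 / real n)
   + 2 / (1 - \<alpha>) * \<rho> * (\<Sum>i=1..n. grid.A \<alpha> \<rho> (n - i) * (LINT s:{real (i - 1) * \<rho>..real i * \<rho>}|lebesgue. Vw s))"
proof -
 interpret L2: semi_inner "{v. in_L2 L v}" "inner_L2 L" by (rule semi_inner_L2)
 have \<rho>: "0 < \<rho>" using \<tau> N by (simp add: \<rho>_def)
 interpret grid \<alpha> \<rho> n by unfold_locales (use \<alpha> \<rho> in auto)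
 have N\<rho>: "real N * \<rho> = \<tau>" using N by (simp add: \<rho>_def)
 have "real n <= real (K * N)" using n by (subst of_nat_le_iff) simp
 then have "real n * \<rho> <= real (K * N) * \<rho>" using \<rho> by (intro mult_right_mono) auto
 then have nT: "tt n <= T" using N by (simp add: T_def \<rho>_def)
 define un where "un k x = u x (of_int k * \<rho>)" for k :: int and x
 have unW: "un k \<in> {v. in_L2 L v}" if "- int N <= k" "k <= int n" for k
 proof -
  have "real_of_int k <= real n" "- real N <= real_of_int k" using that by linarith+
  then have "real_of_int k * \<rho> <= tt n" "- (real N * \<rho>) <= real_of_int k * \<rho>"
   using \<rho> mult_right_mono[of "- real N" "real_of_int k" \<rho>] by (auto intro: mult_right_mono)
  then show ?thesis using in_L2_u[of "of_int k * \<rho>"] nT N\<rho> by (simp add: un_def[abs_def])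
 qed
 have dd: "discrete_deriv \<alpha> \<rho> un n = (\<Sum>k=1..n. A_coeff \<alpha> \<rho> (n - k) *\<^sub>R (un (int k) - un (int k - 1)))"
  by (rule ext) (simp add: discrete_deriv_def sum_fun_apply)
 have J: "J_delay \<alpha> \<rho> N un n = \<rho> powr (1 - \<alpha>) *\<^sub>R (\<Sum>k=0..n. g_coeff (\<alpha> - 1) (n - k) *\<^sub>R un (int k - int N))"
  by (rule ext) (simp add: J_delay_def sum_fun_apply)
 have "discrete_deriv \<alpha> \<rho> un n \<in> {v. in_L2 L v}"
  unfolding dd by (intro L2.W_intros(5) L2.W_intros(3) L2.W_intros(2) unW) auto
 moreover have "J_delay \<alpha> \<rho> N un n \<in> {v. in_L2 L v}"
  unfolding J by (intro L2.W_intros(3) L2.W_intros(5) unW) auto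
 moreover have "0 < tt n" using n \<rho> by simp
 then have "(%x. E x (tt n)) \<in> {v. in_L2 L v}" using in_L2_E nT by simp
 moreover have "H_corr \<alpha> \<tau> N \<phi> d\<phi> n \<in> {v. in_L2 L v}" "F_rhs \<alpha> b \<tau> N f \<phi> d\<phi> n \<in> {v. in_L2 L v}"
  using in_L2_H in_L2_F[of n N] nT by (auto simp: \<rho>_def)
 moreover have "residual N n = discrete_deriv \<alpha> \<rho> un n - b *\<^sub>R J_delay \<alpha> \<rho> N un n - b *\<^sub>R H_corr \<alpha> \<tau> N \<phi> d\<phi> n - F_rhs \<alpha> b \<tau> N f \<phi> d\<phi> n - (%x. E x (tt n))"
  by (rule ext) (simp add: residual_def Let_def un_def[abs_def] \<rho>_def)
 ultimately have "residual N n \<in> {v. in_L2 L v}" by (simp only: L2.W_intros)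
 then show rL: "in_L2 L (residual N n)" by simp
 define cc where "cc = 2 / (1 - \<alpha>) * \<rho>"
 have cc: "0 <= cc" using \<alpha> \<rho> by (simp add: cc_def)
 define y where "y i x = (LINT s:{tt (i - 1)..tt i}|lebesgue. \<bar>Y2c x s\<bar>)" for i x
 define c0 where "c0 = C4 * Cz / real n + \<bar>b\<bar> * (cc * (\<Sum>i=1..n. A (n - i) * (LINT s:{tt (i - 1)..tt i}|lebesgue. Bw s)))"
 have cell: "0 <= tt (i - 1)" "tt i <= T" "{tt (i - 1)..tt i} \<subseteq> {0..T}" if "i \<in> {1..n}" for i
  using order_trans[OF tt_mono[of i n] nT] that \<rho> by auto
 have y: "y i \<in> {v. in_L2 L v}" "L2.nrm (y i) <= (LINT s:{tt (i - 1)..tt i}|lebesgue. norm_L2 L (%x. Y2 x s))" if "i \<in> {1..n}" for i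
  using Minkowski_cell[OF cell(1,2)[OF that]] by (simp_all add: y_def[abs_def] nrm_L2)
 have c0W: "(%x. c0) \<in> {v. in_L2 L v}" using in_L2_const by simp
 have C40: "0 <= C4" using Gamma_pos1 \<alpha> by (simp add: C4_def C3_def)
 have Bw0: "0 <= (LINT s:{tt (i - 1)..tt i}|lebesgue. Bw s)" for i
  unfolding set_lebesgue_integral_def using Bw_nonneg by (intro integral_nonneg_AE) auto
 have "0 <= (\<Sum>i=1..n. A (n - i) * (LINT s:{tt (i - 1)..tt i}|lebesgue. Bw s))"
  by (intro sum_nonneg mult_nonneg_nonneg less_imp_le[OF A_pos] Bw0)
 then have c0: "0 <= c0" unfolding c0_def using C40 Cz_nonneg cc by (intro add_nonneg_nonneg mult_nonneg_nonneg) auto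
 define g where "g = (%x. c0) + cc *\<^sub>R (\<Sum>i=1..n. A (n - i) *\<^sub>R y i)"
 have sW: "(\<Sum>i=1..n. A (n - i) *\<^sub>R y i) \<in> {v. in_L2 L v}" using y by (intro L2.W_intros(5) L2.W_intros(3)) auto
 have gW: "g \<in> {v. in_L2 L v}" unfolding g_def using c0W sW by (intro L2.W_intros(1) L2.W_intros(3))
 have ptw: "\<bar>residual N n x\<bar> <= g x" if x: "x \<in> {0..L}" for x
 proof -
  have "\<bar>residual N n x\<bar> <= C4 * Cz / real n + cc * (\<Sum>i=1..n. A (n - i) * y i x)
    + \<bar>b\<bar> * (cc * (\<Sum>i=1..n. A (n - i) * (LINT s:{tt (i - 1)..tt i}|lebesgue. Bw s)))"
   using residual_bound[OF x N n, folded \<rho>_def] unfolding cc_def y_def .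
  moreover have "g x = c0 + cc * (\<Sum>i=1..n. A (n - i) * y i x)" by (simp add: g_def sum_fun_apply)
  ultimately show ?thesis unfolding c0_def by linarith
 qed
 have "norm_L2 L (residual N n) <= norm_L2 L g"
  using rL gW ptw by (intro in_L2_mono(2)) (auto simp: in_L2_def)
 also have "... = L2.nrm g" by (simp add: nrm_L2)
 also have "... <= L2.nrm (%x. c0) + L2.nrm (cc *\<^sub>R (\<Sum>i=1..n. A (n - i) *\<^sub>R y i))"
  unfolding g_def using c0W sW by (intro L2.nrm_triangle L2.W_intros(3))
 also have "... <= c0 * sqrt L + cc * (\<Sum>i=1..n. A (n - i) * (LINT s:{tt (i - 1)..tt i}|lebesgue. norm_L2 L (%x. Y2 x s)))"
 proof (rule add_mono)
  show "L2.nrm (%x. c0) <= c0 * sqrt L" using norm_L2_const[of L c0] L c0 by (simp add: nrm_L2)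
  have "L2.nrm (\<Sum>i=1..n. A (n - i) *\<^sub>R y i) <= (\<Sum>i=1..n. L2.nrm (A (n - i) *\<^sub>R y i))"
   using y by (intro L2.nrm_sum L2.W_intros(3)) auto
  also have "... <= (\<Sum>i=1..n. A (n - i) * (LINT s:{tt (i - 1)..tt i}|lebesgue. norm_L2 L (%x. Y2 x s)))"
  proof (rule sum_mono)
   fix i assume i: "i \<in> {1..n}"
   have "L2.nrm (A (n - i) *\<^sub>R y i) = A (n - i) * L2.nrm (y i)" using A_pos[of "n - i"] by (subst L2.nrm_scale[OF y(1)[OF i]]) simp
   then show "L2.nrm (A (n - i) *\<^sub>R y i) <= A (n - i) * (LINT s:{tt (i - 1)..tt i}|lebesgue. norm_L2 L (%x. Y2 x s))"
    using mult_left_mono[OF y(2)[OF i], of "A (n - i)"] A_pos[of "n - i"] by simp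
  qed
  finally show "L2.nrm (cc *\<^sub>R (\<Sum>i=1..n. A (n - i) *\<^sub>R y i)) <= cc * (\<Sum>i=1..n. A (n - i) * (LINT s:{tt (i - 1)..tt i}|lebesgue. norm_L2 L (%x. Y2 x s)))"
   using cc by (subst L2.nrm_scale[OF sW]) (auto intro: mult_left_mono)
 qed
 also have "... = C4 * Cz * sqrt L * (1 / real n) + cc * (\<Sum>i=1..n. A (n - i) * (LINT s:{tt (i - 1)..tt i}|lebesgue. Vw s))"
 proof -
  have "(LINT s:{tt (i - 1)..tt i}|lebesgue. Vw s) = (LINT s:{tt (i - 1)..tt i}|lebesgue. norm_L2 L (%x. Y2 x s)) + \<bar>b\<bar> * sqrt L * (LINT s:{tt (i - 1)..tt i}|lebesgue. Bw s)"
   if i: "i \<in> {1..n}" for i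
  proof -
   have "set_integrable lebesgue {tt (i - 1)..tt i} (%s. norm_L2 L (%x. Y2 x s))" "set_integrable lebesgue {tt (i - 1)..tt i} (%s. \<bar>b\<bar> * sqrt L * Bw s)"
    using cell(3)[OF i] by (auto intro!: set_integrable_subset[OF Y2_norm_integrable] set_integrable_mult_right set_integrable_subset[OF Bw_integrable])
   from set_integral_add(2)[OF this] show ?thesis by (simp add: Vw_def)
  qed
  then have "(\<Sum>i=1..n. A (n - i) * (LINT s:{tt (i - 1)..tt i}|lebesgue. Vw s)) =
   (\<Sum>i=1..n. A (n - i) * (LINT s:{tt (i - 1)..tt i}|lebesgue. norm_L2 L (%x. Y2 x s))) + \<bar>b\<bar> * sqrt L * (\<Sum>i=1..n. A (n - i) * (LINT s:{tt (i - 1)..tt i}|lebesgue. Bw s))"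
   unfolding sum_distrib_left sum.distrib[symmetric] by (intro sum.cong refl) (simp add: algebra_simps)
  then show ?thesis by (simp add: c0_def algebra_simps)
 qed
 finally show "norm_L2 L (residual N n) <= C4 * Cz * sqrt L * (1 / real n)
   + 2 / (1 - \<alpha>) * \<rho> * (\<Sum>i=1..n. A (n - i) * (LINT s:{tt (i - 1)..tt i}|lebesgue. Vw s))"
  by (simp add: cc_def)
qed

definition CR :: real where
 "CR = 2 * (grid.C4 \<alpha> * Cz * sqrt L) + 2 / (1 - \<alpha>) * (LINT s:{0..T}|lebesgue. Vw s) * T powr (1 - \<alpha>)"

text \<open>The part 1 / n is handled by \<open>sum_weights_harmonic_le\<close>, the origin of the
  logarithm in the rate; the part weighted by A collapses through \<open>sum_convolution_one\<close>
  to \<rho> times the integral of \<open>Vw\<close>.\<close>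

lemma residual_sum:
 fixes N m' :: nat
 defines "\<rho> \<equiv> \<tau> / real N"
 assumes N: "0 < N" and m': "m' \<in> {1..K * N}"
 shows "(\<Sum>n=1..m'. (\<rho> powr \<alpha> * g_coeff (-\<alpha>) (m' - n)) * norm_L2 L (residual N n))
  <= CR * (\<rho> * ((1 + ln (real m')) * (real m' * \<rho>) powr (\<alpha> - 1)))"
proof -
 have \<rho>: "0 < \<rho>" using \<tau> N by (simp add: \<rho>_def)
 interpret grid \<alpha> \<rho> m' by unfold_locales (use \<alpha> \<rho> in auto)
 define c1 where "c1 = C4 * Cz * sqrt L"
 define cc where "cc = 2 / (1 - \<alpha>) * \<rho>"
 have c1: "0 <= c1" using Gamma_pos1 \<alpha> Cz_nonneg L by (simp add: c1_def C4_def C3_def)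
 have cc: "0 <= cc" using \<alpha> \<rho> by (simp add: cc_def)
 define V where "V i = (LINT s:{tt (i - 1)..tt i}|lebesgue. Vw s)" for i
 define G where "G j = \<rho> powr \<alpha> * g_coeff (-\<alpha>) j" for j
 have G: "0 <= G j" for j using g_coeff_neg_pos[of "-\<alpha>" j] \<alpha> by (simp add: G_def)
 have conv: "(\<Sum>i\<le>l. A i * G (l - i)) = 1" for l unfolding A_def G_def using A_G_convolution[OF \<rho>] .
 have m1: "1 <= m'" using m' by simp
 have "real m' <= real (K * N)" using m' by (subst of_nat_le_iff) simp
 then have "real m' * \<rho> <= real (K * N) * \<rho>" using \<rho> by (intro mult_right_mono) auto
 then have mT: "tt m' <= T" using N by (simp add: T_def \<rho>_def)
 have tm: "0 < tt m'" using m1 \<rho> by simp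
 let ?l = "1 + ln (real m')"
 have l1: "1 <= ?l" using m1 by simp
 have "(\<Sum>n=1..m'. G (m' - n) * norm_L2 L (residual N n)) <= (\<Sum>n=1..m'. G (m' - n) * (c1 * (1 / real n) + cc * (\<Sum>i=1..n. A (n - i) * V i)))"
 proof (intro sum_mono mult_left_mono G)
  fix n assume "n \<in> {1..m'}"
  then have "n \<in> {1..K * N}" using m' by auto
  from residual_norm(2)[OF N this] show "norm_L2 L (residual N n) <= c1 * (1 / real n) + cc * (\<Sum>i=1..n. A (n - i) * V i)"
   by (simp add: c1_def cc_def V_def \<rho>_def)
 qed
 also have "... = c1 * \<rho> powr \<alpha> * (\<Sum>n=1..m'. g_coeff (-\<alpha>) (m' - n) * (1 / real n)) + cc * (\<Sum>n=1..m'. G (m' - n) * (\<Sum>i=1..n. A (n - i) * V i))"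
  unfolding sum_distrib_left[of _ _ "{1..m'}"] sum.distrib[symmetric] G_def by (intro sum.cong refl) (simp add: algebra_simps)
 finally have S: "(\<Sum>n=1..m'. G (m' - n) * norm_L2 L (residual N n))
  <= c1 * \<rho> powr \<alpha> * (\<Sum>n=1..m'. g_coeff (-\<alpha>) (m' - n) * (1 / real n)) + cc * (\<Sum>i=1..m'. V i)"
  unfolding sum_convolution_one[OF conv] .
 have V: "(\<Sum>i=1..m'. V i) <= (LINT s:{0..T}|lebesgue. Vw s)"
 proof -
  have mono: "tt i <= tt (Suc i)" if "i < m'" for i by (rule tt_mono) simp
  have ci: "set_integrable lebesgue {tt i..tt (Suc i)} Vw" if "i < m'" for i
   using cell_subset[OF that] mT by (intro set_integrable_subset[OF Vw_integrable]) auto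
  have "(\<Sum>i=1..m'. V i) = (\<Sum>i<m'. V (Suc i))"
   by (rule sum.reindex_bij_witness[of _ Suc "%i. i - 1"]) auto
  also have "... = (LINT s:{tt 0..tt m'}|lebesgue. Vw s)"
   using absolutely_integrable_partition(2)[of m' tt Vw, OF mono ci] by (simp add: V_def)
  also have "... <= (LINT s:{0..T}|lebesgue. Vw s)"
   unfolding set_lebesgue_integral_def
  proof (rule integral_mono)
   have "set_integrable lebesgue {tt 0..tt m'} Vw" using mT by (intro set_integrable_subset[OF Vw_integrable]) auto
   then show "integrable lebesgue (%s. indicator {tt 0..tt m'} s *\<^sub>R Vw s)" by (simp add: set_integrable_def)
   show "integrable lebesgue (%s. indicator {0..T} s *\<^sub>R Vw s)" using Vw_integrable by (simp add: set_integrable_def)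
   show "indicator {tt 0..tt m'} s *\<^sub>R Vw s <= indicator {0..T} s *\<^sub>R Vw s" for s
    using Vw_nonneg mT by (auto simp: indicator_def)
  qed
  finally show ?thesis .
 qed
 have "c1 * \<rho> powr \<alpha> * (\<Sum>n=1..m'. g_coeff (-\<alpha>) (m' - n) * (1 / real n)) <= c1 * \<rho> powr \<alpha> * (2 * real m' powr (\<alpha> - 1) * ?l)"
  using sum_weights_harmonic_le[OF \<alpha> m1] c1 by (intro mult_left_mono) auto
 also have "... = 2 * c1 * (\<rho> * (?l * tt m' powr (\<alpha> - 1)))"
 proof -
  have "\<rho> * \<rho> powr (\<alpha> - 1) = \<rho> powr \<alpha>" using \<rho> powr_add[of \<rho> 1 "\<alpha> - 1"] by simp
  moreover have "tt m' powr (\<alpha> - 1) = real m' powr (\<alpha> - 1) * \<rho> powr (\<alpha> - 1)" using \<rho> by (simp add: powr_mult)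
  moreover have "c1 * r' * (2 * m1 * l) = 2 * c1 * (\<rho> * (l * (m1 * r)))" if "\<rho> * r = r'" for r r' m1 l
   unfolding that[symmetric] by (simp add: mult_ac)
  ultimately show ?thesis by simp
 qed
 finally have W: "c1 * \<rho> powr \<alpha> * (\<Sum>n=1..m'. g_coeff (-\<alpha>) (m' - n) * (1 / real n)) <= 2 * c1 * (\<rho> * (?l * tt m' powr (\<alpha> - 1)))" .
 \<comment> \<open>A bound of order \<rho> fits into the rate because T^(1 - \<alpha>) t^(\<alpha> -
   1) >= 1 for 0 < t <= T.\<close>
 have X: "cc * (LINT s:{0..T}|lebesgue. Vw s) <= 2 / (1 - \<alpha>) * (LINT s:{0..T}|lebesgue. Vw s) * T powr (1 - \<alpha>) * (\<rho> * (?l * tt m' powr (\<alpha> - 1)))"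
 proof -
  have "1 = tt m' powr (1 - \<alpha>) * tt m' powr (\<alpha> - 1)" using m1 \<rho> by (simp flip: powr_add)
  also have "... <= T powr (1 - \<alpha>) * (?l * tt m' powr (\<alpha> - 1))"
   using mT tm \<alpha> l1 mult_right_mono[OF l1, of "tt m' powr (\<alpha> - 1)"] by (intro mult_mono powr_mono2) auto
  finally have one: "1 <= T powr (1 - \<alpha>) * (?l * tt m' powr (\<alpha> - 1))" .
  have "0 <= (LINT s:{0..T}|lebesgue. Vw s)" unfolding set_lebesgue_integral_def using Vw_nonneg by (intro integral_nonneg_AE) auto
  then have "cc * (LINT s:{0..T}|lebesgue. Vw s) * 1 <= cc * (LINT s:{0..T}|lebesgue. Vw s) * (T powr (1 - \<alpha>) * (?l * tt m' powr (\<alpha> - 1)))"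
   using one cc by (intro mult_left_mono) auto
  then show ?thesis by (simp add: cc_def mult_ac)
 qed
 have "(\<Sum>n=1..m'. G (m' - n) * norm_L2 L (residual N n)) <= 2 * c1 * (\<rho> * (?l * tt m' powr (\<alpha> - 1)))
   + 2 / (1 - \<alpha>) * (LINT s:{0..T}|lebesgue. Vw s) * T powr (1 - \<alpha>) * (\<rho> * (?l * tt m' powr (\<alpha> - 1)))"
  by (rule order_trans[OF S add_mono[OF W order_trans[OF mult_left_mono[OF V cc] X]]])
 then show ?thesis unfolding G_def CR_def c1_def distrib_right .
qed

end

section \<open>Interpolation error of the solution and of its time differences\<close>

context delay_problem begin

lemma interpolation_from_bound:
 assumes part: "is_partition L M P" and g: "continuous_on {0..L} g" "g 0 = 0" "g L = 0"
  and G: "in_L2 L G" "!!x. x \<in> {0..L} ==> \<bar>G x\<bar> <= c"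
  and hat: "!!x1 x2 x3. 0 <= x1 ==> x1 < x2 ==> x2 < x3 ==> x3 <= L ==> hat_jump g x1 x2 x3 = inner_L2 L G (hat x1 x2 x3)"
 shows "norm_L2 L (%x. g x - fe_partition.interp M P g x) <= c * sqrt L * (mesh_size M P)\<^sup>2"
proof -
 interpret fe_partition L M P by unfold_locales (rule part)
 have "norm_L2 L (%x. g x - interp g x) <= h\<^sup>2 * norm_L2 L G" by (rule interpolation_error[OF g G(1) hat])
 also have "... <= h\<^sup>2 * (c * sqrt L)" using in_L2_bounded(2)[of L G c] G L by (intro mult_left_mono) (auto simp: in_L2_def)
 finally show ?thesis by (simp add: mult.commute)
qed

text \<open>For p > 0 the weak equation makes (E - a u) / p a second derivative in x, bounded
  uniformly in time. For p = 0 it gives no such information and the assumed uniform H^2 bound takes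
  over.\<close>

lemma interp_error_exists:
 "\<exists>C\<ge>0. \<forall>M P t. is_partition L M P --> 0 < t --> t <= T -->
  norm_L2 L (%x. u x t - fe_partition.interp M P (%x. u x t) x) <= C * (mesh_size M P)\<^sup>2"
proof (cases "p = 0")
 case True
 from u_H2_bounded[OF True, folded T_def] obtain B where B: "!!t. t \<in> {0..T} ==> H2_norm_le L (%x. u x t) B" by blast
 show ?thesis
 proof (intro exI[of _ "\<bar>B\<bar>"] conjI allI impI)
  fix M P t assume part: "is_partition L M P" and t: "0 < t" "t <= T"
  interpret fe_partition L M P by unfold_locales (rule part)
  obtain g1 g2 where g: "H2_derivs L (%x. u x t) g1 g2" "sqrt ((norm_L2 L (%x. u x t))\<^sup>2 + (norm_L2 L g1)\<^sup>2 + (norm_L2 L g2)\<^sup>2) <= B"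
   using B[of t] t by (auto simp: H2_norm_le_def)
  have "norm_L2 L g2 <= sqrt ((norm_L2 L (%x. u x t))\<^sup>2 + (norm_L2 L g1)\<^sup>2 + (norm_L2 L g2)\<^sup>2)" by (rule real_le_rsqrt) simp
  with g(2) have gB: "norm_L2 L g2 <= \<bar>B\<bar>" by linarith
  have tt: "t \<in> {-\<tau>..T}" using t \<tau> by simp
  have "norm_L2 L (%x. u x t - interp (%x. u x t) x) <= h\<^sup>2 * norm_L2 L g2"
   using u_cont_x[OF tt] u_bd[OF tt] g(1) hat_jump_weak[OF u_cont_x[OF tt] g(1)]
   by (intro interpolation_error) (auto simp: H2_derivs_def)
  also have "... <= \<bar>B\<bar> * h\<^sup>2" using gB by (simp add: mult.commute mult_right_mono)
  finally show "norm_L2 L (%x. u x t - interp (%x. u x t) x) <= \<bar>B\<bar> * h\<^sup>2" .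
 qed simp
next
 case False
 then have p0: "0 < p" using p by simp
 have CE00: "0 <= CE0" using order_trans[OF abs_ge_zero E_bound[of T 0]] T_pos by simp
 show ?thesis
 proof (intro exI[of _ "(CE0 + \<bar>a\<bar> * Cuf) / p * sqrt L"] conjI allI impI)
  show "0 <= (CE0 + \<bar>a\<bar> * Cuf) / p * sqrt L" using CE00 Cuf(1) p0 L by simp
  fix M P t assume part: "is_partition L M P" and t: "0 < t" "t <= T"
  interpret L2: semi_inner "{v. in_L2 L v}" "inner_L2 L" by (rule semi_inner_L2)
  have tt: "t \<in> {-\<tau>..T}" using t \<tau> by simp
  have uW: "(%x. u x t) \<in> {v. in_L2 L v}" and EW: "(%x. E x t) \<in> {v. in_L2 L v}" using in_L2_u[OF tt] in_L2_E[OF t] by auto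
  let ?G = "(1 / p) *\<^sub>R ((%x. E x t) - a *\<^sub>R (%x. u x t))"
  show "norm_L2 L (%x. u x t - fe_partition.interp M P (%x. u x t) x) <= (CE0 + \<bar>a\<bar> * Cuf) / p * sqrt L * (mesh_size M P)\<^sup>2"
  proof (rule interpolation_from_bound[OF part u_cont_x[OF tt]])
   show "u 0 t = 0" "u L t = 0" using u_bd[OF tt] by auto
   have "?G \<in> {v. in_L2 L v}" using uW EW by (intro L2.W_intros(2,3))
   then show "in_L2 L ?G" by simp
   show "\<bar>?G x\<bar> <= (CE0 + \<bar>a\<bar> * Cuf) / p" if x: "x \<in> {0..L}" for x
   proof -
    have "\<bar>a * u x t\<bar> <= \<bar>a\<bar> * Cuf" unfolding abs_mult using Cuf(2)[OF x tt] by (intro mult_left_mono) auto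
    then have "\<bar>E x t - a * u x t\<bar> <= CE0 + \<bar>a\<bar> * Cuf" using E_bound[OF t, of x] by linarith
    then show ?thesis using p0 by (simp add: abs_divide divide_right_mono)
   qed
   show "hat_jump (%x. u x t) x1 x2 x3 = inner_L2 L ?G (hat x1 x2 x3)" if ab: "0 <= x1" "x1 < x2" "x2 < x3" "x3 <= L" for x1 x2 x3
   proof -
    have hW: "hat x1 x2 x3 \<in> {v. in_L2 L v}" using in_L2_hat by simp
    have alg: "j = (1 / p) * (e - a * w)" if "p * j + a * w = e" for j w e using that p0 by auto
    have G: "inner_L2 L ?G (hat x1 x2 x3) = (1 / p) * (inner_L2 L (%x. E x t) (hat x1 x2 x3) - a * inner_L2 L (%x. u x t) (hat x1 x2 x3))"
     using L2.ip_scale L2.ip_diff L2.W_intros(2,3) uW EW hW by metis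
    show ?thesis unfolding G by (rule alg[OF weak_equation[OF ab t]])
   qed
  qed
 qed
qed

text \<open>The weak equations at s and t are subtracted; the second derivative of the difference is
  then controlled by the Hoelder bounds for E and u, whence the two exponents \<alpha> and 1 -
  \<alpha>.\<close>

lemma interp_difference_exists:
 "\<exists>C\<ge>0. \<forall>M P s t. 0 < p --> is_partition L M P --> 0 < s --> s <= t --> t <= T -->
  norm_L2 L (%x. (u x s - u x t) - fe_partition.interp M P (%x. u x s - u x t) x)
   <= C * ((t - s) powr \<alpha> + (t - s) powr (1 - \<alpha>)) * (mesh_size M P)\<^sup>2"
proof (cases "0 < p")
 case p0: True
 have CE0': "0 <= CE"
 proof -
  have "0 <= CE * ((T - T/2) powr \<alpha> + (T - T/2) powr (1 - \<alpha>))" using order_trans[OF abs_ge_zero E_Holder[of 0 "T/2" T]] T_pos L by simp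
  moreover have "0 < (T - T/2) powr \<alpha> + (T - T/2) powr (1 - \<alpha>)" using T_pos by (intro add_pos_pos) auto
  ultimately show ?thesis by (simp add: zero_le_mult_iff)
 qed
 define c where "c = (CE + \<bar>a\<bar> * (Cz / \<alpha>)) / p"
 have c0: "0 <= c" using CE0' Cz_nonneg \<alpha> p0 by (simp add: c_def)
 show ?thesis
 proof (intro exI[of _ "c * sqrt L"] conjI allI impI)
  show "0 <= c * sqrt L" using c0 L by simp
  fix M P s t assume part: "is_partition L M P" and s: "0 < s" "s <= t" and t: "t <= T"
  interpret L2: semi_inner "{v. in_L2 L v}" "inner_L2 L" by (rule semi_inner_L2)
  let ?w = "(t - s) powr \<alpha> + (t - s) powr (1 - \<alpha>)"
  have ts: "t \<in> {-\<tau>..T}" "s \<in> {-\<tau>..T}" "0 < t" "s <= T" using s t \<tau> by auto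
  have W: "(%x. u x t) \<in> {v. in_L2 L v}" "(%x. E x t) \<in> {v. in_L2 L v}" "(%x. u x s) \<in> {v. in_L2 L v}" "(%x. E x s) \<in> {v. in_L2 L v}"
   using in_L2_u in_L2_E ts s t by auto
  let ?G = "(1 / p) *\<^sub>R (((%x. E x s) - (%x. E x t)) - a *\<^sub>R ((%x. u x s) - (%x. u x t)))"
  have "norm_L2 L (%x. (u x s - u x t) - fe_partition.interp M P (%x. u x s - u x t) x) <= (c * ?w) * sqrt L * (mesh_size M P)\<^sup>2"
  proof (rule interpolation_from_bound[OF part, of _ ?G])
   show "continuous_on {0..L} (%x. u x s - u x t)" using u_cont_x ts by (intro continuous_on_diff) auto
   show "u 0 s - u 0 t = 0" "u L s - u L t = 0" using u_bd ts by auto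
   have "?G \<in> {v. in_L2 L v}" using W by (intro L2.W_intros(2,3))
   then show "in_L2 L ?G" by simp
   show "\<bar>?G x\<bar> <= c * ?w" if x: "x \<in> {0..L}" for x
   proof -
    have "\<bar>u x s - u x t\<bar> <= Cz / \<alpha> * (t - s) powr \<alpha>" using u_Holder[OF x, of s t] s t by (simp add: abs_minus_commute)
    also have "... <= Cz / \<alpha> * ?w" using Cz_nonneg \<alpha> by (intro mult_left_mono) auto
    finally have "\<bar>a * (u x s - u x t)\<bar> <= \<bar>a\<bar> * (Cz / \<alpha> * ?w)" unfolding abs_mult by (intro mult_left_mono) auto
    then have "\<bar>(E x s - E x t) - a * (u x s - u x t)\<bar> <= CE * ?w + \<bar>a\<bar> * (Cz / \<alpha> * ?w)"
     using E_Holder[OF x s t] by linarith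
    also have "... = (CE + \<bar>a\<bar> * (Cz / \<alpha>)) * ?w" by (simp only: distrib_right mult.assoc)
    also have "... = c * p * ?w" using p0 by (simp add: c_def)
    finally have le: "\<bar>(E x s - E x t) - a * (u x s - u x t)\<bar> <= c * p * ?w" .
    have "\<bar>?G x\<bar> = \<bar>(E x s - E x t) - a * (u x s - u x t)\<bar> / p" using p0 by (simp add: abs_divide)
    also have "... <= c * p * ?w / p" using le p0 by (intro divide_right_mono) auto
    finally show ?thesis using p0 by simp
   qed
   show "hat_jump (%x. u x s - u x t) x1 x2 x3 = inner_L2 L ?G (hat x1 x2 x3)" if ab: "0 <= x1" "x1 < x2" "x2 < x3" "x3 <= L" for x1 x2 x3
   proof -
    have hW: "hat x1 x2 x3 \<in> {v. in_L2 L v}" using in_L2_hat by simp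
    have alg: "j - j' = (1 / p) * ((e - e') - a * (w - w'))" if "p * j + a * w = e" "p * j' + a * w' = e'" for j w e j' w' e'
    proof -
     have "(e - e') - a * (w - w') = p * (j - j')" unfolding that[symmetric] by (simp add: algebra_simps)
     then show ?thesis using p0 by simp
    qed
    have G: "inner_L2 L ?G (hat x1 x2 x3) = (1 / p) * ((inner_L2 L (%x. E x s) (hat x1 x2 x3) - inner_L2 L (%x. E x t) (hat x1 x2 x3)) - a * (inner_L2 L (%x. u x s) (hat x1 x2 x3) - inner_L2 L (%x. u x t) (hat x1 x2 x3)))"
     using W hW L2.W_intros(2,3) by (simp only: L2.ip_scale L2.ip_diff)
    show ?thesis unfolding G hat_jump_diff by (rule alg[OF weak_equation[OF ab s(1) ts(4)] weak_equation[OF ab ts(3) t]])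
   qed
  qed
  then show "norm_L2 L (%x. (u x s - u x t) - fe_partition.interp M P (%x. u x s - u x t) x) <= c * sqrt L * ?w * (mesh_size M P)\<^sup>2"
   by (simp add: mult_ac)
 qed
qed (auto intro: exI[of _ 0])

end

section \<open>Error recursion and Gronwall argument for a fixed mesh and time step\<close>

text \<open>\<open>CI\<close> and \<open>CH\<close> enter as parameters with their bounds as
  hypotheses, because they have to be chosen before the mesh and the time step.\<close>

locale discrete_problem = delay_problem + fe_partition +
 fixes N :: nat and uh :: "int => real => real" and C0 CI CH :: real
 assumes N: "0 < N"
  and scheme: "fe_scheme \<alpha> L p a b \<tau> K f \<phi> d\<phi> M P N uh"
  and start: "!!n. n \<in> {- int N..0} ==> norm_L2 L (%x. uh n x - \<phi> x (of_int n * (\<tau> / real N))) <= C0 * h\<^sup>2"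
  and CI: "0 <= CI" "!!t. 0 < t ==> t <= T ==> norm_L2 L (%x. u x t - interp (%x. u x t) x) <= CI * h\<^sup>2"
  and CH: "0 <= CH" "!!s t. 0 < p ==> 0 < s ==> s <= t ==> t <= T ==>
   norm_L2 L (%x. (u x s - u x t) - interp (%x. u x s - u x t) x) <= CH * ((t - s) powr \<alpha> + (t - s) powr (1 - \<alpha>)) * h\<^sup>2"
begin

definition \<rho> :: real where "\<rho> = \<tau> / real N"

abbreviation W :: "(real => real) set" where "W \<equiv> {v. in_L2 L v}"

definition un :: "int => real => real" where "un k = (%x. u x (of_int k * \<rho>))"

lemma \<rho>_pos: "0 < \<rho>" and N\<rho>: "real N * \<rho> = \<tau>" and KN\<rho>: "real (K * N) * \<rho> = T"
 using \<tau> N by (auto simp: \<rho>_def T_def)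

sublocale L2: semi_inner W "inner_L2 L" by (rule semi_inner_L2)

sublocale Gk: galerkin W "inner_L2 L" basis "%w v. p * fe_form w v"
proof (intro galerkin.intro galerkin_axioms.intro L2.semi_inner_axioms)
 show "basis \<subseteq> W" using in_L2_hat by (auto simp: basis_def hatf_def)
qed (use finite_basis semi_inner_fe_form[OF p] in auto)

lemma int_le_KN: "n <= K * N ==> int n <= int K * int N"
 by (metis of_nat_le_iff of_nat_mult)

lemma time_range:
 assumes "- int N <= k" "k <= int K * int N" shows "-\<tau> <= of_int k * \<rho>" "of_int k * \<rho> <= T"
proof -
 have "real_of_int k <= real_of_int (int K * int N)" using assms(2) by (simp only: of_int_le_iff)
 then have 1: "- real N <= of_int k" "real_of_int k <= real (K * N)" using assms by (linarith, simp)
 show "-\<tau> <= of_int k * \<rho>" using mult_right_mono[OF 1(1), of \<rho>] \<rho>_pos N\<rho> by simp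
 show "of_int k * \<rho> <= T" using mult_right_mono[OF 1(2), of \<rho>] \<rho>_pos by (simp only: KN\<rho> less_imp_le)
qed

lemma grid_range: "n <= K * N ==> real n * \<rho> <= T"
 using time_range(2)[of "int n"] int_le_KN[of n] by simp

lemma un_W: "- int N <= k ==> k <= int K * int N ==> un k \<in> W"
 using time_range[of k] in_L2_u[of "of_int k * \<rho>"] by (simp add: un_def)

lemma un_bd: "- int N <= k ==> k <= int K * int N ==> un k 0 = 0 & un k L = 0"
 using time_range[of k] u_bd[of "of_int k * \<rho>"] by (simp add: un_def)

lemma uh_fe: "- int N <= k ==> k <= int K * int N ==> uh k \<in> fe_space L M P"
 using scheme unfolding fe_scheme_def by simp

lemma uh_W: "- int N <= k ==> k <= int K * int N ==> uh k \<in> W"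
 using uh_fe fe_space_L2 by blast

lemma uh_interp: "- int N <= k ==> k <= int K * int N ==> v \<in> W ==> inner_L2 L (interp (uh k)) v = inner_L2 L (uh k) v"
 using interp_fe_space[OF uh_fe] by (intro inner_L2_cong) auto

lemma interp_W: "interp v \<in> W" using Gk.span_W[OF interp_span] .

text \<open>Paired with a hat function, \<open>fe_form\<close> is minus the slope jump at the nodes,
  where u and its interpolant agree. Hence the interpolant satisfies the Galerkin form of
  \<open>weak_equation\<close> exactly; linearity extends this to the span.\<close>

lemma weak_span:
 assumes v: "v \<in> span basis" and n: "n \<in> {1..K * N}"
 shows "p * fe_form (interp (un (int n))) v = a * inner_L2 L (un (int n)) v - inner_L2 L (%x. E x (real n * \<rho>)) v"
proof -
 have t: "0 < real n * \<rho>" "real n * \<rho> <= T" using n \<rho>_pos grid_range[of n] by auto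
 have uW: "un (int n) \<in> W" using n int_le_KN[of n] by (intro un_W) auto
 have EW: "(%x. E x (real n * \<rho>)) \<in> W" using in_L2_E[OF t] by simp
 have base: "p * fe_form (interp (un (int n))) v = a * inner_L2 L (un (int n)) v - inner_L2 L (%x. E x (real n * \<rho>)) v" if v: "v \<in> basis" for v
 proof -
  obtain i where i: "i \<in> {1..<M}" "v = hatf i" using v by (auto simp: basis_def)
  have "fe_form (interp (un (int n))) v = fe_form (un (int n)) v"
   using un_bd[of "int n"] n int_le_KN[of n] by (intro fe_form_cong interp_node) auto
  also have "... = - hat_jump (un (int n)) (P (i - 1)) (P i) (P (Suc i))" unfolding i(2) by (rule fe_form_hatf[OF i(1)])
  finally have eq: "fe_form (interp (un (int n))) v = - hat_jump (un (int n)) (P (i - 1)) (P i) (P (Suc i))" .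
  have "0 <= P (i - 1)" "P (i - 1) < P i" "P i < P (Suc i)" "P (Suc i) <= L"
   using i P_range P_Suc[of "i - 1"] P_Suc[of i] by auto
  from weak_equation[OF this t] show ?thesis unfolding eq unfolding i(2) hatf_def by (simp add: un_def)
 qed
 interpret D: semi_inner "span basis" "%w v. p * fe_form w v" by (rule Gk.D_inner)
 let ?Q = "{v. p * fe_form (interp (un (int n))) v = a * inner_L2 L (un (int n)) v - inner_L2 L (%x. E x (real n * \<rho>)) v}"
 have "subspace (span basis \<inter> ?Q)"
 proof (rule subspaceI)
  show "0 \<in> span basis \<inter> ?Q" using D.ip_0_right[OF interp_span] L2.ip_0_right uW EW by (auto simp: span_zero)
  fix x y assume x: "x \<in> span basis \<inter> ?Q"
  show "x + y \<in> span basis \<inter> ?Q" if y: "y \<in> span basis \<inter> ?Q"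
  proof (intro IntI CollectI)
   have xs: "x \<in> span basis" "y \<in> span basis" using x y by auto
   then show "x + y \<in> span basis" by (rule span_add)
   show "p * fe_form (interp (un (int n))) (x + y) = a * inner_L2 L (un (int n)) (x + y) - inner_L2 L (%x. E x (real n * \<rho>)) (x + y)"
    unfolding D.ip_add_right[OF xs interp_span] L2.ip_add_right[OF Gk.span_W[OF xs(1)] Gk.span_W[OF xs(2)] uW] L2.ip_add_right[OF Gk.span_W[OF xs(1)] Gk.span_W[OF xs(2)] EW]
    using x y by (simp add: algebra_simps)
  qed
  show "c *\<^sub>R x \<in> span basis \<inter> ?Q" for c
  proof (intro IntI CollectI)
   have xs: "x \<in> span basis" using x by auto
   then show "c *\<^sub>R x \<in> span basis" by (rule span_scale)
   have "p * fe_form (interp (un (int n))) (c *\<^sub>R x) = c * (a * inner_L2 L (un (int n)) x - inner_L2 L (%x. E x (real n * \<rho>)) x)"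
    unfolding D.ip_scale_right[OF xs interp_span] using x by auto
   then show "p * fe_form (interp (un (int n))) (c *\<^sub>R x) = a * inner_L2 L (un (int n)) (c *\<^sub>R x) - inner_L2 L (%x. E x (real n * \<rho>)) (c *\<^sub>R x)"
    unfolding L2.ip_scale_right[OF Gk.span_W[OF xs] uW] L2.ip_scale_right[OF Gk.span_W[OF xs] EW] by (simp only: right_diff_distrib mult.left_commute)
  qed
 qed
 moreover have "basis \<subseteq> span basis \<inter> ?Q" using base span_superset[of basis] by auto
 ultimately have "span basis \<subseteq> span basis \<inter> ?Q" by (rule span_minimal[rotated])
 then show ?thesis using v by auto
qed


definition A :: "nat => real" where "A j = \<rho> powr (-\<alpha>) * g_coeff (\<alpha> - 1) j"

definition G :: "nat => real" where "G j = \<rho> powr \<alpha> * g_coeff (-\<alpha>) j"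

lemma A_pos: "0 < A j" using g_coeff_neg_pos[of "\<alpha> - 1" j] \<alpha> \<rho>_pos by (simp add: A_def)

lemma G_pos': "0 < G j" using g_coeff_neg_pos[of "-\<alpha>" j] \<alpha> \<rho>_pos by (simp add: G_def)

lemma AG: "(\<Sum>i\<le>l. A i * G (l - i)) = 1" unfolding A_def G_def by (rule A_G_convolution[OF \<rho>_pos])

lemma discrete_deriv_fun: "discrete_deriv \<alpha> \<rho> w n = (\<Sum>k=1..n. A (n - k) *\<^sub>R (w (int k) - w (int k - 1)))"
 by (rule ext) (simp add: discrete_deriv_def sum_fun_apply A_coeff_eq[OF \<alpha>] A_def)

lemma J_delay_fun: "J_delay \<alpha> \<rho> N w n = (\<Sum>k=0..n. (\<rho> * A (n - k)) *\<^sub>R w (int k - int N))"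
proof (rule ext)
 have "\<rho> powr (1 - \<alpha>) * g_coeff (\<alpha> - 1) j = \<rho> * A j" for j
  using \<rho>_pos powr_add[of \<rho> 1 "-\<alpha>"] by (simp add: A_def)
 then show "J_delay \<alpha> \<rho> N w n x = (\<Sum>k=0..n. (\<rho> * A (n - k)) *\<^sub>R w (int k - int N)) x" for x
  by (simp add: J_delay_def sum_fun_apply sum_distrib_left flip: mult.assoc)
qed

lemma discrete_deriv_W:
 assumes "!!k. k \<in> {0..int n} ==> w k \<in> W" shows "discrete_deriv \<alpha> \<rho> w n \<in> W"
 unfolding discrete_deriv_fun using assms by (intro L2.W_intros(5) L2.W_intros(3) L2.W_intros(2)) auto

lemma J_delay_W:
 assumes "!!k. k \<in> {- int N..int n} ==> w k \<in> W" shows "J_delay \<alpha> \<rho> N w n \<in> W"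
 unfolding J_delay_fun using assms by (intro L2.W_intros(5) L2.W_intros(3)) auto

lemma inner_discrete_deriv:
 assumes w: "!!k. k \<in> {0..int n} ==> w k \<in> W" and v: "v \<in> W"
 shows "inner_L2 L (discrete_deriv \<alpha> \<rho> w n) v = (\<Sum>k=1..n. A (n - k) * (inner_L2 L (w (int k)) v - inner_L2 L (w (int k - 1)) v))"
proof -
 have "inner_L2 L (discrete_deriv \<alpha> \<rho> w n) v = (\<Sum>k=1..n. inner_L2 L (A (n - k) *\<^sub>R (w (int k) - w (int k - 1))) v)"
  unfolding discrete_deriv_fun using w v by (intro L2.ip_sum L2.W_intros(3) L2.W_intros(2)) auto
 also have "... = (\<Sum>k=1..n. A (n - k) * (inner_L2 L (w (int k)) v - inner_L2 L (w (int k - 1)) v))"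
 proof (rule sum.cong[OF refl])
  fix k assume k: "k \<in> {1..n}"
  have "w (int k) \<in> W" "w (int k - 1) \<in> W" using k by (auto intro!: w simp del: mem_Collect_eq)
  then show "inner_L2 L (A (n - k) *\<^sub>R (w (int k) - w (int k - 1))) v = A (n - k) * (inner_L2 L (w (int k)) v - inner_L2 L (w (int k - 1)) v)"
   by (simp only: L2.ip_scale L2.ip_diff L2.W_intros(2) v)
 qed
 finally show ?thesis .
qed

text \<open>The discrete solution is replaced by its interpolant in the elliptic and reaction terms,
  since the abstract stability theory needs vectors in \<open>span basis\<close>.\<close>

lemma scheme_eq:
 assumes n: "n \<in> {1..K * N}" and v: "v \<in> span basis"
 shows "inner_L2 L (discrete_deriv \<alpha> \<rho> uh n) v = - p * fe_form (interp (uh (int n))) v + a * inner_L2 L (interp (uh (int n))) v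
  + b * inner_L2 L (J_delay \<alpha> \<rho> N uh n) v + b * inner_L2 L (H_corr \<alpha> \<tau> N \<phi> d\<phi> n) v + inner_L2 L (F_rhs \<alpha> b \<tau> N f \<phi> d\<phi> n) v"
proof -
 have k: "- int N <= int n" "int n <= int K * int N" using int_le_KN[of n] n by auto
 have vf: "v \<in> fe_space L M P" using v span_basis_fe_space by blast
 have "fe_form (interp (uh (int n))) v = fe_form (uh (int n)) v"
  using uh_fe[OF k] by (intro fe_form_cong interp_node) (auto simp: fe_space_def)
 then have "inner_L2 L (deriv (uh (int n))) (deriv v) = fe_form (interp (uh (int n))) v"
  using inner_deriv_fe_space[OF uh_fe[OF k] vf] by simp
 moreover have "inner_L2 L (interp (uh (int n))) v = inner_L2 L (uh (int n)) v" by (rule uh_interp[OF k Gk.span_W[OF v]])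
 ultimately show ?thesis using scheme n vf unfolding fe_scheme_def \<rho>_def by simp
qed

lemma residual_inner:
 assumes n: "n \<in> {1..K * N}" and v: "v \<in> W"
 shows "inner_L2 L (residual N n) v = inner_L2 L (discrete_deriv \<alpha> \<rho> un n) v - b * inner_L2 L (J_delay \<alpha> \<rho> N un n) v
  - b * inner_L2 L (H_corr \<alpha> \<tau> N \<phi> d\<phi> n) v - inner_L2 L (F_rhs \<alpha> b \<tau> N f \<phi> d\<phi> n) v - inner_L2 L (%x. E x (real n * \<rho>)) v"
proof -
 have t: "0 < real n * \<rho>" "real n * \<rho> <= T" using n \<rho>_pos grid_range[of n] by auto
 have uW: "un k \<in> W" if "k \<in> {- int N..int n}" for k using that n int_le_KN[of n] by (intro un_W) auto
 have 1: "discrete_deriv \<alpha> \<rho> un n \<in> W" by (rule discrete_deriv_W) (auto intro!: uW simp del: mem_Collect_eq)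
 have 2: "J_delay \<alpha> \<rho> N un n \<in> W" by (rule J_delay_W) (auto intro!: uW simp del: mem_Collect_eq)
 have 3: "H_corr \<alpha> \<tau> N \<phi> d\<phi> n \<in> W" using in_L2_H by simp
 have 4: "F_rhs \<alpha> b \<tau> N f \<phi> d\<phi> n \<in> W" using in_L2_F[of n N] t by (simp add: \<rho>_def)
 have 5: "(%x. E x (real n * \<rho>)) \<in> W" using in_L2_E[OF t] by simp
 have "residual N n = discrete_deriv \<alpha> \<rho> un n - b *\<^sub>R J_delay \<alpha> \<rho> N un n - b *\<^sub>R H_corr \<alpha> \<tau> N \<phi> d\<phi> n - F_rhs \<alpha> b \<tau> N f \<phi> d\<phi> n - (%x. E x (real n * \<rho>))"
  by (rule ext) (simp add: residual_def Let_def un_def[abs_def] \<rho>_def)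
 then show ?thesis using 1 2 3 4 5 v by (simp only: L2.ip_diff L2.ip_scale L2.W_intros(2,3))
qed

end

context delay_problem begin

text \<open>\<open>CK\<close> bounds the response to the elliptic defect, \<open>C1\<close> is the
  constant of the recursion and \<open>C2\<close> the one after Gronwall. They are defined outside
  \<open>discrete_problem\<close> so that they visibly do not depend on mesh, step or discrete
  solution.\<close>

definition CK :: "real => real => real" where
 "CK CI CH = 2 * CI + \<alpha> * CH * (T powr \<alpha> / \<alpha> + T powr (1 - \<alpha>) / (1 - \<alpha>))"

definition C1 :: "real => real => real => real" where
 "C1 CI CH C0 = 2 * CI + \<bar>C0\<bar> + CK CI CH + T powr \<alpha> / \<alpha> * (\<bar>a\<bar> * CK CI CH) + 2 * T * \<bar>b\<bar> * \<bar>C0\<bar>"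

definition C2 :: "real => real => real => real" where
 "C2 CI CH C0 = (C1 CI CH C0 + CR) * (1 + \<bar>b\<bar> * exp (\<bar>b\<bar> * T) * (T + T / \<alpha>))"

lemma CR_nonneg: "0 <= CR"
proof -
 have "0 < Gamma (1 - \<alpha>)" using \<alpha> by (simp add: Gamma_real_pos)
 \<comment> \<open>\<open>grid.C4\<close> depends on \<alpha> alone, so any admissible step gives
   access to its definition.\<close>
 moreover have "grid \<alpha> 1" using \<alpha> by unfold_locales auto
 ultimately have "0 <= grid.C4 \<alpha>" using \<alpha> by (simp add: grid.C4_def grid.C3_def)
 moreover have "0 <= (LINT s:{0..T}|lebesgue. Vw s)"
  unfolding set_lebesgue_integral_def using Vw_nonneg by (intro integral_nonneg_AE) auto
 ultimately show ?thesis unfolding CR_def using Cz_nonneg L \<alpha> by (intro add_nonneg_nonneg mult_nonneg_nonneg) auto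
qed

end

context discrete_problem begin

definition err :: "nat => real" where "err n = L2.nrm (un (int n) - uh (int n))"

definition rate :: "nat => real" where
 "rate n = \<rho> * ((1 + ln (real n)) * (real n * \<rho>) powr (\<alpha> - 1))"

lemma CK_nonneg: "0 <= (CK CI CH)" using CI CH \<alpha> by (auto simp: CK_def)

lemma C1_nonneg: "0 <= (C1 CI CH C0)"
 unfolding C1_def using CI CK_nonneg \<alpha> T_pos by (intro add_nonneg_nonneg mult_nonneg_nonneg) auto

lemma start_error:
 assumes "k \<in> {- int N..0}" shows "L2.nrm (un k - uh k) <= \<bar>C0\<bar> * h\<^sup>2"
proof -
 have "k <= int K * int N" by (rule order_trans[of _ 0]) (use assms in auto)
 then have "of_int k * \<rho> \<in> {-\<tau>..0}" using time_range[of k] assms \<rho>_pos by (auto simp: mult_nonpos_nonneg)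
 then have e1: "norm_L2 L (%x. - (uh k x - \<phi> x (of_int k * (\<tau> / real N)))) = L2.nrm (un k - uh k)"
  unfolding nrm_L2 by (intro norm_L2_cong) (auto simp: un_def u_init \<rho>_def)
 have neg: "norm_L2 L (%x. - w x) = norm_L2 L w" for w by (simp add: norm_L2_def inner_L2_def)
 have "L2.nrm (un k - uh k) = norm_L2 L (%x. uh k x - \<phi> x (of_int k * (\<tau> / real N)))" using e1 unfolding neg by (rule sym)
 moreover have "C0 * h\<^sup>2 <= \<bar>C0\<bar> * h\<^sup>2" by (intro mult_right_mono) auto
 ultimately show ?thesis using start[OF assms] by simp
qed

text \<open>The indices k <= N refer to starting values; there are at most N + 1 of them, and (N +
  1) \<rho> <= 2 \<tau> <= 2 T.\<close>

lemma delayed_sum: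
 assumes n: "n \<in> {1..K * N}"
 shows "\<rho> * (\<Sum>k=0..n. L2.nrm (un (int k - int N) - uh (int k - int N))) <= 2 * T * \<bar>C0\<bar> * h\<^sup>2 + \<rho> * (\<Sum>j=1..n - N. err j)"
proof -
 let ?E = "%k. L2.nrm (un (int k - int N) - uh (int k - int N))"
 have E0: "0 <= ?E k" if "k <= n" for k
  using that n int_le_KN[of n] by (intro L2.nrm_nonneg L2.W_intros(2) un_W uh_W) auto
 have "(\<Sum>k=0..n. ?E k) = (\<Sum>k\<in>{0..n} \<inter> {..N}. ?E k) + (\<Sum>k\<in>{0..n} - {..N}. ?E k)" by (subst sum.Int_Diff[of _ _ "{..N}"]) auto
 moreover have "(\<Sum>k\<in>{0..n} \<inter> {..N}. ?E k) <= real (N + 1) * (\<bar>C0\<bar> * h\<^sup>2)"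
 proof -
  have "(\<Sum>k\<in>{0..n} \<inter> {..N}. ?E k) <= (\<Sum>k\<in>{0..n} \<inter> {..N}. \<bar>C0\<bar> * h\<^sup>2)" by (intro sum_mono start_error) auto
  also have "... <= (\<Sum>k\<in>{..N}. \<bar>C0\<bar> * h\<^sup>2)" by (intro sum_mono2) auto
  finally show ?thesis by simp
 qed
 moreover have "(\<Sum>k\<in>{0..n} - {..N}. ?E k) = (\<Sum>j=1..n - N. err j)"
  by (rule sum.reindex_bij_witness[of _ "%j. j + N" "%k. k - N"]) (auto simp: err_def of_nat_diff)
 ultimately have "\<rho> * (\<Sum>k=0..n. ?E k) <= \<rho> * (real (N + 1) * (\<bar>C0\<bar> * h\<^sup>2) + (\<Sum>j=1..n - N. err j))"
  using \<rho>_pos by (intro mult_left_mono) auto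
 also have "... = (real (N + 1) * \<rho>) * (\<bar>C0\<bar> * h\<^sup>2) + \<rho> * (\<Sum>j=1..n - N. err j)" by (simp add: algebra_simps)
 also have "... <= (2 * T) * (\<bar>C0\<bar> * h\<^sup>2) + \<rho> * (\<Sum>j=1..n - N. err j)"
 proof (intro add_right_mono mult_right_mono)
  have "real (N + 1) * \<rho> <= real (2 * N) * \<rho>" using N \<rho>_pos by (intro mult_right_mono) auto
  then show "real (N + 1) * \<rho> <= 2 * T" using N\<rho> \<tau>_le_T by simp
 qed auto
 finally show ?thesis by simp
qed

text \<open>The resolvent with \<epsilon> = 0. The last property says that distances to points of
  the span do not increase under projection.\<close>

lemma projection_exists:
 obtains Pr where "!!x. Pr x \<in> span basis"
  "!!x v. x \<in> W ==> v \<in> span basis ==> inner_L2 L (Pr x) v = inner_L2 L x v"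
  "!!x y. x \<in> W ==> y \<in> W ==> Pr (x - y) = Pr x - Pr y"
  "!!x y. x \<in> W ==> y \<in> span basis ==> L2.nrm (Pr x - y) <= L2.nrm (x - y)"
proof -
 obtain Pr where R: "resolvent W (inner_L2 L) Pr" and Ps: "!!x. Pr x \<in> span basis"
  and Pv: "!!x v. x \<in> W ==> v \<in> span basis ==> inner_L2 L (Pr x) v + 0 * (p * fe_form (Pr x) v) = inner_L2 L x v"
  using Gk.resolvent_exists[of 0] by (metis order_refl)
 interpret R: resolvent W "inner_L2 L" Pr by (rule R)
 have Pv': "inner_L2 L (Pr x) v = inner_L2 L x v" if "x \<in> W" "v \<in> span basis" for x v using Pv[OF that] by simp
 have "L2.nrm (Pr x - y) <= L2.nrm (x - y)" if x: "x \<in> W" and y: "y \<in> span basis" for x y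
 proof -
  let ?z = "Pr x - y"
  have z: "?z \<in> span basis" using Ps y by (intro span_diff) auto
  have W: "?z \<in> W" "x - y \<in> W" "y \<in> W" "Pr x \<in> W" using Gk.span_W z y Ps x L2.W_intros(2) by blast+
  have "inner_L2 L ?z ?z = inner_L2 L (Pr x) ?z - inner_L2 L y ?z" using W by (intro L2.ip_diff)
  also have "... = inner_L2 L (x - y) ?z" using Pv'[OF x z] W x by (simp only: L2.ip_diff)
  also have "... <= L2.nrm (x - y) * L2.nrm ?z" using L2.Cauchy_Schwarz[OF W(2,1)] by linarith
  finally have "L2.nrm ?z * L2.nrm ?z <= L2.nrm (x - y) * L2.nrm ?z" using L2.nrm_sq[OF W(1)] by (simp add: power2_eq_square)
  then show ?thesis using L2.nrm_nonneg[OF W(1)] L2.nrm_nonneg[OF W(2)] by (cases "L2.nrm ?z = 0") auto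
 qed
 with Ps Pv' R.R_diff show thesis by (intro that[of Pr]) auto
qed

lemma perturbation_norm:
 assumes k: "k \<in> {1..K * N}"
 defines "r \<equiv> residual N k + b *\<^sub>R (J_delay \<alpha> \<rho> N un k - J_delay \<alpha> \<rho> N uh k)"
 shows "r \<in> W"
  and "L2.nrm r <= norm_L2 L (residual N k) + \<bar>b\<bar> * \<rho> * (\<Sum>i=0..k. A (k - i) * L2.nrm (un (int i - int N) - uh (int i - int N)))"
proof -
 have rW: "residual N k \<in> W" using residual_norm(1)[OF N k] by simp
 have w: "un (int i - int N) - uh (int i - int N) \<in> W" if "i \<in> {0..k}" for i
  using that k int_le_KN[of k] by (intro L2.W_intros(2) un_W uh_W) auto
 have J: "J_delay \<alpha> \<rho> N un k - J_delay \<alpha> \<rho> N uh k = (\<Sum>i=0..k. (\<rho> * A (k - i)) *\<^sub>R (un (int i - int N) - uh (int i - int N)))"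
  unfolding J_delay_fun by (simp only: sum_subtractf[symmetric] scaleR_diff_right)
 have JW: "J_delay \<alpha> \<rho> N un k - J_delay \<alpha> \<rho> N uh k \<in> W" unfolding J using w by (intro L2.W_intros(5) L2.W_intros(3))
 show "r \<in> W" unfolding r_def using rW JW by (intro L2.W_intros(1) L2.W_intros(3))
 have "L2.nrm (J_delay \<alpha> \<rho> N un k - J_delay \<alpha> \<rho> N uh k) <= (\<Sum>i=0..k. L2.nrm ((\<rho> * A (k - i)) *\<^sub>R (un (int i - int N) - uh (int i - int N))))"
  unfolding J using w by (intro L2.nrm_sum L2.W_intros(3))
 also have "... = (\<Sum>i=0..k. \<rho> * (A (k - i) * L2.nrm (un (int i - int N) - uh (int i - int N))))"
 proof (rule sum.cong[OF refl])
  fix i assume i: "i \<in> {0..k}"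
  have "\<bar>\<rho> * A (k - i)\<bar> = \<rho> * A (k - i)" using \<rho>_pos A_pos[of "k - i"] by simp
  then show "L2.nrm ((\<rho> * A (k - i)) *\<^sub>R (un (int i - int N) - uh (int i - int N))) = \<rho> * (A (k - i) * L2.nrm (un (int i - int N) - uh (int i - int N)))"
   by (simp only: L2.nrm_scale[OF w[OF i]] mult.assoc)
 qed
 also have "... = \<rho> * (\<Sum>i=0..k. A (k - i) * L2.nrm (un (int i - int N) - uh (int i - int N)))" by (simp only: sum_distrib_left)
 finally have Jn: "L2.nrm (J_delay \<alpha> \<rho> N un k - J_delay \<alpha> \<rho> N uh k) <= \<rho> * (\<Sum>i=0..k. A (k - i) * L2.nrm (un (int i - int N) - uh (int i - int N)))" .
 have "L2.nrm r <= L2.nrm (residual N k) + L2.nrm (b *\<^sub>R (J_delay \<alpha> \<rho> N un k - J_delay \<alpha> \<rho> N uh k))"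
  unfolding r_def using rW JW by (intro L2.nrm_triangle L2.W_intros(3))
 also have "... <= norm_L2 L (residual N k) + \<bar>b\<bar> * (\<rho> * (\<Sum>i=0..k. A (k - i) * L2.nrm (un (int i - int N) - uh (int i - int N))))"
  unfolding L2.nrm_scale[OF JW] nrm_L2[of L "residual N k"] using Jn by (intro add_left_mono mult_left_mono) auto
 finally show "L2.nrm r <= norm_L2 L (residual N k) + \<bar>b\<bar> * \<rho> * (\<Sum>i=0..k. A (k - i) * L2.nrm (un (int i - int N) - uh (int i - int N)))"
  by (simp only: mult.assoc)
qed

text \<open>For i >= 1 the kernels collapse by \<open>sum_convolution_one\<close>. The summand i = 0
  lies outside that range; its total weight is part of the sum in \<open>AG\<close> and hence at
  most 1.\<close>

lemma G_A_sum:
 assumes E: "0 <= E0 0"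
 shows "(\<Sum>k=1..n. G (n - k) * (\<Sum>i=0..k. A (k - i) * E0 i)) <= (\<Sum>i=0..n. E0 i)"
proof -
 have split: "(\<Sum>i=0..k. A (k - i) * E0 i) = A k * E0 0 + (\<Sum>i=1..k. A (k - i) * E0 i)" for k
  by (simp add: sum.atLeast_Suc_atMost)
 have "(\<Sum>k=1..n. G (n - k) * (\<Sum>i=0..k. A (k - i) * E0 i)) = (\<Sum>k=1..n. G (n - k) * A k) * E0 0 + (\<Sum>k=1..n. G (n - k) * (\<Sum>i=1..k. A (k - i) * E0 i))"
  unfolding split sum_distrib_right by (simp add: distrib_left sum.distrib mult.assoc)
 also have "(\<Sum>k=1..n. G (n - k) * (\<Sum>i=1..k. A (k - i) * E0 i)) = (\<Sum>i=1..n. E0 i)" by (rule sum_convolution_one[OF AG])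
 also have "(\<Sum>k=1..n. G (n - k) * A k) * E0 0 <= 1 * E0 0"
 proof (rule mult_right_mono[OF _ E])
  have "(\<Sum>k=1..n. G (n - k) * A k) <= (\<Sum>k\<le>n. G (n - k) * A k)"
   using A_pos G_pos' by (intro sum_mono2) (auto intro: less_imp_le)
  then show "(\<Sum>k=1..n. G (n - k) * A k) <= 1" using AG[of n] by (simp add: mult.commute)
 qed
 finally show ?thesis by (simp add: sum.atLeast_Suc_atMost)
qed

text \<open>The projected error \<theta> solves the scheme with three data: the residual, the
  delayed error, and the elliptic defect of \<xi>. \<open>stability\<close> bounds their effect by
  \<open>CR\<close>, by a plain history sum and by \<open>CK\<close>, respectively.\<close>

theorem error_recursion:
 assumes n: "n \<in> {1..K * N}"
 shows "err n <= (C1 CI CH C0) * h\<^sup>2 + CR * rate n + \<bar>b\<bar> * \<rho> * (\<Sum>j=1..n - N. err j)"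
proof -
 obtain Pr where Ps: "!!x. Pr x \<in> span basis"
  and Pv: "!!x v. x \<in> W ==> v \<in> span basis ==> inner_L2 L (Pr x) v = inner_L2 L x v"
  and Pd: "!!x y. x \<in> W ==> y \<in> W ==> Pr (x - y) = Pr x - Pr y"
  and Pc: "!!x y. x \<in> W ==> y \<in> span basis ==> L2.nrm (Pr x - y) <= L2.nrm (x - y)"
  by (rule projection_exists) blast
 interpret D: semi_inner "span basis" "%w v. p * fe_form w v" by (rule Gk.D_inner)
 let ?E = "%i. L2.nrm (un (int i - int N) - uh (int i - int N))"
 define \<theta> where "\<theta> k = Pr (un (int k)) - interp (uh (int k))" for k
 \<comment> \<open>For p = 0 the defect p D (\<xi>, v) is zero in any case and no bound on time
   differences of the interpolation error is at hand, so \<xi> is taken to be 0.\<close>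
 define \<xi> where "\<xi> k = (if p = 0 then 0 else Pr (un (int k)) - interp (un (int k)))" for k
 define r where "r k = residual N k + b *\<^sub>R (J_delay \<alpha> \<rho> N un k - J_delay \<alpha> \<rho> N uh k)" for k
 have sub: "k \<in> {1..K * N}" if "k \<in> {1..n}" for k using that n by auto
 have kr: "int k <= int K * int N" if "k <= n" for k using that n int_le_KN[of n] by auto
 have uW: "un (int k) \<in> W" "uh (int k) \<in> W" if "k <= n" for k using un_W[of "int k"] uh_W[of "int k"] kr[OF that] by auto
 have uW': "un k \<in> W" "uh k \<in> W" if "k \<in> {- int N..int n}" for k
  using un_W[of k] uh_W[of k] kr[OF order_refl] that by auto
 have \<theta>s: "\<theta> k \<in> span basis" for k unfolding \<theta>_def by (intro span_diff Ps interp_span)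
 have \<xi>s: "\<xi> k \<in> span basis" for k unfolding \<xi>_def using Ps interp_span by (auto intro: span_diff span_zero)
 have rW: "r k \<in> W" if "k \<in> {1..n}" for k unfolding r_def by (rule perturbation_norm(1)[OF sub[OF that]])
 have inner\<theta>: "inner_L2 L (\<theta> k) v = inner_L2 L (un (int k)) v - inner_L2 L (uh (int k)) v" if "k <= n" "v \<in> span basis" for k v
  using L2.ip_diff[OF Gk.span_W[OF Ps] interp_W Gk.span_W[OF that(2)], of "un (int k)" "uh (int k)"] Pv[OF uW(1)[OF that(1)] that(2)]
   uh_interp[of "int k" v] kr[OF that(1)] Gk.span_W[OF that(2)] by (simp add: \<theta>_def)
 \<comment> \<open>The scheme is subtracted from the residual identity. Pairing with test functions
   cannot distinguish u from its projection, so the time difference and the reaction term of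
   \<theta> match, and \<open>weak_span\<close> replaces \<open>E\<close>.\<close>
 have eq: "inner_L2 L (Gk.ddiff \<alpha> \<rho> \<theta> k) v + p * fe_form (\<theta> k) v - a * inner_L2 L (\<theta> k) v = p * fe_form (\<xi> k) v + inner_L2 L (r k) v"
  if k: "k \<in> {1..n}" and v: "v \<in> span basis" for k v
 proof -
  have vW: "v \<in> W" by (rule Gk.span_W[OF v])
  have kn: "k <= n" using k by simp
  have dW: "un j \<in> W" "uh j \<in> W" if "j \<in> {0..int k}" for j using that kn uW'[of j] by auto
  have JW: "J_delay \<alpha> \<rho> N un k \<in> W" "J_delay \<alpha> \<rho> N uh k \<in> W" by (rule J_delay_W, rule uW', use kn in simp)+
  have "inner_L2 L (Gk.ddiff \<alpha> \<rho> \<theta> k) v = (\<Sum>j=1..k. inner_L2 L (A (k - j) *\<^sub>R (\<theta> j - \<theta> (j - 1))) v)"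
   unfolding Gk.ddiff_def A_def using Gk.span_W[OF \<theta>s] vW by (intro L2.ip_sum L2.W_intros(3) L2.W_intros(2))
  also have "... = (\<Sum>j=1..k. A (k - j) * (inner_L2 L (un (int j)) v - inner_L2 L (un (int j - 1)) v)
    - A (k - j) * (inner_L2 L (uh (int j)) v - inner_L2 L (uh (int j - 1)) v))"
  proof (rule sum.cong[OF refl])
   fix j assume j: "j \<in> {1..k}"
   have jj: "j <= n" "j - 1 <= n" "int (j - 1) = int j - 1" using j kn by auto
   have "inner_L2 L (A (k - j) *\<^sub>R (\<theta> j - \<theta> (j - 1))) v = A (k - j) * (inner_L2 L (\<theta> j) v - inner_L2 L (\<theta> (j - 1)) v)"
    using Gk.span_W[OF \<theta>s] vW L2.W_intros(2) by (simp only: L2.ip_scale L2.ip_diff)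
   then show "inner_L2 L (A (k - j) *\<^sub>R (\<theta> j - \<theta> (j - 1))) v = A (k - j) * (inner_L2 L (un (int j)) v - inner_L2 L (un (int j - 1)) v)
    - A (k - j) * (inner_L2 L (uh (int j)) v - inner_L2 L (uh (int j - 1)) v)"
    unfolding inner\<theta>[OF jj(1) v] inner\<theta>[OF jj(2) v] jj(3) by (simp add: algebra_simps)
  qed
  also have "... = inner_L2 L (discrete_deriv \<alpha> \<rho> un k) v - inner_L2 L (discrete_deriv \<alpha> \<rho> uh k) v"
  proof -
   have "inner_L2 L (discrete_deriv \<alpha> \<rho> un k) v = (\<Sum>j=1..k. A (k - j) * (inner_L2 L (un (int j)) v - inner_L2 L (un (int j - 1)) v))"
    "inner_L2 L (discrete_deriv \<alpha> \<rho> uh k) v = (\<Sum>j=1..k. A (k - j) * (inner_L2 L (uh (int j)) v - inner_L2 L (uh (int j - 1)) v))"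
    by (rule inner_discrete_deriv[OF dW(1) vW], assumption) (rule inner_discrete_deriv[OF dW(2) vW], assumption)
   then show ?thesis by (simp only: sum_subtractf)
  qed
  finally have dd: "inner_L2 L (Gk.ddiff \<alpha> \<rho> \<theta> k) v = inner_L2 L (discrete_deriv \<alpha> \<rho> un k) v - inner_L2 L (discrete_deriv \<alpha> \<rho> uh k) v" .
  have r: "inner_L2 L (r k) v = inner_L2 L (residual N k) v + b * (inner_L2 L (J_delay \<alpha> \<rho> N un k) v - inner_L2 L (J_delay \<alpha> \<rho> N uh k) v)"
   unfolding r_def using JW vW residual_norm(1)[OF N sub[OF k]] L2.W_intros(2,3)
   by (simp only: L2.ip_add L2.ip_scale L2.ip_diff mem_Collect_eq)
  have D\<theta>: "p * fe_form (\<theta> k) v = p * fe_form (Pr (un (int k))) v - p * fe_form (interp (uh (int k))) v"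
   unfolding \<theta>_def by (rule D.ip_diff[OF Ps interp_span v])
  have D\<xi>: "p * fe_form (\<xi> k) v = p * fe_form (Pr (un (int k))) v - p * fe_form (interp (un (int k))) v"
   using D.ip_diff[OF Ps interp_span v] by (simp add: \<xi>_def)
  have uhi: "inner_L2 L (interp (uh (int k))) v = inner_L2 L (uh (int k)) v" using kr[OF kn] by (intro uh_interp vW) auto
  show ?thesis
   unfolding dd r D\<theta> D\<xi> inner\<theta>[OF kn v] residual_inner[OF sub[OF k] vW] scheme_eq[OF sub[OF k] v] weak_span[OF v sub[OF k]] uhi
   by (simp add: algebra_simps)
 qed
 have int_err: "L2.nrm (un (int k) - interp (un (int k))) <= CI * h\<^sup>2" if k: "k \<in> {1..n}" for k
  using CI(2)[of "real k * \<rho>"] grid_range[of k] sub[OF k] \<rho>_pos unfolding nrm_L2 by (simp add: un_def fun_diff_def)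
 have \<xi>n: "L2.nrm (\<xi> k) <= CI * h\<^sup>2" if k: "k \<in> {1..n}" for k
 proof (cases "p = 0")
  case False
  have "k <= n" using k by simp
  then show ?thesis using order_trans[OF Pc[OF uW(1) interp_span] int_err[OF k]] False by (simp add: \<xi>_def)
 qed (use CI in \<open>simp add: \<xi>_def\<close>)
 have \<xi>d: "L2.nrm (\<xi> j - \<xi> k) <= CH * ((real k * \<rho> - real j * \<rho>) powr \<alpha> + (real k * \<rho> - real j * \<rho>) powr (1 - \<alpha>)) * h\<^sup>2"
  if j: "j \<in> {1..<k}" and k: "k \<in> {1..n}" for j k
 proof (cases "p = 0")
  case False
  have jk: "0 < real j * \<rho>" "real j * \<rho> <= real k * \<rho>" "real k * \<rho> <= T" "j <= n" "k <= n" "0 < p"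
   using j k \<rho>_pos grid_range[of k] sub[OF k] False p by auto
  have "\<xi> j - \<xi> k = (Pr (un (int j)) - interp (un (int j))) - (Pr (un (int k)) - interp (un (int k)))"
      using False by (simp only: \<xi>_def if_False)
    also have "\<dots> = (Pr (un (int j)) - Pr (un (int k))) - (interp (un (int j)) - interp (un (int k)))" by (rule ext) simp
    also have "\<dots> = Pr (un (int j) - un (int k)) - interp (%x. un (int j) x - un (int k) x)"
      by (simp only: Pd[OF uW(1)[OF jk(4)] uW(1)[OF jk(5)]] interp_diff)
    finally have xi: "\<xi> j - \<xi> k = Pr (un (int j) - un (int k)) - interp (%x. un (int j) x - un (int k) x)" .
    have "L2.nrm (\<xi> j - \<xi> k) \<le> L2.nrm ((un (int j) - un (int k)) - interp (%x. un (int j) x - un (int k) x))"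
      unfolding xi
   by (rule Pc[OF L2.W_intros(2)[OF uW(1)[OF jk(4)] uW(1)[OF jk(5)]] interp_span])
  also have "... <= CH * ((real k * \<rho> - real j * \<rho>) powr \<alpha> + (real k * \<rho> - real j * \<rho>) powr (1 - \<alpha>)) * h\<^sup>2"
   using CH(2)[OF jk(6) jk(1,2,3)] unfolding nrm_L2 by (simp add: un_def fun_diff_def)
  finally show ?thesis .
 qed (use CH in \<open>simp add: \<xi>_def\<close>)
 \<comment> \<open>The sum over j has the kernel 1 / (k - j) against Hoelder differences;
   \<open>sum_Holder_weights\<close> with exponents \<alpha> and 1 - \<alpha> bounds it without a
   logarithm.\<close>
 have K: "2 * L2.nrm (\<xi> k) + (\<Sum>j=1..<k. \<alpha> / real (k - j) * L2.nrm (\<xi> j - \<xi> k)) <= (CK CI CH) * h\<^sup>2" if k: "k \<in> {1..n}" for k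
 proof -
  let ?d = "%j. real k * \<rho> - real j * \<rho>"
  have kT: "real k * \<rho> <= T" using grid_range[of k] sub[OF k] by auto
  have "(\<Sum>j=1..<k. \<alpha> / real (k - j) * L2.nrm (\<xi> j - \<xi> k)) <= (\<Sum>j=1..<k. \<alpha> / real (k - j) * (CH * (?d j powr \<alpha> + ?d j powr (1 - \<alpha>)) * h\<^sup>2))"
   using \<alpha> k by (intro sum_mono mult_left_mono \<xi>d) auto
  also have "... = \<alpha> * CH * h\<^sup>2 * ((\<Sum>j=1..<k. 1 / real (k - j) * ?d j powr \<alpha>) + (\<Sum>j=1..<k. 1 / real (k - j) * ?d j powr (1 - \<alpha>)))"
   unfolding sum.distrib[symmetric] sum_distrib_left by (intro sum.cong refl) (simp add: divide_simps algebra_simps)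
  also have "... <= \<alpha> * CH * h\<^sup>2 * ((real k * \<rho>) powr \<alpha> / \<alpha> + (real k * \<rho>) powr (1 - \<alpha>) / (1 - \<alpha>))"
   using \<alpha> CH \<rho>_pos by (intro mult_left_mono add_mono sum_Holder_weights) auto
  also have "... <= \<alpha> * CH * h\<^sup>2 * (T powr \<alpha> / \<alpha> + T powr (1 - \<alpha>) / (1 - \<alpha>))"
   using \<alpha> CH \<rho>_pos kT by (intro mult_left_mono add_mono divide_right_mono powr_mono2) auto
  finally have S: "(\<Sum>j=1..<k. \<alpha> / real (k - j) * L2.nrm (\<xi> j - \<xi> k)) <= \<alpha> * CH * h\<^sup>2 * (T powr \<alpha> / \<alpha> + T powr (1 - \<alpha>) / (1 - \<alpha>))" .
    have alg: "(2 * x + y * z) * w = 2 * (x * w) + y * w * z" for x y z w :: real by (simp add: algebra_simps)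
    have "CK CI CH * h\<^sup>2 = 2 * (CI * h\<^sup>2) + \<alpha> * CH * h\<^sup>2 * (T powr \<alpha> / \<alpha> + T powr (1 - \<alpha>) / (1 - \<alpha>))"
      unfolding CK_def by (rule alg)
    with S \<xi>n[OF k] show ?thesis by linarith
 qed
 have n1: "1 <= n" using n by simp
 have "L2.nrm (\<theta> n) <= L2.nrm (\<theta> 0) + (CK CI CH) * h\<^sup>2 + (\<Sum>k=1..n. G (n - k) * (L2.nrm (r k) + \<bar>a\<bar> * ((CK CI CH) * h\<^sup>2)))"
  using Gk.stability[OF \<alpha> \<rho>_pos a \<theta>s rW \<xi>s eq n1 K] unfolding G_def .
 also have "(\<Sum>k=1..n. G (n - k) * (L2.nrm (r k) + \<bar>a\<bar> * ((CK CI CH) * h\<^sup>2))) <=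
  (\<Sum>k=1..n. G (n - k) * (norm_L2 L (residual N k) + \<bar>b\<bar> * \<rho> * (\<Sum>i=0..k. A (k - i) * ?E i) + \<bar>a\<bar> * ((CK CI CH) * h\<^sup>2)))"
  using perturbation_norm(2)[OF sub] by (intro sum_mono mult_left_mono less_imp_le[OF G_pos'] add_right_mono) (simp add: r_def)
 also have "... = (\<Sum>k=1..n. G (n - k) * norm_L2 L (residual N k)) + \<bar>b\<bar> * \<rho> * (\<Sum>k=1..n. G (n - k) * (\<Sum>i=0..k. A (k - i) * ?E i))
   + (\<Sum>k=1..n. G (n - k)) * (\<bar>a\<bar> * ((CK CI CH) * h\<^sup>2))"
  unfolding sum_distrib_right[of _ "{1..n}"] sum_distrib_left[of _ _ "{1..n}"] sum.distrib[symmetric] by (intro sum.cong refl) (simp only: distrib_left mult_ac)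
 finally have 1: "L2.nrm (\<theta> n) <= L2.nrm (\<theta> 0) + (CK CI CH) * h\<^sup>2 + ((\<Sum>k=1..n. G (n - k) * norm_L2 L (residual N k))
   + \<bar>b\<bar> * \<rho> * (\<Sum>k=1..n. G (n - k) * (\<Sum>i=0..k. A (k - i) * ?E i)) + (\<Sum>k=1..n. G (n - k)) * (\<bar>a\<bar> * ((CK CI CH) * h\<^sup>2)))" by simp
 have 2: "(\<Sum>k=1..n. G (n - k) * norm_L2 L (residual N k)) <= CR * rate n"
  using residual_sum[OF N n] by (simp add: G_def rate_def \<rho>_def)
 have "0 <= ?E 0" using N by (intro L2.nrm_nonneg L2.W_intros(2) uW') auto
 from G_A_sum[of ?E n, OF this]
 have "\<bar>b\<bar> * \<rho> * (\<Sum>k=1..n. G (n - k) * (\<Sum>i=0..k. A (k - i) * ?E i)) <= \<bar>b\<bar> * \<rho> * (\<Sum>i=0..n. ?E i)"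
  using \<rho>_pos by (intro mult_left_mono) auto
 also have "... <= \<bar>b\<bar> * (2 * T * \<bar>C0\<bar> * h\<^sup>2 + \<rho> * (\<Sum>j=1..n - N. err j))"
  unfolding mult.assoc[of "\<bar>b\<bar>" \<rho>] by (intro mult_left_mono delayed_sum n) auto
 finally have 3: "\<bar>b\<bar> * \<rho> * (\<Sum>k=1..n. G (n - k) * (\<Sum>i=0..k. A (k - i) * ?E i)) <= \<bar>b\<bar> * (2 * T * \<bar>C0\<bar> * h\<^sup>2 + \<rho> * (\<Sum>j=1..n - N. err j))" .
 have 4: "(\<Sum>k=1..n. G (n - k)) * (\<bar>a\<bar> * ((CK CI CH) * h\<^sup>2)) <= T powr \<alpha> / \<alpha> * (\<bar>a\<bar> * ((CK CI CH) * h\<^sup>2))"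
 proof (rule mult_right_mono)
  have "(\<Sum>k=1..n. G (n - k)) = \<rho> powr \<alpha> * (\<Sum>k=1..n. g_coeff (-\<alpha>) (n - k))" by (simp add: G_def sum_distrib_left)
  also have "... <= \<rho> powr \<alpha> * (real n powr \<alpha> / \<alpha>)" using sum_weights_le[OF \<alpha>] by (intro mult_left_mono) auto
  also have "... = (real n * \<rho>) powr \<alpha> / \<alpha>" using \<rho>_pos by (simp add: powr_mult)
  also have "... <= T powr \<alpha> / \<alpha>" using grid_range[of n] n \<rho>_pos \<alpha> by (intro divide_right_mono powr_mono2) auto
  finally show "(\<Sum>k=1..n. G (n - k)) <= T powr \<alpha> / \<alpha>" .
 qed (use CK_nonneg in auto)
 have 5: "L2.nrm (\<theta> 0) <= \<bar>C0\<bar> * h\<^sup>2"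
 proof -
  have "L2.nrm (\<theta> 0) <= L2.nrm (un 0 - interp (uh 0))" unfolding \<theta>_def using uW(1)[of 0] interp_span Pc[of "un 0" "interp (uh 0)"] by simp
  also have "... = L2.nrm (un 0 - uh 0)" unfolding nrm_L2 using interp_fe_space[OF uh_fe[of 0]] by (intro norm_L2_cong) auto
  finally show ?thesis using start_error[of 0] by simp
 qed
 \<comment> \<open>The error is (u - I u) + (I u - P u) + \<theta>; as projection does not increase
   the distance to I u, the first two terms are each at most CI h^2.\<close>
 have 6: "err n <= 2 * (CI * h\<^sup>2) + L2.nrm (\<theta> n)"
 proof -
  let ?I = "interp (un (int n))" and ?u = "un (int n)"
  have nn: "n \<in> {1..n}" using n1 by simp
  have m: "?u - ?I \<in> W" "?I - Pr ?u \<in> W" "\<theta> n \<in> W" using uW(1)[of n] Gk.span_W Ps interp_span \<theta>s L2.W_intros(2) by blast+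
  have "err n = L2.nrm (?u - interp (uh (int n)))"
   unfolding err_def nrm_L2 using interp_fe_space[OF uh_fe[of "int n"]] kr[of n] by (intro norm_L2_cong) auto
  also have "?u - interp (uh (int n)) = (?u - ?I) + ((?I - Pr ?u) + \<theta> n)" by (simp add: \<theta>_def)
  also have "L2.nrm ... <= L2.nrm (?u - ?I) + L2.nrm ((?I - Pr ?u) + \<theta> n)" using m by (intro L2.nrm_triangle L2.W_intros(1))
  also have "L2.nrm ((?I - Pr ?u) + \<theta> n) <= L2.nrm (?I - Pr ?u) + L2.nrm (\<theta> n)" using m by (intro L2.nrm_triangle)
  also have "L2.nrm (?I - Pr ?u) = L2.nrm (Pr ?u - ?I)" using L2.nrm_minus[OF m(2)] by simp
  also have "L2.nrm (Pr ?u - ?I) <= L2.nrm (?u - ?I)" by (rule Pc[OF uW(1)[OF order_refl] interp_span])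
  finally show ?thesis using int_err[OF nn] by linarith
 qed
 have alg: "err n <= (C1 CI CH C0) * h\<^sup>2 + X + \<bar>b\<bar> * \<rho> * S"
  if "err n <= 2 * (CI * h\<^sup>2) + t" "t <= t0 + (CK CI CH) * h\<^sup>2 + (x + y + z)" "t0 <= \<bar>C0\<bar> * h\<^sup>2" "x <= X" "y <= \<bar>b\<bar> * (2 * T * \<bar>C0\<bar> * h\<^sup>2 + \<rho> * S)"
   "z <= T powr \<alpha> / \<alpha> * (\<bar>a\<bar> * ((CK CI CH) * h\<^sup>2))" for t t0 x y z X S
 proof -
  have "(C1 CI CH C0) * h\<^sup>2 + X + \<bar>b\<bar> * \<rho> * S = 2 * (CI * h\<^sup>2) + (\<bar>C0\<bar> * h\<^sup>2 + (CK CI CH) * h\<^sup>2 + (X + \<bar>b\<bar> * (2 * T * \<bar>C0\<bar> * h\<^sup>2 + \<rho> * S) + T powr \<alpha> / \<alpha> * (\<bar>a\<bar> * ((CK CI CH) * h\<^sup>2))))"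
   unfolding C1_def by (simp only: distrib_right distrib_left mult_ac add_ac)
  then show ?thesis using that by linarith
 qed
 show ?thesis by (rule alg[OF 6 1 5 2 3 4])
qed


lemma rate_nonneg: "1 <= n ==> 0 <= rate n"
 using \<rho>_pos by (simp add: rate_def)

text \<open>The logarithms are bounded by the last one and t^(\<alpha> - 1) is summed by
  \<open>sum_powr_le\<close>, so the accumulated rate is again a multiple of the rate.\<close>

lemma sum_rate:
 assumes n: "n \<in> {1..K * N}" shows "\<rho> * (\<Sum>k=1..n. rate k) <= T / \<alpha> * rate n"
proof -
 have t: "0 < real n * \<rho>" "real n * \<rho> <= T" using n \<rho>_pos grid_range[of n] by auto
 have l: "0 <= 1 + ln (real n)" using n by simp
 have "(\<Sum>k=1..n. rate k) <= (\<Sum>k=1..n. \<rho> * ((1 + ln (real n)) * (real k * \<rho>) powr (\<alpha> - 1)))"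
  unfolding rate_def using \<rho>_pos by (intro sum_mono mult_left_mono mult_right_mono) auto
 also have "... = \<rho> * (1 + ln (real n)) * \<rho> powr (\<alpha> - 1) * (\<Sum>k=1..n. real k powr (\<alpha> - 1))"
  unfolding sum_distrib_left using \<rho>_pos by (intro sum.cong refl) (simp add: powr_mult mult_ac)
 also have "... <= \<rho> * (1 + ln (real n)) * \<rho> powr (\<alpha> - 1) * (real n powr \<alpha> / \<alpha>)"
  using sum_powr_le[of \<alpha> n] \<alpha> \<rho>_pos l by (intro mult_left_mono) auto
 finally have "\<rho> * (\<Sum>k=1..n. rate k) <= \<rho> * (\<rho> * (1 + ln (real n)) * \<rho> powr (\<alpha> - 1) * (real n powr \<alpha> / \<alpha>))"
  using \<rho>_pos by (intro mult_left_mono) auto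
 also have "... = (real n * \<rho>) / \<alpha> * rate n"
 proof -
  have "real n powr \<alpha> = real n * real n powr (\<alpha> - 1)" using n by (simp add: powr_diff)
  then show ?thesis using \<rho>_pos by (simp add: rate_def powr_mult mult_ac)
 qed
 also have "... <= T / \<alpha> * rate n" using t \<alpha> rate_nonneg[of n] n by (intro mult_right_mono divide_right_mono) auto
 finally show ?thesis .
qed

text \<open>Gronwall is applied to the sums of errors; its bound is inserted once more into the
  recursion, where \<open>sum_rate\<close> shows that the history is no worse than the current
  term.\<close>

theorem error_bound:
 assumes n: "n \<in> {1..K * N}" shows "err n <= C2 CI CH C0 * (h\<^sup>2 + rate n)"
proof -
 let ?C = "C1 CI CH C0" and ?c = "\<bar>b\<bar> * \<rho>"
 define Q where "Q k = ?C * h\<^sup>2 + CR * rate k" for k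
 have e0: "0 <= err k" for k by (simp add: err_def nrm_L2)
 have C0': "0 <= ?C" by (rule C1_nonneg)
 have Q0: "0 <= Q k" if "k \<in> {1..K * N}" for k unfolding Q_def using C0' CR_nonneg rate_nonneg[of k] that by auto
 have c0: "0 <= ?c" using \<rho>_pos by simp
 have N1: "1 <= N" using N by simp
 have rec: "err k <= Q k + ?c * (\<Sum>j=1..k - N. err j)" if "k \<in> {1..K * N}" for k
  using error_recursion[OF that] by (simp add: Q_def)
 have t: "real n * \<rho> <= T" using n grid_range[of n] by auto
 have r0: "0 <= rate n" using n rate_nonneg by simp
 define X where "X = exp (\<bar>b\<bar> * T)"
 have S: "\<rho> * (\<Sum>k=1..n. Q k) <= ?C * T * h\<^sup>2 + CR * (T / \<alpha> * rate n)"
 proof -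
  have "\<rho> * (\<Sum>k=1..n. Q k) = ?C * (real n * \<rho>) * h\<^sup>2 + CR * (\<rho> * (\<Sum>k=1..n. rate k))"
  proof -
   have "(\<Sum>k=1..n. Q k) = real n * (?C * h\<^sup>2) + CR * (\<Sum>k=1..n. rate k)" by (simp add: Q_def sum.distrib sum_distrib_left)
   then show ?thesis by (simp add: distrib_left mult_ac)
  qed
  also have "... <= ?C * T * h\<^sup>2 + CR * (T / \<alpha> * rate n)"
   using C0' CR_nonneg t by (intro add_mono mult_right_mono mult_left_mono sum_rate n) auto
  finally show ?thesis .
 qed
 have "(\<Sum>j=1..n - N. err j) <= (\<Sum>j=1..n. err j)" using e0 by (intro sum_mono2) auto
 also have "... <= exp (?c * real n) * (\<Sum>k=1..n. Q k)"
  by (rule discrete_Gronwall[of ?c N err "K * N" Q, OF c0 N1 e0 Q0 rec]) (use n in auto)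
 also have "... <= X * (\<Sum>k=1..n. Q k)"
 proof (rule mult_right_mono)
  show "exp (?c * real n) <= X" unfolding X_def using mult_left_mono[OF t, of "\<bar>b\<bar>"] by (simp add: mult_ac)
  show "0 <= (\<Sum>k=1..n. Q k)" using Q0 n by (intro sum_nonneg) auto
 qed
 finally have "?c * (\<Sum>j=1..n - N. err j) <= ?c * (X * (\<Sum>k=1..n. Q k))" using c0 by (rule mult_left_mono)
 also have "... = \<bar>b\<bar> * X * (\<rho> * (\<Sum>k=1..n. Q k))" by (simp only: mult_ac)
 also have "... <= \<bar>b\<bar> * X * (?C * T * h\<^sup>2 + CR * (T / \<alpha> * rate n))" using S by (intro mult_left_mono) (auto simp: X_def)
 finally have 1: "err n <= Q n + \<bar>b\<bar> * X * (?C * T * h\<^sup>2 + CR * (T / \<alpha> * rate n))" using rec[OF n] by linarith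
 have "?C * T * h\<^sup>2 + CR * (T / \<alpha> * rate n) <= (?C + CR) * (T + T / \<alpha>) * (h\<^sup>2 + rate n)"
 proof -
  have "(?C + CR) * (T + T / \<alpha>) * (h\<^sup>2 + rate n) = ?C * T * h\<^sup>2 + CR * (T / \<alpha> * rate n)
   + (?C * T * rate n + ?C * (T / \<alpha>) * (h\<^sup>2 + rate n) + CR * T * (h\<^sup>2 + rate n) + CR * (T / \<alpha>) * h\<^sup>2)"
   by (simp only: distrib_left distrib_right mult_ac add_ac)
  moreover have "0 <= ?C * T * rate n + ?C * (T / \<alpha>) * (h\<^sup>2 + rate n) + CR * T * (h\<^sup>2 + rate n) + CR * (T / \<alpha>) * h\<^sup>2"
   using C0' CR_nonneg T_pos \<alpha> r0 by (intro add_nonneg_nonneg mult_nonneg_nonneg) auto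
  ultimately show ?thesis by linarith
 qed
 then have 2: "\<bar>b\<bar> * X * (?C * T * h\<^sup>2 + CR * (T / \<alpha> * rate n)) <= \<bar>b\<bar> * X * ((?C + CR) * (T + T / \<alpha>) * (h\<^sup>2 + rate n))"
  by (intro mult_left_mono) (auto simp: X_def)
 have 3: "Q n <= (?C + CR) * (h\<^sup>2 + rate n)"
  using mult_nonneg_nonneg[OF C0' r0] mult_nonneg_nonneg[OF CR_nonneg zero_le_power2[of h]] unfolding Q_def distrib_left distrib_right by linarith
 have "C2 CI CH C0 * (h\<^sup>2 + rate n) = (?C + CR) * (h\<^sup>2 + rate n) + \<bar>b\<bar> * X * ((?C + CR) * (T + T / \<alpha>) * (h\<^sup>2 + rate n))"
  unfolding C2_def X_def distrib_left[of "?C + CR" 1] distrib_right[of "(?C + CR) * 1"] by (simp only: mult_ac mult_1_right)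
 then show ?thesis using 1 2 3 by linarith
qed

end

section \<open>Uniform constants and the final estimate\<close>

lemma (in delay_problem) error_estimate:
 "\<exists>C>0. \<forall>M P N uh. is_partition L M P --> 0 < N --> fe_scheme \<alpha> L p a b \<tau> K f \<phi> d\<phi> M P N uh -->
  (\<forall>n\<in>{- int N..0}. norm_L2 L (%x. uh n x - \<phi> x (of_int n * (\<tau> / real N))) <= C0 * (mesh_size M P)\<^sup>2) -->
  (\<forall>n\<in>{1..K * N}. norm_L2 L (%x. u x (real n * (\<tau> / real N)) - uh (int n) x)
    <= C * ((mesh_size M P)\<^sup>2 + \<tau> / real N * ((1 + ln (real n)) * (real n * (\<tau> / real N)) powr (\<alpha> - 1))))"
proof -
 obtain CI where CI: "0 <= CI" "!!M P t. is_partition L M P ==> 0 < t ==> t <= T ==>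
  norm_L2 L (%x. u x t - fe_partition.interp M P (%x. u x t) x) <= CI * (mesh_size M P)\<^sup>2"
  using interp_error_exists by blast
 obtain CH where CH: "0 <= CH" "!!M P s t. 0 < p ==> is_partition L M P ==> 0 < s ==> s <= t ==> t <= T ==>
  norm_L2 L (%x. (u x s - u x t) - fe_partition.interp M P (%x. u x s - u x t) x)
   <= CH * ((t - s) powr \<alpha> + (t - s) powr (1 - \<alpha>)) * (mesh_size M P)\<^sup>2"
  using interp_difference_exists by blast
 have est: "0 <= C2 CI CH C0 & norm_L2 L (%x. u x (real n * (\<tau> / real N)) - uh (int n) x)
    <= C2 CI CH C0 * ((mesh_size M P)\<^sup>2 + \<tau> / real N * ((1 + ln (real n)) * (real n * (\<tau> / real N)) powr (\<alpha> - 1)))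
   & 0 <= \<tau> / real N * ((1 + ln (real n)) * (real n * (\<tau> / real N)) powr (\<alpha> - 1))"
  if part: "is_partition L M P" and N: "0 < N" and sch: "fe_scheme \<alpha> L p a b \<tau> K f \<phi> d\<phi> M P N uh"
   and st: "\<forall>n\<in>{- int N..0}. norm_L2 L (%x. uh n x - \<phi> x (of_int n * (\<tau> / real N))) <= C0 * (mesh_size M P)\<^sup>2"
   and n: "n \<in> {1..K * N}" for M P N uh n
 proof -
  interpret discrete_problem \<alpha> L p a b \<tau> K m f \<phi> d\<phi> u Y Y1 Y2 \<gamma> \<gamma>t CY C\<phi> M P N uh C0 CI CH
   by (intro discrete_problem.intro discrete_problem_axioms.intro delay_problem_axioms fe_partition.intro part N sch)
    (use st CI CH part in auto)
  have "0 <= C2 CI CH C0" unfolding C2_def using C1_nonneg CR_nonneg T_pos \<alpha> by (intro mult_nonneg_nonneg add_nonneg_nonneg) auto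
  moreover have "err n = norm_L2 L (%x. u x (real n * (\<tau> / real N)) - uh (int n) x)"
   by (simp add: err_def nrm_L2 un_def fun_diff_def \<rho>_def)
  ultimately show ?thesis using error_bound[OF n] rate_nonneg[of n] n unfolding rate_def \<rho>_def by simp
 qed
 \<comment> \<open>C2 may be zero; the absolute value plus one provides a strictly positive
   constant.\<close>
 have mono: "C2 CI CH C0 * z <= (\<bar>C2 CI CH C0\<bar> + 1) * z" if "0 <= z" for z using that by (intro mult_right_mono) auto
 show ?thesis
 proof (intro exI[of _ "\<bar>C2 CI CH C0\<bar> + 1"] conjI allI impI ballI)
  fix M P N uh n
  assume H: "is_partition L M P" "0 < N" "fe_scheme \<alpha> L p a b \<tau> K f \<phi> d\<phi> M P N uh"
   "\<forall>n\<in>{- int N..0}. norm_L2 L (%x. uh n x - \<phi> x (of_int n * (\<tau> / real N))) <= C0 * (mesh_size M P)\<^sup>2" "n \<in> {1..K * N}"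
  note E = est[OF H]
  show "norm_L2 L (%x. u x (real n * (\<tau> / real N)) - uh (int n) x)
   <= (\<bar>C2 CI CH C0\<bar> + 1) * ((mesh_size M P)\<^sup>2 + \<tau> / real N * ((1 + ln (real n)) * (real n * (\<tau> / real N)) powr (\<alpha> - 1)))"
   by (rule order_trans[OF conjunct1[OF conjunct2[OF E]] mono]) (use E in auto)
 qed auto
qed

theorem theorem4p1:
  fixes \<alpha> L p a b \<tau> :: real and K m :: nat
    and f \<phi> d\<phi> u Y Y1 Y2 :: "real \<Rightarrow> real \<Rightarrow> real"
    and \<gamma> :: "nat \<Rightarrow> real \<Rightarrow> real" and \<gamma>t :: "real \<Rightarrow> real"
    and CY C\<phi> C0 \<sigma> :: real
  assumes "0 < \<alpha>" "\<alpha> < 1" "0 < L" "0 \<le> p" "a \<le> 0" "b \<noteq> 0" "0 < \<tau>" "0 < K"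
    and f_cont: "continuous_on ({0..L} \<times> {0..real K * \<tau>}) (\<lambda>(x, t). f x t)"
    and phi_cont: "continuous_on ({0..L} \<times> {-\<tau>..0}) (\<lambda>(x, t). \<phi> x t)"
    and solution: "delay_solution \<alpha> L p a b \<tau> K f \<phi> u"
    and m_def: "m = (LEAST i. 0 < i \<and> (real i + 1) * \<alpha> > 1)"
    (* the j = 0 term of the sum is separated because 0 powr 0 = 0 *)
    and decomposition: "\<And>x t. x \<in> {0..L} \<Longrightarrow> t \<in> {0..real K * \<tau>} \<Longrightarrow>
          u x t = \<gamma> 0 x + (\<Sum>j=1..m. \<gamma> j x * t powr (real j * \<alpha>)) + \<gamma>t x * t + Y x t"
    and gamma_bounded: "\<And>j. j \<le> m \<Longrightarrow> bounded (\<gamma> j ` {0..L})"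
    and gammat_bounded: "bounded (\<gamma>t ` {0..L})"
    and Y_zero: "\<And>x. x \<in> {0..L} \<Longrightarrow> Y x 0 = 0 \<and> Y1 x 0 = 0"
    and Y_deriv: "\<And>x t. x \<in> {0..L} \<Longrightarrow> t \<in> {0..real K * \<tau>} \<Longrightarrow>
          (Y x has_real_derivative Y1 x t) (at t within {0..real K * \<tau>})"
    and Y1_cont: "\<And>x. x \<in> {0..L} \<Longrightarrow> continuous_on {0..real K * \<tau>} (Y1 x)"
    and Y1_bound: "\<And>x t. x \<in> {0..L} \<Longrightarrow> t \<in> {0..real K * \<tau>} \<Longrightarrow>
          \<bar>Y1 x t\<bar> \<le> CY * (1 + t powr ((real m + 1) * \<alpha> - 1))"
    (* Y2 is the second time derivative of Y, i.e. Y1 is absolutely continuous in time *)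
    and Y2_deriv: "\<And>x t. x \<in> {0..L} \<Longrightarrow> t \<in> {0..real K * \<tau>} \<Longrightarrow>
          Y1 x t - Y1 x 0 = (LINT s:{0..t}|lebesgue. Y2 x s)"
    and Y2_L1: "\<And>x. x \<in> {0..L} \<Longrightarrow> set_integrable lebesgue {0..real K * \<tau>} (Y2 x)"
    and Y2_L1_L2: "in_L1_L2 (real K * \<tau>) L Y2"
    and u_H2: "\<And>t. t \<in> {0..real K * \<tau>} \<Longrightarrow> in_H2 L (\<lambda>x. u x t)"
    (* for p > 0 such a bound follows from the equation *)
    and u_H2_bounded: "p = 0 \<Longrightarrow> \<exists>B. \<forall>t\<in>{0..real K * \<tau>}. H2_norm_le L (\<lambda>x. u x t) B"
    and phi_deriv: "\<And>x t. x \<in> {0..L} \<Longrightarrow> t \<in> {-\<tau>..0} \<Longrightarrow>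
          (\<phi> x has_real_derivative d\<phi> x t) (at t within {-\<tau>..0})"
    and dphi_cont: "\<And>x. x \<in> {0..L} \<Longrightarrow> continuous_on {-\<tau>..0} (d\<phi> x)"
    and dphi_bound: "\<And>x t. x \<in> {0..L} \<Longrightarrow> t \<in> {-\<tau>..0} \<Longrightarrow> \<bar>d\<phi> x t\<bar> \<le> C\<phi>"
  shows "\<exists>C>0. \<forall>M P N uh.
           is_partition L M P \<longrightarrow> quasi_uniform \<sigma> M P \<longrightarrow> 0 < N \<longrightarrow>
           fe_scheme \<alpha> L p a b \<tau> K f \<phi> d\<phi> M P N uh \<longrightarrow>
           (\<forall>n\<in>{- int N..0}.
              norm_L2 L (\<lambda>x. uh n x - \<phi> x (of_int n * (\<tau> / real N))) \<le> C0 * (mesh_size M P)\<^sup>2) \<longrightarrow>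
           (\<forall>k\<in>{1..K}. \<forall>n\<in>{(k - 1) * N + 1..k * N}.
              norm_L2 L (\<lambda>x. u x (real n * (\<tau> / real N)) - uh (int n) x)
              \<le> C * ((mesh_size M P)\<^sup>2
                   + \<tau> / real N
                     * ((\<Sum>j=1..k - 1. 1 + ln (real n - real j * real N))
                        + (1 + ln (real n)) * (real n * (\<tau> / real N)) powr (\<alpha> - 1))))"
proof -
  interpret delay_problem \<alpha> L p a b \<tau> K m f \<phi> d\<phi> u Y Y1 Y2 \<gamma> \<gamma>t CY C\<phi>
    by (intro delay_problem.intro) (fact assms)+
  obtain C where C: "0 < C" and est: "\<And>M P N uh n. is_partition L M P \<Longrightarrow> 0 < N \<Longrightarrow> fe_scheme \<alpha> L p a b \<tau> K f \<phi> d\<phi> M P N uh \<Longrightarrow>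
     (\<forall>n\<in>{- int N..0}. norm_L2 L (\<lambda>x. uh n x - \<phi> x (of_int n * (\<tau> / real N))) \<le> C0 * (mesh_size M P)\<^sup>2) \<Longrightarrow> n \<in> {1..K * N} \<Longrightarrow>
     norm_L2 L (\<lambda>x. u x (real n * (\<tau> / real N)) - uh (int n) x)
        \<le> C * ((mesh_size M P)\<^sup>2 + \<tau> / real N * ((1 + ln (real n)) * (real n * (\<tau> / real N)) powr (\<alpha> - 1)))"
    using error_estimate[of C0] by blast
  show ?thesis
  proof (intro exI[of _ C] conjI C allI impI ballI)
    fix M P N uh k n
    assume part: "is_partition L M P" and N: "0 < N" and scheme: "fe_scheme \<alpha> L p a b \<tau> K f \<phi> d\<phi> M P N uh"
      and start: "\<forall>n\<in>{- int N..0}. norm_L2 L (\<lambda>x. uh n x - \<phi> x (of_int n * (\<tau> / real N))) \<le> C0 * (mesh_size M P)\<^sup>2"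
      and k: "k \<in> {1..K}" and n: "n \<in> {(k - 1) * N + 1..k * N}"
    have "k * N \<le> K * N" using k by simp
    moreover have "1 \<le> n" "n \<le> k * N" using n by auto
    ultimately have nK: "n \<in> {1..K * N}" unfolding atLeastAtMost_iff by linarith
    \<comment> \<open>Adding the history sum only enlarges the bound of \<open>est\<close>: j <= k -
      1 and n >= (k - 1) N + 1 give n - j N >= 1, so every logarithm is nonnegative.\<close>
    have log: "0 \<le> 1 + ln (real n - real j * real N)" if j: "j \<in> {1..k - 1}" for j
    proof -
      have "j * N \<le> (k - 1) * N" using j by simp
      moreover have "(k - 1) * N + 1 \<le> n" using n by simp
      ultimately have "j * N + 1 \<le> n" by linarith
      then have "real (j * N + 1) \<le> real n" by (simp only: of_nat_le_iff)
      then have "1 \<le> real n - real j * real N" by simp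
      from ln_ge_zero[OF this] show ?thesis by simp
    qed
    have "0 \<le> (\<Sum>j=1..k - 1. 1 + ln (real n - real j * real N))" using log by (rule sum_nonneg)
    then have "C * ((mesh_size M P)\<^sup>2 + \<tau> / real N * ((1 + ln (real n)) * (real n * (\<tau> / real N)) powr (\<alpha> - 1)))
      \<le> C * ((mesh_size M P)\<^sup>2 + \<tau> / real N * ((\<Sum>j=1..k - 1. 1 + ln (real n - real j * real N))
          + (1 + ln (real n)) * (real n * (\<tau> / real N)) powr (\<alpha> - 1)))"
      using C \<open>0 < \<tau>\<close> by (intro mult_left_mono add_left_mono) auto
    with est[OF part N scheme start nK]
    show "norm_L2 L (\<lambda>x. u x (real n * (\<tau> / real N)) - uh (int n) x)
      \<le> C * ((mesh_size M P)\<^sup>2 + \<tau> / real N * ((\<Sum>j=1..k - 1. 1 + ln (real n - real j * real N))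
          + (1 + ln (real n)) * (real n * (\<tau> / real N)) powr (\<alpha> - 1)))"
      by (rule order_trans)
  qed
qed

end
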